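(* Let $P$ be a fractal distribution on $\mathcal{M}^*$ and let $b\geq2$ be an integer. Then there is an (extended) base-$b$ CP-distribution $Q$ whose continuous centering is $P$ and whose second component is distributed according to normalized Lebesgue measure on $B_{1}$; likewise, each ergodic component of $P$ with respect to the map $S_{\log b}^{*}$ is the discrete centering of some (extended) base-$b$ CP-distribution whose second component is distributed according to normalized Lebesgue measure on $B_1$.
   Context: Fix $d\ge 1$. $\mathbb{R}^d$ carries the sup-norm; $B_r(x)$ is the closed ball, $B_1=B_1(0)=[-1,1]^d$. $\mathcal{M}$ is the space of Radon measures on $\mathbb{R}^d$ with the weak topology (tested against continuous compactly supported functions). "Distribution" means a Borel probability measure on a space of measures (or of pairs). For $\mu(B_1)>0$ put $\mu^*=\frac{1}{\mu(B_1)}\mu$, $\mu^{\square}=\mu^*|_{B_1}$, $\mathcal{M}^*=\{\mu:\mu(B_1)=1\}$, $\mathcal{M}^{\square}=\mathcal{P}(B_1)$. Let $T_x(y)=y-x$, $S_t(y)=e^t y$, acting on measures by push-forward; $T_x^*\mu=(T_x\mu)^*$, $S_t^*\mu=(S_t\mu)^*$. $S^*=(S^*_t)_{t\in\mathbb{R}}$ acts on $\{\mu\in\mathcal{M}^*:0\in\operatorname{supp}\mu\}$; $S^*$-invariant distributions are understood to be concentrated on this set. Fractal distribution (FD): a probability distribution $P$ on $\mathcal{M}^*$ that is $S^*$-invariant and quasi-Palm, i.e. for every bounded open neighborhood $U$ of $0$, $P\sim\int\int_U\delta_{T_x^*\mu}\,d\mu(x)\,dP(\mu)$ ($\sim$: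 same null sets). CP-distributions. For $b\ge2$ let $\mathcal{D}_b(\mathbb{R})=\{[\frac kb,\frac{k+2}{b}):k\in\mathbb{Z},\ k\equiv b \bmod 2\}$, and let $\mathcal{D}_b$ be the partition of $\mathbb{R}^d$ into products $I_1\times\cdots\times I_d$, $I_i\in\mathcal{D}_b(\mathbb{R})$; $\mathcal{D}_b(x)$ is the cell containing $x$. For a cell (cube) $D$ with center $c$ and side $2r$, $T_D(y)=\frac1r(y-c)$. Define $M_b^{\square}(\mu,x)=((T_{\mathcal{D}_b(x)}\mu)^{\square},T_{\mathcal{D}_b(x)}x)$ for $x\in B_1$, $\mu(\mathcal{D}_b(x))>0$. A distribution $Q$ on $\mathcal{M}^{\square}\times B_1$ is adapted if $\int f(\nu,x)\,dQ(\nu,x)=\int\left(\int f(\nu,x)\,d\nu(x)\right)dQ(\nu)$ for all $f\in C(\mathcal{M}^{\square}\times B_1)$. A restricted base-$b$ CP-distribution is an $M_b^{\square}$-invariant adapted probability distribution on $\mathcal{M}^{\square}\times B_1$. Extended version: given a restricted CP-distribution $Q_0$, let $(\mu_n,x_n)_{n\in\mathbb{Z}}$ be the two-sided stationary process with marginal $Q_0$ and $(\mu_{n+1},x_{n+1})=M_b^{\square}(\mu_n,x_n)$. For $n\ge0$ let $\nu_n=(T_{\mathcal{D}_{b^n}(x_{-n})}\mu_{-n})^*$; these are increasing in $n$ (each is a restriction of the next), and $\nu(A)=\lim_n\nu_n(A)$ defines a Radon measure. The extended version of $Q_0$ is the law of $(\nu,x_0)$, a distribution on $\mathcal{M}^*\times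 B_1$. An extended CP-distribution is one arising in this way. Centering: $\operatorname{cent}_0(\mu,x)=T_x^*\mu$ for $x\in\operatorname{supp}\mu$. For an extended base-$b$ CP-distribution $Q$, the discrete centering is the push-forward $\operatorname{cent}_0Q$, and the continuous centering is $\operatorname{cent}Q=\frac{1}{\log b}\int_0^{\log b}S_t^*\operatorname{cent}_0Q\,dt$. "Each ergodic component" means almost every one in the ergodic decomposition of $P$ for the map $S^*_{\log b}$. *)

theory Defs
  imports "HOL-Probability.Probability"
begin

section \<open>Borel structures and partially defined maps\<close>

definition borel_of :: "'a topology \<Rightarrow> 'a measure" where
  "borel_of X = sigma (topspace X) {U. openin X U}"

text \<open>
  Several maps below are only defined on a subset \<open>D\<close> of the space that carries full measure, so images
  are taken after restricting to \<open>D\<close>.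
\<close>

definition push_on :: "'a set \<Rightarrow> ('a \<Rightarrow> 'b) \<Rightarrow> 'b measure \<Rightarrow> 'a measure \<Rightarrow> 'b measure" where
  "push_on D f N P = distr (restrict_space P D) N f"

definition invariant_on :: "'a set \<Rightarrow> ('a \<Rightarrow> 'a) \<Rightarrow> 'a measure \<Rightarrow> bool" where
  "invariant_on D f P \<longleftrightarrow> (AE x in P. x \<in> D) \<and> push_on D f P P = P"

definition ergodic_on :: "'a set \<Rightarrow> ('a \<Rightarrow> 'a) \<Rightarrow> 'a measure \<Rightarrow> bool" where
  "ergodic_on D f P \<longleftrightarrow> prob_space P \<and> invariant_on D f P \<and>
     (\<forall>A\<in>sets P. {x \<in> D. f x \<in> A} = A \<inter> D \<longrightarrow> emeasure P A = 0 \<or> emeasure P A = 1)"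

text \<open>
  The ergodic decomposition, given as the distribution \<open>\<Theta>\<close> of the ergodic components on the space
  of all probability measures: \<open>\<Theta>\<close> is carried by the ergodic measures and has barycentre \<open>P\<close>.
\<close>

definition ergodic_decomposition ::
    "'a set \<Rightarrow> ('a \<Rightarrow> 'a) \<Rightarrow> 'a measure \<Rightarrow> 'a measure measure \<Rightarrow> bool" where
  "ergodic_decomposition D f P \<Theta> \<longleftrightarrow>
     prob_space \<Theta> \<and> sets \<Theta> = sets (prob_algebra P) \<and>
     (AE p in \<Theta>. ergodic_on D f p) \<and>
     (\<forall>A\<in>sets P. emeasure P A = (\<integral>\<^sup>+ p. emeasure p A \<partial>\<Theta>))"


section \<open>Spaces of measures\<close>

text \<open>The closed unit ball of the sup-norm.\<close>

abbreviation B1 :: "(real ^ 'd) set" where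
  "B1 \<equiv> cbox (\<chi> i. - 1) (\<chi> i. 1)"

text \<open>On Euclidean space the Radon measures are exactly the locally finite Borel measures.\<close>

definition radon_measures :: "(real ^ 'd) measure set" where
  "radon_measures = {\<mu>. sets \<mu> = sets borel \<and> (\<forall>K. compact K \<longrightarrow> emeasure \<mu> K < \<infinity>)}"

definition weak_topology :: "(real ^ 'd) measure topology" where
  "weak_topology = topology_generated_by
     {{\<mu> \<in> radon_measures. (\<integral>x. f x \<partial>\<mu>) \<in> V} | (f :: real ^ 'd \<Rightarrow> real) V.
        continuous_on UNIV f \<and> compact (closure {x. f x \<noteq> 0}) \<and> open V}"

definition Mstar :: "(real ^ 'd) measure topology" where
  "Mstar = subtopology weak_topology {\<mu>. emeasure \<mu> B1 = 1}"

text \<open>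
  A probability measure on \<^term>\<open>B1\<close> is identified with the measure on the whole space that gives
  no mass to the complement of \<^term>\<open>B1\<close>.
\<close>

definition Mbox :: "(real ^ 'd) measure topology" where
  "Mbox = subtopology weak_topology {\<mu>. emeasure \<mu> B1 = 1 \<and> emeasure \<mu> (- B1) = 0}"

definition Mstar_B1 :: "((real ^ 'd) measure \<times> (real ^ 'd)) topology" where
  "Mstar_B1 = prod_topology Mstar (top_of_set B1)"

definition Mbox_B1 :: "((real ^ 'd) measure \<times> (real ^ 'd)) topology" where
  "Mbox_B1 = prod_topology Mbox (top_of_set B1)"

definition normalize_star :: "(real ^ 'd) measure \<Rightarrow> (real ^ 'd) measure" where
  "normalize_star \<mu> = scale_measure (1 / emeasure \<mu> B1) \<mu>"

definition normalize_box :: "(real ^ 'd) measure \<Rightarrow> (real ^ 'd) measure" where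
  "normalize_box \<mu> = density (normalize_star \<mu>) (indicator B1)"

definition msupp :: "(real ^ 'd) measure \<Rightarrow> (real ^ 'd) set" where
  "msupp \<mu> = {x. \<forall>U. open U \<longrightarrow> x \<in> U \<longrightarrow> emeasure \<mu> U > 0}"

definition transl_star :: "real ^ 'd \<Rightarrow> (real ^ 'd) measure \<Rightarrow> (real ^ 'd) measure" where
  "transl_star x \<mu> = normalize_star (distr \<mu> borel (\<lambda>y. y - x))"

definition scale_star :: "real \<Rightarrow> (real ^ 'd) measure \<Rightarrow> (real ^ 'd) measure" where
  "scale_star t \<mu> = normalize_star (distr \<mu> borel (\<lambda>y. exp t *\<^sub>R y))"

definition scale_dom :: "(real ^ 'd) measure set" where
  "scale_dom = {\<mu> \<in> topspace Mstar. 0 \<in> msupp \<mu>}"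


section \<open>Fractal distributions\<close>

text \<open>
  The measure \<open>\<integral> \<integral>\<^sub>U \<delta>(T\<^sub>x\<^sup>* \<mu>) d\<mu>(x) dP(\<mu>)\<close>.  If \<open>T\<^sub>x \<mu>\<close> gives no mass to \<^term>\<open>B1\<close>, which happens
  only for \<open>x\<close> in a \<open>\<mu>\<close>-null set, then \<^term>\<open>transl_star x \<mu>\<close> lies outside \<^term>\<open>topspace Mstar\<close>
  and does not contribute.
\<close>

definition palm_measure ::
    "(real ^ 'd) set \<Rightarrow> (real ^ 'd) measure measure \<Rightarrow> (real ^ 'd) measure measure" where
  "palm_measure U P = measure_of (space P) (sets P)
     (\<lambda>A. \<integral>\<^sup>+ \<mu>. (\<integral>\<^sup>+ x. indicator U x * indicator A (transl_star x \<mu>) \<partial>\<mu>) \<partial>P)"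

definition quasi_palm :: "(real ^ 'd) measure measure \<Rightarrow> bool" where
  "quasi_palm P \<longleftrightarrow>
     (\<forall>U. bounded U \<longrightarrow> open U \<longrightarrow> 0 \<in> U \<longrightarrow> null_sets P = null_sets (palm_measure U P))"

definition fractal_distribution :: "(real ^ 'd) measure measure \<Rightarrow> bool" where
  "fractal_distribution P \<longleftrightarrow>
     prob_space P \<and> sets P = sets (borel_of Mstar) \<and>
     (\<forall>t. invariant_on scale_dom (scale_star t) P) \<and> quasi_palm P"


section \<open>CP-distributions\<close>

definition badic_intervals :: "nat \<Rightarrow> real set set" where
  "badic_intervals b =
     {{real_of_int k / real b ..< real_of_int (k + 2) / real b} | k :: int. k mod 2 = int b mod 2}"

definition badic_cells :: "nat \<Rightarrow> (real ^ 'd) set set" where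
  "badic_cells b = {{x. \<forall>i. x $ i \<in> I i} | I. \<forall>i. I i \<in> badic_intervals b}"

definition badic_cell :: "nat \<Rightarrow> real ^ 'd \<Rightarrow> (real ^ 'd) set" where
  "badic_cell b x = (THE D. D \<in> badic_cells b \<and> x \<in> D)"

definition half_open_cube :: "real ^ 'd \<Rightarrow> real \<Rightarrow> (real ^ 'd) set" where
  "half_open_cube c r = {y. \<forall>i. c $ i - r \<le> y $ i \<and> y $ i < c $ i + r}"

definition cube_map :: "(real ^ 'd) set \<Rightarrow> real ^ 'd \<Rightarrow> real ^ 'd" where
  "cube_map D = (THE T. \<exists>c r. r > 0 \<and> D = half_open_cube c r \<and> T = (\<lambda>y. (1 / r) *\<^sub>R (y - c)))"

definition CP_dom :: "nat \<Rightarrow> ((real ^ 'd) measure \<times> (real ^ 'd)) set" where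
  "CP_dom b = {(\<mu>, x) \<in> topspace Mbox_B1. emeasure \<mu> (badic_cell b x) > 0}"

fun CP_map :: "nat \<Rightarrow> (real ^ 'd) measure \<times> (real ^ 'd) \<Rightarrow> (real ^ 'd) measure \<times> (real ^ 'd)" where
  "CP_map b (\<mu>, x) =
     (normalize_box (distr \<mu> borel (cube_map (badic_cell b x))), cube_map (badic_cell b x) x)"

definition adapted :: "((real ^ 'd) measure \<times> (real ^ 'd)) measure \<Rightarrow> bool" where
  "adapted Q \<longleftrightarrow>
     (\<forall>f. continuous_map Mbox_B1 euclideanreal f \<longrightarrow>
        (\<integral>z. f z \<partial>Q) = (\<integral>z. (\<integral>x\<in>B1. f (fst z, x) \<partial>fst z) \<partial>Q))"

definition restricted_CP :: "nat \<Rightarrow> ((real ^ 'd) measure \<times> (real ^ 'd)) measure \<Rightarrow> bool" where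
  "restricted_CP b Q \<longleftrightarrow>
     prob_space Q \<and> sets Q = sets (borel_of Mbox_B1) \<and>
     invariant_on (CP_dom b) (CP_map b) Q \<and> adapted Q"

definition CP_orbits :: "nat \<Rightarrow> (int \<Rightarrow> (real ^ 'd) measure \<times> (real ^ 'd)) set" where
  "CP_orbits b = {\<omega>. \<forall>n. \<omega> n \<in> CP_dom b \<and> \<omega> (n + 1) = CP_map b (\<omega> n)}"

text \<open>The law, on sequence space, of the two-sided stationary process with marginal \<open>Q0\<close>.\<close>

definition two_sided_process ::
    "nat \<Rightarrow> ((real ^ 'd) measure \<times> (real ^ 'd)) measure \<Rightarrow>
     (int \<Rightarrow> (real ^ 'd) measure \<times> (real ^ 'd)) measure \<Rightarrow> bool" where
  "two_sided_process b Q0 R \<longleftrightarrow>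
     prob_space R \<and> sets R = sets (\<Pi>\<^sub>M n\<in>(UNIV :: int set). borel_of Mbox_B1) \<and>
     distr R R (\<lambda>\<omega> n. \<omega> (n + 1)) = R \<and>
     distr R (borel_of Mbox_B1) (\<lambda>\<omega>. \<omega> 0) = Q0 \<and>
     (AE \<omega> in R. \<omega> \<in> CP_orbits b)"

definition extension_approx ::
    "nat \<Rightarrow> (int \<Rightarrow> (real ^ 'd) measure \<times> (real ^ 'd)) \<Rightarrow> nat \<Rightarrow> (real ^ 'd) measure" where
  "extension_approx b \<omega> n =
     (let (\<mu>, x) = \<omega> (- int n)
      in normalize_star (distr \<mu> borel (cube_map (badic_cell (b ^ n) x))))"

definition extension_measure ::
    "nat \<Rightarrow> (int \<Rightarrow> (real ^ 'd) measure \<times> (real ^ 'd)) \<Rightarrow> (real ^ 'd) measure" where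
  "extension_measure b \<omega> =
     measure_of UNIV (sets borel) (\<lambda>A. lim (\<lambda>n. emeasure (extension_approx b \<omega> n) A))"

definition extended_version ::
    "nat \<Rightarrow> ((real ^ 'd) measure \<times> (real ^ 'd)) measure \<Rightarrow>
     ((real ^ 'd) measure \<times> (real ^ 'd)) measure \<Rightarrow> bool" where
  "extended_version b Q0 Q \<longleftrightarrow>
     (\<exists>R. two_sided_process b Q0 R \<and>
        Q = push_on (CP_orbits b) (\<lambda>\<omega>. (extension_measure b \<omega>, snd (\<omega> 0))) (borel_of Mstar_B1) R)"

definition extended_CP :: "nat \<Rightarrow> ((real ^ 'd) measure \<times> (real ^ 'd)) measure \<Rightarrow> bool" where
  "extended_CP b Q \<longleftrightarrow> (\<exists>Q0. restricted_CP b Q0 \<and> extended_version b Q0 Q)"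


section \<open>Centering\<close>

definition discrete_centering ::
    "((real ^ 'd) measure \<times> (real ^ 'd)) measure \<Rightarrow> (real ^ 'd) measure measure" where
  "discrete_centering Q =
     push_on {(\<mu>, x). x \<in> msupp \<mu>} (\<lambda>(\<mu>, x). transl_star x \<mu>) (borel_of Mstar) Q"

definition continuous_centering ::
    "nat \<Rightarrow> ((real ^ 'd) measure \<times> (real ^ 'd)) measure \<Rightarrow> (real ^ 'd) measure measure" where
  "continuous_centering b Q = measure_of (topspace Mstar) (sets (borel_of Mstar))
     (\<lambda>A. (\<integral>\<^sup>+ t\<in>{0..ln (real b)}.
              emeasure (push_on scale_dom (scale_star t) (borel_of Mstar) (discrete_centering Q)) A
            \<partial>lborel) / ennreal (ln (real b)))"

definition lebesgue_second :: "((real ^ 'd) measure \<times> (real ^ 'd)) measure \<Rightarrow> bool" where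
  "lebesgue_second Q \<longleftrightarrow> distr Q borel snd = uniform_measure lborel B1"

end

theory Submission
  imports Defs
begin

text \<open>
  Let \<open>p\<close> be \<open>S\<^sup>*\<close>-invariant, let \<open>\<mu>\<close> have law \<open>p\<close> and let \<open>z\<close> be an independent uniform point
  of \<open>B1\<close>. The law of \<open>(T\<^sup>* \<mu>, z)\<close>, with the translation moving the origin to \<open>z\<close>, is
  centred back to \<open>p\<close> and is invariant under the extended magnification, because \<open>S\<^sup>*\<close> preserves \<open>p\<close>
  while \<open>z\<close> is split into an independent base-\<open>b\<close> digit and a remainder that is again uniform.
  Independent digits for the past give the two-sided process.

  Adaptedness is what needs the quasi-Palm property. For a fixed measure \<open>\<nu>\<close>, a set \<open>A\<close> of
  measures and a cell \<open>C\<close>, the deviations \<open>1\<^sub>A(\<nu>\<^sub>n) (1\<^sub>C(x\<^sub>n) - \<nu>\<^sub>n(C))\<close> along the orbit of a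
  \<open>\<nu>\<close>-random point are bounded and orthogonal at distance \<open>k\<close> or more when \<open>C\<close> has level \<open>k\<close>, so their
  averages tend to 0 at \<open>\<nu>\<close>-almost every point. By Fubini and the quasi-Palm property, for \<open>P\<close>-almost every \<open>\<mu>\<close>
  the same holds for almost every uniform translation of \<open>\<mu>\<close>, followed along the orbit of
  the point to which the origin was moved. This condition on \<open>\<mu>\<close> is inherited by almost every ergodic component of
  \<open>P\<close>, and for an invariant \<open>p\<close> satisfying it, stationarity makes the mean deviations vanish,
  which is adaptedness.
\<close>

text \<open>The quasi-Palm property compares null sets only, whereas adaptedness is an equality of
  integrals. It can therefore be used only through an almost sure statement; the vanishing of
  averages is such a statement, and stationarity turns it back into an equality. Ergodic components
  are known to be invariant under the scaling by b, but not to be quasi-Palm. This is why the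
  averaging condition is formulated for a single measure and tested on countably many pairs
  \<open>A\<close>, \<open>C\<close>: it then fails only on one null set for P, and null sets of P
  are null for almost every component.

  The uniform translation has a second effect. Measures are normalised on closed windows, while the
  partition consists of half-open cells, and \<mu> may charge their boundaries. All boundaries lie
  in rational hyperplanes, which almost every translate of \<mu> does not charge, and a uniform
  point has irrational coordinates almost surely.

  Adaptedness is asked for every continuous function, so bounds have to come from compactness of the
  probability measures on \<open>B1\<close>.\<close>

section \<open>The weak topology\<close>

text \<open>
  The topology of \<open>X\<close> is pulled back along \<open>e\<close>, hence second countable; \<open>e\<close> need not be injective.
\<close>

definition coord_embedding :: "'a topology \<Rightarrow> ('a \<Rightarrow> 'b::second_countable_topology) \<Rightarrow> bool" where
  "coord_embedding X e \<longleftrightarrow> (\<forall>U. openin X U \<longleftrightarrow> (\<exists>V. open V \<and> U = e -` V \<inter> topspace X))"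

lemma coord_embedding_subtopology:
  assumes "coord_embedding X e"
  shows "coord_embedding (subtopology X S) e"
  using assms unfolding coord_embedding_def openin_subtopology topspace_subtopology by auto

lemma coord_embedding_top_of_set: "coord_embedding (top_of_set S) (\<lambda>x. x)"
  unfolding coord_embedding_def by (auto simp: openin_subtopology)

lemma coord_embedding_prod:
  assumes X: "coord_embedding X e" and Y: "coord_embedding Y k"
  shows "coord_embedding (prod_topology X Y) (\<lambda>z. (e (fst z), k (snd z)))"
  unfolding coord_embedding_def
proof (intro allI iffI)
  fix S assume "openin (prod_topology X Y) S"
  hence S: "S \<subseteq> topspace X \<times> topspace Y"
    and *: "\<And>x y. (x, y) \<in> S \<Longrightarrow> \<exists>U V. openin X U \<and> openin Y V \<and> x \<in> U \<and> y \<in> V \<and> U \<times> V \<subseteq> S"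
    using openin_subset by (force, unfold openin_prod_topology_alt, blast)
  \<comment> \<open>Taking all rectangles whose trace lies in \<open>S\<close> gives an open set
    without choosing one rectangle for each point.\<close>
  define W where "W = \<Union>{U \<times> V |U V. open U \<and> open V \<and>
    (e -` U \<inter> topspace X) \<times> (k -` V \<inter> topspace Y) \<subseteq> S}"
  have "open W" unfolding W_def by (intro open_Union) (auto intro: open_Times)
  moreover have "S = (\<lambda>z. (e (fst z), k (snd z))) -` W \<inter> topspace (prod_topology X Y)"
  proof (intro set_eqI iffI)
    fix z assume zS: "z \<in> S"
    obtain x y where z: "z = (x, y)" by (cases z)
    with zS have xy: "(x, y) \<in> S" by simp
    obtain U V where UV: "openin X U" "openin Y V" "x \<in> U" "y \<in> V" "U \<times> V \<subseteq> S" using *[OF xy] by blast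
    obtain U' V' where "open U'" "U = e -` U' \<inter> topspace X" "open V'" "V = k -` V' \<inter> topspace Y"
      using X Y UV unfolding coord_embedding_def by metis
    hence "(e x, k y) \<in> W" using UV unfolding W_def by auto
    thus "z \<in> (\<lambda>z. (e (fst z), k (snd z))) -` W \<inter> topspace (prod_topology X Y)" using S xy z by auto
  qed (auto simp: W_def)
  ultimately show "\<exists>V. open V \<and> S = (\<lambda>z. (e (fst z), k (snd z))) -` V \<inter> topspace (prod_topology X Y)" by blast
next
  fix S assume "\<exists>V. open V \<and> S = (\<lambda>z. (e (fst z), k (snd z))) -` V \<inter> topspace (prod_topology X Y)"
  then obtain W where W: "open W \<and> S = (\<lambda>z. (e (fst z), k (snd z))) -` W \<inter> topspace (prod_topology X Y)" ..
  show "openin (prod_topology X Y) S"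
    unfolding openin_prod_topology_alt
  proof safe
    fix x y assume xy: "(x, y) \<in> S"
    have exy: "(e x, k y) \<in> W" using xy unfolding conjunct2[OF W] by (simp add: vimage_def)
    obtain A B where AB: "open A" "open B" "e x \<in> A" "k y \<in> B" "A \<times> B \<subseteq> W"
      using open_prod_elim[OF conjunct1[OF W] exy] by (metis mem_Sigma_iff)
    show "\<exists>U V. openin X U \<and> openin Y V \<and> x \<in> U \<and> y \<in> V \<and> U \<times> V \<subseteq> S"
      using AB xy X Y W unfolding coord_embedding_def
      by (intro exI[of _ "e -` A \<inter> topspace X"] exI[of _ "k -` B \<inter> topspace Y"]) auto
  qed
qed

section \<open>Borel sigma-algebras in coordinates\<close>

lemma space_borel_of [simp]: "space (borel_of X) = topspace X"
  unfolding borel_of_def by (simp add: space_measure_of_conv)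

lemma sets_borel_of: "sets (borel_of X) = sigma_sets (topspace X) {U. openin X U}"
  unfolding borel_of_def by (rule sets_measure_of) (auto dest: openin_subset)

lemma sets_borel_of_embedding:
  assumes "coord_embedding X e"
  shows "sets (borel_of X) = sets (vimage_algebra (topspace X) e borel)"
proof -
  have "sets (vimage_algebra (topspace X) e borel) =
      sigma_sets (topspace X) {e -` A \<inter> topspace X |A. A \<in> Collect open}"
    unfolding borel_def by (subst vimage_algebra_sigma) (auto simp: sets_measure_of_conv)
  also have "{e -` A \<inter> topspace X |A. A \<in> Collect open} = {U. openin X U}"
    using assms unfolding coord_embedding_def by auto
  finally show ?thesis by (simp add: sets_borel_of)
qed

text \<open>Every measurability question for these topologies is reduced to the coordinates, which
  take values in a second countable space.\<close>

lemma measurable_borel_of_iff: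
  assumes "coord_embedding X e"
  shows "f \<in> measurable M (borel_of X) \<longleftrightarrow>
    (\<forall>x\<in>space M. f x \<in> topspace X) \<and> (\<lambda>x. e (f x)) \<in> borel_measurable M" (is "?l = ?r")
proof -
  have "f \<in> measurable M (borel_of X) \<longleftrightarrow> f \<in> measurable M (vimage_algebra (topspace X) e borel)"
    using measurable_cong_sets[OF refl sets_borel_of_embedding[OF assms]] by blast
  also have "\<dots> \<longleftrightarrow> ?r"
  proof
    assume f: "f \<in> measurable M (vimage_algebra (topspace X) e borel)"
    have "e \<in> measurable (vimage_algebra (topspace X) e borel) borel" by (rule measurable_vimage_algebra1) auto
    from measurable_compose[OF f this] measurable_space[OF f] show ?r by auto
  next
    assume ?r thus "f \<in> measurable M (vimage_algebra (topspace X) e borel)"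
      by (intro measurable_vimage_algebra2) auto
  qed
  finally show ?thesis .
qed

lemma measurable_coord_embedding: "coord_embedding X e \<Longrightarrow> e \<in> borel_measurable (borel_of X)"
  using measurable_borel_of_iff[of X e "\<lambda>x. x" "borel_of X"] by simp

text \<open>Both sides are pulled back along the pair of coordinate maps, and in a second countable
  target the Borel sets of the product are generated by rectangles.\<close>

lemma sets_borel_of_prod:
  assumes X: "coord_embedding X e" and Y: "coord_embedding Y k"
  shows "sets (borel_of (prod_topology X Y)) = sets (borel_of X \<Otimes>\<^sub>M borel_of Y)"
proof -
  note XY = coord_embedding_prod[OF X Y]
  have [measurable]: "e \<in> borel_measurable (borel_of X)" "k \<in> borel_measurable (borel_of Y)"
    using measurable_coord_embedding X Y by auto
  have 1: "(\<lambda>z. z) \<in> measurable (borel_of X \<Otimes>\<^sub>M borel_of Y) (borel_of (prod_topology X Y))"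
    by (subst measurable_borel_of_iff[OF XY]) (auto simp: space_pair_measure borel_prod[symmetric])
  have "(\<lambda>z. (e (fst z), k (snd z))) \<in> borel_measurable (borel_of (prod_topology X Y))"
    by (rule measurable_coord_embedding[OF XY])
  from measurable_compose[OF this[unfolded borel_prod[symmetric]] measurable_fst]
    measurable_compose[OF this[unfolded borel_prod[symmetric]] measurable_snd]
  have [measurable]: "(\<lambda>z. e (fst z)) \<in> borel_measurable (borel_of (prod_topology X Y))"
     "(\<lambda>z. k (snd z)) \<in> borel_measurable (borel_of (prod_topology X Y))" by auto
  have [measurable]: "fst \<in> measurable (borel_of (prod_topology X Y)) (borel_of X)"
    "snd \<in> measurable (borel_of (prod_topology X Y)) (borel_of Y)"
    by (subst measurable_borel_of_iff[OF X], auto, subst measurable_borel_of_iff[OF Y], auto)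
  have 2: "(\<lambda>z. z) \<in> measurable (borel_of (prod_topology X Y)) (borel_of X \<Otimes>\<^sub>M borel_of Y)"
    by (simp add: measurable_pair_iff o_def)
  have sp: "space (borel_of X \<Otimes>\<^sub>M borel_of Y) = topspace (prod_topology X Y)" by (simp add: space_pair_measure)
  show ?thesis
  proof safe
    fix A assume "A \<in> sets (borel_of (prod_topology X Y))"
    from measurable_sets[OF 1 this] sets.sets_into_space[OF this] sp
    show "A \<in> sets (borel_of X \<Otimes>\<^sub>M borel_of Y)" by (simp add: Int_absorb2)
  next
    fix A assume "A \<in> sets (borel_of X \<Otimes>\<^sub>M borel_of Y)"
    from measurable_sets[OF 2 this] sets.sets_into_space[OF this] sp
    show "A \<in> sets (borel_of (prod_topology X Y))" by (simp add: Int_absorb2)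
  qed
qed

text \<open>
  Integrals against the countably many tents determine the weak topology: the tents of each mesh form
  a partition of unity, so their finite combinations approximate compactly supported continuous functions.
\<close>

definition hat :: "real \<Rightarrow> real" where "hat s = max 0 (1 - \<bar>s\<bar>)"

definition tent :: "nat \<times> ('d \<Rightarrow> int) \<Rightarrow> real ^ 'd \<Rightarrow> real" where
  "tent k x = (\<Prod>i\<in>UNIV. hat (real (Suc (fst k)) * x $ i - real_of_int (snd k i)))"

definition tent_coords :: "(real ^ 'd) measure \<Rightarrow> nat \<times> ('d \<Rightarrow> int) \<Rightarrow> real" where
  "tent_coords \<mu> = (\<lambda>k. \<integral>x. tent k x \<partial>\<mu>)"

lemma hat_nonneg: "0 \<le> hat s" by (simp add: hat_def)

lemma continuous_hat [continuous_intros]: "continuous_on S f \<Longrightarrow> continuous_on S (\<lambda>x. hat (f x))"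
  unfolding hat_def by (intro continuous_intros)

lemma tent_nonneg: "0 \<le> tent k x" unfolding tent_def by (intro prod_nonneg) (simp add: hat_nonneg)

lemma continuous_tent: "continuous_on S (tent k)"
  unfolding tent_def by (intro continuous_intros)

lemma tent_nonzeroD:
  assumes "tent k x \<noteq> 0"
  shows "\<bar>real (Suc (fst k)) * x $ i - real_of_int (snd k i)\<bar> < 1"
proof -
  have "hat (real (Suc (fst k)) * x $ i - real_of_int (snd k i)) \<noteq> 0"
    using assms unfolding tent_def by auto
  thus ?thesis unfolding hat_def by (auto simp: max_def split: if_splits)
qed

lemma near_lattice:
  fixes r x j :: real
  assumes "r > 0" "\<bar>r * x - j\<bar> < 1"
  shows "\<bar>x - j / r\<bar> \<le> 1 / r"
proof -
  have "x - j / r = (r * x - j) / r" using assms(1) by (simp add: field_simps)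
  thus ?thesis using assms by (simp add: divide_right_mono)
qed

lemma bounded_support_tent: "bounded {x. tent k x \<noteq> 0}"
proof -
  have "{x. tent k x \<noteq> 0} \<subseteq> cbox (\<chi> i. real_of_int (snd k i) / real (Suc (fst k)) - 1) (\<chi> i. real_of_int (snd k i) / real (Suc (fst k)) + 1)"
  proof
    fix x assume "x \<in> {x. tent k x \<noteq> 0}"
    hence *: "\<bar>real (Suc (fst k)) * x $ i - real_of_int (snd k i)\<bar> < 1" for i using tent_nonzeroD by blast
    have near: "\<bar>x $ i - real_of_int (snd k i) / real (Suc (fst k))\<bar> \<le> 1" for i
      using near_lattice[OF _ *[of i]] by (rule order_trans) auto
    thus "x \<in> cbox (\<chi> i. real_of_int (snd k i) / real (Suc (fst k)) - 1) (\<chi> i. real_of_int (snd k i) / real (Suc (fst k)) + 1)"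
      unfolding mem_box_cart
    proof (intro allI)
      fix i
      show "(\<chi> i. real_of_int (snd k i) / real (Suc (fst k)) - 1) $ i \<le> x $ i \<and>
          x $ i \<le> (\<chi> i. real_of_int (snd k i) / real (Suc (fst k)) + 1) $ i"
        using abs_le_D1[OF near[of i]] abs_le_D2[OF near[of i]] by simp
    qed
  qed
  thus ?thesis using bounded_cbox bounded_subset by blast
qed

text \<open>Only the floor of t and its successor can lie at distance less than 1 from t, and their
  two hats add up to 1. The index range extends one step beyond \<open>L\<close> so that it contains
  both.\<close>

lemma sum_hat:
  fixes t :: real and L :: int
  assumes "\<bar>t\<bar> \<le> L"
  shows "(\<Sum>j\<in>{-L-1..L+1}. hat (t - real_of_int j)) = 1"
proof -
  have 0: "hat (t - real_of_int j) = 0" if "j \<noteq> \<lfloor>t\<rfloor>" "j \<noteq> \<lfloor>t\<rfloor> + 1" for j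
  proof -
    have "j < \<lfloor>t\<rfloor> \<or> j > \<lfloor>t\<rfloor> + 1" using that by linarith
    hence "\<bar>t - real_of_int j\<bar> \<ge> 1" by linarith
    thus ?thesis by (simp add: hat_def)
  qed
  have "(\<Sum>j\<in>{-L-1..L+1}. hat (t - real_of_int j)) = (\<Sum>j\<in>{\<lfloor>t\<rfloor>, \<lfloor>t\<rfloor> + 1}. hat (t - real_of_int j))"
    using assms 0 by (intro sum.mono_neutral_right) (auto, linarith+)
  also have "\<dots> = hat (t - \<lfloor>t\<rfloor>) + hat (t - (\<lfloor>t\<rfloor> + 1))" by simp
  also have "\<dots> = (1 - (t - \<lfloor>t\<rfloor>)) + (t - \<lfloor>t\<rfloor>)"
    by (intro arg_cong2[of _ _ _ _ "(+)"]; unfold hat_def; linarith)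
  finally show ?thesis by simp
qed

lemma sum_tent:
  fixes x :: "real ^ 'd" and L :: int
  assumes "\<And>i. \<bar>real (Suc n) * x $ i\<bar> \<le> L"
  shows "(\<Sum>j\<in>Pi\<^sub>E UNIV (\<lambda>_. {-L-1..L+1}). tent (n, j) x) = 1"
proof -
  have "(\<Sum>j\<in>Pi\<^sub>E UNIV (\<lambda>_. {-L-1..L+1}). tent (n, j) x) =
      (\<Prod>i\<in>UNIV. \<Sum>j\<in>{-L-1..L+1}. hat (real (Suc n) * x $ i - real_of_int j))"
    unfolding tent_def by (subst prod_sum_PiE) auto
  also have "\<dots> = 1" using sum_hat[OF assms] by simp
  finally show ?thesis .
qed

text \<open>Tents are nonnegative, so the index range may be enlarged until it covers x, where the
  sum becomes exactly 1.\<close>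

lemma sum_tent_le_1:
  fixes x :: "real ^ 'd" and L :: int
  shows "(\<Sum>j\<in>Pi\<^sub>E UNIV (\<lambda>_. {-L-1..L+1}). tent (n, j) x) \<le> 1"
proof -
  define L' where "L' = max L \<lceil>real (Suc n) * norm x\<rceil>"
  have "\<bar>real (Suc n) * x $ i\<bar> \<le> L'" for i
  proof -
    have "real (Suc n) * \<bar>x $ i\<bar> \<le> real (Suc n) * norm x" by (intro mult_left_mono component_le_norm_cart) auto
    also have "\<dots> \<le> \<lceil>real (Suc n) * norm x\<rceil>" by (rule le_of_int_ceiling)
    also have "\<dots> \<le> L'" unfolding L'_def by linarith
    finally show ?thesis by (simp only: abs_mult abs_of_nat)
  qed
  from sum_tent[OF this] have "(\<Sum>j\<in>Pi\<^sub>E UNIV (\<lambda>_. {-L'-1..L'+1}). tent (n, j) x) = 1" .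
  moreover have "(\<Sum>j\<in>Pi\<^sub>E UNIV (\<lambda>_. {-L-1..L+1}). tent (n, j) x) \<le>
      (\<Sum>j\<in>Pi\<^sub>E UNIV (\<lambda>_. {-L'-1..L'+1}). tent (n, j) x)"
    by (intro sum_mono2 finite_PiE PiE_mono) (auto simp: L'_def tent_nonneg)
  ultimately show ?thesis by simp
qed

text \<open>The error is measured against a fixed finite sum of coarse tents instead of a constant.
  Its integral is then controlled by finitely many tent coordinates, also for measures of infinite
  total mass. The range \<open>L0\<close> depends on the support of f only, not on \<delta>.\<close>

lemma tent_approximation:
  fixes f :: "real ^ 'd \<Rightarrow> real"
  assumes f: "continuous_on UNIV f" and B: "\<And>x. f x \<noteq> 0 \<Longrightarrow> norm x \<le> B" and "B \<ge> 0" and \<delta>: "\<delta> > 0"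
  defines "L0 \<equiv> \<lceil>B\<rceil> + 3"
  shows "\<exists>J a. finite J \<and> (\<forall>x. \<bar>f x - (\<Sum>k\<in>J. a k * tent k x)\<bar> \<le>
    \<delta> * (\<Sum>j\<in>Pi\<^sub>E UNIV (\<lambda>_. {-L0-1..L0+1}). tent (0, j) x))"
proof -
  have "uniformly_continuous_on UNIV f"
  proof -
    have 1: "uniformly_continuous_on (cball 0 (B + 1)) f"
      by (intro compact_uniformly_continuous continuous_on_subset[OF f]) auto
    show ?thesis unfolding uniformly_continuous_on_def
    proof (intro allI impI)
      fix e :: real assume "e > 0"
      then obtain d where d: "d > 0" "\<And>x y. x \<in> cball 0 (B+1) \<Longrightarrow> y \<in> cball 0 (B+1) \<Longrightarrow> dist y x < d \<Longrightarrow> dist (f y) (f x) < e"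
        using 1 unfolding uniformly_continuous_on_def by metis
      show "\<exists>d>0. \<forall>x\<in>UNIV. \<forall>y\<in>UNIV. dist y x < d \<longrightarrow> dist (f y) (f x) < e"
      proof (intro exI[of _ "min d 1"] conjI ballI impI)
        fix x y :: "real ^ 'd" assume xy: "dist y x < min d 1"
        show "dist (f y) (f x) < e"
        proof (cases "norm x \<le> B \<or> norm y \<le> B")
          case True
          have "norm x \<le> norm y + dist y x" "norm y \<le> norm x + dist y x"
            unfolding dist_norm by norm+
          hence "x \<in> cball 0 (B+1)" "y \<in> cball 0 (B+1)" using True xy by auto
          thus ?thesis using d xy by auto
        next
          case False
          hence "f x = 0" "f y = 0" using B by force+
          thus ?thesis using \<open>e > 0\<close> by simp
        qed
      qed (use d in auto)
    qed
  qed
  then obtain d where d: "d > 0" "\<And>x y. dist y x < d \<Longrightarrow> dist (f y) (f x) < \<delta>"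
    using \<delta> unfolding uniformly_continuous_on_def by (metis UNIV_I)
  \<comment> \<open>A point where a tent of mesh \<open>n\<close> is nonzero is within 1/(n+1) of
    its node in every coordinate; the factor \<open>CARD('d)\<close> comes from bounding the
    Euclidean norm by the sum of the coordinates.\<close>
  obtain n where "real CARD('d) / d < real n" using reals_Archimedean2 by blast
  hence n: "real CARD('d) / d < real (Suc n)" by simp
  define L where "L = \<lceil>real (Suc n) * B\<rceil>"
  define J where "J = (\<lambda>j::'d \<Rightarrow> int. (n, j)) ` Pi\<^sub>E UNIV (\<lambda>_. {-L-1..L+1})"
  define a where "a k = f (\<chi> i. real_of_int (snd k i) / real (Suc n))" for k :: "nat \<times> ('d \<Rightarrow> int)"
  have fJ: "finite J" unfolding J_def by (intro finite_imageI finite_PiE) auto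
  have near: "\<bar>f x - a k\<bar> * tent k x \<le> \<delta> * tent k x" if "k \<in> J" for k x
  proof (cases "tent k x = 0")
    case False
    have k: "fst k = n" using that unfolding J_def by auto
    have c: "\<bar>x $ i - real_of_int (snd k i) / real (Suc n)\<bar> \<le> 1 / real (Suc n)" for i
      using tent_nonzeroD[OF False, of i] k by (intro near_lattice) auto
    have "dist x (\<chi> i. real_of_int (snd k i) / real (Suc n)) \<le> (\<Sum>i\<in>UNIV. \<bar>(x - (\<chi> i. real_of_int (snd k i) / real (Suc n))) $ i\<bar>)"
      unfolding dist_norm by (rule norm_le_l1_cart)
    also have "\<dots> \<le> (\<Sum>i\<in>(UNIV::'d set). 1 / real (Suc n))" using c by (intro sum_mono) simp
    also have "\<dots> = real CARD('d) / real (Suc n)" by simp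
    also have "\<dots> < d" using n d(1) by (simp add: field_simps)
    finally have "\<bar>f x - a k\<bar> < \<delta>" using d(2) unfolding a_def dist_real_def by blast
    thus ?thesis by (intro mult_right_mono) (auto simp: tent_nonneg)
  qed simp
  have "\<bar>f x - (\<Sum>k\<in>J. a k * tent k x)\<bar> \<le>
    \<delta> * (\<Sum>j\<in>Pi\<^sub>E UNIV (\<lambda>_. {-L0-1..L0+1}). tent (0, j) x)" for x
  proof -
    have eq: "f x = (\<Sum>k\<in>J. f x * tent k x)"
    proof (cases "f x = 0")
      case False
      have "\<bar>real (Suc n) * x $ i\<bar> \<le> L" for i
      proof -
        have "\<bar>x $ i\<bar> \<le> B" using component_le_norm_cart[of x i] B[OF False] by linarith
        hence "real (Suc n) * \<bar>x $ i\<bar> \<le> real (Suc n) * B" by (intro mult_left_mono) auto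
        also have "\<dots> \<le> L" unfolding L_def by (rule le_of_int_ceiling)
        finally show ?thesis by (simp only: abs_mult abs_of_nat)
      qed
      from sum_tent[OF this] have "(\<Sum>k\<in>J. tent k x) = 1"
        unfolding J_def by (subst sum.reindex) (simp_all add: inj_on_def comp_def)
      thus ?thesis by (simp add: sum_distrib_left[symmetric])
    qed simp
    have "\<bar>f x - (\<Sum>k\<in>J. a k * tent k x)\<bar> = \<bar>\<Sum>k\<in>J. (f x - a k) * tent k x\<bar>"
      by (subst eq) (simp only: left_diff_distrib sum_subtractf)
    also have "\<dots> \<le> (\<Sum>k\<in>J. \<bar>f x - a k\<bar> * tent k x)"
      by (rule order_trans[OF sum_abs]) (auto simp: abs_mult tent_nonneg intro!: sum_mono)
    also have "\<dots> \<le> (\<Sum>k\<in>J. \<delta> * tent k x)" using near by (intro sum_mono) auto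
    also have "\<dots> = \<delta> * (\<Sum>k\<in>J. tent k x)" unfolding sum_distrib_left ..
    also have "(\<Sum>k\<in>J. tent k x) \<le> (\<Sum>j\<in>Pi\<^sub>E UNIV (\<lambda>_. {-L0-1..L0+1}). tent (0, j) x)"
    proof (cases "\<forall>i. \<bar>real (Suc 0) * x $ i\<bar> \<le> L0")
      case True
      have "(\<Sum>k\<in>J. tent k x) \<le> 1"
        using sum_tent_le_1[where L=L and n=n and x=x] unfolding J_def
        by (subst sum.reindex) (simp_all add: inj_on_def comp_def)
      thus ?thesis using sum_tent[of 0 x L0] True by simp
    next
      case False
      then obtain i where i: "\<bar>x $ i\<bar> > L0" by (auto simp: not_le)
      have "tent k x = 0" if "k \<in> J" for k
      proof (rule ccontr)
        assume "tent k x \<noteq> 0"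
        from tent_nonzeroD[OF this, of i] that
        have 1: "\<bar>real (Suc n) * x $ i - real_of_int (snd k i)\<bar> < 1" by (auto simp: J_def)
        have "snd k i \<in> {-L-1..L+1}" using that by (auto simp: J_def)
        hence 2: "\<bar>real_of_int (snd k i)\<bar> \<le> L + 1" by (simp add: abs_le_iff)
        \<comment> \<open>The 3 in \<open>L0\<close> is made of the rounding in \<open>L\<close>,
          the extra index on each side and the radius of a tent. Where the coarse sum can differ
          from 1, all tents used in the approximation vanish.\<close>
        have 3: "L < real (Suc n) * B + 1" unfolding L_def by linarith
        have "\<bar>real (Suc n) * x $ i\<bar> < real (Suc n) * B + 3" using 1 2 3 by linarith
        hence "real (Suc n) * \<bar>x $ i\<bar> < real (Suc n) * B + 3" by (simp only: abs_mult abs_of_nat)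
        also have "\<dots> \<le> real (Suc n) * (B + 3)" by (simp add: algebra_simps)
        finally have "\<bar>x $ i\<bar> < B + 3" by (simp only: mult_less_cancel_left)
        thus False using i unfolding L0_def by linarith
      qed
      hence "(\<Sum>k\<in>J. tent k x) = 0" by (intro sum.neutral) auto
      thus ?thesis by (simp add: sum_nonneg tent_nonneg)
    qed
    finally show ?thesis using \<delta> by simp
  qed
  hence "finite J \<and> (\<forall>x. \<bar>f x - (\<Sum>k\<in>J. a k * tent k x)\<bar> \<le>
    \<delta> * (\<Sum>j\<in>Pi\<^sub>E UNIV (\<lambda>_. {-L0-1..L0+1}). tent (0, j) x))"
    using fJ by simp
  thus ?thesis by (intro exI)
qed

section \<open>The weak topology in tent coordinates\<close>

lemma radon_integrable:
  fixes f :: "real ^ 'd \<Rightarrow> real"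
  assumes \<mu>: "\<mu> \<in> radon_measures" and f: "continuous_on UNIV f" "bounded {x. f x \<noteq> 0}"
  shows "integrable \<mu> f"
proof -
  define K where "K = closure {x. f x \<noteq> 0}"
  have K: "compact K" unfolding K_def using f(2) by simp
  have "compact (f ` K)" by (intro compact_continuous_image continuous_on_subset[OF f(1)] K) auto
  then obtain C where C: "\<And>x. x \<in> K \<Longrightarrow> norm (f x) \<le> C" using compact_imp_bounded bounded_iff by (metis imageI)
  have sets: "sets \<mu> = sets borel" and fin: "emeasure \<mu> K < \<infinity>" using \<mu> K unfolding radon_measures_def by auto
  have fm: "f \<in> borel_measurable \<mu>"
    using borel_measurable_continuous_onI[OF f(1)] measurable_cong_sets[OF sets refl] by blast
  have K0: "f x = 0" if "x \<notin> K" for x using that closure_subset[of "{x. f x \<noteq> 0}"] unfolding K_def by auto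
  show ?thesis
    by (rule integrableI_bounded_set[where A=K and B=C]) (use K0 C fm fin sets compact_imp_closed[OF K] in auto)
qed

lemma integrable_tent: "\<mu> \<in> radon_measures \<Longrightarrow> integrable \<mu> (tent k)"
  by (intro radon_integrable continuous_tent bounded_support_tent)

lemma topspace_weak [simp]: "topspace (weak_topology :: (real ^ 'd) measure topology) = radon_measures"
proof -
  have "topspace (weak_topology :: (real ^ 'd) measure topology) =
    \<Union>{{\<mu> \<in> radon_measures. (\<integral>x. f x \<partial>\<mu>) \<in> V} | (f :: real ^ 'd \<Rightarrow> real) V.
        continuous_on UNIV f \<and> compact (closure {x. f x \<noteq> 0}) \<and> open V}"
    unfolding weak_topology_def by (rule topology_generated_by_topspace)
  moreover have "radon_measures \<in> {{\<mu> \<in> radon_measures. (\<integral>x. f x \<partial>\<mu>) \<in> V} | (f :: real ^ 'd \<Rightarrow> real) V.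
        continuous_on UNIV f \<and> compact (closure {x. f x \<noteq> 0}) \<and> open V}"
    by (rule CollectI, intro exI[of _ "\<lambda>x. 0"] exI[of _ UNIV]) auto
  ultimately show ?thesis by blast
qed

lemma openin_weak_generator:
  fixes f :: "real ^ 'd \<Rightarrow> real"
  assumes "continuous_on UNIV f" "bounded {x. f x \<noteq> 0}" "open V"
  shows "openin weak_topology {\<mu> \<in> radon_measures. (\<integral>x. f x \<partial>\<mu>) \<in> V}"
  unfolding weak_topology_def by (rule topology_generated_by_Basis) (use assms in auto)

lemma abs_integral_sub_tents_le:
  assumes \<mu>: "\<mu> \<in> radon_measures" and f: "integrable \<mu> f" and J: "finite J" "finite J'"
    and le: "\<And>x. \<bar>f x - (\<Sum>k\<in>J. a k * tent k x)\<bar> \<le> \<delta> * (\<Sum>k\<in>J'. tent k x)"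
  shows "\<bar>(\<integral>x. f x \<partial>\<mu>) - (\<Sum>k\<in>J. a k * tent_coords \<mu> k)\<bar> \<le> \<delta> * (\<Sum>k\<in>J'. tent_coords \<mu> k)"
proof -
  have i: "integrable \<mu> (tent k)" for k by (rule integrable_tent[OF \<mu>])
  have "(\<integral>x. f x \<partial>\<mu>) - (\<Sum>k\<in>J. a k * tent_coords \<mu> k) = (\<integral>x. f x - (\<Sum>k\<in>J. a k * tent k x) \<partial>\<mu>)"
    unfolding tent_coords_def using f i by simp
  also have "\<bar>\<dots>\<bar> \<le> (\<integral>x. \<delta> * (\<Sum>k\<in>J'. tent k x) \<partial>\<mu>)"
    by (rule order_trans[OF integral_abs_bound], rule integral_mono) (use f i le in auto)
  also have "\<dots> = \<delta> * (\<Sum>k\<in>J'. tent_coords \<mu> k)" unfolding tent_coords_def using i by simp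
  finally show ?thesis .
qed

text \<open>Tents are themselves test functions, which gives one inclusion. For the other, the
  integral of a test function is close to a finite combination of coordinates as long as the mass
  seen by the coarse tents stays bounded.\<close>

lemma coord_embedding_weak: "coord_embedding weak_topology tent_coords"
  unfolding coord_embedding_def topspace_weak
proof (intro allI iffI)
  fix U :: "(real ^ 'd) measure set"
  define T where "T = pullback_topology radon_measures (tent_coords :: (real ^ 'd) measure \<Rightarrow> _) euclidean"
  have gen: "openin T {\<mu> \<in> radon_measures. (\<integral>x. f x \<partial>\<mu>) \<in> V}"
    if f: "continuous_on UNIV f" "bounded {x. f x \<noteq> 0}" and V: "open V" for f :: "real ^ 'd \<Rightarrow> real" and V
  proof (subst openin_subopen, intro ballI)
    fix \<mu>0 assume m0: "\<mu>0 \<in> {\<mu> \<in> radon_measures. (\<integral>x. f x \<partial>\<mu>) \<in> V}"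
    then obtain \<epsilon> where \<epsilon>: "\<epsilon> > 0" "ball (\<integral>x. f x \<partial>\<mu>0) \<epsilon> \<subseteq> V" using V open_contains_ball by blast
    obtain B where B: "B > 0" "\<And>x. f x \<noteq> 0 \<Longrightarrow> norm x \<le> B" using f(2) unfolding bounded_pos by auto
    define L0 where "L0 = \<lceil>B\<rceil> + 3"
    define J0 where "J0 = (\<lambda>j::'d \<Rightarrow> int. (0::nat, j)) ` Pi\<^sub>E UNIV (\<lambda>_. {-L0-1..L0+1})"
    define \<Phi> where "\<Phi> x = (\<Sum>k\<in>J0. x k)" for x :: "nat \<times> ('d \<Rightarrow> int) \<Rightarrow> real"
    define C where "C = \<Phi> (tent_coords \<mu>0) + 1"
    have C: "C > 0" unfolding C_def \<Phi>_def tent_coords_def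
      by (intro add_nonneg_pos sum_nonneg integral_nonneg) (auto simp: tent_nonneg)
    have J0: "finite J0" "(\<Sum>j\<in>Pi\<^sub>E UNIV (\<lambda>_. {-L0-1..L0+1}). tent (0, j) x) = (\<Sum>k\<in>J0. tent k x)" for x
      unfolding J0_def by (auto intro!: finite_PiE, subst sum.reindex) (simp_all add: inj_on_def comp_def)
    have "\<epsilon> / (3 * C) > 0" using \<epsilon> C by simp
    from tent_approximation[OF f(1) B(2) less_imp_le[OF B(1)] this] obtain J a where
      J: "finite J" "\<And>x. \<bar>f x - (\<Sum>k\<in>J. a k * tent k x)\<bar> \<le> \<epsilon> / (3 * C) * (\<Sum>k\<in>J0. tent k x)"
      unfolding L0_def[symmetric] J0(2) by metis
    define G where "G x = (\<Sum>k\<in>J. a k * x k)" for x :: "nat \<times> ('d \<Rightarrow> int) \<Rightarrow> real"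
    \<comment> \<open>The second condition bounds the coarse tent sum, hence the approximation
      error, at all measures of the neighbourhood at once.\<close>
    define W where "W = {x. \<bar>G x - G (tent_coords \<mu>0)\<bar> < \<epsilon> / 3 \<and> \<Phi> x < C}"
    have cont: "continuous_on UNIV G" "continuous_on UNIV \<Phi>"
      unfolding G_def \<Phi>_def by (intro continuous_intros continuous_on_product_coordinates)+
    have "open W" unfolding W_def
      by (intro open_Collect_conj open_Collect_less continuous_intros cont)
    have est: "\<bar>(\<integral>x. f x \<partial>\<mu>) - G (tent_coords \<mu>)\<bar> \<le> \<epsilon> / 3"
      if "\<mu> \<in> radon_measures" "\<Phi> (tent_coords \<mu>) < C" for \<mu>
    proof -
      have "\<bar>(\<integral>x. f x \<partial>\<mu>) - G (tent_coords \<mu>)\<bar> \<le> \<epsilon> / (3 * C) * \<Phi> (tent_coords \<mu>)"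
        unfolding G_def \<Phi>_def by (rule abs_integral_sub_tents_le[OF that(1) radon_integrable[OF that(1) f] J(1) J0(1) J(2)])
      also have "\<dots> \<le> \<epsilon> / (3 * C) * C" using that(2) \<epsilon> C by (intro mult_left_mono) auto
      finally show ?thesis using C by simp
    qed
    show "\<exists>S. openin T S \<and> \<mu>0 \<in> S \<and> S \<subseteq> {\<mu> \<in> radon_measures. (\<integral>x. f x \<partial>\<mu>) \<in> V}"
    proof (intro exI[of _ "tent_coords -` W \<inter> radon_measures"] conjI subsetI)
      show "openin T (tent_coords -` W \<inter> radon_measures)"
        unfolding T_def openin_pullback_topology using \<open>open W\<close> by auto
      show "\<mu>0 \<in> tent_coords -` W \<inter> radon_measures" using m0 \<epsilon> unfolding W_def C_def by auto
      fix \<mu> assume \<mu>: "\<mu> \<in> tent_coords -` W \<inter> radon_measures"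
      have "\<bar>(\<integral>x. f x \<partial>\<mu>) - G (tent_coords \<mu>)\<bar> \<le> \<epsilon> / 3" "\<bar>(\<integral>x. f x \<partial>\<mu>0) - G (tent_coords \<mu>0)\<bar> \<le> \<epsilon> / 3"
        by (rule est; use \<mu> m0 in \<open>simp add: W_def C_def\<close>)+
      moreover have "\<bar>G (tent_coords \<mu>) - G (tent_coords \<mu>0)\<bar> < \<epsilon> / 3" using \<mu> unfolding W_def by simp
      ultimately have "\<bar>(\<integral>x. f x \<partial>\<mu>) - (\<integral>x. f x \<partial>\<mu>0)\<bar> < \<epsilon>" by linarith
      hence "(\<integral>x. f x \<partial>\<mu>) \<in> V" using \<epsilon>(2) by (auto simp: dist_real_def subset_iff)
      thus "\<mu> \<in> {\<mu> \<in> radon_measures. (\<integral>x. f x \<partial>\<mu>) \<in> V}" using \<mu> by simp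
    qed
  qed
  {
    assume "openin weak_topology U"
    hence "generate_topology_on {{\<mu> \<in> radon_measures. (\<integral>x. f x \<partial>\<mu>) \<in> V} | (f :: real ^ 'd \<Rightarrow> real) V.
        continuous_on UNIV f \<and> compact (closure {x. f x \<noteq> 0}) \<and> open V} U"
      unfolding weak_topology_def by (rule openin_topology_generated_by)
    hence "openin T U"
      by (rule generate_topology_on_coarsest[rotated 2]) (auto intro!: gen)
    thus "\<exists>V. open V \<and> U = tent_coords -` V \<inter> radon_measures"
      unfolding T_def openin_pullback_topology by simp
  }
  {
    assume "\<exists>V. open V \<and> U = tent_coords -` V \<inter> radon_measures"
    then obtain V where V: "open V" "U = tent_coords -` V \<inter> radon_measures" by (elim exE conjE)
    have "continuous_map weak_topology (product_topology (\<lambda>_. euclideanreal) UNIV) (tent_coords :: (real ^ 'd) measure \<Rightarrow> _)"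
    proof (rule continuous_map_coordinatewise_then_product)
      fix k :: "nat \<times> ('d \<Rightarrow> int)"
      show "continuous_map weak_topology euclideanreal (\<lambda>x. tent_coords x k)"
        unfolding continuous_map_def tent_coords_def
        using openin_weak_generator[OF continuous_tent[of UNIV k] bounded_support_tent[of k]] by simp
    qed auto
    hence "openin weak_topology {x \<in> radon_measures. tent_coords x \<in> V}"
      using V(1) unfolding euclidean_product_topology continuous_map_def by auto
    also have "{x \<in> radon_measures. tent_coords x \<in> V} = U" unfolding V(2) by auto
    finally show "openin weak_topology U" .
  }
qed

section \<open>Measurability of measure-valued maps\<close>

lemma measurable_nn_integral_family:
  fixes K :: "'a \<Rightarrow> 'b measure"
  assumes s: "\<And>w. w \<in> space M \<Longrightarrow> sets (K w) = sets N"
    and ev: "\<And>A. A \<in> sets N \<Longrightarrow> (\<lambda>w. emeasure (K w) A) \<in> borel_measurable M"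
    and g: "g \<in> borel_measurable N"
  shows "(\<lambda>w. \<integral>\<^sup>+x. g x \<partial>K w) \<in> borel_measurable M"
proof -
  have mK: "h \<in> borel_measurable (K w)" if "h \<in> borel_measurable N" "w \<in> space M" for w and h :: "'b \<Rightarrow> ennreal"
    using that(1) unfolding measurable_cong_sets[OF s[OF that(2)] refl] .
  show ?thesis
  using g
proof (induction g rule: borel_measurable_induct)
  case (cong f g)
  have "(\<lambda>w. \<integral>\<^sup>+x. g x \<partial>K w) \<in> borel_measurable M \<longleftrightarrow> (\<lambda>w. \<integral>\<^sup>+x. f x \<partial>K w) \<in> borel_measurable M"
    by (intro measurable_cong nn_integral_cong) (use cong s sets_eq_imp_space_eq in metis)
  from iffD1[OF this cong(4)] show ?case .
next
  case (set A)
  have "(\<lambda>w. \<integral>\<^sup>+x. indicator A x \<partial>K w) \<in> borel_measurable M \<longleftrightarrow> (\<lambda>w. emeasure (K w) A) \<in> borel_measurable M"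
    by (intro measurable_cong) (use set s in simp)
  from iffD2[OF this ev[OF set]] show ?case .
next
  case (mult u c)
  have *: "(\<lambda>w. \<integral>\<^sup>+x. c * u x \<partial>K w) \<in> borel_measurable M \<longleftrightarrow> (\<lambda>w. c * (\<integral>\<^sup>+x. u x \<partial>K w)) \<in> borel_measurable M"
    by (intro measurable_cong nn_integral_cmult mK[OF mult(2)])
  note [measurable] = mult.IH
  show ?case by (rule iffD2[OF *]) measurable
next
  case (add u v)
  have *: "(\<lambda>w. \<integral>\<^sup>+x. v x + u x \<partial>K w) \<in> borel_measurable M \<longleftrightarrow>
      (\<lambda>w. (\<integral>\<^sup>+x. v x \<partial>K w) + (\<integral>\<^sup>+x. u x \<partial>K w)) \<in> borel_measurable M"
    by (intro measurable_cong nn_integral_add mK[OF add(1)] mK[OF add(3)])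
  show ?case by (rule iffD2[OF *], rule borel_measurable_add; rule add)
next
  case (seq U)
  have "(\<lambda>w. \<integral>\<^sup>+x. Sup (range U) x \<partial>K w) \<in> borel_measurable M \<longleftrightarrow>
      (\<lambda>w. SUP i. \<integral>\<^sup>+x. U i x \<partial>K w) \<in> borel_measurable M"
  proof (intro measurable_cong)
    fix w assume w: "w \<in> space M"
    have "U i \<in> borel_measurable (K w)" for i by (rule mK[OF seq(1) w])
    thus "(\<integral>\<^sup>+x. Sup (range U) x \<partial>K w) = (SUP i. \<integral>\<^sup>+x. U i x \<partial>K w)"
      unfolding SUP_apply by (intro nn_integral_monotone_convergence_SUP seq)
  qed
  from iffD2[OF this borel_measurable_SUP[OF countableI_type seq.IH]] show ?case .
qed
qed

text \<open>The converse of the measurability of evaluations: tent coordinates are integrals, and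
  integrals are built from masses of Borel sets. Almost every map into a space of measures is
  treated through this criterion.\<close>

lemma measurable_weakI:
  fixes K :: "'a \<Rightarrow> (real ^ 'd) measure"
  assumes r: "\<And>w. w \<in> space M \<Longrightarrow> K w \<in> radon_measures"
    and ev: "\<And>A. A \<in> sets borel \<Longrightarrow> (\<lambda>w. emeasure (K w) A) \<in> borel_measurable M"
  shows "K \<in> measurable M (borel_of weak_topology)"
  unfolding measurable_borel_of_iff[OF coord_embedding_weak]
proof (intro conjI ballI)
  show "(\<lambda>w. tent_coords (K w)) \<in> borel_measurable M"
  proof (rule measurable_coordinatewise_then_product)
    fix k :: "nat \<times> ('d \<Rightarrow> int)"
    have s: "sets (K w) = sets borel" if "w \<in> space M" for w using r[OF that] by (auto simp: radon_measures_def)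
    have tb: "tent k \<in> borel_measurable borel" using borel_measurable_continuous_onI[OF continuous_tent] .
    have "(\<lambda>w. enn2real (\<integral>\<^sup>+x. ennreal (tent k x) \<partial>K w)) \<in> borel_measurable M"
      by (intro borel_measurable_enn2real measurable_nn_integral_family[OF s ev]) (use tb in auto)
    moreover have "tent_coords (K w) k = enn2real (\<integral>\<^sup>+x. ennreal (tent k x) \<partial>K w)" if "w \<in> space M" for w
      unfolding tent_coords_def
      by (intro integral_eq_nn_integral) (use tb tent_nonneg[of k] in \<open>auto simp: measurable_cong_sets[OF s[OF that] refl]\<close>)
    ultimately show "(\<lambda>w. tent_coords (K w) k) \<in> borel_measurable M"
      by (subst measurable_cong) auto
  qed
qed (use r in auto)

lemma measurable_integral_weak:
  fixes f :: "real ^ 'd \<Rightarrow> real"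
  assumes f: "continuous_on UNIV f" "bounded {x. f x \<noteq> 0}"
  shows "(\<lambda>\<mu>. \<integral>x. f x \<partial>\<mu>) \<in> borel_measurable (borel_of weak_topology)"
proof (rule borel_measurableI)
  fix S :: "real set" assume "open S"
  from openin_weak_generator[OF f this]
  show "(\<lambda>\<mu>. \<integral>x. f x \<partial>\<mu>) -` S \<inter> space (borel_of weak_topology) \<in> sets (borel_of weak_topology)"
    unfolding sets_borel_of by (intro sigma_sets.Basic) (auto simp: vimage_def Int_def conj_commute)
qed

text \<open>The indicator of an open set is an increasing limit of truncated multiples of the
  distance to the complement; boundedness of \<open>U\<close> makes these test functions.\<close>

lemma measurable_emeasure_weak_open:
  fixes U :: "(real ^ 'd) set"
  assumes U: "open U" "bounded U"
  shows "(\<lambda>\<mu>. emeasure \<mu> U) \<in> borel_measurable (borel_of weak_topology)"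
proof -
  define f where "f n x = min 1 (real n * infdist x (- U))" for n x
  have ne: "- U \<noteq> {}" using U(2) not_bounded_UNIV by (metis compl_bot_eq double_compl)
  have f0: "f n x = 0" if "x \<notin> U" for n x using that unfolding f_def by (simp add: infdist_zero)
  have f1: "f n x \<ge> 0" for n x unfolding f_def by (simp add: infdist_nonneg)
  have cont: "continuous_on UNIV (f n)" for n unfolding f_def by (intro continuous_intros)
  have supp: "bounded {x. f n x \<noteq> 0}" for n by (rule bounded_subset[OF U(2)]) (use f0 in auto)
  have sup: "(SUP n. ennreal (f n x)) = indicator U x" for x
  proof (cases "x \<in> U")
    case True
    hence "infdist x (- U) \<noteq> 0"
      using in_closed_iff_infdist_zero[of "- U" x] U(1) ne by auto
    hence p: "infdist x (- U) > 0" using infdist_nonneg[of x "- U"] by linarith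
    obtain n where n: "1 / infdist x (- U) < real n" using reals_Archimedean2 by blast
    have "f n x = 1" using n p unfolding f_def by (simp add: field_simps)
    moreover have "ennreal (f m x) \<le> 1" for m unfolding f_def by (simp add: ennreal_le_1)
    ultimately have "(SUP n. ennreal (f n x)) = 1"
      by (intro antisym SUP_least SUP_upper2[of n]) auto
    thus ?thesis using True by simp
  qed (use f0 in simp)
  have "emeasure \<mu> U = (SUP n. ennreal (\<integral>x. f n x \<partial>\<mu>))" if \<mu>: "\<mu> \<in> radon_measures" for \<mu>
  proof -
    have sm: "sets \<mu> = sets borel" using \<mu> by (auto simp: radon_measures_def)
    have fm: "f n \<in> borel_measurable \<mu>" for n
      using borel_measurable_continuous_onI[OF cont] measurable_cong_sets[OF sm refl] by blast
    have "emeasure \<mu> U = (\<integral>\<^sup>+x. indicator U x \<partial>\<mu>)" using U(1) sm by simp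
    also have "\<dots> = (\<integral>\<^sup>+x. (SUP n. ennreal (f n x)) \<partial>\<mu>)" using sup by simp
    also have "\<dots> = (SUP n. \<integral>\<^sup>+x. ennreal (f n x) \<partial>\<mu>)"
    proof (rule nn_integral_monotone_convergence_SUP)
      show "incseq (\<lambda>n x. ennreal (f n x))"
        by (intro incseq_SucI le_funI ennreal_leI) (auto simp: f_def algebra_simps intro!: min.coboundedI2 infdist_nonneg)
    qed (use fm in auto)
    also have "\<dots> = (SUP n. ennreal (\<integral>x. f n x \<partial>\<mu>))"
      using radon_integrable[OF \<mu> cont supp] f1 by (simp add: nn_integral_eq_integral)
    finally show ?thesis .
  qed
  moreover have "(\<lambda>\<mu>. SUP n. ennreal (\<integral>x. f n x \<partial>\<mu>)) \<in> borel_measurable (borel_of weak_topology)"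
    by (intro borel_measurable_SUP measurable_compose[OF measurable_integral_weak[OF cont supp]]) auto
  ultimately show ?thesis by (subst measurable_cong) auto
qed

lemma emeasure_SUP_box:
  fixes \<mu> :: "(real ^ 'd) measure"
  assumes "sets \<mu> = sets borel" "A \<in> sets borel"
  shows "emeasure \<mu> A = (SUP n. emeasure \<mu> (A \<inter> ball 0 (real n)))"
proof -
  have *: "x \<in> (\<Union>n. A \<inter> ball 0 (real n))" if "x \<in> A" for x
  proof -
    obtain n where "norm x < real n" using reals_Archimedean2 by blast
    thus ?thesis using that by (intro UN_I[of n]) auto
  qed
  have "(\<Union>n. A \<inter> ball 0 (real n)) = A"
    by (rule equalityI[OF UN_least[OF Int_lower1] subsetI[OF *]])
  moreover have "range (\<lambda>n. A \<inter> ball 0 (real n)) \<subseteq> sets \<mu>"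
    unfolding assms(1) by (intro image_subsetI sets.Int assms(2) borel_open open_ball)
  moreover have "incseq (\<lambda>n. A \<inter> ball 0 (real n))"
  proof (rule incseq_SucI)
    fix n show "A \<inter> ball 0 (real n) \<subseteq> A \<inter> ball 0 (real (Suc n))" by force
  qed
  ultimately show ?thesis using SUP_emeasure_incseq[of "\<lambda>n. A \<inter> ball 0 (real n)" \<mu>] by simp
qed

lemma radon_finite_bounded:
  assumes "\<mu> \<in> radon_measures" "bounded A"
  shows "emeasure \<mu> A < \<infinity>"
proof -
  have "emeasure \<mu> A \<le> emeasure \<mu> (closure A)"
    using assms(1) by (intro emeasure_mono closure_subset) (auto simp: radon_measures_def)
  also have "\<dots> < \<infinity>" using assms unfolding radon_measures_def by auto
  finally show ?thesis .
qed

lemma radonI: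
  fixes \<mu> :: "(real ^ 'd) measure"
  assumes "sets \<mu> = sets borel" "\<And>n::nat. emeasure \<mu> (ball 0 (real n)) < \<infinity>"
  shows "\<mu> \<in> radon_measures"
  unfolding radon_measures_def
proof (intro CollectI conjI allI impI)
  fix K :: "(real ^ 'd) set" assume K: "compact K"
  obtain B where "\<And>x. x \<in> K \<Longrightarrow> norm x \<le> B" using compact_imp_bounded[OF K] unfolding bounded_iff by auto
  moreover obtain n where "B < real n" using reals_Archimedean2 by blast
  ultimately have "K \<subseteq> ball 0 (real n)" by force
  hence "emeasure \<mu> K \<le> emeasure \<mu> (ball 0 (real n))" using assms(1) by (intro emeasure_mono) auto
  thus "emeasure \<mu> K < \<infinity>" using assms(2) order_le_less_trans by blast
qed (use assms in auto)

text \<open>Dynkin's argument starting from the open sets. It is carried out inside each ball,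
  because complements require subtracting finite masses; a supremum over the balls follows at the
  end.\<close>

lemma measurable_emeasure_weak [measurable]:
  fixes A :: "(real ^ 'd) set"
  assumes A: "A \<in> sets borel"
  shows "(\<lambda>\<mu>. emeasure \<mu> A) \<in> borel_measurable (borel_of weak_topology)"
proof -
  let ?W = "borel_of weak_topology :: (real ^ 'd) measure measure"
  have ist: "Int_stable {S :: (real ^ 'd) set. open S}" and gp: "{S :: (real ^ 'd) set. open S} \<subseteq> Pow UNIV"
    by (auto simp: Int_stable_def)
  have *: "(\<lambda>\<mu>. emeasure \<mu> (A \<inter> ball 0 (real n))) \<in> borel_measurable ?W"
    if "A \<in> sigma_sets UNIV {S. open S}" for A and n :: nat
    using ist gp that
  proof (induction A rule: sigma_sets_induct_disjoint)
    case (basic A)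
    thus ?case by (intro measurable_emeasure_weak_open) (auto intro: bounded_subset)
  next
    case (compl A)
    have "A \<in> sets borel" using compl(1) by (simp add: borel_def)
    have "emeasure \<mu> ((UNIV - A) \<inter> ball 0 (real n)) = emeasure \<mu> (ball 0 (real n)) - emeasure \<mu> (A \<inter> ball 0 (real n))"
      if \<mu>: "\<mu> \<in> radon_measures" for \<mu>
    proof -
      have "(UNIV - A) \<inter> ball 0 (real n) = ball 0 (real n) - (A \<inter> ball 0 (real n))" by auto
      moreover have "emeasure \<mu> (A \<inter> ball 0 (real n)) \<noteq> \<infinity>"
        using radon_finite_bounded[OF \<mu>, of "A \<inter> ball 0 (real n)"] bounded_subset[OF bounded_ball] by (auto simp: less_top)
      ultimately show ?thesis using \<mu> \<open>A \<in> sets borel\<close>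
        by (simp add: emeasure_Diff radon_measures_def)
    qed
    moreover have "(\<lambda>\<mu>. emeasure \<mu> (ball 0 (real n)) - emeasure \<mu> (A \<inter> ball 0 (real n))) \<in> borel_measurable ?W"
      by (intro borel_measurable_minus_ennreal measurable_emeasure_weak_open compl) auto
    ultimately show ?case by (subst measurable_cong) auto
  next
    case (union F)
    have Fb: "F i \<in> sets borel" for i using union(2) by (simp add: borel_def image_subset_iff)
    have "emeasure \<mu> (\<Union>(range F) \<inter> ball 0 (real n)) = (\<Sum>i. emeasure \<mu> (F i \<inter> ball 0 (real n)))"
      if \<mu>: "\<mu> \<in> radon_measures" for \<mu>
    proof -
      have "(\<Sum>i. emeasure \<mu> (F i \<inter> ball 0 (real n))) = emeasure \<mu> (\<Union>i. F i \<inter> ball 0 (real n))"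
        using union(1) Fb \<mu> by (intro suminf_emeasure) (auto simp: disjoint_family_on_def radon_measures_def)
      moreover have "\<Union>(range F) \<inter> ball 0 (real n) = (\<Union>i. F i \<inter> ball 0 (real n))" by blast
      ultimately show ?thesis by (simp only:)
    qed
    moreover have "(\<lambda>\<mu>. \<Sum>i. emeasure \<mu> (F i \<inter> ball 0 (real n))) \<in> borel_measurable ?W"
      by (intro borel_measurable_suminf_order union)
    ultimately show ?case by (subst measurable_cong) auto
  next
    case empty show ?case by simp
  qed
  have "A \<in> sigma_sets UNIV {S. open S}" using A by (simp add: borel_def)
  hence "(\<lambda>\<mu>. SUP n. emeasure \<mu> (A \<inter> ball 0 (real n))) \<in> borel_measurable ?W"
    by (intro borel_measurable_SUP *) auto
  moreover have "emeasure \<mu> A = (SUP n. emeasure \<mu> (A \<inter> ball 0 (real n)))" if "\<mu> \<in> radon_measures" for \<mu>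
    using that A by (intro emeasure_SUP_box) (auto simp: radon_measures_def)
  ultimately show ?thesis by (subst measurable_cong) auto
qed

section \<open>The spaces \<open>Mstar\<close> and \<open>Mbox\<close>\<close>

lemma borel_of_subtopology_measurable:
  assumes "coord_embedding X e" "f \<in> measurable (borel_of X) N"
  shows "f \<in> measurable (borel_of (subtopology X S)) N"
proof -
  have "(\<lambda>x. x) \<in> measurable (borel_of (subtopology X S)) (borel_of X)"
    unfolding measurable_borel_of_iff[OF assms(1)]
    using measurable_coord_embedding[OF coord_embedding_subtopology[OF assms(1)]] by auto
  from measurable_compose[OF this assms(2)] show ?thesis .
qed

lemma measurable_subtopologyI:
  assumes "coord_embedding X e" "f \<in> measurable M (borel_of X)" "\<And>w. w \<in> space M \<Longrightarrow> f w \<in> S"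
  shows "f \<in> measurable M (borel_of (subtopology X S))"
  using assms(2,3) unfolding measurable_borel_of_iff[OF assms(1)]
    measurable_borel_of_iff[OF coord_embedding_subtopology[OF assms(1)]] by auto

lemma coord_embedding_Mstar: "coord_embedding Mstar tent_coords"
  and coord_embedding_Mbox: "coord_embedding Mbox tent_coords"
  unfolding Mstar_def Mbox_def by (intro coord_embedding_subtopology coord_embedding_weak)+

lemma topspace_Mstar: "topspace Mstar = {\<mu> \<in> radon_measures. emeasure \<mu> B1 = 1}"
  and topspace_Mbox: "topspace Mbox = {\<mu> \<in> radon_measures. emeasure \<mu> B1 = 1 \<and> emeasure \<mu> (- B1) = 0}"
  unfolding Mstar_def Mbox_def by auto

lemma coord_embedding_Mbox_B1: "coord_embedding Mbox_B1 (\<lambda>z. (tent_coords (fst z), snd z))"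
  unfolding Mbox_B1_def by (intro coord_embedding_prod coord_embedding_Mbox coord_embedding_top_of_set)

lemma topspace_Mstar_B1: "topspace Mstar_B1 = topspace Mstar \<times> B1"
  and topspace_Mbox_B1: "topspace Mbox_B1 = topspace Mbox \<times> B1"
  unfolding Mstar_B1_def Mbox_B1_def by auto

lemma measurable_emeasure_Mstar [measurable]:
  "A \<in> sets borel \<Longrightarrow> (\<lambda>\<mu>. emeasure \<mu> A) \<in> borel_measurable (borel_of Mstar)"
  and measurable_emeasure_Mbox [measurable]:
  "A \<in> sets borel \<Longrightarrow> (\<lambda>\<mu>. emeasure \<mu> A) \<in> borel_measurable (borel_of Mbox)"
  unfolding Mstar_def Mbox_def
  by (intro borel_of_subtopology_measurable[OF coord_embedding_weak] measurable_emeasure_weak; assumption)+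

text \<open>Having the same mass on \<open>A\<close> as \<mu> is a Borel condition, and every Borel
  set is a preimage under \<open>tent_coords\<close>. Such a set cannot separate two measures with
  equal coordinates.\<close>

lemma tent_coords_inj:
  assumes "\<mu> \<in> radon_measures" "\<nu> \<in> radon_measures" "tent_coords \<mu> = tent_coords \<nu>"
  shows "\<mu> = \<nu>"
proof (rule measure_eqI)
  show s: "sets \<mu> = sets \<nu>" using assms by (auto simp: radon_measures_def)
  fix A assume "A \<in> sets \<mu>"
  hence A: "A \<in> sets borel" using assms by (auto simp: radon_measures_def)
  have "(\<lambda>\<mu>. emeasure \<mu> A) -` {emeasure \<mu> A} \<inter> topspace weak_topology \<in> sets (borel_of weak_topology)"
    using measurable_sets[OF measurable_emeasure_weak[OF A]] by (metis borel_singleton space_borel_of sets.empty_sets)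
  then obtain V where V: "(\<lambda>\<mu>. emeasure \<mu> A) -` {emeasure \<mu> A} \<inter> radon_measures = tent_coords -` V \<inter> radon_measures"
    unfolding sets_borel_of_embedding[OF coord_embedding_weak] by (auto simp: sets_vimage_algebra2)
  have "\<mu> \<in> tent_coords -` V \<inter> radon_measures" unfolding V[symmetric] using assms by simp
  hence "\<nu> \<in> tent_coords -` V \<inter> radon_measures" using assms by simp
  thus "emeasure \<mu> A = emeasure \<nu> A" unfolding V[symmetric] by simp
qed

text \<open>Restricting to a ball and dividing by one plus its mass gives subprobability kernels;
  the added 1 excludes division by zero. Undoing the factor and letting the balls grow recovers the
  original integral as a supremum.\<close>

lemma measurable_nn_integral_radon_kernel:
  fixes K :: "'a \<Rightarrow> (real ^ 'd) measure"
  assumes K: "K \<in> measurable M (borel_of weak_topology)"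
    and f: "(\<lambda>z. f (fst z) (snd z)) \<in> borel_measurable (M \<Otimes>\<^sub>M borel)"
  shows "(\<lambda>w. \<integral>\<^sup>+y. f w y \<partial>K w) \<in> borel_measurable M"
proof -
  have rad: "K w \<in> radon_measures" if "w \<in> space M" for w using measurable_space[OF K that] by simp
  hence s: "sets (K w) = sets borel" if "w \<in> space M" for w using that by (auto simp: radon_measures_def)
  have ev [measurable]: "(\<lambda>w. emeasure (K w) A) \<in> borel_measurable M" if "A \<in> sets borel" for A
    using measurable_compose[OF K measurable_emeasure_weak[OF that]] .
  define C where "C n = ball (0::real ^ 'd) (real n)" for n
  have C: "C n \<in> sets borel" for n unfolding C_def by simp
  define L where "L n w = scale_measure (1 / (1 + emeasure (K w) (C n))) (density (K w) (indicator (C n)))" for n w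
  have fin: "emeasure (K w) (C n) < \<infinity>" if "w \<in> space M" for w n
    using radon_finite_bounded[OF rad[OF that]] unfolding C_def by simp
  have Lev: "emeasure (L n w) A = (1 / (1 + emeasure (K w) (C n))) * emeasure (K w) (C n \<inter> A)"
    if "w \<in> space M" "A \<in> sets borel" for n w A
    unfolding L_def using that s[OF that(1)] C
    by (simp add: emeasure_density indicator_inter_arith[symmetric])
  have L: "L n \<in> measurable M (subprob_algebra borel)" for n
  proof (rule measurable_subprob_algebra)
    fix w assume w: "w \<in> space M"
    show sL: "sets (L n w) = sets borel" unfolding L_def using s[OF w] by simp
    have "emeasure (L n w) UNIV \<le> 1"
    proof -
      let ?c = "emeasure (K w) (C n)"
      have "1 / (1 + ?c) * ?c \<le> 1 / (1 + ?c) * (1 + ?c)" by (intro mult_left_mono) auto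
      also have "\<dots> = 1" using fin[OF w, of n]
        by (simp add: mult.commute[of "1 / _"] ennreal_times_divide ennreal_divide_self)
      finally show ?thesis using Lev[OF w, of UNIV n] by simp
    qed
    thus "subprob_space (L n w)" using sL by (intro subprob_spaceI) (auto dest: sets_eq_imp_space_eq)
  next
    fix A :: "(real ^ 'd) set" assume A: "A \<in> sets borel"
    have [measurable]: "(\<lambda>w. emeasure (K w) (C n \<inter> A)) \<in> borel_measurable M" "(\<lambda>w. emeasure (K w) (C n)) \<in> borel_measurable M"
      using ev A C by auto
    have "(\<lambda>w. (1 / (1 + emeasure (K w) (C n))) * emeasure (K w) (C n \<inter> A)) \<in> borel_measurable M"
      by measurable
    thus "(\<lambda>w. emeasure (L n w) A) \<in> borel_measurable M" using Lev A by (subst measurable_cong) auto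
  qed
  have fw: "f w \<in> borel_measurable (K w)" if "w \<in> space M" for w
    using measurable_compose_Pair1[OF that f] s[OF that] measurable_cong_sets by auto
  have "(\<integral>\<^sup>+y. f w y \<partial>K w) = (SUP n. (1 + emeasure (K w) (C n)) * (\<integral>\<^sup>+y. f w y \<partial>L n w))" if w: "w \<in> space M" for w
  proof -
    have [measurable]: "f w \<in> borel_measurable (K w)" "C n \<in> sets (K w)" for n using fw[OF w] s[OF w] C by auto
    have sup: "f w y = (SUP n. indicator (C n) y * f w y)" for y
    proof -
      obtain n where "norm y < real n" using reals_Archimedean2 by blast
      hence "f w y \<le> (SUP n. indicator (C n) y * f w y)" by (intro SUP_upper2[of n]) (auto simp: C_def)
      moreover have "(SUP n. indicator (C n) y * f w y) \<le> f w y" by (intro SUP_least) (auto simp: indicator_def)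
      ultimately show ?thesis by (rule antisym)
    qed
    have "(\<integral>\<^sup>+y. f w y \<partial>K w) = (\<integral>\<^sup>+y. (SUP n. indicator (C n) y * f w y) \<partial>K w)" using sup by (metis (no_types, lifting))
    also have "\<dots> = (SUP n. \<integral>\<^sup>+y. indicator (C n) y * f w y \<partial>K w)"
    proof (intro nn_integral_monotone_convergence_SUP)
      show "incseq (\<lambda>n y. indicator (C n) y * f w y)"
        by (auto simp: incseq_def le_fun_def C_def indicator_def)
    qed measurable
    also have "\<dots> = (SUP n. (1 + emeasure (K w) (C n)) * (\<integral>\<^sup>+y. f w y \<partial>L n w))"
    proof (intro SUP_cong refl)
      fix n
      let ?c = "emeasure (K w) (C n)"
      have "(\<integral>\<^sup>+y. f w y \<partial>L n w) = (1 / (1 + ?c)) * (\<integral>\<^sup>+y. f w y \<partial>density (K w) (indicator (C n)))"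
        unfolding L_def by (intro nn_integral_scale_measure) simp
      also have "(\<integral>\<^sup>+y. f w y \<partial>density (K w) (indicator (C n))) = (\<integral>\<^sup>+y. indicator (C n) y * f w y \<partial>K w)"
        by (intro nn_integral_density) auto
      finally have "(1 + ?c) * (\<integral>\<^sup>+y. f w y \<partial>L n w) = ((1 + ?c) * (1 / (1 + ?c))) * (\<integral>\<^sup>+y. indicator (C n) y * f w y \<partial>K w)"
        by (simp add: mult.assoc)
      also have "(1 + ?c) * (1 / (1 + ?c)) = 1" using fin[OF w, of n]
        by (simp add: ennreal_times_divide ennreal_divide_self)
      finally show "(\<integral>\<^sup>+y. indicator (C n) y * f w y \<partial>K w) = (1 + ?c) * (\<integral>\<^sup>+y. f w y \<partial>L n w)" by simp
    qed
    finally show ?thesis .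
  qed
  moreover have "(\<lambda>w. SUP n. (1 + emeasure (K w) (C n)) * (\<integral>\<^sup>+y. f w y \<partial>L n w)) \<in> borel_measurable M"
  proof (intro borel_measurable_SUP)
    fix n
    have [measurable]: "(\<lambda>w. \<integral>\<^sup>+y. f w y \<partial>L n w) \<in> borel_measurable M"
      by (rule nn_integral_measurable_subprob_algebra2[OF _ L]) (use f in \<open>simp add: case_prod_beta'\<close>)
    have [measurable]: "(\<lambda>w. emeasure (K w) (C n)) \<in> borel_measurable M" using ev C by auto
    show "(\<lambda>w. (1 + emeasure (K w) (C n)) * (\<integral>\<^sup>+y. f w y \<partial>L n w)) \<in> borel_measurable M" by measurable
  qed auto
  ultimately show ?thesis by (subst measurable_cong) auto
qed

section \<open>Magnification\<close>

text \<open>The common form of all normalised maps: \<open>transl_star x\<close> is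
  \<open>magnify 1 x\<close>, \<open>scale_star t\<close> is \<open>magnify (exp t) 0\<close>, and
  blowing up a cell with centre c and half side 1/N is \<open>magnify N c\<close>. A single
  composition law then covers translations, scalings and magnifications.\<close>

definition magnify :: "real \<Rightarrow> real ^ 'd \<Rightarrow> (real ^ 'd) measure \<Rightarrow> (real ^ 'd) measure" where
  "magnify r c \<mu> = normalize_star (distr \<mu> borel (\<lambda>y. r *\<^sub>R (y - c)))"

text \<open>For positive r this is the closed cube with centre c and half side 1/r; its mass is the
  normalising constant of \<open>magnify\<close>.\<close>

definition window :: "real \<Rightarrow> real ^ 'd \<Rightarrow> (real ^ 'd) set" where
  "window r c = (\<lambda>y. r *\<^sub>R (y - c)) -` B1"

definition restrict_B1 :: "(real ^ 'd) measure \<Rightarrow> (real ^ 'd) measure" where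
  "restrict_B1 \<mu> = density \<mu> (indicator B1)"

lemma mem_B1: "(x :: real ^ 'd) \<in> B1 \<longleftrightarrow> (\<forall>i. \<bar>x $ i\<bar> \<le> 1)"
  by (auto simp: mem_box_cart abs_le_iff minus_le_iff)

lemma mem_window: "r > 0 \<Longrightarrow> y \<in> window r c \<longleftrightarrow> (\<forall>i. \<bar>y $ i - c $ i\<bar> \<le> 1 / r)"
  unfolding window_def vimage_def mem_Collect_eq mem_B1
  by (simp add: abs_mult pos_le_divide_eq mult.commute)

lemma homothety_measurable [measurable]: "(\<lambda>y. r *\<^sub>R (y - c)) \<in> borel_measurable (borel :: (real ^ 'd) measure)"
  by measurable

lemma sets_normalize_star [simp]: "sets (normalize_star \<mu>) = sets \<mu>"
  by (simp add: normalize_star_def)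

lemma sets_magnify [simp]: "sets (magnify r c \<mu>) = sets borel"
  by (simp add: magnify_def)

lemma window_borel [measurable]: "window r c \<in> sets borel"
proof -
  have "(\<lambda>y. r *\<^sub>R (y - c)) -` B1 \<inter> space borel \<in> sets borel"
    by (rule measurable_sets[OF homothety_measurable]) simp
  thus ?thesis by (simp add: window_def)
qed

lemma preimage_homothety_borel:
  "A \<in> sets borel \<Longrightarrow> (\<lambda>y. r *\<^sub>R (y - c)) -` A \<in> sets (borel :: (real ^ 'd) measure)"
  using measurable_sets[OF homothety_measurable, of A r c] by simp

lemma emeasure_distr_homothety:
  fixes \<mu> :: "(real ^ 'd) measure"
  assumes "sets \<mu> = sets borel" "A \<in> sets borel"
  shows "emeasure (distr \<mu> borel (\<lambda>y. r *\<^sub>R (y - c))) A = emeasure \<mu> ((\<lambda>y. r *\<^sub>R (y - c)) -` A)"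
proof -
  have "(\<lambda>y. r *\<^sub>R (y - c)) \<in> measurable \<mu> borel"
    using homothety_measurable unfolding measurable_cong_sets[OF assms(1) refl] .
  from emeasure_distr[OF this assms(2)] show ?thesis
    using sets_eq_imp_space_eq[OF assms(1)] by simp
qed

lemma emeasure_magnify:
  assumes "sets \<mu> = sets borel" "A \<in> sets borel"
  shows "emeasure (magnify r c \<mu>) A = emeasure \<mu> ((\<lambda>y. r *\<^sub>R (y - c)) -` A) / emeasure \<mu> (window r c)"
  using emeasure_distr_homothety[OF assms, of r c] emeasure_distr_homothety[OF assms(1), of B1 r c]
  unfolding magnify_def normalize_star_def
  by (simp add: window_def[symmetric] mult.commute[of "1 / _"] ennreal_times_divide)

lemma bounded_window: "r > 0 \<Longrightarrow> bounded (window r c)"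
proof -
  assume r: "r > 0"
  have "window r c \<subseteq> cbox (c - (\<chi> i. 1 / r)) (c + (\<chi> i. 1 / r))"
  proof
    fix y assume "y \<in> window r c"
    hence *: "\<bar>y $ i - c $ i\<bar> \<le> 1 / r" for i using mem_window[OF r] by blast
    show "y \<in> cbox (c - (\<chi> i. 1 / r)) (c + (\<chi> i. 1 / r))"
      unfolding mem_box_cart
    proof (intro allI conjI)
      fix i show "(c - (\<chi> i. 1 / r)) $ i \<le> y $ i" using *[of i] by (simp add: abs_le_iff)
      show "y $ i \<le> (c + (\<chi> i. 1 / r)) $ i" using *[of i] by (simp add: abs_le_iff)
    qed
  qed
  thus ?thesis using bounded_cbox bounded_subset by blast
qed

lemma radon_sets: "\<mu> \<in> radon_measures \<Longrightarrow> sets \<mu> = sets borel"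
  by (simp add: radon_measures_def)

lemma window_finite: "\<mu> \<in> radon_measures \<Longrightarrow> r > 0 \<Longrightarrow> emeasure \<mu> (window r c) < \<infinity>"
  by (intro radon_finite_bounded bounded_window)

lemma emeasure_magnify_B1:
  assumes "\<mu> \<in> radon_measures" "r > 0"
  shows "emeasure (magnify r c \<mu>) B1 = (if emeasure \<mu> (window r c) = 0 then 0 else 1)"
proof -
  have "emeasure (magnify r c \<mu>) B1 = emeasure \<mu> (window r c) / emeasure \<mu> (window r c)"
    using emeasure_magnify[OF radon_sets[OF assms(1)], of B1 r c] by (simp add: window_def)
  thus ?thesis using window_finite[OF assms, of c] by (auto simp: ennreal_divide_self)
qed

text \<open>Division by a null window yields only the masses 0 and \<infinity>, so an undefined
  magnification is recognised by its leaving \<open>Mstar\<close>.\<close>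

lemma magnify_in_Mstar_iff:
  assumes \<mu>: "\<mu> \<in> radon_measures" and r: "r > 0"
  shows "magnify r c \<mu> \<in> topspace Mstar \<longleftrightarrow> emeasure \<mu> (window r c) > 0"
proof
  assume "magnify r c \<mu> \<in> topspace Mstar"
  thus "emeasure \<mu> (window r c) > 0" unfolding topspace_Mstar using emeasure_magnify_B1[OF assms, of c]
    by (auto split: if_splits simp: zero_less_iff_neq_zero)
next
  assume p: "emeasure \<mu> (window r c) > 0"
  have "magnify r c \<mu> \<in> radon_measures"
  proof (rule radonI)
    fix n :: nat
    have sub: "(\<lambda>y. r *\<^sub>R (y - c)) -` ball 0 (real n) \<subseteq> ball c (real n / r)"
      using r by (auto simp: dist_norm norm_minus_commute pos_less_divide_eq mult.commute)
    have "emeasure \<mu> ((\<lambda>y. r *\<^sub>R (y - c)) -` ball 0 (real n)) < \<infinity>"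
      by (rule radon_finite_bounded[OF \<mu> bounded_subset[OF bounded_ball sub]])
    thus "emeasure (magnify r c \<mu>) (ball 0 (real n)) < \<infinity>"
      using p by (subst emeasure_magnify[OF radon_sets[OF \<mu>]])
        (auto simp: ennreal_divide_eq_top_iff less_top[symmetric])
  qed simp
  thus "magnify r c \<mu> \<in> topspace Mstar" unfolding topspace_Mstar
    using emeasure_magnify_B1[OF assms, of c] p by auto
qed

lemma Mstar_radon: "\<mu> \<in> topspace Mstar \<Longrightarrow> \<mu> \<in> radon_measures"
  and Mbox_radon: "\<mu> \<in> topspace Mbox \<Longrightarrow> \<mu> \<in> radon_measures"
  by (auto simp: topspace_Mstar topspace_Mbox)

lemma ennreal_divide_cancel_finite:
  fixes a b w :: ennreal
  assumes "0 < w" "w < \<infinity>"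
  shows "(a / w) / (b / w) = a / b"
proof -
  obtain r where r: "w = ennreal r" "r > 0" using assms by (cases w) auto
  have "inverse (inverse w) = w" using r by (simp add: inverse_ennreal)
  hence "inverse (b * inverse w) = inverse b * w"
    using assms r by (subst ennreal_inverse_mult') (auto simp: inverse_ennreal)
  hence "(a / w) / (b / w) = a * inverse b * (inverse w * w)"
    unfolding divide_ennreal_def by (simp add: ac_simps)
  also have "inverse w * w = 1"
    using assms by (metis divide_ennreal_def ennreal_divide_self infinity_ennreal_def less_irrefl mult.commute)
  finally show ?thesis unfolding divide_ennreal_def by simp
qed

text \<open>The normalising constant of the inner magnification cancels. It must be positive, which
  is assumed, and finite, which holds on bounded windows.\<close>

lemma magnify_magnify:
  assumes \<mu>: "\<mu> \<in> radon_measures" and r: "r > 0" "r' > 0" and p: "emeasure \<mu> (window r' c') > 0"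
  shows "magnify r c (magnify r' c' \<mu>) = magnify (r * r') (c' + (1 / r') *\<^sub>R c) \<mu>"
proof (rule measure_eqI)
  fix A assume "A \<in> sets (magnify r c (magnify r' c' \<mu>))"
  hence A: "A \<in> sets borel" by simp
  have comp: "(\<lambda>y. r' *\<^sub>R (y - c')) -` (\<lambda>y. r *\<^sub>R (y - c)) -` S = (\<lambda>y. (r * r') *\<^sub>R (y - (c' + (1 / r') *\<^sub>R c))) -` S" for S
  proof -
    have "r *\<^sub>R (r' *\<^sub>R (y - c') - c) = (r * r') *\<^sub>R (y - (c' + (1 / r') *\<^sub>R c))" for y
      using r by (simp add: algebra_simps)
    thus ?thesis by (simp add: vimage_def)
  qed
  have "emeasure (magnify r c (magnify r' c' \<mu>)) A =
     (emeasure \<mu> ((\<lambda>y. (r * r') *\<^sub>R (y - (c' + (1 / r') *\<^sub>R c))) -` A) / emeasure \<mu> (window r' c')) /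
     (emeasure \<mu> (window (r * r') (c' + (1 / r') *\<^sub>R c)) / emeasure \<mu> (window r' c'))"
    using emeasure_magnify[OF sets_magnify A, of r c r' c' \<mu>]
      emeasure_magnify[OF radon_sets[OF \<mu>] preimage_homothety_borel[OF A], of r' c' r c]
      emeasure_magnify[OF radon_sets[OF \<mu>] window_borel, of r' c' r c]
    unfolding comp[of A] window_def[of r c] comp[of B1] window_def[of "r * r'"] by simp
  also have "\<dots> = emeasure (magnify (r * r') (c' + (1 / r') *\<^sub>R c) \<mu>) A"
    using p window_finite[OF \<mu> r(2), of c'] emeasure_magnify[OF radon_sets[OF \<mu>] A]
    by (simp add: ennreal_divide_cancel_finite)
  finally show "emeasure (magnify r c (magnify r' c' \<mu>)) A = emeasure (magnify (r * r') (c' + (1 / r') *\<^sub>R c) \<mu>) A" .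
qed simp

lemma magnify_1_0:
  assumes "\<mu> \<in> topspace Mstar"
  shows "magnify 1 0 \<mu> = \<mu>"
proof (rule measure_eqI)
  fix A assume "A \<in> sets (magnify 1 0 \<mu>)"
  thus "emeasure (magnify 1 0 \<mu>) A = emeasure \<mu> A"
    using assms emeasure_magnify[of \<mu> A 1 0] ennreal_divide_self[of 1]
    by (auto simp: topspace_Mstar radon_measures_def window_def divide_ennreal_def)
qed (use assms in \<open>simp add: topspace_Mstar radon_measures_def\<close>)

lemma transl_star_magnify: "transl_star x \<mu> = magnify 1 x \<mu>"
  and scale_star_magnify: "scale_star t \<mu> = magnify (exp t) 0 \<mu>"
  by (simp_all add: transl_star_def scale_star_def magnify_def)

text \<open>The strict inequalities place x in the interior of the window; a support point
  guarantees mass for open sets, not for closed ones that it touches.\<close>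

lemma window_pos_of_msupp:
  assumes "x \<in> msupp \<mu>" "sets \<mu> = sets borel" "r > 0" "\<And>i. \<bar>x $ i - c $ i\<bar> < 1 / r"
  shows "emeasure \<mu> (window r c) > 0"
proof -
  define U where "U = {y. \<forall>i. \<bar>y $ i - c $ i\<bar> < 1 / r}"
  have "U = (\<Inter>i. {y. \<bar>y $ i - c $ i\<bar> < 1 / r})" unfolding U_def by blast
  also have "open \<dots>" by (intro open_INT open_Collect_less continuous_intros ballI) simp
  finally have "open U" .
  hence "emeasure \<mu> U > 0" using assms(1,4) unfolding msupp_def U_def by auto
  also have "emeasure \<mu> U \<le> emeasure \<mu> (window r c)"
    using assms(2,3) by (intro emeasure_mono) (auto simp: U_def mem_window less_imp_le)
  finally show ?thesis .
qed

text \<open>The complement of the support is covered by the null members of a countable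
  basis.\<close>

lemma AE_msupp:
  fixes \<mu> :: "(real ^ 'd) measure"
  assumes "sets \<mu> = sets borel"
  shows "AE y in \<mu>. y \<in> msupp \<mu>"
proof -
  obtain B :: "(real ^ 'd) set set" where B: "countable B" "topological_basis B"
    using ex_countable_basis by blast
  have "AE y in \<mu>. \<forall>U\<in>{U\<in>B. emeasure \<mu> U = 0}. y \<notin> U"
  proof (subst AE_ball_countable)
    show "countable {U\<in>B. emeasure \<mu> U = 0}" using B(1) by simp
    show "\<forall>U\<in>{U\<in>B. emeasure \<mu> U = 0}. AE y in \<mu>. y \<notin> U"
    proof
      fix U assume U: "U \<in> {U\<in>B. emeasure \<mu> U = 0}"
      hence "U \<in> null_sets \<mu>" using topological_basis_open[OF B(2)] assms by (auto intro!: null_setsI)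
      thus "AE y in \<mu>. y \<notin> U" by (rule AE_not_in)
    qed
  qed
  thus ?thesis
  proof (rule AE_mp, intro AE_I2 impI)
    fix y assume y: "\<forall>U\<in>{U\<in>B. emeasure \<mu> U = 0}. y \<notin> U"
    show "y \<in> msupp \<mu>" unfolding msupp_def
    proof (intro CollectI allI impI)
      fix U assume U: "open U" "y \<in> U"
      then obtain V where V: "V \<in> B" "y \<in> V" "V \<subseteq> U" using topological_basisE[OF B(2)] by metis
      hence "emeasure \<mu> V > 0" using y by (auto simp: zero_less_iff_neq_zero)
      also have "emeasure \<mu> V \<le> emeasure \<mu> U" using V(3) U(1) assms by (intro emeasure_mono) auto
      finally show "emeasure \<mu> U > 0" .
    qed
  qed
qed

lemma sets_restrict_B1 [simp]: "sets (restrict_B1 \<mu>) = sets \<mu>"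
  by (simp add: restrict_B1_def)

lemma emeasure_restrict_B1:
  assumes "sets \<mu> = sets borel" "A \<in> sets borel"
  shows "emeasure (restrict_B1 \<mu>) A = emeasure \<mu> (B1 \<inter> A)"
  using assms unfolding restrict_B1_def
  by (simp add: emeasure_density indicator_inter_arith[symmetric])

lemma normalize_box_magnify: "normalize_box (distr \<mu> borel (\<lambda>y. r *\<^sub>R (y - c))) = restrict_B1 (magnify r c \<mu>)"
  by (simp add: normalize_box_def restrict_B1_def magnify_def)

lemma restrict_B1_in_Mbox:
  assumes "\<mu> \<in> topspace Mstar"
  shows "restrict_B1 \<mu> \<in> topspace Mbox"
proof -
  have r: "\<mu> \<in> radon_measures" and 1: "emeasure \<mu> B1 = 1" using assms by (auto simp: topspace_Mstar)
  note s = radon_sets[OF r]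
  have "restrict_B1 \<mu> \<in> radon_measures"
  proof (rule radonI)
    fix n :: nat
    have "emeasure (restrict_B1 \<mu>) (ball 0 (real n)) = emeasure \<mu> (B1 \<inter> ball 0 (real n))"
      by (rule emeasure_restrict_B1[OF s]) simp
    also have "\<dots> < \<infinity>" by (intro radon_finite_bounded[OF r] bounded_Int) simp
    finally show "emeasure (restrict_B1 \<mu>) (ball 0 (real n)) < \<infinity>" .
  qed (use s in simp)
  thus ?thesis unfolding topspace_Mbox
    using emeasure_restrict_B1[OF s, of B1] emeasure_restrict_B1[OF s, of "- B1"] 1 by simp
qed

text \<open>After restriction the magnified measure depends only on the mass in the window. This is
  how the restricted dynamics follows the extended one.\<close>

lemma restrict_magnify_restrict:
  assumes s: "sets \<mu> = sets borel" and sub: "window r c \<subseteq> B1"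
  shows "restrict_B1 (magnify r c (restrict_B1 \<mu>)) = restrict_B1 (magnify r c \<mu>)"
proof (rule measure_eqI)
  fix A assume "A \<in> sets (restrict_B1 (magnify r c (restrict_B1 \<mu>)))"
  hence A: "A \<in> sets borel" by simp
  have *: "B1 \<inter> (\<lambda>y. r *\<^sub>R (y - c)) -` (B1 \<inter> A) = (\<lambda>y. r *\<^sub>R (y - c)) -` (B1 \<inter> A)" "B1 \<inter> window r c = window r c"
    using sub unfolding window_def by auto
  have BA: "B1 \<inter> A \<in> sets borel" using A by simp
  have s': "sets (restrict_B1 \<mu>) = sets borel" using s by simp
  have "emeasure (restrict_B1 (magnify r c (restrict_B1 \<mu>))) A
     = emeasure (restrict_B1 \<mu>) ((\<lambda>y. r *\<^sub>R (y - c)) -` (B1 \<inter> A)) / emeasure (restrict_B1 \<mu>) (window r c)"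
    using emeasure_restrict_B1[OF sets_magnify A] emeasure_magnify[OF s' BA] by simp
  also have "\<dots> = emeasure \<mu> ((\<lambda>y. r *\<^sub>R (y - c)) -` (B1 \<inter> A)) / emeasure \<mu> (window r c)"
    using emeasure_restrict_B1[OF s preimage_homothety_borel[OF BA], of r c] emeasure_restrict_B1[OF s window_borel, of r c]
    unfolding * by simp
  also have "\<dots> = emeasure (restrict_B1 (magnify r c \<mu>)) A"
    using emeasure_restrict_B1[OF sets_magnify A] emeasure_magnify[OF s BA] by simp
  finally show "emeasure (restrict_B1 (magnify r c (restrict_B1 \<mu>))) A = emeasure (restrict_B1 (magnify r c \<mu>)) A" .
qed simp

section \<open>Measurability of magnification\<close>

lemma measurable_emeasure_magnify:
  fixes K :: "'a \<Rightarrow> (real ^ 'd) measure"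
  assumes K: "K \<in> measurable M (borel_of weak_topology)" and c: "c \<in> borel_measurable M" and A: "A \<in> sets borel"
  shows "(\<lambda>w. emeasure (magnify r (c w) (K w)) A) \<in> borel_measurable M"
proof -
  have pre: "(\<lambda>w. emeasure (K w) ((\<lambda>y. r *\<^sub>R (y - c w)) -` S)) \<in> borel_measurable M" if S: "S \<in> sets borel" for S
  proof -
    have "(\<lambda>w. \<integral>\<^sup>+y. indicator S (r *\<^sub>R (y - c w)) \<partial>K w) \<in> borel_measurable M"
      by (rule measurable_nn_integral_radon_kernel[OF K]) (use c S in measurable)
    moreover have "(\<integral>\<^sup>+y. indicator S (r *\<^sub>R (y - c w)) \<partial>K w) = emeasure (K w) ((\<lambda>y. r *\<^sub>R (y - c w)) -` S)" if "w \<in> space M" for w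
    proof -
      have s: "sets (K w) = sets borel" using measurable_space[OF K that] by (simp add: radon_measures_def)
      have "(\<integral>\<^sup>+y. indicator S (r *\<^sub>R (y - c w)) \<partial>K w) = (\<integral>\<^sup>+y. indicator ((\<lambda>y. r *\<^sub>R (y - c w)) -` S) y \<partial>K w)"
        by (simp add: indicator_def)
      also have "\<dots> = emeasure (K w) ((\<lambda>y. r *\<^sub>R (y - c w)) -` S)"
        by (rule nn_integral_indicator) (use preimage_homothety_borel[OF S] s in simp)
      finally show ?thesis .
    qed
    ultimately show ?thesis by (subst measurable_cong) auto
  qed
  have "(\<lambda>w. emeasure (K w) ((\<lambda>y. r *\<^sub>R (y - c w)) -` A) / emeasure (K w) (window r (c w))) \<in> borel_measurable M"
    unfolding window_def by (intro borel_measurable_divide_ennreal pre A) simp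
  moreover have "emeasure (magnify r (c w) (K w)) A = emeasure (K w) ((\<lambda>y. r *\<^sub>R (y - c w)) -` A) / emeasure (K w) (window r (c w))"
    if "w \<in> space M" for w
    using measurable_space[OF K that] by (intro emeasure_magnify A) (simp add: radon_measures_def)
  ultimately show ?thesis by (subst measurable_cong) auto
qed

text \<open>The family may contain measures that are not Radon, such as magnifications on null
  windows; they can be cut out measurably by countably many balls.\<close>

lemma sets_Collect_radon:
  fixes K :: "'a \<Rightarrow> (real ^ 'd) measure"
  assumes s: "\<And>w. w \<in> space M \<Longrightarrow> sets (K w) = sets borel"
    and ev: "\<And>A. A \<in> sets borel \<Longrightarrow> (\<lambda>w. emeasure (K w) A) \<in> borel_measurable M"
  shows "{w \<in> space M. K w \<in> radon_measures} \<in> sets M"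
proof -
  have [measurable]: "(\<lambda>w. emeasure (K w) (ball 0 (real n))) \<in> borel_measurable M" for n by (rule ev) simp
  have "{w \<in> space M. \<forall>n::nat. emeasure (K w) (ball 0 (real n)) < \<infinity>} \<in> sets M" by measurable
  also have "{w \<in> space M. \<forall>n::nat. emeasure (K w) (ball 0 (real n)) < \<infinity>} = {w \<in> space M. K w \<in> radon_measures}"
    using radonI[OF s] radon_finite_bounded[OF _ bounded_ball] by (intro Collect_cong) auto
  finally show ?thesis .
qed

lemma sets_Collect_Mstar:
  fixes K :: "'a \<Rightarrow> (real ^ 'd) measure"
  assumes s: "\<And>w. w \<in> space M \<Longrightarrow> sets (K w) = sets borel"
    and ev: "\<And>A. A \<in> sets borel \<Longrightarrow> (\<lambda>w. emeasure (K w) A) \<in> borel_measurable M"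
  shows "{w \<in> space M. K w \<in> topspace Mstar} \<in> sets M"
proof -
  have [measurable]: "(\<lambda>w. emeasure (K w) B1) \<in> borel_measurable M" by (rule ev) simp
  have "{w \<in> space M. K w \<in> radon_measures} \<inter> {w \<in> space M. emeasure (K w) B1 = 1} \<in> sets M"
  proof (rule sets.Int)
    show "{w \<in> space M. K w \<in> radon_measures} \<in> sets M" using s ev by (rule sets_Collect_radon)
  qed measurable
  also have "{w \<in> space M. K w \<in> radon_measures} \<inter> {w \<in> space M. emeasure (K w) B1 = 1} = {w \<in> space M. K w \<in> topspace Mstar}"
    unfolding topspace_Mstar by blast
  finally show ?thesis .
qed

lemma sets_Collect_Mbox:
  fixes K :: "'a \<Rightarrow> (real ^ 'd) measure"
  assumes s: "\<And>w. w \<in> space M \<Longrightarrow> sets (K w) = sets borel"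
    and ev: "\<And>A. A \<in> sets borel \<Longrightarrow> (\<lambda>w. emeasure (K w) A) \<in> borel_measurable M"
  shows "{w \<in> space M. K w \<in> topspace Mbox} \<in> sets M"
proof -
  have [measurable]: "(\<lambda>w. emeasure (K w) (- B1)) \<in> borel_measurable M" by (rule ev) simp
  have "{w \<in> space M. K w \<in> topspace Mstar} \<inter> {w \<in> space M. emeasure (K w) (- B1) = 0} \<in> sets M"
  proof (rule sets.Int)
    show "{w \<in> space M. K w \<in> topspace Mstar} \<in> sets M" using s ev by (rule sets_Collect_Mstar)
  qed measurable
  moreover have "{w \<in> space M. K w \<in> topspace Mstar} \<inter> {w \<in> space M. emeasure (K w) (- B1) = 0} = {w \<in> space M. K w \<in> topspace Mbox}"
    unfolding topspace_Mstar topspace_Mbox by blast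
  ultimately show ?thesis by (simp only:)
qed

lemma measurable_MstarI:
  fixes K :: "'a \<Rightarrow> (real ^ 'd) measure"
  assumes "\<And>w. w \<in> space M \<Longrightarrow> K w \<in> topspace Mstar"
    and "\<And>A. A \<in> sets borel \<Longrightarrow> (\<lambda>w. emeasure (K w) A) \<in> borel_measurable M"
  shows "K \<in> measurable M (borel_of Mstar)"
  unfolding Mstar_def
  by (intro measurable_subtopologyI[OF coord_embedding_weak] measurable_weakI)
     (use assms in \<open>auto simp: topspace_Mstar\<close>)

lemma measurable_MboxI:
  fixes K :: "'a \<Rightarrow> (real ^ 'd) measure"
  assumes "\<And>w. w \<in> space M \<Longrightarrow> K w \<in> topspace Mbox"
    and "\<And>A. A \<in> sets borel \<Longrightarrow> (\<lambda>w. emeasure (K w) A) \<in> borel_measurable M"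
  shows "K \<in> measurable M (borel_of Mbox)"
  unfolding Mbox_def
  by (intro measurable_subtopologyI[OF coord_embedding_weak] measurable_weakI)
     (use assms in \<open>auto simp: topspace_Mbox\<close>)

lemma measurable_Mstar_weak: "(\<lambda>\<mu>. \<mu>) \<in> measurable (borel_of Mstar) (borel_of weak_topology)"
  unfolding Mstar_def by (rule borel_of_subtopology_measurable[OF coord_embedding_weak]) simp

lemma measurable_Mbox_weak: "(\<lambda>\<mu>. \<mu>) \<in> measurable (borel_of Mbox) (borel_of weak_topology)"
  unfolding Mbox_def by (rule borel_of_subtopology_measurable[OF coord_embedding_weak]) simp

section \<open>Compactness\<close>

text \<open>Open sets of \<open>X\<close> are preimages of open sets under e, so convergence of the
  coordinates is all that continuity of f uses.\<close>

lemma tendsto_coord_embedding: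
  assumes e: "coord_embedding X e" and f: "continuous_map X euclideanreal f"
    and z: "\<And>k. z k \<in> topspace X" "l \<in> topspace X" and lim: "(\<lambda>k. e (z k)) \<longlonglongrightarrow> e l"
  shows "(\<lambda>k. f (z k)) \<longlonglongrightarrow> f l"
proof (rule topological_tendstoI)
  fix S assume S: "open S" "f l \<in> S"
  have "openin X {x \<in> topspace X. f x \<in> S}" using f S(1) unfolding continuous_map_def by simp
  then obtain V where V: "open V" "{x \<in> topspace X. f x \<in> S} = e -` V \<inter> topspace X"
    using e unfolding coord_embedding_def by metis
  have "l \<in> e -` V \<inter> topspace X" unfolding V(2)[symmetric] using z S by simp
  hence "\<forall>\<^sub>F k in sequentially. e (z k) \<in> V" using topological_tendstoD[OF lim V(1)] by simp
  thus "\<forall>\<^sub>F k in sequentially. f (z k) \<in> S"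
  proof eventually_elim
    case (elim k)
    hence "z k \<in> e -` V \<inter> topspace X" using z(1) by simp
    thus ?case unfolding V(2)[symmetric] by simp
  qed
qed

text \<open>
  Schoenberg's space-filling curve. It reduces compactness of the probability measures on \<open>B1\<close> to
  Helly's selection theorem on the line.
\<close>

definition digit_wave :: "real \<Rightarrow> real" where
  "digit_wave t = min 1 (max 0 (1 / 2 - cos (pi * t)))"

lemma digit_wave_bounds: "0 \<le> digit_wave t" "digit_wave t \<le> 1"
  by (auto simp: digit_wave_def)

lemma digit_wave_periodic: "digit_wave (2 * real_of_int k + t) = digit_wave t"
proof -
  have "cos (pi * (2 * real_of_int k + t)) = cos (pi * t + 2 * pi * real_of_int k)" by (simp add: algebra_simps)
  also have "\<dots> = cos (pi * t)" by (simp add: cos_add cos_int_2pin sin_int_2pin)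
  finally show ?thesis by (simp add: digit_wave_def)
qed

lemma digit_wave_0:
  assumes "0 \<le> t" "t \<le> 1 / 3"
  shows "digit_wave t = 0"
proof -
  have "cos (pi / 3) \<le> cos (pi * t)" using assms by (intro cos_monotone_0_pi_le) auto
  thus ?thesis by (simp add: cos_60 digit_wave_def)
qed

lemma digit_wave_1:
  assumes "2 / 3 \<le> t" "t \<le> 1"
  shows "digit_wave t = 1"
proof -
  have "cos (pi * t) \<le> cos (pi - pi / 3)" using assms by (intro cos_monotone_0_pi_le) (auto simp: field_simps)
  also have "\<dots> = - (1 / 2)" by (simp add: cos_120)
  finally show ?thesis by (simp add: digit_wave_def)
qed

lemma sums_half: "(\<lambda>j. (1 / 2) ^ Suc j) sums (1 :: real)"
  using power_half_series .

lemma sums_third: "(\<lambda>j. 2 * (1 / 3) ^ Suc j) sums (1 :: real)"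
proof -
  have "(\<lambda>j. (1 / 3 :: real) ^ j) sums (1 / (1 - 1 / 3))" by (rule geometric_sums) simp
  from sums_mult[OF this, of "2 / 3"] show ?thesis by simp
qed

text \<open>For \<epsilon> with values 0 and 1 this is the point of the Cantor set with ternary
  digits \<open>2 * \<epsilon> m\<close>.\<close>

definition ternary :: "(nat \<Rightarrow> real) \<Rightarrow> real" where
  "ternary \<epsilon> = (\<Sum>m. 2 * \<epsilon> m * (1 / 3) ^ Suc m)"

lemma summable_ternary:
  assumes "\<And>m. \<epsilon> m \<in> {0, 1 :: real}"
  shows "summable (\<lambda>m. 2 * \<epsilon> m * (1 / 3) ^ Suc m)"
proof (rule summable_comparison_test[OF _ sums_summable[OF sums_third]], intro exI allI impI)
  fix m show "norm (2 * \<epsilon> m * (1 / 3) ^ Suc m) \<le> 2 * (1 / 3) ^ Suc m"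
    using assms[of m] by auto
qed

lemma ternary_bounds:
  assumes "\<And>m. \<epsilon> m \<in> {0, 1 :: real}"
  shows "0 \<le> ternary \<epsilon>" "ternary \<epsilon> \<le> 1"
proof -
  have e: "0 \<le> \<epsilon> m" "\<epsilon> m \<le> 1" for m using assms[of m] by auto
  show "0 \<le> ternary \<epsilon>" unfolding ternary_def
    by (intro suminf_nonneg summable_ternary assms) (simp add: e)
  have "ternary \<epsilon> \<le> (\<Sum>m. 2 * (1 / 3) ^ Suc m)" unfolding ternary_def
    by (intro suminf_le summable_ternary assms sums_summable[OF sums_third]) (use e in \<open>simp add: mult_left_le_one_le\<close>)
  thus "ternary \<epsilon> \<le> 1" using sums_unique[OF sums_third] by simp
qed

lemma ternary_Suc:
  assumes "\<And>m. \<epsilon> m \<in> {0, 1 :: real}"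
  shows "3 * ternary \<epsilon> = 2 * \<epsilon> 0 + ternary (\<lambda>m. \<epsilon> (Suc m))"
proof -
  have "ternary \<epsilon> = (\<Sum>m. 2 * \<epsilon> (Suc m) * (1 / 3) ^ Suc (Suc m)) + 2 * \<epsilon> 0 * (1 / 3)"
  proof -
    have "(\<Sum>m. 2 * \<epsilon> (Suc m) * (1 / 3) ^ Suc (Suc m)) = ternary \<epsilon> - 2 * \<epsilon> 0 * (1 / 3) ^ Suc 0"
      unfolding ternary_def by (rule suminf_split_head[OF summable_ternary[OF assms]])
    thus ?thesis by (simp only: power_one_right) simp
  qed
  also have "(\<Sum>m. 2 * \<epsilon> (Suc m) * (1 / 3) ^ Suc (Suc m)) = (\<Sum>m. (1 / 3) * (2 * \<epsilon> (Suc m) * (1 / 3) ^ Suc m))"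
    by (intro suminf_cong) simp
  also have "\<dots> = (1 / 3) * ternary (\<lambda>m. \<epsilon> (Suc m))"
    unfolding ternary_def by (rule suminf_mult) (rule summable_ternary[OF assms])
  finally show ?thesis by simp
qed

text \<open>Multiplication by \<open>3 ^ m\<close> brings digit m to the front up to an even
  integer, which the period 2 of the wave ignores. A leading digit 0 or 2 puts the rest into [0,1/3]
  or [2/3,1], where the wave is constant.\<close>

lemma digit_wave_ternary:
  assumes "\<And>m. \<epsilon> m \<in> {0, 1 :: real}"
  shows "digit_wave (3 ^ m * ternary \<epsilon>) = \<epsilon> m"
  using assms
proof (induction m arbitrary: \<epsilon>)
  case 0
  have b: "0 \<le> ternary (\<lambda>m. \<epsilon> (Suc m))" "ternary (\<lambda>m. \<epsilon> (Suc m)) \<le> 1"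
    by (intro ternary_bounds 0)+
  have t: "ternary \<epsilon> = (2 * \<epsilon> 0 + ternary (\<lambda>m. \<epsilon> (Suc m))) / 3" using ternary_Suc[of \<epsilon>, OF 0] by simp
  show ?case
  proof (cases "\<epsilon> 0 = 0")
    case True
    thus ?thesis using b t by (simp add: digit_wave_0)
  next
    case False
    hence "\<epsilon> 0 = 1" using 0[of 0] by simp
    thus ?thesis using b t by (simp add: digit_wave_1)
  qed
next
  case (Suc m)
  have s: "\<epsilon> (Suc k) \<in> {0, 1}" for k by (rule Suc.prems)
  obtain k :: int where k: "3 ^ m * \<epsilon> 0 = real_of_int k"
    using Suc.prems[of 0] that[of 0] that[of "3 ^ m"] by auto
  have "3 ^ Suc m * ternary \<epsilon> = 3 ^ m * (3 * ternary \<epsilon>)" by simp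
  also have "\<dots> = 2 * real_of_int k + 3 ^ m * ternary (\<lambda>m. \<epsilon> (Suc m))"
    unfolding ternary_Suc[of \<epsilon>, OF Suc.prems] k[symmetric] by (simp add: algebra_simps)
  finally show ?case using Suc.IH[of "\<lambda>m. \<epsilon> (Suc m)", OF s] by (simp only: digit_wave_periodic)
qed

text \<open>Binary digits, with 1 expanded as 0.111... . The values for arguments outside the unit
  interval keep every digit in {0,1}, so the code of any point of the space lies in [0,1].\<close>

definition bdigit :: "nat \<Rightarrow> real \<Rightarrow> real" where
  "bdigit j u = (if u \<ge> 1 then 1 else if u < 0 then 0 else real_of_int (\<lfloor>2 ^ Suc j * u\<rfloor> - 2 * \<lfloor>2 ^ j * u\<rfloor>))"

lemma bdigit_01: "bdigit j u \<in> {0, 1}"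
proof -
  have "\<lfloor>2 * t\<rfloor> - 2 * \<lfloor>t\<rfloor> = 0 \<or> \<lfloor>2 * t\<rfloor> - 2 * \<lfloor>t\<rfloor> = 1" for t :: real by linarith
  from this[of "2 ^ j * u"] show ?thesis unfolding bdigit_def by (auto simp: mult.assoc)
qed

text \<open>For u below 1 the partial sums telescope to the truncations of u after J binary
  places.\<close>

lemma bdigit_sums:
  assumes "0 \<le> u" "u \<le> 1"
  shows "(\<lambda>j. bdigit j u * (1 / 2) ^ Suc j) sums u"
proof (cases "u = 1")
  case True
  thus ?thesis using sums_half by (simp add: bdigit_def)
next
  case False
  hence u: "0 \<le> u" "u < 1" using assms by auto
  have part: "(\<Sum>j<J. bdigit j u * (1 / 2) ^ Suc j) = real_of_int \<lfloor>2 ^ J * u\<rfloor> / 2 ^ J" for J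
  proof (induction J)
    case 0
    have "\<lfloor>u\<rfloor> = 0" using u by linarith
    thus ?case by simp
  next
    case (Suc J)
    have "(\<Sum>j<Suc J. bdigit j u * (1 / 2) ^ Suc j) = real_of_int \<lfloor>2 ^ J * u\<rfloor> / 2 ^ J +
      (real_of_int \<lfloor>2 ^ Suc J * u\<rfloor> - 2 * real_of_int \<lfloor>2 ^ J * u\<rfloor>) / 2 ^ Suc J"
      unfolding sum.lessThan_Suc Suc.IH using u by (simp add: bdigit_def power_divide)
    also have "\<dots> = real_of_int \<lfloor>2 ^ Suc J * u\<rfloor> / 2 ^ Suc J" by (simp add: diff_divide_distrib)
    finally show ?case .
  qed
  have "(\<lambda>J. real_of_int \<lfloor>2 ^ J * u\<rfloor> / 2 ^ J) \<longlonglongrightarrow> u"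
  proof (rule real_tendsto_sandwich)
    show "(\<lambda>J. u - (1 / 2) ^ J) \<longlonglongrightarrow> u"
      using tendsto_diff[OF tendsto_const LIMSEQ_power_zero[of "1 / 2 :: real"], of u] by simp
    show "\<forall>\<^sub>F J in sequentially. u - (1 / 2) ^ J \<le> real_of_int \<lfloor>2 ^ J * u\<rfloor> / 2 ^ J"
    proof (intro always_eventually allI)
      fix J :: nat
      have "2 ^ J * u - 1 \<le> real_of_int \<lfloor>2 ^ J * u\<rfloor>" by linarith
      hence "(2 ^ J * u - 1) / 2 ^ J \<le> real_of_int \<lfloor>2 ^ J * u\<rfloor> / 2 ^ J" by (intro divide_right_mono) auto
      thus "u - (1 / 2) ^ J \<le> real_of_int \<lfloor>2 ^ J * u\<rfloor> / 2 ^ J" by (simp add: diff_divide_distrib power_divide)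
    qed
    show "\<forall>\<^sub>F J in sequentially. real_of_int \<lfloor>2 ^ J * u\<rfloor> / 2 ^ J \<le> u"
    proof (intro always_eventually allI)
      fix J :: nat
      have "real_of_int \<lfloor>2 ^ J * u\<rfloor> / 2 ^ J \<le> (2 ^ J * u) / 2 ^ J" by (intro divide_right_mono) auto
      thus "real_of_int \<lfloor>2 ^ J * u\<rfloor> / 2 ^ J \<le> u" by simp
    qed
  qed simp
  thus ?thesis unfolding sums_def part .
qed

text \<open>The digits of the coordinates are interleaved: coordinate i occupies the positions
  congruent to \<open>h i\<close> modulo the dimension, and the corresponding wave reads exactly
  these. The Borel right inverse \<gamma> codes measures on \<open>B1\<close> as measures on the
  line, and \<phi> decodes them continuously.\<close>

lemma ex_space_filling_curve:
  "\<exists>(\<phi> :: real \<Rightarrow> real ^ 'd) \<gamma>. continuous_on UNIV \<phi> \<and> range \<phi> \<subseteq> B1 \<and> \<gamma> \<in> borel_measurable borel \<and>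
     (\<forall>x. 0 \<le> \<gamma> x \<and> \<gamma> x \<le> 1) \<and> (\<forall>x\<in>B1. \<phi> (\<gamma> x) = x)"
proof -
  obtain h where h: "bij_betw h (UNIV :: 'd set) {0..<CARD('d)}" using ex_bij_betw_finite_nat[of "UNIV :: 'd set"] by auto
  have inj: "h i = h j \<longleftrightarrow> i = j" for i j using h unfolding bij_betw_def inj_on_def by auto
  have hlt: "h i < CARD('d)" for i using h unfolding bij_betw_def by fastforce
  define n where "n = CARD('d)"
  define wave where "wave i t = (\<Sum>j. digit_wave (3 ^ (n * j + h i) * t) * (1 / 2) ^ Suc j)" for i t
  have bnd: "norm (digit_wave (3 ^ (n * j + h i) * t) * (1 / 2) ^ Suc j) \<le> (1 / 2) ^ Suc j" for i j t
    using digit_wave_bounds[of "3 ^ (n * j + h i) * t"] by (simp add: mult_left_le_one_le)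
  have sm: "summable (\<lambda>j. digit_wave (3 ^ (n * j + h i) * t) * (1 / 2) ^ Suc j)" for i t
    by (rule summable_comparison_test[OF _ sums_summable[OF sums_half]]) (use bnd in blast)
  have wave_cont: "continuous_on UNIV (wave i)" for i
  proof -
    have "uniform_limit UNIV (\<lambda>J t. \<Sum>j<J. digit_wave (3 ^ (n * j + h i) * t) * (1 / 2) ^ Suc j) (wave i) sequentially"
      unfolding wave_def by (rule Weierstrass_m_test[OF bnd sums_summable[OF sums_half]])
    thus ?thesis
    proof (rule uniform_limit_theorem[rotated])
      show "\<forall>\<^sub>F J in sequentially. continuous_on UNIV (\<lambda>t. \<Sum>j<J. digit_wave (3 ^ (n * j + h i) * t) * (1 / 2) ^ Suc j)"
        unfolding digit_wave_def by (intro always_eventually allI continuous_intros)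
    qed simp
  qed
  have wave01: "0 \<le> wave i t \<and> wave i t \<le> 1" for i t
  proof
    show "0 \<le> wave i t" unfolding wave_def by (intro suminf_nonneg sm) (simp add: digit_wave_bounds)
    have "wave i t \<le> (\<Sum>j. (1 / 2) ^ Suc j)" unfolding wave_def
      by (intro suminf_le sm sums_summable[OF sums_half]) (simp add: mult_left_le_one_le digit_wave_bounds)
    thus "wave i t \<le> 1" using sums_unique[OF sums_half] by simp
  qed
  define \<phi> where "\<phi> t = (\<chi> i. 2 * wave i t - 1)" for t
  define \<epsilon> where "\<epsilon> x m = bdigit (m div n) ((x $ the_inv h (m mod n) + 1) / 2)" for x :: "real ^ 'd" and m
  have \<epsilon>01: "\<epsilon> x m \<in> {0, 1}" for x m unfolding \<epsilon>_def by (rule bdigit_01)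
  have "continuous_on UNIV \<phi>" unfolding \<phi>_def
    by (subst continuous_on_componentwise) (auto simp: Basis_vec_def inner_axis intro!: continuous_intros wave_cont)
  moreover have "range \<phi> \<subseteq> B1"
  proof -
    have "\<bar>2 * wave i t - 1\<bar> \<le> 1" for i t using wave01[of i t] by linarith
    thus ?thesis by (auto simp: mem_B1 \<phi>_def)
  qed
  moreover have "(\<lambda>x. ternary (\<epsilon> x)) \<in> borel_measurable borel"
    unfolding ternary_def \<epsilon>_def bdigit_def by measurable
  moreover have "\<forall>x. 0 \<le> ternary (\<epsilon> x) \<and> ternary (\<epsilon> x) \<le> 1" using ternary_bounds[of "\<epsilon> _", OF \<epsilon>01] by blast
  moreover have "\<forall>x\<in>B1. \<phi> (ternary (\<epsilon> x)) = x"
  proof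
    fix x :: "real ^ 'd" assume x: "x \<in> B1"
    have "wave i (ternary (\<epsilon> x)) = (x $ i + 1) / 2" for i
    proof -
      have "\<bar>x $ i\<bar> \<le> 1" using x by (simp add: mem_B1)
      hence u: "0 \<le> (x $ i + 1) / 2" "(x $ i + 1) / 2 \<le> 1" by (auto simp: abs_le_iff)
      have hn: "h i < n" unfolding n_def by (rule hlt)
      have "\<epsilon> x (n * j + h i) = bdigit j ((x $ i + 1) / 2)" for j
      proof -
        have "inj h" using inj by (simp add: inj_def)
        thus ?thesis using hn unfolding \<epsilon>_def by (simp add: the_inv_f_f)
      qed
      hence "wave i (ternary (\<epsilon> x)) = (\<Sum>j. bdigit j ((x $ i + 1) / 2) * (1 / 2) ^ Suc j)"
        unfolding wave_def digit_wave_ternary[OF \<epsilon>01] by simp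
      also have "\<dots> = (x $ i + 1) / 2" by (rule sums_unique[symmetric, OF bdigit_sums[OF u]])
      finally show ?thesis .
    qed
    hence "2 * wave i (ternary (\<epsilon> x)) - 1 = x $ i" for i by (simp only:) (simp add: field_simps)
    thus "\<phi> (ternary (\<epsilon> x)) = x" by (simp add: \<phi>_def vec_eq_iff)
  qed
  ultimately show ?thesis by blast
qed

section \<open>Sequential compactness of \<open>Mbox\<close>\<close>

lemma prob_space_Mbox:
  fixes \<kappa> :: "(real ^ 'd) measure"
  assumes "\<kappa> \<in> topspace Mbox"
  shows "prob_space \<kappa>" "AE x in \<kappa>. x \<in> B1"
proof -
  have s: "sets \<kappa> = sets borel" by (intro radon_sets Mbox_radon assms)
  have sp: "space \<kappa> = UNIV" using sets_eq_imp_space_eq[OF s] by simp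
  have B: "emeasure \<kappa> B1 = 1" "emeasure \<kappa> (- B1) = 0" using assms by (auto simp: topspace_Mbox)
  have "emeasure \<kappa> UNIV = emeasure \<kappa> B1 + emeasure \<kappa> (- B1)"
    using s by (subst plus_emeasure) (auto simp: Compl_partition)
  thus "prob_space \<kappa>" using B sp by (intro prob_spaceI) simp
  have "- B1 \<in> null_sets \<kappa>" using B(2) s by (intro null_setsI) auto
  from AE_not_in[OF this] show "AE x in \<kappa>. x \<in> B1" by simp
qed

text \<open>Coded by \<gamma>, the measures live on [0,1] and are tight, so a subsequence converges
  weakly on the line. Continuity of \<phi> carries the convergence back, and the members of the
  sequence are recovered because \<phi> inverts \<gamma> on \<open>B1\<close>.\<close>

lemma Mbox_sequentially_compact:
  fixes \<kappa> :: "nat \<Rightarrow> (real ^ 'd) measure"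
  assumes \<kappa>: "\<And>k. \<kappa> k \<in> topspace Mbox"
  shows "\<exists>r \<theta>. strict_mono (r :: nat \<Rightarrow> nat) \<and> \<theta> \<in> topspace Mbox \<and>
    (\<forall>k. (\<lambda>n. tent_coords (\<kappa> (r n)) k) \<longlonglongrightarrow> tent_coords \<theta> k)"
proof -
  obtain \<phi> :: "real \<Rightarrow> real ^ 'd" and \<gamma> where \<phi>: "continuous_on UNIV \<phi>" "range \<phi> \<subseteq> B1"
    and \<gamma>: "\<gamma> \<in> borel_measurable borel" "\<And>x. 0 \<le> \<gamma> x" "\<And>x. \<gamma> x \<le> 1" "\<And>x. x \<in> B1 \<Longrightarrow> \<phi> (\<gamma> x) = x"
    using ex_space_filling_curve by blast
  have \<phi>m: "\<phi> \<in> borel_measurable borel" by (rule borel_measurable_continuous_onI[OF \<phi>(1)])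
  have s: "sets (\<kappa> k) = sets borel" for k by (intro radon_sets Mbox_radon \<kappa>)
  note P = prob_space_Mbox(1)[OF \<kappa>] and AEB = prob_space_Mbox(2)[OF \<kappa>]
  have \<gamma>\<kappa>: "\<gamma> \<in> borel_measurable (\<kappa> k)" for k using \<gamma>(1) unfolding measurable_cong_sets[OF s refl] .
  define \<nu> where "\<nu> k = distr (\<kappa> k) borel \<gamma>" for k
  have rd: "real_distribution (\<nu> k)" for k
    unfolding \<nu>_def real_distribution_def real_distribution_axioms_def
    using prob_space.prob_space_distr[OF P \<gamma>\<kappa>] by simp
  have "tight \<nu>" unfolding tight_def
  proof (intro conjI allI impI rd)
    fix e :: real assume e: "e > 0"
    have "measure (\<nu> k) {-1<..2} = 1" for k
    proof -
      have "measure (\<nu> k) {-1<..2} = measure (\<kappa> k) (\<gamma> -` {-1<..2} \<inter> space (\<kappa> k))"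
        unfolding \<nu>_def by (rule measure_distr[OF \<gamma>\<kappa>]) simp
      also have "\<gamma> -` {-1<..2} \<inter> space (\<kappa> k) = space (\<kappa> k)"
      proof -
        have "\<gamma> x \<in> {-1<..2}" for x using \<gamma>(2)[of x] \<gamma>(3)[of x] by auto
        thus ?thesis by auto
      qed
      finally show ?thesis using prob_space.prob_space[OF P] by simp
    qed
    thus "\<exists>a b. a < b \<and> (\<forall>n. 1 - e < measure (\<nu> n) {a<..b})"
      using e by (intro exI[of _ "-1"] exI[of _ 2]) simp
  qed
  from tight_imp_convergent_subsubsequence[OF this strict_mono_id] obtain r M where
    r: "strict_mono (r :: nat \<Rightarrow> nat)" and M: "real_distribution M" and wc: "weak_conv_m (\<nu> \<circ> id \<circ> r) M" by blast
  interpret M: real_distribution M by (rule M)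
  have \<phi>M: "\<phi> \<in> borel_measurable M" using \<phi>m by simp
  define \<theta> where "\<theta> = distr M borel \<phi>"
  interpret L: prob_space \<theta> unfolding \<theta>_def by (rule M.prob_space_distr[OF \<phi>M])
  have \<theta>s: "sets \<theta> = sets borel" by (simp add: \<theta>_def)
  have "emeasure \<theta> B1 = emeasure M (\<phi> -` B1 \<inter> space M)" "emeasure \<theta> (- B1) = emeasure M (\<phi> -` (- B1) \<inter> space M)"
    unfolding \<theta>_def by (rule emeasure_distr[OF \<phi>M]; simp)+
  moreover have "\<phi> -` B1 \<inter> space M = space M" "\<phi> -` (- B1) \<inter> space M = {}" using \<phi>(2) by auto
  ultimately have "emeasure \<theta> B1 = 1" "emeasure \<theta> (- B1) = 0" using M.emeasure_space_1 by simp_all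
  moreover have "\<theta> \<in> radon_measures"
    by (rule radonI[OF \<theta>s]) (simp add: less_top[symmetric])
  ultimately have \<theta>M: "\<theta> \<in> topspace Mbox" by (simp add: topspace_Mbox)
  have "(\<lambda>n. tent_coords (\<kappa> (r n)) k) \<longlonglongrightarrow> tent_coords \<theta> k" for k :: "nat \<times> ('d \<Rightarrow> int)"
  proof -
    have tb: "tent k \<in> borel_measurable borel" by (rule borel_measurable_continuous_onI[OF continuous_tent])
    have c: "continuous_on UNIV (\<lambda>t. tent k (\<phi> t))"
      by (rule continuous_on_compose2[OF continuous_tent \<phi>(1)]) auto
    have t1: "norm (tent k x) \<le> 1" for x
      unfolding tent_def abs_prod real_norm_def by (intro prod_le_1) (auto simp: hat_def)
    have "(\<lambda>n. \<integral>t. tent k (\<phi> t) \<partial>(\<nu> \<circ> id \<circ> r) n) \<longlonglongrightarrow> (\<integral>t. tent k (\<phi> t) \<partial>M)"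
      by (rule weak_conv_imp_integral_bdd_continuous_conv[OF _ M wc])
         (use rd c t1 in \<open>auto simp: continuous_on_eq_continuous_at\<close>)
    moreover have "(\<integral>t. tent k (\<phi> t) \<partial>M) = tent_coords \<theta> k"
      unfolding \<theta>_def tent_coords_def by (rule integral_distr[symmetric, OF \<phi>M tb])
    moreover have "(\<integral>t. tent k (\<phi> t) \<partial>(\<nu> \<circ> id \<circ> r) n) = tent_coords (\<kappa> (r n)) k" for n
    proof -
      have "(\<integral>t. tent k (\<phi> t) \<partial>\<nu> (r n)) = (\<integral>x. tent k (\<phi> (\<gamma> x)) \<partial>\<kappa> (r n))"
        unfolding \<nu>_def by (rule integral_distr[OF \<gamma>\<kappa>]) (rule measurable_compose[OF \<phi>m tb])
      also have "\<dots> = (\<integral>x. tent k x \<partial>\<kappa> (r n))"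
      proof (rule integral_cong_AE)
        show "(\<lambda>x. tent k (\<phi> (\<gamma> x))) \<in> borel_measurable (\<kappa> (r n))"
          by (rule measurable_compose[OF measurable_compose[OF \<gamma>\<kappa> \<phi>m] tb])
        show "tent k \<in> borel_measurable (\<kappa> (r n))" using tb unfolding measurable_cong_sets[OF s refl] .
        show "AE x in \<kappa> (r n). tent k (\<phi> (\<gamma> x)) = tent k x" using AEB by eventually_elim (simp add: \<gamma>(4))
      qed
      finally show ?thesis by (simp add: tent_coords_def)
    qed
    ultimately show ?thesis by simp
  qed
  thus ?thesis using r \<theta>M by blast
qed

text \<open>Supplies the bounds for dominated convergence, since adaptedness is tested on all
  continuous functions. An unbounded f would be unbounded along a convergent subsequence.\<close>

lemma continuous_Mbox_B1_bounded:
  fixes f :: "(real ^ 'd) measure \<times> (real ^ 'd) \<Rightarrow> real"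
  assumes f: "continuous_map Mbox_B1 euclideanreal f"
  shows "\<exists>B. \<forall>z\<in>topspace Mbox_B1. \<bar>f z\<bar> \<le> B"
proof (rule ccontr)
  assume "\<not> ?thesis"
  hence "\<forall>k::nat. \<exists>z. z \<in> topspace Mbox_B1 \<and> \<bar>f z\<bar> > real k" by (metis not_le)
  then obtain z where z: "\<And>k::nat. z k \<in> topspace Mbox_B1" "\<And>k. \<bar>f (z k)\<bar> > real k" by metis
  have z1: "fst (z k) \<in> topspace Mbox" and z2: "snd (z k) \<in> B1" for k using z(1)[of k] by (auto simp: Mbox_B1_def)
  from Mbox_sequentially_compact[of "\<lambda>k. fst (z k)", OF z1] obtain r \<theta> where
    r: "strict_mono (r :: nat \<Rightarrow> nat)" and \<theta>: "\<theta> \<in> topspace Mbox"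
    and lim1: "\<And>k. (\<lambda>n. tent_coords (fst (z (r n))) k) \<longlonglongrightarrow> tent_coords \<theta> k" by blast
  have "seq_compact (B1 :: (real ^ 'd) set)" using compact_cbox compact_imp_seq_compact by blast
  then obtain x q where x: "x \<in> (B1 :: (real ^ 'd) set)" and q: "strict_mono (q :: nat \<Rightarrow> nat)"
    and lim2: "((\<lambda>n. snd (z (r n))) \<circ> q) \<longlonglongrightarrow> x"
    using z2 unfolding seq_compact_def by (metis (no_types, lifting))
  define y where "y n = z (r (q n))" for n
  have "limitin (product_topology (\<lambda>_. euclideanreal) UNIV) (\<lambda>n. tent_coords (fst (y n))) (tent_coords \<theta>) sequentially"
    unfolding limitin_componentwise
    using LIMSEQ_subseq_LIMSEQ[OF lim1 q] by (auto simp: y_def comp_def)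
  hence "(\<lambda>n. tent_coords (fst (y n))) \<longlonglongrightarrow> tent_coords \<theta>"
    unfolding euclidean_product_topology by simp
  moreover have "(\<lambda>n. snd (y n)) \<longlonglongrightarrow> x" using lim2 by (simp add: y_def comp_def)
  ultimately have lim: "(\<lambda>n. (tent_coords (fst (y n)), snd (y n))) \<longlonglongrightarrow> (tent_coords (fst (\<theta>, x)), snd (\<theta>, x))"
    unfolding fst_conv snd_conv by (rule tendsto_Pair)
  have "(\<lambda>n. f (y n)) \<longlonglongrightarrow> f (\<theta>, x)"
    by (rule tendsto_coord_embedding[OF coord_embedding_Mbox_B1 f _ _ lim])
       (use z(1) \<theta> x in \<open>auto simp: y_def Mbox_B1_def\<close>)
  hence "Bseq (\<lambda>n. f (y n))" using convergent_imp_Bseq convergentI by blast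
  then obtain K where K: "\<And>n. norm (f (y n)) \<le> K" unfolding Bseq_def by blast
  obtain n where n: "K < real n" using reals_Archimedean2 by blast
  \<comment> \<open>Passing to subsequences only increases the index, so the growth of f along z
    survives.\<close>
  have "n \<le> r (q n)" using seq_suble[OF strict_mono_o[OF r q], of n] by simp
  hence "K < \<bar>f (y n)\<bar>" using n z(2)[of "r (q n)"] unfolding y_def by linarith
  thus False using K[of n] by simp
qed

section \<open>Cells\<close>

text \<open>The floor is the number of the cell containing t, counted from -1 in steps of length
  2/N. Since cell number m starts at -1 + 2m/N, the parity condition of
  \<open>badic_intervals\<close> is built in.\<close>

definition grid_center :: "nat \<Rightarrow> real \<Rightarrow> real" where
  "grid_center N t = - 1 + (2 * real_of_int \<lfloor>real N * (t + 1) / 2\<rfloor> + 1) / real N"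

definition cell_center :: "nat \<Rightarrow> real ^ 'd \<Rightarrow> real ^ 'd" where
  "cell_center N x = (\<chi> i. grid_center N (x $ i))"

text \<open>The position of x inside its cell, rescaled to the half-open unit cube: the second
  component of the CP map.\<close>

definition cell_shift :: "nat \<Rightarrow> real ^ 'd \<Rightarrow> real ^ 'd" where
  "cell_shift N x = real N *\<^sub>R (x - cell_center N x)"

lemma grid_center_le_iff:
  assumes "N > 0"
  shows "grid_center N t - 1 / real N \<le> s \<longleftrightarrow> real_of_int \<lfloor>real N * (t + 1) / 2\<rfloor> \<le> real N * (s + 1) / 2"
    and "s < grid_center N t + 1 / real N \<longleftrightarrow> real N * (s + 1) / 2 < real_of_int \<lfloor>real N * (t + 1) / 2\<rfloor> + 1"
proof -
  define n m where "n = real N" and "m = real_of_int \<lfloor>real N * (t + 1) / 2\<rfloor>"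
  have n: "n > 0" using assms n_def by simp
  have "- 1 + (2 * m + 1) / n - 1 / n = (2 * m) / n - 1" "- 1 + (2 * m + 1) / n + 1 / n = (2 * m + 2) / n - 1"
    using n by (simp_all add: add_divide_distrib)
  moreover have "(2 * m) / n \<le> s + 1 \<longleftrightarrow> m \<le> n * (s + 1) / 2" "s + 1 < (2 * m + 2) / n \<longleftrightarrow> n * (s + 1) / 2 < m + 1"
    unfolding pos_divide_le_eq[OF n] pos_less_divide_eq[OF n] by (auto simp: mult.commute)
  moreover have g: "grid_center N t = - 1 + (2 * m + 1) / n" unfolding grid_center_def m_def n_def ..
  ultimately show "grid_center N t - 1 / real N \<le> s \<longleftrightarrow> real_of_int \<lfloor>real N * (t + 1) / 2\<rfloor> \<le> real N * (s + 1) / 2"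
    "s < grid_center N t + 1 / real N \<longleftrightarrow> real N * (s + 1) / 2 < real_of_int \<lfloor>real N * (t + 1) / 2\<rfloor> + 1"
    unfolding g m_def[symmetric] unfolding n_def[symmetric] by (simp_all only: diff_le_eq less_diff_eq)
qed

lemma grid_center_bounds:
  assumes "N > 0"
  shows "grid_center N t - 1 / real N \<le> t" "t < grid_center N t + 1 / real N"
  unfolding grid_center_le_iff[OF assms] by linarith+

lemma grid_center_eqI:
  assumes "N > 0" "grid_center N t - 1 / real N \<le> s" "s < grid_center N t + 1 / real N"
  shows "grid_center N s = grid_center N t"
proof -
  have "\<lfloor>real N * (s + 1) / 2\<rfloor> = \<lfloor>real N * (t + 1) / 2\<rfloor>"
    using assms(2,3) unfolding grid_center_le_iff[OF assms(1)] by (intro floor_unique)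
  thus ?thesis by (simp add: grid_center_def)
qed

text \<open>Passing to the rescaled coordinate inside a coarse cell shifts the argument of the fine
  floor by an integer, so the fine grid refines the coarse one.\<close>

lemma grid_center_mult:
  assumes "N > 0" "M > 0"
  shows "grid_center (N * M) t = grid_center N t + grid_center M (real N * (t - grid_center N t)) / real N"
proof -
  define m F where "m = \<lfloor>real N * (t + 1) / 2\<rfloor>" and "F = \<lfloor>real (N * M) * (t + 1) / 2\<rfloor>"
  define u where "u = grid_center M (real N * (t - grid_center N t))"
  have g: "grid_center N t = - 1 + (2 * real_of_int m + 1) / real N" unfolding grid_center_def m_def ..
  define q where "q = (2 * real_of_int m + 1) / real N"
  have "real N * q = 2 * real_of_int m + 1" unfolding q_def using assms by simp
  hence "real N * (t - grid_center N t) = real N * t + real N - 2 * real_of_int m - 1"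
    unfolding g q_def[symmetric] by (simp add: algebra_simps)
  hence "real M * (real N * (t - grid_center N t) + 1) / 2 = real M * (real N * t + real N - 2 * real_of_int m - 1 + 1) / 2"
    by (simp only:)
  also have "\<dots> = real (N * M) * (t + 1) / 2 - real_of_int (int M * m)"
    by (simp add: field_simps)
  finally have "real M * (real N * (t - grid_center N t) + 1) / 2 = real (N * M) * (t + 1) / 2 - real_of_int (int M * m)" .
  hence "\<lfloor>real M * (real N * (t - grid_center N t) + 1) / 2\<rfloor> = F - int M * m"
    unfolding F_def by (simp only: floor_diff_of_int)
  hence "u = - 1 + (2 * (real_of_int F - real M * real_of_int m) + 1) / real M"
    unfolding u_def grid_center_def[of M] by simp
  hence u: "u = (2 * real_of_int F + 1) / real M - (2 * real_of_int m + 1)"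
    using assms by (simp add: field_simps)
  have "- 1 + (2 * real_of_int F + 1) / real (N * M) = - 1 + (2 * real_of_int m + 1) / real N + u / real N"
    unfolding u diff_divide_distrib by (simp add: mult.commute)
  thus ?thesis unfolding g[symmetric] u_def grid_center_def[of "N * M"] F_def .
qed

lemma grid_index_bounds:
  assumes "N > 0" "- 1 \<le> t" "t < 1"
  shows "\<lfloor>real N * (t + 1) / 2\<rfloor> \<in> {0..<int N}"
proof -
  have "0 \<le> real N * (t + 1) / 2" using assms by simp
  moreover have "real N * (t + 1) / 2 < real N * 2 / 2" using assms by (intro divide_strict_right_mono mult_strict_left_mono) auto
  ultimately show ?thesis by (simp add: floor_less_iff)
qed

lemma abs_grid_center_le:
  assumes "N > 0" "- 1 \<le> t" "t < 1"
  shows "\<bar>grid_center N t\<bar> \<le> 1 - 1 / real N"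
proof -
  define m n where "m = real_of_int \<lfloor>real N * (t + 1) / 2\<rfloor>" and "n = real N"
  have n: "n > 0" using assms n_def by simp
  have m: "0 \<le> m" "m \<le> n - 1" using grid_index_bounds[OF assms] unfolding m_def n_def by auto
  have "1 / n \<le> (2 * m + 1) / n" "(2 * m + 1) / n \<le> (2 * n - 1) / n"
    using m n by (simp_all add: divide_right_mono)
  moreover have "(2 * n - 1) / n = 2 - 1 / n" using n by (simp add: diff_divide_distrib)
  moreover have "grid_center N t = - 1 + (2 * m + 1) / n" unfolding grid_center_def m_def n_def ..
  ultimately show ?thesis unfolding abs_le_iff n_def[symmetric] by linarith
qed

lemma finite_grid_center: "N > 0 \<Longrightarrow> finite (grid_center N ` {-1..<1})"
proof -
  assume N: "N > 0"
  have "grid_center N ` {-1..<1} \<subseteq> (\<lambda>m. - 1 + (2 * real_of_int m + 1) / real N) ` {0..<int N}"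
    using grid_index_bounds[OF N] unfolding grid_center_def by auto
  thus ?thesis by (rule finite_subset) simp
qed

lemma grid_center_rat: "grid_center N t \<in> \<rat>"
  unfolding grid_center_def by (intro Rats_add Rats_divide Rats_mult) auto

section \<open>Cells in the space\<close>

lemma mem_half_open_cube: "y \<in> half_open_cube c r \<longleftrightarrow> (\<forall>i. c $ i - r \<le> y $ i \<and> y $ i < c $ i + r)"
  by (simp add: half_open_cube_def)

lemma mem_cell: "N > 0 \<Longrightarrow> x \<in> half_open_cube (cell_center N x) (1 / real N)"
  by (simp add: mem_half_open_cube cell_center_def grid_center_bounds)

lemma cell_center_eq_iff:
  "N > 0 \<Longrightarrow> cell_center N y = cell_center N x \<longleftrightarrow> y \<in> half_open_cube (cell_center N x) (1 / real N)"
proof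
  assume N: "N > 0" "y \<in> half_open_cube (cell_center N x) (1 / real N)"
  have "grid_center N (y $ i) = grid_center N (x $ i)" for i
    by (rule grid_center_eqI) (use N in \<open>auto simp: mem_half_open_cube cell_center_def\<close>)
  thus "cell_center N y = cell_center N x" by (simp add: cell_center_def)
qed (use mem_cell in metis)

lemma cell_shift_mem: "N > 0 \<Longrightarrow> cell_shift N x \<in> half_open_cube 0 1"
  unfolding mem_half_open_cube cell_shift_def cell_center_def
  using grid_center_bounds[of N "x $ _"] by (simp add: field_simps)

lemma cell_center_plus_shift: "N > 0 \<Longrightarrow> x = cell_center N x + (1 / real N) *\<^sub>R cell_shift N x"
  by (simp add: cell_shift_def)

text \<open>Together with \<open>cell_shift_mult\<close> this makes one step of base
  \<open>b ^ n\<close> the same as n steps of base b.\<close>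

lemma cell_center_mult:
  "N > 0 \<Longrightarrow> M > 0 \<Longrightarrow> cell_center (N * M) x = cell_center N x + (1 / real N) *\<^sub>R cell_center M (cell_shift N x)"
  by (simp add: vec_eq_iff cell_center_def cell_shift_def grid_center_mult)

lemma cell_shift_mult:
  "N > 0 \<Longrightarrow> M > 0 \<Longrightarrow> cell_shift (N * M) x = cell_shift M (cell_shift N x)"
  unfolding cell_shift_def[of "N * M"] cell_center_mult cell_shift_def[of M]
  by (simp add: cell_shift_def algebra_simps)

text \<open>Describes the inverse branches of the magnification, which allow past digits to be
  prescribed freely.\<close>

lemma cell_center_affine:
  assumes "N > 0" "y \<in> half_open_cube 0 1"
  shows "cell_center N (cell_center N x + (1 / real N) *\<^sub>R y) = cell_center N x"
  unfolding cell_center_eq_iff[OF assms(1)] mem_half_open_cube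
proof (intro allI)
  fix i
  have "-1 \<le> y $ i" "y $ i < 1" using assms(2) by (auto simp: mem_half_open_cube)
  thus "cell_center N x $ i - 1 / real N \<le> (cell_center N x + (1 / real N) *\<^sub>R y) $ i \<and>
      (cell_center N x + (1 / real N) *\<^sub>R y) $ i < cell_center N x $ i + 1 / real N"
    using divide_right_mono[of "-1" "y $ i" "real N"] divide_strict_right_mono[of "y $ i" 1 "real N"] assms(1) by simp
qed

lemma cell_shift_affine:
  "N > 0 \<Longrightarrow> y \<in> half_open_cube 0 1 \<Longrightarrow> cell_shift N (cell_center N x + (1 / real N) *\<^sub>R y) = y"
  by (simp add: cell_shift_def cell_center_affine)

lemma abs_cell_center_le:
  "N > 0 \<Longrightarrow> x \<in> half_open_cube 0 1 \<Longrightarrow> \<bar>cell_center N x $ i\<bar> \<le> 1 - 1 / real N"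
  unfolding cell_center_def by (simp add: abs_grid_center_le mem_half_open_cube)

lemma cell_center_in_unit:
  assumes "N > 0" "x \<in> half_open_cube 0 1"
  shows "cell_center N x \<in> half_open_cube 0 1"
  unfolding mem_half_open_cube
proof
  fix i
  have "\<bar>cell_center N x $ i\<bar> < 1"
    by (rule le_less_trans[OF abs_cell_center_le[OF assms]]) (use assms in simp)
  thus "(0::real ^ 'a) $ i - 1 \<le> cell_center N x $ i \<and> cell_center N x $ i < (0::real ^ 'a) $ i + 1"
    by (simp add: abs_less_iff)
qed

lemma cell_center_cell_center:
  assumes "N > 0" "M > 0"
  shows "cell_center N (cell_center (N * M) x) = cell_center N x"
  unfolding cell_center_mult[OF assms]
  by (intro cell_center_affine cell_center_in_unit cell_shift_mem assms)

lemma finite_cell_centers: "N > 0 \<Longrightarrow> finite (cell_center N ` half_open_cube (0 :: real ^ 'd) 1)"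
proof -
  assume N: "N > 0"
  have "cell_center N ` half_open_cube (0 :: real ^ 'd) 1 \<subseteq> {x. \<forall>i. x $ i \<in> grid_center N ` {-1..<1}}"
    by (auto simp: cell_center_def mem_half_open_cube)
  also have "\<dots> = (\<lambda>f. \<chi> i. f i) ` (Pi\<^sub>E UNIV (\<lambda>_. grid_center N ` {-1..<1}))"
  proof (intro equalityI subsetI)
    fix x :: "real ^ 'd" assume "x \<in> {x. \<forall>i. x $ i \<in> grid_center N ` {-1..<1}}"
    thus "x \<in> (\<lambda>f. \<chi> i. f i) ` (Pi\<^sub>E UNIV (\<lambda>_. grid_center N ` {-1..<1}))"
      by (intro image_eqI[of _ _ "\<lambda>i. x $ i"]) auto
  qed (auto simp: PiE_iff)
  finally show ?thesis
    by (rule finite_subset) (intro finite_imageI finite_PiE finite_grid_center N; simp)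
qed

lemma half_open_unit_subset: "half_open_cube 0 1 \<subseteq> B1"
  by (auto simp: mem_half_open_cube mem_B1 abs_le_iff) (metis less_imp_le minus_le_iff add.inverse_inverse)+

text \<open>Centres keep distance 1/N from the boundary of \<open>B1\<close>, so even the closed
  cell stays inside.\<close>

lemma window_cell_subset_B1:
  assumes "N > 0" "x \<in> half_open_cube 0 1"
  shows "window (real N) (cell_center N x) \<subseteq> B1"
proof
  fix y assume y: "y \<in> window (real N) (cell_center N x)"
  show "y \<in> B1" unfolding mem_B1
  proof
    fix i
    have "\<bar>y $ i - cell_center N x $ i\<bar> \<le> 1 / real N" using y assms(1) by (simp add: mem_window)
    thus "\<bar>y $ i\<bar> \<le> 1" using abs_cell_center_le[OF assms, of i] by linarith
  qed
qed

lemma cell_subset_window: "N > 0 \<Longrightarrow> half_open_cube c (1 / real N) \<subseteq> window (real N) c"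
  by (auto simp: mem_half_open_cube mem_window abs_le_iff algebra_simps)
    (metis add.commute diff_le_eq le_diff_eq less_imp_le)+

text \<open>The parity condition says that k has the form -N + 2m, and the point x determines m as
  the floor in \<open>grid_center\<close>.\<close>

lemma badic_cell_eq:
  assumes N: "N > 0"
  shows "badic_cell N x = half_open_cube (cell_center N x) (1 / real N)"
  unfolding badic_cell_def
proof (rule the_equality)
  have cellI: "{grid_center N t - 1 / real N ..< grid_center N t + 1 / real N} \<in> badic_intervals N" for t
    unfolding badic_intervals_def
  proof (intro CollectI exI[of _ "- int N + 2 * \<lfloor>real N * (t + 1) / 2\<rfloor>"] conjI)
    show "(- int N + 2 * \<lfloor>real N * (t + 1) / 2\<rfloor>) mod 2 = int N mod 2" by presburger
    show "{grid_center N t - 1 / real N ..< grid_center N t + 1 / real N} =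
      {real_of_int (- int N + 2 * \<lfloor>real N * (t + 1) / 2\<rfloor>) / real N ..<
        real_of_int (- int N + 2 * \<lfloor>real N * (t + 1) / 2\<rfloor> + 2) / real N}"
      using N unfolding grid_center_def by (intro arg_cong2[of _ _ _ _ atLeastLessThan]) (simp_all add: field_simps)
  qed
  show "half_open_cube (cell_center N x) (1 / real N) \<in> badic_cells N \<and> x \<in> half_open_cube (cell_center N x) (1 / real N)"
  proof
    show "half_open_cube (cell_center N x) (1 / real N) \<in> badic_cells N"
      unfolding badic_cells_def using cellI
      by (intro CollectI exI[of _ "\<lambda>i. {grid_center N (x $ i) - 1 / real N ..< grid_center N (x $ i) + 1 / real N}"])
         (auto simp: half_open_cube_def cell_center_def)
  qed (rule mem_cell[OF N])
  fix D assume D: "D \<in> badic_cells N \<and> x \<in> D"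
  then obtain I where I: "D = {x. \<forall>i. x $ i \<in> I i}" "\<And>i. I i \<in> badic_intervals N"
    unfolding badic_cells_def by auto
  have "I i = {grid_center N (x $ i) - 1 / real N ..< grid_center N (x $ i) + 1 / real N}" for i
  proof -
    obtain k where k: "I i = {real_of_int k / real N ..< real_of_int (k + 2) / real N}" "k mod 2 = int N mod 2"
      using I(2)[of i] unfolding badic_intervals_def by auto
    have "x $ i \<in> I i" using D I(1) by auto
    hence b: "real_of_int k \<le> real N * (x $ i)" "real N * (x $ i) < real_of_int k + 2"
      using N unfolding k(1) by (auto simp: field_simps)
    obtain m where m: "k = - int N + 2 * m"
    proof -
      have "(k + int N) mod 2 = 0" using k(2) by presburger
      hence "k + int N = 2 * ((k + int N) div 2)" by presburger
      thus ?thesis using that[of "(k + int N) div 2"] by linarith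
    qed
    have "\<lfloor>real N * (x $ i + 1) / 2\<rfloor> = m"
      using b unfolding m by (intro floor_unique) (simp_all add: field_simps)
    thus ?thesis unfolding k(1) m grid_center_def using N
      by (intro arg_cong2[of _ _ _ _ atLeastLessThan]) (simp_all add: field_simps)
  qed
  thus "D = half_open_cube (cell_center N x) (1 / real N)"
    unfolding I(1) half_open_cube_def cell_center_def by auto
qed

text \<open>Makes the definite description in \<open>cube_map\<close> meaningful. Centre and radius
  are read off from the extreme coordinates; the upper faces do not belong to the cube and are
  reached by density.\<close>

lemma half_open_cube_inject:
  fixes c c' :: "real ^ 'd"
  assumes "r > 0" "r' > 0" "half_open_cube c r = half_open_cube c' r'"
  shows "c = c' \<and> r = r'"
proof -
  have le: "c' $ i - r' \<le> c $ i - r \<and> c $ i + r \<le> c' $ i + r'"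
    if r: "r > 0" "r' > 0" and sub: "half_open_cube c r \<subseteq> half_open_cube c' r'" for c c' :: "real ^ 'd" and r r' i
  proof
    have "(\<chi> i. c $ i - r) \<in> half_open_cube c r" using r by (simp add: mem_half_open_cube)
    hence "(\<chi> i. c $ i - r) \<in> half_open_cube c' r'" using sub by blast
    thus "c' $ i - r' \<le> c $ i - r" by (simp add: mem_half_open_cube)
    show "c $ i + r \<le> c' $ i + r'"
    proof (rule dense_le_bounded[of "c $ i - r"])
      fix w assume w: "c $ i - r < w" "w < c $ i + r"
      have "(\<chi> j. if j = i then w else c $ j) \<in> half_open_cube c r" using r w by (simp add: mem_half_open_cube)
      hence "(\<chi> j. if j = i then w else c $ j) \<in> half_open_cube c' r'" using sub by blast
      hence "(\<chi> j. if j = i then w else c $ j) $ i < c' $ i + r'" unfolding mem_half_open_cube by blast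
      thus "w \<le> c' $ i + r'" by simp
    qed (use r in simp)
  qed
  have 1: "c $ i - r = c' $ i - r' \<and> c $ i + r = c' $ i + r'" for i
    using le[of r r' c c' i] le[of r' r c' c i] assms by auto
  have "c $ i = c' $ i" for i using 1[of i] by linarith
  moreover have "r = r'" using 1[of undefined] by linarith
  ultimately show ?thesis by (simp add: vec_eq_iff)
qed

lemma cube_map_half_open_cube:
  fixes c :: "real ^ 'd"
  assumes "r > 0"
  shows "cube_map (half_open_cube c r) = (\<lambda>y. (1 / r) *\<^sub>R (y - c))"
  unfolding cube_map_def
proof (rule the_equality)
  show "\<exists>c' r'. r' > 0 \<and> half_open_cube c r = half_open_cube c' r' \<and> (\<lambda>y. (1 / r) *\<^sub>R (y - c)) = (\<lambda>y. (1 / r') *\<^sub>R (y - c'))"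
    using assms by blast
  fix T assume "\<exists>c' r'. r' > 0 \<and> half_open_cube c r = half_open_cube c' r' \<and> T = (\<lambda>y. (1 / r') *\<^sub>R (y - c'))"
  thus "T = (\<lambda>y. (1 / r) *\<^sub>R (y - c))" using half_open_cube_inject[OF assms] by metis
qed

lemma cube_map_badic_cell: "N > 0 \<Longrightarrow> cube_map (badic_cell N x) = (\<lambda>y. real N *\<^sub>R (y - cell_center N x))"
  by (simp add: badic_cell_eq cube_map_half_open_cube)

lemma CP_map_eq: "b > 0 \<Longrightarrow> CP_map b (\<mu>, x) = (restrict_B1 (magnify (real b) (cell_center b x) \<mu>), cell_shift b x)"
  by (simp add: cube_map_badic_cell normalize_box_magnify cell_shift_def)

lemma mem_CP_dom: "b > 0 \<Longrightarrow> (\<mu>, x) \<in> CP_dom b \<longleftrightarrow>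
    \<mu> \<in> topspace Mbox \<and> x \<in> B1 \<and> emeasure \<mu> (half_open_cube (cell_center b x) (1 / real b)) > 0"
  by (simp add: CP_dom_def topspace_Mbox_B1 badic_cell_eq)

lemma extension_approx_eq: "b > 0 \<Longrightarrow> extension_approx b \<omega> n =
    magnify (real (b ^ n)) (cell_center (b ^ n) (snd (\<omega> (- int n)))) (fst (\<omega> (- int n)))"
  unfolding extension_approx_def Let_def
  by (simp add: case_prod_beta cube_map_badic_cell magnify_def)

text \<open>
  Irrational points avoid all cell boundaries; the exceptional hyperplanes are countably many.
\<close>

definition irrational_point :: "real ^ 'd \<Rightarrow> bool" where
  "irrational_point x \<longleftrightarrow> (\<forall>i. x $ i \<notin> \<rat>)"

lemma irrational_affine:
  assumes "irrational_point x" "\<And>i. c $ i \<in> \<rat>" "q \<in> \<rat>" "q \<noteq> 0"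
  shows "irrational_point (c + q *\<^sub>R x)"
  unfolding irrational_point_def
proof (intro allI notI)
  fix i assume "(c + q *\<^sub>R x) $ i \<in> \<rat>"
  hence "((c + q *\<^sub>R x) $ i - c $ i) / q \<in> \<rat>" by (intro Rats_divide Rats_diff assms)
  thus False using assms(1,4) unfolding irrational_point_def by simp
qed

lemma cell_center_rat: "cell_center N x $ i \<in> \<rat>"
  by (simp add: cell_center_def grid_center_rat)

lemma irrational_cell_shift:
  assumes "irrational_point x" "N > 0"
  shows "irrational_point (cell_shift N x)"
proof -
  have "irrational_point (- (real N *\<^sub>R cell_center N x) + real N *\<^sub>R x)"
    using assms cell_center_rat[of N x] by (intro irrational_affine) (auto intro!: Rats_mult)
  thus ?thesis by (simp add: cell_shift_def algebra_simps)
qed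

lemma irrational_unit:
  assumes "irrational_point x" "x \<in> B1"
  shows "\<bar>x $ i\<bar> < 1"
proof -
  have "x $ i \<noteq> 1" "x $ i \<noteq> -1" using assms(1) unfolding irrational_point_def by (metis Rats_1, metis Rats_1 Rats_minus_iff)
  moreover have "\<bar>x $ i\<bar> \<le> 1" using assms(2) by (simp add: mem_B1)
  ultimately show ?thesis by linarith
qed

lemma irrational_half_open:
  assumes "irrational_point x" "x \<in> B1"
  shows "x \<in> half_open_cube 0 1"
  using irrational_unit[OF assms] by (simp add: mem_half_open_cube abs_less_iff less_imp_le minus_less_iff minus_le_iff)

lemma cell_center_measurable [measurable]: "cell_center N \<in> borel_measurable (borel :: (real ^ 'd) measure)"
proof -
  have "(\<lambda>x::real ^ 'd. grid_center N (x $ i)) \<in> borel_measurable borel" for i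
    unfolding grid_center_def by measurable
  thus ?thesis unfolding cell_center_def
    by (subst borel_measurable_euclidean_space) (auto simp: Basis_vec_def inner_axis)
qed

lemma cell_shift_measurable [measurable]: "cell_shift N \<in> borel_measurable (borel :: (real ^ 'd) measure)"
  unfolding cell_shift_def by measurable

lemma half_open_cube_borel [measurable]: "half_open_cube c r \<in> sets (borel :: (real ^ 'd) measure)"
proof -
  have "half_open_cube c r = {y \<in> space borel. \<forall>i. c $ i - r \<le> y $ i \<and> y $ i < c $ i + r}" by (simp add: half_open_cube_def)
  also have "\<dots> \<in> sets borel" by measurable
  finally show ?thesis .
qed

section \<open>Averages along orbits\<close>

text \<open>In the expanded square every row has at most 2k entries that need not vanish, and each
  entry is at most 1.\<close>

lemma integral_square_sum_le:
  fixes h :: "nat \<Rightarrow> 'a \<Rightarrow> real"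
  assumes M: "prob_space M" and h: "\<And>n. h n \<in> borel_measurable M" "\<And>n x. \<bar>h n x\<bar> \<le> 1"
    and orth: "\<And>n m. n + k \<le> m \<Longrightarrow> (\<integral>x. h n x * h m x \<partial>M) = 0"
  shows "(\<integral>x. (\<Sum>n<N. h n x)\<^sup>2 \<partial>M) \<le> 2 * real k * real N"
proof -
  interpret prob_space M by (rule M)
  have hh: "\<bar>h n x * h m x\<bar> \<le> 1" for n m x
    unfolding abs_mult using h(2)[of n x] h(2)[of m x] by (intro mult_le_one) auto
  have int: "integrable M (\<lambda>x. h n x * h m x)" for n m
    by (rule integrable_const_bound[of _ 1]) (use h hh in auto)
  have le1: "(\<integral>x. h n x * h m x \<partial>M) \<le> 1" for n m
  proof -
    have "(\<integral>x. h n x * h m x \<partial>M) \<le> (\<integral>x. 1 \<partial>M)"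
      by (intro integral_mono int abs_le_D1[OF hh]) simp
    thus ?thesis by (simp add: prob_space)
  qed
  have "(\<integral>x. (\<Sum>n<N. h n x)\<^sup>2 \<partial>M) = (\<integral>x. (\<Sum>n<N. \<Sum>m<N. h n x * h m x) \<partial>M)"
    by (simp add: power2_eq_square sum_product)
  also have "\<dots> = (\<Sum>n<N. \<Sum>m<N. \<integral>x. h n x * h m x \<partial>M)" using int by simp
  also have "\<dots> \<le> (\<Sum>n<N. 2 * real k)"
  proof (rule sum_mono)
    fix n assume n: "n \<in> {..<N}"
    \<comment> \<open>The interval consists of the indices m closer than k to n. Subtraction in the
      natural numbers cuts it off at 0, which only removes indices that do not exist.\<close>
    have "(\<Sum>m<N. \<integral>x. h n x * h m x \<partial>M) \<le> (\<Sum>m<N. if m \<in> {n + 1 - k..<n + k} then 1 else 0)"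
    proof (rule sum_mono)
      fix m
      have "(\<integral>x. h n x * h m x \<partial>M) = 0" if "m \<notin> {n + 1 - k..<n + k}"
      proof (cases "n + k \<le> m")
        case False
        hence "m + k \<le> n" using that by auto
        from orth[OF this] show ?thesis by (simp add: mult.commute)
      qed (rule orth)
      thus "(\<integral>x. h n x * h m x \<partial>M) \<le> (if m \<in> {n + 1 - k..<n + k} then 1 else 0)"
        using le1[of n m] by simp
    qed
    also have "\<dots> = real (card ({..<N} \<inter> {n + 1 - k..<n + k}))"
      by (subst sum.inter_restrict[symmetric]) auto
    also have "\<dots> \<le> real (card {n + 1 - k..<n + k})" by (intro of_nat_mono card_mono) auto
    also have "\<dots> \<le> 2 * real k" by simp
    finally show "(\<Sum>m<N. \<integral>x. h n x * h m x \<partial>M) \<le> 2 * real k" .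
  qed
  finally show ?thesis by (simp add: mult.commute)
qed

text \<open>
  Averaging over the first \<open>j\<^sup>2\<close> terms makes the second moments, of order \<open>1 / j\<^sup>2\<close>, summable.
\<close>

lemma AE_average_tendsto_0:
  fixes h :: "nat \<Rightarrow> 'a \<Rightarrow> real"
  assumes M: "prob_space M" and h: "\<And>n. h n \<in> borel_measurable M" "\<And>n x. \<bar>h n x\<bar> \<le> 1"
    and orth: "\<And>n m. n + k \<le> m \<Longrightarrow> (\<integral>x. h n x * h m x \<partial>M) = 0"
  shows "AE x in M. (\<lambda>j. (\<Sum>n<j\<^sup>2. h n x) / real (j\<^sup>2)) \<longlonglongrightarrow> 0"
proof -
  interpret prob_space M by (rule M)
  define S where "S j x = ((\<Sum>n<j\<^sup>2. h n x) / real (j\<^sup>2))\<^sup>2" for j x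
  have S0: "S j x \<ge> 0" for j x unfolding S_def by simp
  have Sm [measurable]: "S j \<in> borel_measurable M" for j unfolding S_def using h(1) by measurable
  have Sle: "S j x \<le> 1" for j x
  proof -
    have "\<bar>\<Sum>n<j\<^sup>2. h n x\<bar> \<le> (\<Sum>n<j\<^sup>2. 1)" by (rule order_trans[OF sum_abs sum_mono]) (rule h(2))
    hence "\<bar>(\<Sum>n<j\<^sup>2. h n x) / real (j\<^sup>2)\<bar> \<le> 1" by (cases "j = 0") simp_all
    thus ?thesis unfolding S_def by (rule abs_square_le_1[THEN iffD2])
  qed
  have Sint: "integrable M (S j)" for j
    by (rule integrable_const_bound[of _ 1]) (use S0 Sle in auto)
  have ES: "(\<integral>x. S j x \<partial>M) \<le> 2 * real k * inverse (real j ^ 2)" for j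
  proof (cases "j = 0")
    case False
    have "(\<integral>x. S j x \<partial>M) = (\<integral>x. (\<Sum>n<j\<^sup>2. h n x)\<^sup>2 \<partial>M) / (real (j\<^sup>2))\<^sup>2"
      unfolding S_def power_divide by simp
    also have "\<dots> \<le> (2 * real k * real (j\<^sup>2)) / (real (j\<^sup>2))\<^sup>2"
      by (intro divide_right_mono integral_square_sum_le assms) auto
    also have "\<dots> = 2 * real k * inverse (real j ^ 2)" using False by (simp add: power2_eq_square field_simps)
    finally show ?thesis .
  qed (simp add: S_def)
  have sm: "summable (\<lambda>j. 2 * real k * inverse (real j ^ 2))"
    by (intro summable_mult inverse_power_summable) simp
  have "(\<integral>\<^sup>+x. (\<Sum>j. ennreal (S j x)) \<partial>M) = (\<Sum>j. \<integral>\<^sup>+x. ennreal (S j x) \<partial>M)"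
    by (rule nn_integral_suminf) measurable
  also have "\<dots> = (\<Sum>j. ennreal (\<integral>x. S j x \<partial>M))"
    using Sint S0 by (simp add: nn_integral_eq_integral)
  also have "\<dots> \<le> (\<Sum>j. ennreal (2 * real k * inverse (real j ^ 2)))"
    by (intro suminf_le ennreal_leI ES summableI)
  also have "\<dots> = ennreal (\<Sum>j. 2 * real k * inverse (real j ^ 2))" by (intro suminf_ennreal2 sm) simp
  also have "\<dots> < \<infinity>" by simp
  finally have fin: "(\<integral>\<^sup>+x. (\<Sum>j. ennreal (S j x)) \<partial>M) \<noteq> \<infinity>" by simp
  have "AE x in M. (\<Sum>j. ennreal (S j x)) \<noteq> \<infinity>"
    by (rule nn_integral_PInf_AE[OF _ fin]) measurable
  thus ?thesis
  proof (rule AE_mp, intro AE_I2 impI)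
    fix x assume "(\<Sum>j. ennreal (S j x)) \<noteq> \<infinity>"
    hence "summable (\<lambda>j. S j x)" by (intro summable_suminf_not_top S0) simp
    from summable_LIMSEQ_zero[OF this] have "(\<lambda>j. sqrt (S j x)) \<longlonglongrightarrow> sqrt 0" by (rule tendsto_real_sqrt)
    hence "(\<lambda>j. \<bar>(\<Sum>n<j\<^sup>2. h n x) / real (j\<^sup>2)\<bar>) \<longlonglongrightarrow> 0"
      unfolding S_def real_sqrt_abs by simp
    thus "(\<lambda>j. (\<Sum>n<j\<^sup>2. h n x) / real (j\<^sup>2)) \<longlonglongrightarrow> 0" by (rule tendsto_rabs_zero_cancel)
  qed
qed

text \<open>At level \<open>b ^ n\<close> this is the measure component after n steps of the CP map,
  obtained by a single magnification.\<close>

definition scenery :: "nat \<Rightarrow> (real ^ 'd) measure \<Rightarrow> real ^ 'd \<Rightarrow> (real ^ 'd) measure" where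
  "scenery N \<kappa> z = restrict_B1 (magnify (real N) (cell_center N z) \<kappa>)"

text \<open>If z has law \<kappa> and its level-N cell is given, the rescaled position has law
  \<open>scenery N \<kappa> z\<close>, up to cell boundaries. The second factor is therefore centred
  in every cell. \<open>A\<close> tests the measure, \<open>C\<close> the point.\<close>

definition discrepancy ::
    "(real ^ 'd) measure set \<Rightarrow> (real ^ 'd) set \<Rightarrow> nat \<Rightarrow> (real ^ 'd) measure \<Rightarrow> real ^ 'd \<Rightarrow> real" where
  "discrepancy A C N \<kappa> z = indicator A (scenery N \<kappa> z) * (indicator C (cell_shift N z) - measure (scenery N \<kappa> z) C)"

section \<open>Sceneries and discrepancies\<close>

lemma emeasure_scenery:
  assumes "sets \<kappa> = sets borel" "A \<in> sets borel"
  shows "emeasure (scenery N \<kappa> z) A =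
    emeasure \<kappa> ((\<lambda>y. real N *\<^sub>R (y - cell_center N z)) -` (B1 \<inter> A)) / emeasure \<kappa> (window (real N) (cell_center N z))"
  unfolding scenery_def using assms
  by (subst emeasure_restrict_B1) (simp_all add: emeasure_magnify)

lemma preimage_subset_window: "(\<lambda>y. r *\<^sub>R (y - c)) -` (B1 \<inter> A) \<subseteq> window r c"
  unfolding window_def by blast

lemma measure_scenery:
  assumes \<kappa>: "\<kappa> \<in> radon_measures" and N: "N > 0" and C: "C \<in> sets borel"
  shows "measure (scenery N \<kappa> z) C =
    measure \<kappa> ((\<lambda>y. real N *\<^sub>R (y - cell_center N z)) -` (B1 \<inter> C)) / measure \<kappa> (window (real N) (cell_center N z))"
proof -
  let ?a = "emeasure \<kappa> ((\<lambda>y. real N *\<^sub>R (y - cell_center N z)) -` (B1 \<inter> C))"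
  let ?w = "emeasure \<kappa> (window (real N) (cell_center N z))"
  have w: "?w < \<infinity>" using N by (intro window_finite[OF \<kappa>]) simp
  have aw: "?a \<le> ?w"
    by (rule emeasure_mono[OF preimage_subset_window]) (simp add: radon_sets[OF \<kappa>])
  have "measure (scenery N \<kappa> z) C = enn2real (?a / ?w)"
    unfolding measure_def emeasure_scenery[OF radon_sets[OF \<kappa>] C] ..
  \<comment> \<open>On a null window the numerator is null as well, and 0/0 is 0 on both
    sides.\<close>
  also have "\<dots> = enn2real ?a / enn2real ?w"
  proof (cases "?w = 0")
    case True
    hence "?a = 0" using aw by simp
    thus ?thesis using True by simp
  next
    case False
    have "?a < \<infinity>" using aw w by (rule le_less_trans)
    thus ?thesis using False w
      by (cases ?a; cases ?w) (simp_all add: divide_ennreal)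
  qed
  finally show ?thesis by (simp add: measure_def)
qed

lemma measure_scenery_le_1:
  assumes \<kappa>: "\<kappa> \<in> radon_measures" and N: "N > 0" and C: "C \<in> sets borel"
  shows "measure (scenery N \<kappa> z) C \<le> 1"
proof -
  have "measure \<kappa> ((\<lambda>y. real N *\<^sub>R (y - cell_center N z)) -` (B1 \<inter> C)) \<le> measure \<kappa> (window (real N) (cell_center N z))"
    using window_finite[OF \<kappa>, of "real N" "cell_center N z"] N radon_sets[OF \<kappa>] C
    by (intro measure_mono_fmeasurable preimage_subset_window)
       (simp_all add: fmeasurable_def preimage_homothety_borel)
  thus ?thesis unfolding measure_scenery[OF assms] by (auto simp: divide_le_eq_1 zero_less_measure_iff)
qed

lemma abs_discrepancy_le_1:
  assumes "\<kappa> \<in> radon_measures" "N > 0" "C \<in> sets borel"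
  shows "\<bar>discrepancy A C N \<kappa> z\<bar> \<le> 1"
  using measure_scenery_le_1[OF assms, of z] measure_nonneg[of "scenery N \<kappa> z" C]
  unfolding discrepancy_def by (auto simp: indicator_def)

text \<open>The level-N scenery and the level-K cell inside it depend only on the level-NK cell of
  z. They are therefore known from the centre of any finer cell.\<close>

lemma discrepancy_cell_center:
  assumes N: "N > 0" "K > 0" "M > 0"
  shows "discrepancy A {y. cell_center K y = c0} N \<kappa> (cell_center (N * K * M) z) = discrepancy A {y. cell_center K y = c0} N \<kappa> z"
proof -
  let ?c = "cell_center (N * K * M) z"
  have 1: "cell_center N ?c = cell_center N z"
    using cell_center_cell_center[of N "K * M" z] N by (simp add: mult.assoc)
  have "cell_center (N * K) ?c = cell_center (N * K) z"
    using cell_center_cell_center[of "N * K" M z] N by simp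
  hence "cell_center N ?c + (1 / real N) *\<^sub>R cell_center K (cell_shift N ?c) =
      cell_center N z + (1 / real N) *\<^sub>R cell_center K (cell_shift N z)"
    unfolding cell_center_mult[OF N(1,2), of ?c] cell_center_mult[OF N(1,2), of z] .
  hence "cell_center K (cell_shift N ?c) = cell_center K (cell_shift N z)"
    using N unfolding 1 by simp
  thus ?thesis using 1 unfolding discrepancy_def scenery_def by (simp add: indicator_def)
qed

lemma AE_off_rational_hyperplane:
  fixes \<kappa> :: "(real ^ 'd) measure"
  assumes s: "sets \<kappa> = sets borel" and null: "\<And>i q. q \<in> \<rat> \<Longrightarrow> emeasure \<kappa> {x. x $ i = q} = 0"
  shows "AE x in \<kappa>. irrational_point x"
proof -
  have "AE x in \<kappa>. \<forall>i. \<forall>q\<in>\<rat>. x $ i \<noteq> q"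
  proof (subst AE_all_countable, intro allI)
    fix i
    have "AE x in \<kappa>. x $ i \<noteq> q" if "q \<in> \<rat>" for q
    proof -
      have "{x. x $ i = q} \<in> null_sets \<kappa>"
      proof (rule null_setsI[OF null[OF that]])
        have "{x::real ^ 'd. x $ i = q} = {x \<in> space borel. x $ i = q}" by simp
        also have "\<dots> \<in> sets borel" by measurable
        finally show "{x. x $ i = q} \<in> sets \<kappa>" using s by simp
      qed
      from AE_not_in[OF this] show ?thesis by simp
    qed
    thus "AE x in \<kappa>. \<forall>q\<in>\<rat>. x $ i \<noteq> q" by (subst AE_ball_countable) (auto intro: countable_rat)
  qed
  thus ?thesis unfolding irrational_point_def by eventually_elim blast
qed

text \<open>A discrepancy has mean zero on every cell of its own level, and discrepancies at least k
  levels earlier are constant there; hence the orthogonality at distance k. Null rational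
  hyperplanes reconcile the closed windows that normalise with the half-open cells that form the
  partition.\<close>

lemma AE_discrepancy_average:
  fixes \<kappa> :: "(real ^ 'd) measure" and b k :: nat and c0 :: "real ^ 'd"
  assumes \<kappa>: "\<kappa> \<in> topspace Mbox" and null: "\<And>i q. q \<in> \<rat> \<Longrightarrow> emeasure \<kappa> {x. x $ i = q} = 0" and b: "b > 0"
  defines "C \<equiv> {y. cell_center (b ^ k) y = c0}"
  shows "AE z in \<kappa>. (\<lambda>j. (\<Sum>n<j\<^sup>2. discrepancy A C (b ^ n) \<kappa> z) / real (j\<^sup>2)) \<longlonglongrightarrow> 0"
proof -
  have r: "\<kappa> \<in> radon_measures" by (rule Mbox_radon[OF \<kappa>])
  note s = radon_sets[OF r]
  have sp: "space \<kappa> = UNIV" using sets_eq_imp_space_eq[OF s] by simp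
  note P = prob_space_Mbox(1)[OF \<kappa>]
  interpret prob_space \<kappa> by (rule P)
  have Cb [measurable]: "C \<in> sets borel" unfolding C_def
  proof -
    have "{y::real ^ 'd. cell_center (b ^ k) y = c0} = {y \<in> space borel. cell_center (b ^ k) y = c0}" by simp
    also have "\<dots> \<in> sets borel" by measurable
    finally show "{y::real ^ 'd. cell_center (b ^ k) y = c0} \<in> sets borel" .
  qed
  have "AE z in \<kappa>. z \<in> B1" by (rule prob_space_Mbox(2)[OF \<kappa>])
  moreover have "AE z in \<kappa>. irrational_point z" using s null by (rule AE_off_rational_hyperplane)
  ultimately have AEz: "AE z in \<kappa>. z \<in> half_open_cube 0 1 \<and> irrational_point z"
    by eventually_elim (use irrational_half_open in blast)
  have fin: "finite (cell_center (b ^ m) ` half_open_cube (0 :: real ^ 'd) 1)" for m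
    using b by (intro finite_cell_centers) simp
  define E where "E m c = {z :: real ^ 'd. cell_center (b ^ m) z = c}" for m c
  have Eb [measurable]: "E m c \<in> sets \<kappa>" for m c
  proof -
    have "E m c = {y \<in> space borel. cell_center (b ^ m) y = c}" unfolding E_def by simp
    also have "\<dots> \<in> sets borel" by measurable
    finally show ?thesis using s by simp
  qed
  define h where "h n z = discrepancy A C (b ^ n) \<kappa> z" for n z
  have h1: "\<bar>h n z\<bar> \<le> 1" for n z unfolding h_def using b by (intro abs_discrepancy_le_1 r Cb) simp
  define \<Phi> where "\<Phi> n c = (indicator A (restrict_B1 (magnify (real (b ^ n)) c \<kappa>)) :: real)" for n c
  define q where "q n c = measure (restrict_B1 (magnify (real (b ^ n)) c \<kappa>)) C" for n c
  have h_on: "h n z = \<Phi> n c * (indicator C (real (b ^ n) *\<^sub>R (z - c)) - q n c)" if "z \<in> E n c" for n z c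
    using that unfolding h_def discrepancy_def scenery_def \<Phi>_def q_def E_def cell_shift_def by auto
  \<comment> \<open>Only finitely many cells meet the half-open unit cube, which has full measure
    here, so the expansion over cells is a finite sum.\<close>
  have h_exp: "AE z in \<kappa>. h n z = (\<Sum>c\<in>cell_center (b ^ m) ` half_open_cube 0 1. indicator (E m c) z * h n z)" for n m
    using AEz
  proof eventually_elim
    case (elim z)
    have "(\<Sum>c\<in>cell_center (b ^ m) ` half_open_cube 0 1. indicator (E m c) z * h n z) =
      (\<Sum>c\<in>cell_center (b ^ m) ` half_open_cube 0 1. if c = cell_center (b ^ m) z then h n z else 0)"
      by (intro sum.cong) (auto simp: E_def)
    also have "\<dots> = h n z" using elim by (subst sum.delta[OF fin]) auto
    finally show ?case by simp
  qed
  \<comment> \<open>On one cell the factor from \<open>A\<close> is constant and the rest is an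
    indicator minus a constant; countably many cells are patched together.\<close>
  have hm: "h n \<in> borel_measurable \<kappa>" for n
  proof -
    have cnt: "countable (range (cell_center (b ^ n) :: real ^ 'd \<Rightarrow> real ^ 'd))"
    proof -
      have "range (cell_center (b ^ n) :: real ^ 'd \<Rightarrow> real ^ 'd) \<subseteq>
        (\<lambda>f. \<chi> i. - 1 + (2 * real_of_int (f i) + 1) / real (b ^ n)) ` (UNIV :: ('d \<Rightarrow> int) set)"
        unfolding cell_center_def grid_center_def by auto
      thus ?thesis by (rule countable_subset) simp
    qed
    have "(\<lambda>z. h n z) \<in> borel_measurable borel"
    proof (rule measurable_piecewise_restrict[where C="(\<lambda>c. E n c) ` range (cell_center (b ^ n))"])
      show "countable ((\<lambda>c. E n c) ` range (cell_center (b ^ n)))" using cnt by simp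
      show "space borel \<subseteq> \<Union> ((\<lambda>c. E n c) ` range (cell_center (b ^ n)))" unfolding E_def by auto
      fix \<Omega> assume "\<Omega> \<in> (\<lambda>c. E n c) ` range (cell_center (b ^ n))"
      then obtain c where c: "\<Omega> = E n c" by auto
      show "\<Omega> \<inter> space borel \<in> sets borel" using Eb s c by simp
      have "(\<lambda>z. \<Phi> n c * (indicator C (real (b ^ n) *\<^sub>R (z - c)) - q n c)) \<in> borel_measurable (restrict_space borel \<Omega>)"
        by (intro measurable_restrict_space1) measurable
      thus "h n \<in> borel_measurable (restrict_space borel \<Omega>)"
        by (subst measurable_cong[where g="\<lambda>z. \<Phi> n c * (indicator C (real (b ^ n) *\<^sub>R (z - c)) - q n c)"])
           (auto simp: c space_restrict_space h_on)
    qed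
    thus ?thesis unfolding measurable_cong_sets[OF s refl] by simp
  qed
  \<comment> \<open>On one cell the scenery is the conditional law of the rescaled point, so the two
    terms of the discrepancy cancel.\<close>
  have cell0: "(\<integral>z. indicator (E m c) z * h m z \<partial>\<kappa>) = 0" if c: "c \<in> cell_center (b ^ m) ` half_open_cube 0 1" for m c
  proof -
    obtain z0 where z0: "c = cell_center (b ^ m) z0" using c by auto
    have bm: "b ^ m > 0" using b by simp
    let ?T = "\<lambda>y. real (b ^ m) *\<^sub>R (y - c)"
    have Tb: "?T -` S \<in> sets \<kappa>" if "S \<in> sets borel" for S using preimage_homothety_borel[OF that] s by simp
    have Ecell: "E m c = half_open_cube c (1 / real (b ^ m))"
      unfolding E_def z0 using cell_center_eq_iff[OF bm] by auto
    have EW: "E m c \<subseteq> window (real (b ^ m)) c" unfolding Ecell by (rule cell_subset_window[OF bm])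
    \<comment> \<open>The window exceeds the cell only by points on faces with rational
      coordinates.\<close>
    have AEW: "AE z in \<kappa>. z \<in> window (real (b ^ m)) c \<longleftrightarrow> z \<in> E m c"
      using AEz
    proof eventually_elim
      case (elim z)
      show ?case
      proof
        assume z: "z \<in> window (real (b ^ m)) c"
        hence *: "\<bar>z $ i - c $ i\<bar> \<le> 1 / real (b ^ m)" for i using mem_window bm by (metis of_nat_0_less_iff)
        have "z $ i < c $ i + 1 / real (b ^ m)" for i
        proof -
          have "c $ i + 1 / real (b ^ m) \<in> \<rat>" unfolding z0
            by (intro Rats_add cell_center_rat Rats_divide) auto
          hence "z $ i \<noteq> c $ i + 1 / real (b ^ m)" using elim unfolding irrational_point_def by metis
          thus ?thesis using *[of i] by (simp add: abs_le_iff)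
        qed
        thus "z \<in> E m c" unfolding Ecell mem_half_open_cube using * by (auto simp: abs_le_iff) (metis add.commute diff_le_eq minus_diff_eq)
      qed (use EW in auto)
    qed
    have W1: "measure \<kappa> (window (real (b ^ m)) c) = measure \<kappa> (E m c)"
      by (rule measure_eq_AE[OF AEW _ Eb]) (simp add: s)
    have BC: "B1 \<inter> C \<in> sets borel" using Cb by (intro sets.Int) auto
    have "AE z in \<kappa>. z \<in> ?T -` (B1 \<inter> C) \<longleftrightarrow> z \<in> E m c \<inter> ?T -` C"
      using AEW
    proof eventually_elim
      case (elim z)
      have "z \<in> window (real (b ^ m)) c \<longleftrightarrow> ?T z \<in> B1" unfolding window_def by (rule vimage_eq)
      thus ?case using elim by (simp only: vimage_eq Int_iff)
    qed
    hence W2: "measure \<kappa> (?T -` (B1 \<inter> C)) = measure \<kappa> (E m c \<inter> ?T -` C)"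
      by (rule measure_eq_AE[OF _ Tb[OF BC] sets.Int[OF Eb Tb[OF Cb]]])
    note W = W1 W2
    have "q m c = measure \<kappa> (E m c \<inter> ?T -` C) / measure \<kappa> (E m c)"
      using measure_scenery[OF r bm Cb, of z0] unfolding q_def scenery_def z0[symmetric] W .
    hence qq: "measure \<kappa> (E m c \<inter> ?T -` C) = q m c * measure \<kappa> (E m c)"
      using measure_mono_fmeasurable[of "E m c \<inter> ?T -` C" "E m c" \<kappa>] Tb[OF Cb]
      by (cases "measure \<kappa> (E m c) = 0") (auto simp: measure_le_0_iff fmeasurable_eq_sets)
    have "(\<integral>z. indicator (E m c) z * h m z \<partial>\<kappa>) = (\<integral>z. \<Phi> m c * (indicator (E m c \<inter> ?T -` C) z - q m c * indicator (E m c) z) \<partial>\<kappa>)"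
      by (intro Bochner_Integration.integral_cong refl) (auto simp: indicator_def h_on)
    also have "\<dots> = \<Phi> m c * (measure \<kappa> (E m c \<inter> ?T -` C) - q m c * measure \<kappa> (E m c))"
      using Tb[OF Cb] by (simp add: sp less_top[symmetric])
    also have "\<dots> = 0" using qq by simp
    finally show ?thesis .
  qed
  have orth: "(\<integral>z. h n z * h m z \<partial>\<kappa>) = 0" if nm: "n + k \<le> m" for n m
  proof -
    let ?I = "cell_center (b ^ m) ` half_open_cube (0 :: real ^ 'd) 1"
    \<comment> \<open>The exponent m is split into the level n, the depth k of \<open>C\<close> and
      a remainder, so \<open>h n\<close> sees only the centre of a level-m cell and can be taken out
      of the integral.\<close>
    have hc: "h n z = h n c" if "z \<in> E m c" for z c
    proof -
      have bm: "b ^ m = b ^ n * b ^ k * b ^ (m - n - k)" using nm by (simp add: power_add[symmetric])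
      have "c = cell_center (b ^ n * b ^ k * b ^ (m - n - k)) z" using that unfolding E_def bm by simp
      thus ?thesis unfolding h_def C_def using b by (simp add: discrepancy_cell_center)
    qed
    have int: "integrable \<kappa> (\<lambda>z. indicator (E m c) z * h m z)" for c
      by (rule integrable_const_bound[of _ 1]) (use h1 hm in \<open>auto simp: indicator_def\<close>)
    have "(\<integral>z. h n z * h m z \<partial>\<kappa>) = (\<integral>z. (\<Sum>c\<in>?I. h n c * (indicator (E m c) z * h m z)) \<partial>\<kappa>)"
    proof (rule integral_cong_AE)
      show "AE z in \<kappa>. h n z * h m z = (\<Sum>c\<in>?I. h n c * (indicator (E m c) z * h m z))"
        using h_exp[of m m]
      proof eventually_elim
        case (elim z)
        have "h n z * h m z = (\<Sum>c\<in>?I. h n z * (indicator (E m c) z * h m z))"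
          by (subst elim) (simp add: sum_distrib_left)
        also have "\<dots> = (\<Sum>c\<in>?I. h n c * (indicator (E m c) z * h m z))"
          by (intro sum.cong refl) (auto simp: indicator_def hc)
        finally show ?case .
      qed
    qed (use hm in measurable)
    also have "\<dots> = (\<Sum>c\<in>?I. h n c * (\<integral>z. indicator (E m c) z * h m z \<partial>\<kappa>))"
      using int by simp
    also have "\<dots> = 0" using cell0 by simp
    finally show ?thesis .
  qed
  from AE_average_tendsto_0[of \<kappa> h, OF P hm h1 orth] show ?thesis unfolding h_def .
qed

section \<open>Transfer by the quasi-Palm property\<close>

text \<open>Points where \<open>K\<close> leaves \<open>Mstar\<close> cannot belong to the set. They
  are given a default value so that a total measurable map results; if all points are of this kind,
  the set is empty.\<close>

lemma sets_Collect_Mstar_pair: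
  fixes K :: "'a \<Rightarrow> (real ^ 'd) measure"
  assumes s: "\<And>w. w \<in> space M \<Longrightarrow> sets (K w) = sets borel"
    and ev: "\<And>A. A \<in> sets borel \<Longrightarrow> (\<lambda>w. emeasure (K w) A) \<in> borel_measurable M"
    and g: "g \<in> measurable M N" and A: "A \<in> sets (borel_of Mstar \<Otimes>\<^sub>M N)"
  shows "{w \<in> space M. (K w, g w) \<in> A} \<in> sets M"
proof (cases "\<exists>w0\<in>space M. K w0 \<in> topspace Mstar")
  case True
  then obtain d where d: "d \<in> topspace (Mstar :: (real ^ 'd) measure topology)" by auto
  define f where "f w = (if K w \<in> topspace Mstar then K w else d)" for w
  have D: "{w \<in> space M. K w \<in> topspace Mstar} \<in> sets M" using s ev by (rule sets_Collect_Mstar)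
  have fm: "f \<in> measurable M (borel_of Mstar)"
  proof (rule measurable_MstarI)
    fix S :: "(real ^ 'd) set" assume S: "S \<in> sets borel"
    have "(\<lambda>w. if K w \<in> topspace Mstar then emeasure (K w) S else emeasure d S) \<in> borel_measurable M"
      by (intro measurable_If ev[OF S] D) simp
    thus "(\<lambda>w. emeasure (f w) S) \<in> borel_measurable M" unfolding f_def by (simp add: if_distrib[of "\<lambda>\<kappa>. emeasure \<kappa> S"])
  qed (auto simp: f_def d)
  have "(\<lambda>w. (f w, g w)) \<in> measurable M (borel_of Mstar \<Otimes>\<^sub>M N)" by (rule measurable_Pair[OF fm g])
  from measurable_sets[OF this A] have "(\<lambda>w. (f w, g w)) -` A \<inter> space M \<in> sets M" .
  from sets.Int[OF D this]
  have "{w \<in> space M. K w \<in> topspace Mstar} \<inter> ((\<lambda>w. (f w, g w)) -` A \<inter> space M) \<in> sets M" .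
  also have "{w \<in> space M. K w \<in> topspace Mstar} \<inter> ((\<lambda>w. (f w, g w)) -` A \<inter> space M) = {w \<in> space M. (K w, g w) \<in> A}"
    using sets.sets_into_space[OF A] by (auto simp: f_def space_pair_measure)
  finally show ?thesis .
next
  case False
  hence "{w \<in> space M. (K w, g w) \<in> A} = {}"
    using sets.sets_into_space[OF A] by (auto simp: space_pair_measure)
  thus ?thesis by (simp only: sets.empty_sets)
qed

section \<open>The uniform law on the cube\<close>

definition unif_B1 :: "(real ^ 'd) measure" where
  "unif_B1 = uniform_measure lborel B1"

lemma sets_unif_B1 [simp, measurable_cong]: "sets unif_B1 = sets borel"
  by (simp add: unif_B1_def)

lemma space_unif_B1 [simp]: "space unif_B1 = UNIV"
  by (simp add: unif_B1_def)

lemma emeasure_lborel_B1_bounds: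
  "emeasure lborel (B1 :: (real ^ 'd) set) \<noteq> 0" "emeasure lborel (B1 :: (real ^ 'd) set) < \<infinity>"
proof -
  have *: "((\<chi> i. 1) - (\<chi> i. - 1) :: real ^ 'd) \<bullet> b = 2" "(\<chi> i. (- 1 :: real)) \<bullet> b \<le> (\<chi> i. (1 :: real)) \<bullet> b"
    if "b \<in> Basis" for b :: "real ^ 'd"
    using that by (auto simp: Basis_vec_def inner_axis)
  have "emeasure lborel (B1 :: (real ^ 'd) set) = ennreal (\<Prod>b\<in>(Basis :: (real ^ 'd) set). 2)"
    unfolding emeasure_lborel_cbox_eq using * by simp
  thus "emeasure lborel (B1 :: (real ^ 'd) set) \<noteq> 0" "emeasure lborel (B1 :: (real ^ 'd) set) < \<infinity>" by simp_all
qed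

lemma prob_space_unif_B1: "prob_space unif_B1"
  unfolding unif_B1_def using emeasure_lborel_B1_bounds by (intro prob_space_uniform_measure) (auto simp: less_top[symmetric])

lemma AE_unif_B1_iff: "(AE z in unif_B1. Q z) \<longleftrightarrow> (AE z in lborel. z \<in> (B1 :: (real ^ 'd) set) \<longrightarrow> Q z)"
  unfolding unif_B1_def using emeasure_lborel_B1_bounds by (intro AE_uniform_measure) (auto simp: less_top[symmetric])

lemma null_hyperplane: "{x :: real ^ 'd. x $ i = q} \<in> null_sets lborel"
proof -
  have "{x :: real ^ 'd. x $ i = q} = {x. x \<bullet> axis i 1 = q}" by (simp add: inner_axis)
  moreover have "negligible {x :: real ^ 'd. x \<bullet> axis i 1 = q}"
    by (rule negligible_standard_hyperplane) (simp add: axis_in_Basis_iff)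
  ultimately have "{x :: real ^ 'd. x $ i = q} \<in> null_sets lebesgue" by (simp add: negligible_iff_null_sets)
  moreover have "{x :: real ^ 'd. x $ i = q} \<in> sets lborel"
  proof -
    have "{x :: real ^ 'd. x $ i = q} = {x \<in> space borel. x $ i = q}" by simp
    also have "\<dots> \<in> sets borel" by measurable
    finally show ?thesis by simp
  qed
  ultimately show ?thesis by (auto simp: null_sets_def)
qed

lemma AE_lborel_irrational: "AE x in lborel. irrational_point (x :: real ^ 'd)"
  by (rule AE_off_rational_hyperplane) (use null_hyperplane in auto)

lemma AE_unif_B1_irrational: "AE x in unif_B1. irrational_point (x :: real ^ 'd) \<and> x \<in> B1"
  unfolding AE_unif_B1_iff using AE_lborel_irrational by eventually_elim auto

lemma radon_sigma_finite:
  fixes \<mu> :: "(real ^ 'd) measure"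
  assumes "\<mu> \<in> radon_measures"
  shows "sigma_finite_measure \<mu>"
proof
  note s = radon_sets[OF assms]
  show "\<exists>A. countable A \<and> A \<subseteq> sets \<mu> \<and> \<Union> A = space \<mu> \<and> (\<forall>a\<in>A. emeasure \<mu> a \<noteq> \<infinity>)"
  proof (intro exI[of _ "range (\<lambda>n::nat. ball 0 (real n))"] conjI ballI)
    show "range (\<lambda>n::nat. ball (0::real ^ 'd) (real n)) \<subseteq> sets \<mu>"
      unfolding s by (intro image_subsetI borel_open open_ball)
    have *: "x \<in> \<Union> (range (\<lambda>n::nat. ball (0::real ^ 'd) (real n)))" for x
    proof -
      obtain n where "norm x < real n" using reals_Archimedean2 by blast
      thus ?thesis by (intro UN_I[of n]) auto
    qed
    have "space \<mu> = UNIV" using sets_eq_imp_space_eq[OF s] by simp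
    thus "\<Union> (range (\<lambda>n::nat. ball (0::real ^ 'd) (real n))) = space \<mu>"
      by (simp only:) (rule UNIV_eq_I[OF *, symmetric])
    fix a assume "a \<in> range (\<lambda>n::nat. ball (0::real ^ 'd) (real n))"
    then obtain n where "a = ball 0 (real n)" by auto
    thus "emeasure \<mu> a \<noteq> \<infinity>" using radon_finite_bounded[OF assms bounded_ball[of 0 "real n"]] by simp
  qed simp
qed

text \<open>Null sets pull back because the normalising mass is finite; division by an infinite mass
  would turn sets of finite positive mass into null sets.\<close>

lemma AE_magnifyD:
  assumes \<mu>: "\<mu> \<in> radon_measures" and r: "r > 0" and AE: "AE x in magnify r c \<mu>. Q x"
  shows "AE y in \<mu>. Q (r *\<^sub>R (y - c))"
proof -
  obtain N where N: "{x \<in> space (magnify r c \<mu>). \<not> Q x} \<subseteq> N" "emeasure (magnify r c \<mu>) N = 0" "N \<in> sets (magnify r c \<mu>)"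
    using AE by (rule AE_E)
  have Nb: "N \<in> sets borel" using N(3) by simp
  have sp: "space (magnify r c \<mu>) = UNIV" using sets_eq_imp_space_eq[OF sets_magnify] by auto
  have "emeasure \<mu> ((\<lambda>y. r *\<^sub>R (y - c)) -` N) / emeasure \<mu> (window r c) = 0"
    using N(2) emeasure_magnify[OF radon_sets[OF \<mu>] Nb] by simp
  hence "emeasure \<mu> ((\<lambda>y. r *\<^sub>R (y - c)) -` N) = 0"
    using window_finite[OF \<mu> r, of c] by (auto simp: ennreal_divide_eq_0_iff)
  hence "(\<lambda>y. r *\<^sub>R (y - c)) -` N \<in> null_sets \<mu>"
    using preimage_homothety_borel[OF Nb] radon_sets[OF \<mu>] by (intro null_setsI) auto
  from AE_not_in[OF this] show ?thesis
    by (rule AE_mp) (use N(1) sp in \<open>auto intro!: AE_I2\<close>)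
qed

lemma AE_lborel_shift:
  fixes y :: "real ^ 'd"
  assumes "AE z in lborel. Q z"
  shows "AE w in lborel. Q (w - y)"
proof -
  have "AE z in distr lborel borel ((+) (- y)). Q z" unfolding lborel_distr_plus by (rule assms)
  from AE_distrD[OF _ this] show ?thesis by (simp add: add.commute)
qed

lemma kernel_const_measurable:
  assumes "\<mu> \<in> radon_measures"
  shows "(\<lambda>w. \<mu>) \<in> measurable M (borel_of weak_topology)"
  using assms by (intro measurable_const) simp

text \<open>Put w = y + z. Moving \<mu> by z and looking at the image of y is the same as recentring
  at y and then moving the origin to w. Fubini exchanges the choices of y and z, and translation
  invariance of Lebesgue measure replaces z by w.\<close>

lemma AE_swap_translation:
  fixes \<mu> :: "(real ^ 'd) measure" and G :: "((real ^ 'd) measure \<times> (real ^ 'd)) set"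
  assumes \<mu>: "\<mu> \<in> radon_measures" and G: "G \<in> sets (borel_of Mstar \<Otimes>\<^sub>M borel)"
    and AE: "AE z in unif_B1. AE x in magnify 1 (- z) \<mu>. x \<in> B1 \<longrightarrow> (magnify 1 (- z) \<mu>, x) \<notin> G"
  shows "AE y in \<mu>. AE w in lborel. w - y \<in> B1 \<longrightarrow> w \<in> B1 \<longrightarrow> (magnify 1 (y - w) \<mu>, w) \<notin> G"
proof -
  interpret \<mu>: sigma_finite_measure \<mu> by (rule radon_sigma_finite[OF \<mu>])
  interpret L: prob_space unif_B1 by (rule prob_space_unif_B1)
  interpret pair_sigma_finite unif_B1 \<mu> ..
  note s [measurable_cong] = radon_sets[OF \<mu>]
  let ?M = "unif_B1 \<Otimes>\<^sub>M \<mu>"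
  have "{w \<in> space ?M. (magnify 1 (- fst w) \<mu>, snd w + fst w) \<in> G} \<in> sets ?M"
  proof (rule sets_Collect_Mstar_pair[OF _ _ _ G])
    show "(\<lambda>w. emeasure (magnify 1 (- fst w) \<mu>) A) \<in> borel_measurable ?M" if "A \<in> sets borel" for A
      by (rule measurable_emeasure_magnify[OF kernel_const_measurable[OF \<mu>] _ that]) measurable
  qed (simp, measurable)
  note S = this
  have B: "{w \<in> space ?M. snd w + fst w \<in> B1} \<in> sets ?M" by measurable
  have "space ?M - ({w \<in> space ?M. snd w + fst w \<in> B1} \<inter> {w \<in> space ?M. (magnify 1 (- fst w) \<mu>, snd w + fst w) \<in> G}) \<in> sets ?M"
    by (rule sets.Diff[OF sets.top sets.Int[OF B S]])
  also have "space ?M - ({w \<in> space ?M. snd w + fst w \<in> B1} \<inter> {w \<in> space ?M. (magnify 1 (- fst w) \<mu>, snd w + fst w) \<in> G})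
    = {w \<in> space ?M. snd w + fst w \<in> B1 \<longrightarrow> (magnify 1 (- fst w) \<mu>, snd w + fst w) \<notin> G}" by blast
  finally have ms: "{w \<in> space ?M. snd w + fst w \<in> B1 \<longrightarrow> (magnify 1 (- fst w) \<mu>, snd w + fst w) \<notin> G} \<in> sets ?M" .
  have "AE z in unif_B1. AE y in \<mu>. y + z \<in> B1 \<longrightarrow> (magnify 1 (- z) \<mu>, y + z) \<notin> G"
    using AE
  proof eventually_elim
    case (elim z)
    from AE_magnifyD[OF \<mu> _ elim] show ?case by simp
  qed
  hence "AE y in \<mu>. AE z in unif_B1. y + z \<in> B1 \<longrightarrow> (magnify 1 (- z) \<mu>, y + z) \<notin> G"
    by (subst AE_commute[symmetric]) (rule ms)
  thus ?thesis
  proof eventually_elim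
    case (elim y)
    hence "AE z in lborel. z \<in> B1 \<longrightarrow> y + z \<in> B1 \<longrightarrow> (magnify 1 (- z) \<mu>, y + z) \<notin> G"
      unfolding AE_unif_B1_iff .
    from AE_lborel_shift[OF this, of y] show ?case by simp
  qed
qed

text \<open>
  Recentring \<open>\<mu>\<close> at a \<open>\<mu>\<close>-typical point and then translating by a uniform amount is the same as
  translating first and choosing the typical point afterwards. The points \<open>w\<close> are kept at distance
  \<open>1 / (k + 1)\<close> from the boundary of \<open>B1\<close> so that small recentrings do not leave \<open>B1\<close>.
\<close>

lemma quasi_palm_transfer:
  fixes P :: "(real ^ 'd) measure measure" and G :: "((real ^ 'd) measure \<times> (real ^ 'd)) set"
  assumes FD: "fractal_distribution P" and G: "G \<in> sets (borel_of Mstar \<Otimes>\<^sub>M borel)"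
    and AE: "\<And>\<mu>. \<mu> \<in> scale_dom \<Longrightarrow>
      AE z in unif_B1. AE x in magnify 1 (- z) \<mu>. x \<in> B1 \<longrightarrow> (magnify 1 (- z) \<mu>, x) \<notin> G"
  shows "AE \<mu> in P. AE w in unif_B1. (magnify 1 (- w) \<mu>, w) \<notin> G"
proof -
  have P: "prob_space P" and sP [measurable_cong]: "sets P = sets (borel_of Mstar)"
    and dom: "AE \<mu> in P. \<mu> \<in> scale_dom" and qp: "quasi_palm P"
    using FD unfolding fractal_distribution_def invariant_on_def by auto
  have spP: "space P = topspace Mstar" using sets_eq_imp_space_eq[OF sP] by simp
  define W where "W k = {w :: real ^ 'd. \<forall>i. \<bar>w $ i\<bar> \<le> 1 - 1 / real (Suc k)}" for k
  define F where "F k \<mu> \<longleftrightarrow> (AE w in lborel. w \<in> W k \<longrightarrow> (magnify 1 (- w) \<mu>, w) \<notin> G)" for k \<mu>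
  have Wb [measurable]: "W k \<in> sets borel" for k
  proof -
    have "W k = {w \<in> space borel. \<forall>i. \<bar>w $ i\<bar> \<le> 1 - 1 / real (Suc k)}" unfolding W_def by simp
    also have "\<dots> \<in> sets borel" by measurable
    finally show ?thesis .
  qed
  \<comment> \<open>The quasi-Palm property speaks of null sets, which are measurable by definition,
    so the exceptional set of measures has to be shown measurable.\<close>
  have Fm: "{\<mu> \<in> space P. \<not> F k \<mu>} \<in> sets P" for k
  proof -
    let ?M = "P \<Otimes>\<^sub>M (lborel :: (real ^ 'd) measure)"
    have "{w \<in> space ?M. (magnify 1 (- snd w) (fst w), snd w) \<in> G} \<in> sets ?M"
    proof (rule sets_Collect_Mstar_pair[OF _ _ _ G])
      have "fst \<in> measurable ?M (borel_of Mstar)" by measurable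
      from measurable_compose[OF this measurable_Mstar_weak] have "fst \<in> measurable ?M (borel_of weak_topology)" .
      thus "(\<lambda>w. emeasure (magnify 1 (- snd w) (fst w)) A) \<in> borel_measurable ?M" if "A \<in> sets borel" for A
        by (rule measurable_emeasure_magnify[OF _ _ that]) measurable
    qed (simp, measurable)
    note S = this
    have B: "{w \<in> space ?M. snd w \<in> W k} \<in> sets ?M" by measurable
    have "{w \<in> space ?M. snd w \<in> W k} \<inter> {w \<in> space ?M. (magnify 1 (- snd w) (fst w), snd w) \<in> G} \<in> sets ?M"
      by (rule sets.Int[OF B S])
    also have "{w \<in> space ?M. snd w \<in> W k} \<inter> {w \<in> space ?M. (magnify 1 (- snd w) (fst w), snd w) \<in> G} =
      {w \<in> space ?M. snd w \<in> W k \<and> (magnify 1 (- snd w) (fst w), snd w) \<in> G}" by blast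
    finally have S: "{w \<in> space ?M. snd w \<in> W k \<and> (magnify 1 (- snd w) (fst w), snd w) \<in> G} \<in> sets ?M" (is "?S \<in> _")
      .
    have "(\<lambda>\<mu>. emeasure lborel (Pair \<mu> -` ?S)) \<in> borel_measurable P"
      by (rule lborel.measurable_emeasure_Pair[OF S])
    hence "{\<mu> \<in> space P. emeasure lborel (Pair \<mu> -` ?S) \<noteq> 0} \<in> sets P" by measurable
    also have "{\<mu> \<in> space P. emeasure lborel (Pair \<mu> -` ?S) \<noteq> 0} = {\<mu> \<in> space P. \<not> F k \<mu>}"
    proof (intro Collect_cong conj_cong refl)
      fix \<mu> assume "\<mu> \<in> space P"
      hence eq: "Pair \<mu> -` ?S = {w \<in> space lborel. \<not> (w \<in> W k \<longrightarrow> (magnify 1 (- w) \<mu>, w) \<notin> G)}"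
        by (auto simp: space_pair_measure)
      have "Pair \<mu> -` ?S \<in> sets lborel" using S by (rule sets_Pair1)
      from AE_iff_measurable[OF this eq[symmetric]]
      show "emeasure lborel (Pair \<mu> -` ?S) \<noteq> 0 \<longleftrightarrow> \<not> F k \<mu>" unfolding F_def by simp
    qed
    finally show ?thesis .
  qed
  \<comment> \<open>Matched with \<open>W k\<close>: for y in \<open>U k\<close> and w in
    \<open>W k\<close> the difference w - y stays in \<open>B1\<close>.\<close>
  define U where "U k = {y :: real ^ 'd. \<forall>i. \<bar>y $ i\<bar> < 1 / real (Suc k)}" for k
  have "AE \<mu> in P. F k \<mu>" for k
  proof -
    have "U k = (\<Inter>i. {y. \<bar>y $ i\<bar> < 1 / real (Suc k)})" unfolding U_def by blast
    also have "open \<dots>" by (intro open_INT open_Collect_less continuous_intros ballI) simp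
    finally have oU: "open (U k)" .
    have U0: "0 \<in> U k" unfolding U_def by simp
    have "U k \<subseteq> B1"
    proof
      fix y assume y: "y \<in> U k"
      show "y \<in> B1" unfolding mem_B1
      proof
        fix i
        have "\<bar>y $ i\<bar> < 1 / real (Suc k)" using y by (simp add: U_def)
        also have "\<dots> \<le> 1" by simp
        finally show "\<bar>y $ i\<bar> \<le> 1" by simp
      qed
    qed
    hence bU: "bounded (U k)" using bounded_cbox bounded_subset by blast
    let ?N = "{\<mu> \<in> space P. \<not> F k \<mu>}"
    have "(\<integral>\<^sup>+ \<mu>. (\<integral>\<^sup>+ x. indicator (U k) x * indicator ?N (transl_star x \<mu>) \<partial>\<mu>) \<partial>P) = (\<integral>\<^sup>+ \<mu>. 0 \<partial>P)"
    proof (rule nn_integral_cong_AE, use dom in eventually_elim)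
      case (elim \<mu>)
      hence \<mu>M: "\<mu> \<in> topspace Mstar" by (simp add: scale_dom_def)
      note \<mu>r = Mstar_radon[OF \<mu>M]
      have "AE x in \<mu>. indicator (U k) x * indicator ?N (transl_star x \<mu>) = (0 :: ennreal)"
        using AE_swap_translation[OF \<mu>r G AE[OF elim]] AE_msupp[OF radon_sets[OF \<mu>r]]
      proof eventually_elim
        case (elim y)
        have pos: "emeasure \<mu> (window 1 y) > 0"
          by (rule window_pos_of_msupp[OF elim(2) radon_sets[OF \<mu>r]]) auto
        have "F k (transl_star y \<mu>)" if y: "y \<in> U k"
          unfolding F_def using elim(1)
        proof eventually_elim
          case (elim w)
          show ?case
          proof
            assume w: "w \<in> W k"
            have "w - y \<in> B1" "w \<in> B1" unfolding mem_B1
            proof (safe)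
              fix i
              have *: "\<bar>w $ i\<bar> \<le> 1 - 1 / real (Suc k)" "\<bar>y $ i\<bar> < 1 / real (Suc k)" using w y unfolding W_def U_def by blast+
              show "\<bar>(w - y) $ i\<bar> \<le> 1" using * by simp
              show "\<bar>w $ i\<bar> \<le> 1" using * by linarith
            qed
            hence "(magnify 1 (y - w) \<mu>, w) \<notin> G" using elim by blast
            thus "(magnify 1 (- w) (transl_star y \<mu>), w) \<notin> G"
              unfolding transl_star_magnify using magnify_magnify[OF \<mu>r _ _ pos, of 1 "- w"] by simp
          qed
        qed
        thus ?case by (auto simp: indicator_def)
      qed
      from nn_integral_cong_AE[OF this] show ?case by simp
    qed
    \<comment> \<open>\<open>measure_of\<close> assigns either this integral or 0, so the value is 0
      in both cases and countable additivity of the integral need not be discussed.\<close>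
    hence "emeasure (palm_measure (U k) P) ?N = 0"
      unfolding palm_measure_def emeasure_measure_of_conv by simp
    moreover have "?N \<in> sets (palm_measure (U k) P)"
      unfolding palm_measure_def using Fm by simp
    ultimately have "?N \<in> null_sets (palm_measure (U k) P)" by (rule null_setsI)
    moreover have "null_sets P = null_sets (palm_measure (U k) P)"
      using qp bU oU U0 unfolding quasi_palm_def by blast
    ultimately have "?N \<in> null_sets P" by simp
    from AE_not_in[OF this] show ?thesis by (rule AE_mp) (auto intro!: AE_I2)
  qed
  hence "AE \<mu> in P. \<forall>k. F k \<mu>" by (subst AE_all_countable) simp
  thus ?thesis
  proof eventually_elim
    case (elim \<mu>)
    hence "AE w in lborel. \<forall>k. w \<in> W k \<longrightarrow> (magnify 1 (- w) \<mu>, w) \<notin> G"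
      unfolding F_def by (subst AE_all_countable) simp
    thus ?case unfolding AE_unif_B1_iff using AE_lborel_irrational
    proof eventually_elim
      case (elim w)
      show ?case
      proof
        assume w: "w \<in> B1"
        \<comment> \<open>An irrational point of \<open>B1\<close> has all coordinates below 1 in
          absolute value, hence lies in some \<open>W k\<close>. Only a null set of w is lost in the
          union.\<close>
        define m where "m = Max (range (\<lambda>i. \<bar>w $ i\<bar>))"
        have m: "\<bar>w $ i\<bar> \<le> m" for i unfolding m_def by (intro Max_ge) auto
        have "m \<in> range (\<lambda>i. \<bar>w $ i\<bar>)" unfolding m_def by (intro Max_in) auto
        hence "m < 1" using irrational_unit[OF elim(2) w] by auto
        then obtain k where k: "inverse (real (Suc k)) < 1 - m" using reals_Archimedean[of "1 - m"] by auto
        have "w \<in> W k" unfolding W_def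
        proof (intro CollectI allI)
          fix i show "\<bar>w $ i\<bar> \<le> 1 - 1 / real (Suc k)" using m[of i] k by (simp add: inverse_eq_divide)
        qed
        thus "(magnify 1 (- w) \<mu>, w) \<notin> G" using elim(1) by blast
      qed
    qed
  qed
qed

section \<open>Almost sure vanishing of the averages\<close>

lemma restrict_B1_measurable: "restrict_B1 \<in> measurable (borel_of Mstar) (borel_of Mbox)"
proof (rule measurable_MboxI)
  fix A :: "(real ^ 'd) set" assume A: "A \<in> sets borel"
  have "(\<lambda>\<mu>. emeasure \<mu> (B1 \<inter> A)) \<in> borel_measurable (borel_of Mstar)"
    using A by (intro measurable_emeasure_Mstar) auto
  moreover have "emeasure (restrict_B1 \<mu>) A = emeasure \<mu> (B1 \<inter> A)" if "\<mu> \<in> topspace Mstar" for \<mu> :: "(real ^ 'd) measure"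
    using radon_sets[OF Mstar_radon[OF that]] A by (rule emeasure_restrict_B1)
  ultimately show "(\<lambda>\<mu>. emeasure (restrict_B1 \<mu>) A) \<in> borel_measurable (borel_of Mstar)"
    by (subst measurable_cong) auto
qed (simp add: restrict_B1_in_Mbox)

lemma measurable_emeasure_scenery:
  fixes K :: "'a \<Rightarrow> (real ^ 'd) measure"
  assumes K: "K \<in> measurable M (borel_of weak_topology)" and g: "g \<in> borel_measurable M" and A: "A \<in> sets borel"
  shows "(\<lambda>w. emeasure (scenery N (K w) (g w)) A) \<in> borel_measurable M"
proof -
  have "(\<lambda>w. emeasure (magnify (real N) (cell_center N (g w)) (K w)) (B1 \<inter> A)) \<in> borel_measurable M"
    using A g by (intro measurable_emeasure_magnify[OF K]) auto
  thus ?thesis unfolding scenery_def emeasure_restrict_B1[OF sets_magnify A] .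
qed

lemma sets_scenery [simp]: "sets (scenery N \<kappa> z) = sets borel"
  by (simp add: scenery_def)

lemma sets_Collect_Mbox_mem:
  fixes K :: "'a \<Rightarrow> (real ^ 'd) measure"
  assumes s: "\<And>w. w \<in> space M \<Longrightarrow> sets (K w) = sets borel"
    and ev: "\<And>A. A \<in> sets borel \<Longrightarrow> (\<lambda>w. emeasure (K w) A) \<in> borel_measurable M"
    and A: "A \<in> sets (borel_of Mbox)"
  shows "{w \<in> space M. K w \<in> A} \<in> sets M"
proof -
  define D where "D = {w \<in> space M. K w \<in> topspace Mbox}"
  have D: "D \<in> sets M" unfolding D_def using s ev by (rule sets_Collect_Mbox)
  have "K \<in> measurable (restrict_space M D) (borel_of Mbox)"
    by (rule measurable_MboxI) (auto simp: space_restrict_space D_def intro!: measurable_restrict_space1 ev)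
  from measurable_sets[OF this A] have "K -` A \<inter> space (restrict_space M D) \<in> sets (restrict_space M D)" .
  hence "K -` A \<inter> space (restrict_space M D) \<in> sets M"
    using D by (subst (asm) sets_restrict_space_iff) auto
  also have "K -` A \<inter> space (restrict_space M D) = {w \<in> space M. K w \<in> A}"
    using sets.sets_into_space[OF A] by (auto simp: space_restrict_space D_def)
  finally show ?thesis .
qed

text \<open>The scenery of an arbitrary pair may fall outside \<open>Mbox\<close>, so the event that
  it lies in \<open>A\<close> is treated separately from the remaining factor.\<close>

lemma measurable_discrepancy:
  fixes K :: "'a \<Rightarrow> (real ^ 'd) measure"
  assumes K: "K \<in> measurable M (borel_of weak_topology)" and g: "g \<in> borel_measurable M"
    and A: "A \<in> sets (borel_of Mbox)" and C: "C \<in> sets borel"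
  shows "(\<lambda>w. discrepancy A C N (K w) (g w)) \<in> borel_measurable M"
proof -
  have 1: "{w \<in> space M. scenery N (K w) (g w) \<in> A} \<in> sets M"
    by (rule sets_Collect_Mbox_mem[OF _ measurable_emeasure_scenery[OF K g] A]) auto
  have [measurable]: "(\<lambda>w. indicator {w \<in> space M. scenery N (K w) (g w) \<in> A} w :: real) \<in> borel_measurable M"
    using 1 by measurable
  have [measurable]: "(\<lambda>w. measure (scenery N (K w) (g w)) C) \<in> borel_measurable M"
    unfolding measure_def by (intro borel_measurable_enn2real measurable_emeasure_scenery[OF K g C])
  have [measurable]: "C \<in> sets borel" "g \<in> borel_measurable M" using C g by auto
  have "(\<lambda>w. indicator {w \<in> space M. scenery N (K w) (g w) \<in> A} w *
      (indicator C (cell_shift N (g w)) - measure (scenery N (K w) (g w)) C)) \<in> borel_measurable M"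
    by measurable
  thus ?thesis
    by (rule iffD1[OF measurable_cong, rotated]) (simp add: discrepancy_def indicator_def)
qed

lemma cell_borel: "{y. cell_center N y = c0} \<in> sets (borel :: (real ^ 'd) measure)"
proof -
  have "{y::real ^ 'd. cell_center N y = c0} = {y \<in> space borel. cell_center N y = c0}" by simp
  also have "\<dots> \<in> sets borel" by measurable
  finally show ?thesis .
qed

text \<open>The squares are the subsequence along which convergence is available; to identify a
  mean, one subsequence suffices.\<close>

definition averages_vanish ::
    "(real ^ 'd) measure set \<Rightarrow> (real ^ 'd) set \<Rightarrow> nat \<Rightarrow> (real ^ 'd) measure \<Rightarrow> real ^ 'd \<Rightarrow> bool" where
  "averages_vanish A C b \<nu> z \<longleftrightarrow>
    (\<lambda>j. (\<Sum>n<j\<^sup>2. discrepancy A C (b ^ n) (restrict_B1 \<nu>) z) / real (j\<^sup>2)) \<longlonglongrightarrow> 0"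

lemma sets_Collect_tendsto_0:
  fixes f :: "nat \<Rightarrow> 'a \<Rightarrow> real"
  assumes [measurable]: "\<And>j. f j \<in> borel_measurable M"
  shows "{w \<in> space M. (\<lambda>j. f j w) \<longlonglongrightarrow> 0} \<in> sets M"
proof -
  have "(\<lambda>j. f j w) \<longlonglongrightarrow> 0 \<longleftrightarrow> (\<forall>k. \<exists>j0. \<forall>j\<ge>j0. \<bar>f j w\<bar> < inverse (real (Suc k)))" for w
  proof
    assume "(\<lambda>j. f j w) \<longlonglongrightarrow> 0"
    thus "\<forall>k. \<exists>j0. \<forall>j\<ge>j0. \<bar>f j w\<bar> < inverse (real (Suc k))"
      unfolding LIMSEQ_iff by (auto dest!: spec[of _ "inverse (real (Suc _))"] simp del: of_nat_Suc)
  next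
    assume *: "\<forall>k. \<exists>j0. \<forall>j\<ge>j0. \<bar>f j w\<bar> < inverse (real (Suc k))"
    show "(\<lambda>j. f j w) \<longlonglongrightarrow> 0" unfolding LIMSEQ_iff
    proof (intro allI impI)
      fix r :: real assume "r > 0"
      then obtain k where k: "inverse (real (Suc k)) < r" using reals_Archimedean by blast
      obtain j0 where j0: "\<forall>j\<ge>j0. \<bar>f j w\<bar> < inverse (real (Suc k))" using * by blast
      have "\<forall>j\<ge>j0. norm (f j w - 0) < r" using j0 k less_trans by auto
      thus "\<exists>j0. \<forall>j\<ge>j0. norm (f j w - 0) < r" ..
    qed
  qed
  hence "{w \<in> space M. (\<lambda>j. f j w) \<longlonglongrightarrow> 0} = {w \<in> space M. \<forall>k. \<exists>j0. \<forall>j. j \<ge> j0 \<longrightarrow> \<bar>f j w\<bar> < inverse (real (Suc k))}" by simp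
  also have "\<dots> \<in> sets M" by measurable
  finally show ?thesis .
qed

lemma scale_dom_Mstar: "\<mu> \<in> scale_dom \<Longrightarrow> \<mu> \<in> topspace Mstar"
  by (simp add: scale_dom_def)

lemma window_translate_pos:
  fixes \<mu> :: "(real ^ 'd) measure"
  assumes \<mu>: "\<mu> \<in> scale_dom" and z: "irrational_point z" "z \<in> B1"
  shows "emeasure \<mu> (window 1 (- z)) > 0"
proof (rule window_pos_of_msupp)
  show "0 \<in> msupp \<mu>" using \<mu> by (simp add: scale_dom_def)
  show "sets \<mu> = sets borel" using \<mu> by (intro radon_sets Mstar_radon scale_dom_Mstar)
  show "\<bar>0 $ i - (- z) $ i\<bar> < 1 / 1" for i using irrational_unit[OF z, of i] by simp
qed simp

lemma magnify_translate_Mstar: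
  fixes \<mu> :: "(real ^ 'd) measure"
  assumes \<mu>: "\<mu> \<in> scale_dom" and z: "irrational_point z" "z \<in> B1"
  shows "magnify 1 (- z) \<mu> \<in> topspace Mstar"
  using window_translate_pos[OF assms] Mstar_radon[OF scale_dom_Mstar[OF \<mu>]]
  by (subst magnify_in_Mstar_iff) auto

text \<open>Although \<mu> may charge rational hyperplanes, for each fixed y almost every z makes y
  + z irrational. Fubini turns this into a statement on almost every translate.\<close>

lemma AE_translate_no_rational_hyperplanes:
  fixes \<mu> :: "(real ^ 'd) measure"
  assumes \<mu>: "\<mu> \<in> radon_measures"
  shows "AE z in unif_B1. \<forall>i. \<forall>q\<in>\<rat>. emeasure (magnify 1 (- z) \<mu>) {x. x $ i = q} = 0"
proof -
  interpret \<mu>: sigma_finite_measure \<mu> by (rule radon_sigma_finite[OF \<mu>])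
  interpret L: prob_space unif_B1 by (rule prob_space_unif_B1)
  interpret pair_sigma_finite unif_B1 \<mu> ..
  note s [measurable_cong] = radon_sets[OF \<mu>]
  let ?M = "unif_B1 \<Otimes>\<^sub>M \<mu>"
  have irr: "irrational_point x \<longleftrightarrow> (\<forall>i. \<forall>r::rat. x $ i \<noteq> real_of_rat r)" for x :: "real ^ 'd"
    unfolding irrational_point_def Rats_def by blast
  have ms: "{w \<in> space ?M. irrational_point (snd w + fst w)} \<in> sets ?M"
    unfolding irr by measurable
  have "AE y in \<mu>. AE z in unif_B1. irrational_point (y + z)"
  proof (rule AE_I2)
    fix y
    have "AE z in lborel. irrational_point (y + z)"
      using AE_lborel_shift[OF AE_lborel_irrational, of "- y"] by (simp add: add.commute)
    thus "AE z in unif_B1. irrational_point (y + z)"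
      unfolding AE_unif_B1_iff by eventually_elim simp
  qed
  hence "AE z in unif_B1. AE y in \<mu>. irrational_point (y + z)"
    by (subst AE_commute) (rule ms)
  thus ?thesis
  proof eventually_elim
    case (elim z)
    show ?case
    proof (intro allI ballI)
      fix i and q :: real assume q: "q \<in> \<rat>"
      have Hb: "{x::real ^ 'd. x $ i = q} \<in> sets borel"
        using null_hyperplane[of i q] by auto
      have "AE y in \<mu>. y \<notin> (\<lambda>y. 1 *\<^sub>R (y - - z)) -` {x. x $ i = q}"
        using elim by eventually_elim (use q in \<open>auto simp: irrational_point_def\<close>)
      hence "emeasure \<mu> ((\<lambda>y. 1 *\<^sub>R (y - - z)) -` {x. x $ i = q}) = 0"
        using preimage_homothety_borel[OF Hb, of 1 "- z"] s
        by (subst (asm) AE_iff_null_sets[symmetric]) (auto simp: null_sets_def)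
      thus "emeasure (magnify 1 (- z) \<mu>) {x. x $ i = q} = 0"
        unfolding emeasure_magnify[OF s Hb] by simp
    qed
  qed
qed

text \<open>For a fixed \<mu>, averages vanish at points drawn from the translated measure itself.
  \<open>quasi_palm_transfer\<close> replaces such a point by the one to which the origin was
  moved.\<close>

lemma AE_averages_vanish:
  fixes P :: "(real ^ 'd) measure measure" and c0 :: "real ^ 'd" and b k :: nat
  assumes FD: "fractal_distribution P" and b: "b > 0" and A: "A \<in> sets (borel_of Mbox)"
  defines "C \<equiv> {y. cell_center (b ^ k) y = c0}"
  shows "AE \<mu> in P. AE w in unif_B1. averages_vanish A C b (magnify 1 (- w) \<mu>) w"
proof -
  let ?M = "borel_of Mstar \<Otimes>\<^sub>M (borel :: (real ^ 'd) measure)"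
  have C: "C \<in> sets borel" unfolding C_def by (rule cell_borel)
  define G where "G = {w \<in> space ?M. \<not> averages_vanish A C b (fst w) (snd w)}"
  have K: "(\<lambda>w. restrict_B1 (fst w)) \<in> measurable ?M (borel_of weak_topology)"
    by (intro measurable_compose[OF measurable_compose[OF measurable_fst restrict_B1_measurable] measurable_Mbox_weak])
  have dm: "(\<lambda>w. discrepancy A C N (restrict_B1 (fst w)) (snd w)) \<in> borel_measurable ?M" for N
    by (rule measurable_discrepancy[OF K _ A C]) measurable
  have "{w \<in> space ?M. averages_vanish A C b (fst w) (snd w)} \<in> sets ?M"
    unfolding averages_vanish_def by (intro sets_Collect_tendsto_0 borel_measurable_divide borel_measurable_sum dm) auto
  from sets.Diff[OF sets.top this] have G: "G \<in> sets ?M" unfolding G_def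
    by (rule back_subst[of "\<lambda>S. S \<in> sets ?M"]) blast
  have "AE \<mu> in P. AE w in unif_B1. (magnify 1 (- w) \<mu>, w) \<notin> G"
  proof (rule quasi_palm_transfer[OF FD G])
    fix \<mu> :: "(real ^ 'd) measure" assume \<mu>: "\<mu> \<in> scale_dom"
    note \<mu>r = Mstar_radon[OF scale_dom_Mstar[OF \<mu>]]
    show "AE z in unif_B1. AE x in magnify 1 (- z) \<mu>. x \<in> B1 \<longrightarrow> (magnify 1 (- z) \<mu>, x) \<notin> G"
      using AE_unif_B1_irrational AE_translate_no_rational_hyperplanes[OF \<mu>r]
    proof eventually_elim
      case (elim z)
      let ?\<nu> = "magnify 1 (- z) \<mu>"
      have \<nu>: "?\<nu> \<in> topspace Mstar" using \<mu> elim(1) by (intro magnify_translate_Mstar) auto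
      have "AE x in restrict_B1 ?\<nu>. averages_vanish A C b ?\<nu> x"
        unfolding averages_vanish_def C_def
      proof (rule AE_discrepancy_average[OF restrict_B1_in_Mbox[OF \<nu>] _ b])
        fix i and q :: real assume q: "q \<in> \<rat>"
        have Hb: "{x::real ^ 'd. x $ i = q} \<in> sets borel"
          using null_hyperplane[of i q] by auto
        have "emeasure (restrict_B1 ?\<nu>) {x. x $ i = q} = emeasure ?\<nu> (B1 \<inter> {x. x $ i = q})"
          by (rule emeasure_restrict_B1[OF sets_magnify Hb])
        also have "\<dots> \<le> emeasure ?\<nu> {x. x $ i = q}" using Hb by (intro emeasure_mono) auto
        also have "\<dots> = 0" using elim(2) q by blast
        finally show "emeasure (restrict_B1 ?\<nu>) {x. x $ i = q} = 0" by simp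
      qed
      hence "AE x in ?\<nu>. 0 < (indicator B1 x :: ennreal) \<longrightarrow> averages_vanish A C b ?\<nu> x"
        unfolding restrict_B1_def by (subst (asm) AE_density) (auto intro!: borel_measurable_indicator)
      thus ?case by eventually_elim (auto simp: G_def indicator_def)
    qed
  qed
  moreover have "AE \<mu> in P. \<mu> \<in> scale_dom" using FD unfolding fractal_distribution_def invariant_on_def by blast
  ultimately show ?thesis
  proof eventually_elim
    case (elim \<mu>)
    from elim(1) AE_unif_B1_irrational show ?case
    proof eventually_elim
      case (elim w)
      have "magnify 1 (- w) \<mu> \<in> topspace Mstar"
        using \<open>\<mu> \<in> scale_dom\<close> elim(2) by (intro magnify_translate_Mstar) auto
      thus ?case using elim(1) unfolding G_def by (simp add: space_pair_measure)
    qed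
  qed
qed

section \<open>Digits of a uniform point\<close>

lemma emeasure_lborel_homothety:
  fixes c :: "real ^ 'd"
  assumes "r > 0" "S \<in> sets borel"
  shows "emeasure lborel ((\<lambda>y. r *\<^sub>R (y - c)) -` S) = emeasure lborel S / ennreal (r ^ CARD('d))"
proof -
  have eq: "(\<lambda>x. - (r *\<^sub>R c) + r *\<^sub>R x) = (\<lambda>y. r *\<^sub>R (y - c))" by (simp add: fun_eq_iff algebra_simps)
  have "emeasure lborel S = emeasure (density (distr lborel borel (\<lambda>y. r *\<^sub>R (y - c))) (\<lambda>_. \<bar>r\<bar> ^ DIM(real ^ 'd))) S"
    using lborel_affine[of r "- (r *\<^sub>R c)"] assms(1) unfolding eq by simp
  also have "\<dots> = ennreal (r ^ CARD('d)) * emeasure lborel ((\<lambda>y. r *\<^sub>R (y - c)) -` S)"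
    using assms by (subst emeasure_density_const) (simp_all add: emeasure_distr)
  finally have "emeasure lborel S = emeasure lborel ((\<lambda>y. r *\<^sub>R (y - c)) -` S) * ennreal (r ^ CARD('d))"
    by (simp add: mult.commute)
  thus ?thesis using assms(1) by (simp add: mult_divide_eq_ennreal)
qed

lemma emeasure_unif_B1:
  fixes A :: "(real ^ 'd) set"
  shows "A \<in> sets borel \<Longrightarrow> emeasure unif_B1 A = emeasure lborel (B1 \<inter> A) / emeasure lborel (B1 :: (real ^ 'd) set)"
  unfolding unif_B1_def by (subst emeasure_uniform_measure) auto

lemma emeasure_unif_B1_half_open:
  fixes A :: "(real ^ 'd) set"
  assumes "A \<in> sets borel"
  shows "emeasure unif_B1 A = emeasure lborel (half_open_cube 0 1 \<inter> A) / emeasure lborel (B1 :: (real ^ 'd) set)"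
proof -
  have "emeasure lborel (B1 \<inter> A) = emeasure lborel (half_open_cube (0 :: real ^ 'd) 1 \<inter> A)"
  proof (rule emeasure_eq_AE)
    show "AE x in lborel. x \<in> B1 \<inter> A \<longleftrightarrow> x \<in> half_open_cube (0 :: real ^ 'd) 1 \<inter> A"
      using AE_lborel_irrational by eventually_elim (use irrational_half_open half_open_unit_subset in blast)
  qed (use assms in auto)
  thus ?thesis using emeasure_unif_B1[OF assms] by simp
qed

text \<open>All cells are homothetic copies of the unit cube with the same ratio, so the volume of
  the points with digit in \<open>B\<close> and remainder in \<open>A\<close> factorises. This is
  the independence behind the digit process.\<close>

lemma unif_B1_shift_center:
  assumes N: "N > 0"
  shows "distr unif_B1 (borel \<Otimes>\<^sub>M borel) (\<lambda>z. (cell_shift N z, cell_center N z)) =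
    unif_B1 \<Otimes>\<^sub>M distr unif_B1 borel (cell_center N :: real ^ 'd \<Rightarrow> _)" (is "?D = ?R")
proof (rule pair_measure_eqI[symmetric])
  let ?H = "half_open_cube (0 :: real ^ 'd) 1"
  let ?I = "cell_center N ` ?H"
  interpret U: prob_space "unif_B1 :: (real ^ 'd) measure" by (rule prob_space_unif_B1)
  show "sigma_finite_measure (unif_B1 :: (real ^ 'd) measure)" by unfold_locales
  interpret K: prob_space "distr unif_B1 borel (cell_center N :: real ^ 'd \<Rightarrow> _)"
    by (rule U.prob_space_distr) measurable
  show "sigma_finite_measure (distr unif_B1 borel (cell_center N :: real ^ 'd \<Rightarrow> _))" by unfold_locales
  show "sets ?R = sets ?D" by (auto intro!: sets_pair_measure_cong)
  \<comment> \<open>The proportion of cells with centre in \<open>B\<close>. That it is the law of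
    the centre comes out of \<open>key\<close> with \<open>A\<close> the whole space.\<close>
  define q where "q B = of_nat (card (?I \<inter> B)) * (1 / ennreal (real N ^ CARD('d)))" for B
  have key: "emeasure unif_B1 {z. cell_shift N z \<in> A \<and> cell_center N z \<in> B} = emeasure unif_B1 A * q B"
    if A: "A \<in> sets borel" and B: "B \<in> sets borel" for A B :: "(real ^ 'd) set"
  proof -
    have Sb: "{z. cell_shift N z \<in> A \<and> cell_center N z \<in> B} \<in> sets borel"
    proof -
      have [measurable]: "A \<in> sets borel" "B \<in> sets borel" by fact+
      have "{z. cell_shift N z \<in> A \<and> cell_center N z \<in> B} = {z \<in> space borel. cell_shift N z \<in> A \<and> cell_center N z \<in> B}" by simp
      also have "\<dots> \<in> sets borel" by measurable
      finally show ?thesis .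
    qed
    let ?T = "\<lambda>c y. real N *\<^sub>R (y - c)"
    have sub: "?T c -` (?H \<inter> A) = {z \<in> ?H. cell_center N z = c \<and> cell_shift N z \<in> A}" if "c \<in> ?I" for c
    proof -
      obtain z0 where z0: "z0 \<in> ?H" "c = cell_center N z0" using \<open>c \<in> ?I\<close> by blast
      show ?thesis
      proof (intro set_eqI iffI)
        fix z assume "z \<in> ?T c -` (?H \<inter> A)"
        hence z: "?T c z \<in> ?H" "?T c z \<in> A" by auto
        have "z = c + (1 / real N) *\<^sub>R ?T c z" using N by simp
        hence "cell_center N z = cell_center N (c + (1 / real N) *\<^sub>R ?T c z)" by (rule arg_cong)
        also have "\<dots> = c" unfolding z0(2) by (rule cell_center_affine[OF N]) (use z(1) z0(2) in simp)
        finally have c: "cell_center N z = c" .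
        have "z \<in> ?H" unfolding mem_half_open_cube
        proof
          fix i
          have "\<bar>c $ i\<bar> \<le> 1 - 1 / real N" unfolding z0 by (rule abs_cell_center_le[OF N z0(1)])
          moreover have "c $ i - 1 / real N \<le> z $ i \<and> z $ i < c $ i + 1 / real N"
            using mem_cell[OF N, of z] unfolding c mem_half_open_cube by blast
          ultimately show "(0 :: real ^ 'd) $ i - 1 \<le> z $ i \<and> z $ i < (0 :: real ^ 'd) $ i + 1"
            by (auto simp: abs_le_iff)
        qed
        thus "z \<in> {z \<in> ?H. cell_center N z = c \<and> cell_shift N z \<in> A}" using c z(2) by (simp add: cell_shift_def)
      next
        fix z assume "z \<in> {z \<in> ?H. cell_center N z = c \<and> cell_shift N z \<in> A}"
        thus "z \<in> ?T c -` (?H \<inter> A)" using cell_shift_mem[OF N, of z] by (auto simp: cell_shift_def)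
      qed
    qed
    have fin: "finite (?I \<inter> B)" using finite_cell_centers[OF N] by blast
    have HA: "?H \<inter> A \<in> sets borel" using A by (intro sets.Int half_open_cube_borel)
    have "?H \<inter> {z. cell_shift N z \<in> A \<and> cell_center N z \<in> B} =
        (\<Union>c\<in>?I \<inter> B. {z \<in> ?H. cell_center N z = c \<and> cell_shift N z \<in> A})"
      by auto
    also have "\<dots> = (\<Union>c\<in>?I \<inter> B. ?T c -` (?H \<inter> A))"
      by (intro SUP_cong refl) (rule sub[symmetric], erule IntD1)
    also have "emeasure lborel \<dots> = (\<Sum>c\<in>?I \<inter> B. emeasure lborel (?T c -` (?H \<inter> A)))"
    proof (rule sum_emeasure[symmetric, OF _ _ fin])
      show "(\<lambda>c. ?T c -` (?H \<inter> A)) ` (?I \<inter> B) \<subseteq> sets lborel"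
        using preimage_homothety_borel[OF HA] by (intro image_subsetI) (simp only: sets_lborel)
      show "disjoint_family_on (\<lambda>c. ?T c -` (?H \<inter> A)) (?I \<inter> B)"
      proof (unfold disjoint_family_on_def, intro ballI impI)
        fix c d assume cd: "c \<in> ?I \<inter> B" "d \<in> ?I \<inter> B" "c \<noteq> d"
        show "?T c -` (?H \<inter> A) \<inter> ?T d -` (?H \<inter> A) = {}"
          unfolding sub[OF IntD1[OF cd(1)]] sub[OF IntD1[OF cd(2)]] using cd(3) by auto
      qed
    qed
    also have "\<dots> = (\<Sum>c\<in>?I \<inter> B. emeasure lborel (?H \<inter> A) / ennreal (real N ^ CARD('d)))"
      by (intro sum.cong refl emeasure_lborel_homothety HA) (use N in simp)
    also have "\<dots> = of_nat (card (?I \<inter> B)) * (emeasure lborel (?H \<inter> A) / ennreal (real N ^ CARD('d)))" by simp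
    finally have "emeasure unif_B1 {z. cell_shift N z \<in> A \<and> cell_center N z \<in> B} =
      of_nat (card (?I \<inter> B)) * (emeasure lborel (?H \<inter> A) / ennreal (real N ^ CARD('d))) / emeasure lborel (B1 :: (real ^ 'd) set)"
      unfolding emeasure_unif_B1_half_open[OF Sb] by simp
    thus ?thesis unfolding q_def emeasure_unif_B1_half_open[OF A] divide_ennreal_def by (simp add: ac_simps)
  qed
  fix A B assume "A \<in> sets (unif_B1 :: (real ^ 'd) measure)" "B \<in> sets (distr unif_B1 borel (cell_center N :: real ^ 'd \<Rightarrow> _))"
  hence A: "A \<in> sets borel" and B: "B \<in> sets borel" by simp_all
  have "emeasure (distr unif_B1 borel (cell_center N)) B = emeasure unif_B1 {z. cell_shift N z \<in> UNIV \<and> cell_center N z \<in> B}"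
    using B by (subst emeasure_distr) (auto simp: vimage_def)
  also have "\<dots> = q B" using key[of UNIV B] B U.emeasure_space_1 by simp
  finally have "emeasure (distr unif_B1 borel (cell_center N)) B = q B" .
  moreover have "emeasure ?D (A \<times> B) = emeasure unif_B1 {z. cell_shift N z \<in> A \<and> cell_center N z \<in> B}"
    using A B by (subst emeasure_distr) (auto simp: vimage_def)
  ultimately show "emeasure unif_B1 A * emeasure (distr unif_B1 borel (cell_center N)) B = emeasure ?D (A \<times> B)"
    using key[OF A B] by simp
qed

section \<open>The stationary process\<close>

text \<open>
  The junk value of \<open>distr\<close> along a non-measurable map is excluded by requiring measurable preimages of
  \<open>g\<close> on \<open>D\<close> only.
\<close>

lemma push_on_eq_distr:
  assumes D: "D \<inter> space M \<in> sets M" "AE x in M. x \<in> D"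
    and f: "f \<in> measurable M N" and eq: "AE x in M. f x = g x"
    and pre: "\<And>A. A \<in> sets N \<Longrightarrow> {x \<in> space M. x \<in> D \<and> g x \<in> A} \<in> sets M"
  shows "push_on D g N M = distr M N f"
proof -
  have "emeasure (restrict_space M D) (g -` A \<inter> space (restrict_space M D)) = emeasure M (f -` A \<inter> space M)"
    if A: "A \<in> sets N" for A
  proof -
    have e: "g -` A \<inter> space (restrict_space M D) = {x \<in> space M. x \<in> D \<and> g x \<in> A}"
      by (auto simp: space_restrict_space)
    have "emeasure (restrict_space M D) (g -` A \<inter> space (restrict_space M D)) = emeasure M {x \<in> space M. x \<in> D \<and> g x \<in> A}"
      unfolding e using D by (subst emeasure_restrict_space) (auto simp: Int_commute)
    also have "\<dots> = emeasure M (f -` A \<inter> space M)"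
    proof (rule emeasure_eq_AE[OF _ pre[OF A] measurable_sets[OF f A]])
      show "AE x in M. x \<in> {x \<in> space M. x \<in> D \<and> g x \<in> A} \<longleftrightarrow> x \<in> f -` A \<inter> space M"
        using D(2) eq by eventually_elim auto
    qed
    finally show ?thesis .
  qed
  thus ?thesis unfolding push_on_def distr_def
    by (intro measure_of_eq sets.space_closed) (simp add: sets.sigma_sets_eq)
qed

lemma push_on_eq_distr_on:
  assumes D: "D \<inter> space M \<in> sets M" "AE x in M. x \<in> D"
    and f: "f \<in> measurable M N" and eq: "\<And>x. x \<in> space M \<Longrightarrow> x \<in> D \<Longrightarrow> f x = g x"
  shows "push_on D g N M = distr M N f"
proof (rule push_on_eq_distr[OF D f])
  have "AE x in M. x \<in> space M" by (rule AE_space)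
  with D(2) show "AE x in M. f x = g x" by eventually_elim (rule eq)
  fix A assume A: "A \<in> sets N"
  have "{x \<in> space M. x \<in> D \<and> g x \<in> A} = (D \<inter> space M) \<inter> (f -` A \<inter> space M)" using eq by auto
  also have "\<dots> \<in> sets M" using D(1) measurable_sets[OF f A] by (rule sets.Int)
  finally show "{x \<in> space M. x \<in> D \<and> g x \<in> A} \<in> sets M" .
qed

section \<open>Supports under magnification\<close>

lemma msupp_magnify:
  assumes \<mu>: "\<mu> \<in> radon_measures" and r: "r > 0" and x: "x \<in> msupp \<mu>"
  shows "r *\<^sub>R (x - c) \<in> msupp (magnify r c \<mu>)"
  unfolding msupp_def
proof (intro CollectI allI impI)
  fix U assume U: "open U" "r *\<^sub>R (x - c) \<in> U"
  have "open ((\<lambda>y. r *\<^sub>R (y - c)) -` U)" by (intro open_vimage U continuous_intros)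
  hence "emeasure \<mu> ((\<lambda>y. r *\<^sub>R (y - c)) -` U) > 0" using x U(2) unfolding msupp_def by auto
  moreover have "emeasure (magnify r c \<mu>) U = emeasure \<mu> ((\<lambda>y. r *\<^sub>R (y - c)) -` U) / emeasure \<mu> (window r c)"
    using U by (intro emeasure_magnify radon_sets[OF \<mu>]) auto
  ultimately show "emeasure (magnify r c \<mu>) U > 0"
    using window_finite[OF \<mu> r, of c] by (auto simp: ennreal_zero_less_divide)
qed

lemma magnify_0_scale_dom:
  fixes \<mu> :: "(real ^ 'd) measure"
  assumes \<mu>: "\<mu> \<in> scale_dom" and r: "r > 0"
  shows "magnify r 0 \<mu> \<in> scale_dom"
proof -
  note \<mu>r = Mstar_radon[OF scale_dom_Mstar[OF \<mu>]]
  have s: "0 \<in> msupp \<mu>" using \<mu> by (simp add: scale_dom_def)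
  have "emeasure \<mu> (window r 0) > 0"
    by (rule window_pos_of_msupp[OF s radon_sets[OF \<mu>r] r]) (use r in simp)
  hence "magnify r 0 \<mu> \<in> topspace Mstar" using magnify_in_Mstar_iff[OF \<mu>r r] by blast
  thus ?thesis using msupp_magnify[OF \<mu>r r s, of 0] by (simp add: scale_dom_def)
qed

text \<open>Testing with countably many balls makes membership in the support a measurable
  condition.\<close>

lemma mem_msupp_iff:
  assumes s: "sets \<mu> = sets borel"
  shows "x \<in> msupp \<mu> \<longleftrightarrow> (\<forall>n. emeasure \<mu> (ball x (inverse (real (Suc n)))) > 0)"
proof
  assume "x \<in> msupp \<mu>" thus "\<forall>n. emeasure \<mu> (ball x (inverse (real (Suc n)))) > 0"
    unfolding msupp_def by (auto simp del: of_nat_Suc)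
next
  assume *: "\<forall>n. emeasure \<mu> (ball x (inverse (real (Suc n)))) > 0"
  show "x \<in> msupp \<mu>" unfolding msupp_def
  proof (intro CollectI allI impI)
    fix U assume U: "open U" "x \<in> U"
    then obtain e where e: "e > 0" "ball x e \<subseteq> U" using open_contains_ball by blast
    obtain n where n: "inverse (real (Suc n)) < e" using reals_Archimedean[OF e(1)] by blast
    have "0 < emeasure \<mu> (ball x (inverse (real (Suc n))))" using * by blast
    also have "\<dots> \<le> emeasure \<mu> U"
    proof (rule emeasure_mono)
      show "ball x (inverse (real (Suc n))) \<subseteq> U" using e(2) n by force
    qed (use U s in simp)
    finally show "emeasure \<mu> U > 0" .
  qed
qed

lemma sets_Collect_msupp:
  fixes K :: "'a \<Rightarrow> (real ^ 'd) measure"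
  assumes K: "K \<in> measurable M (borel_of weak_topology)" and g [measurable]: "g \<in> borel_measurable M"
  shows "{w \<in> space M. g w \<in> msupp (K w)} \<in> sets M"
proof -
  have s: "sets (K w) = sets borel" if "w \<in> space M" for w
    using measurable_space[OF K that] by (simp add: radon_measures_def)
  have [measurable]: "(\<lambda>w. emeasure (K w) (ball (g w) r)) \<in> borel_measurable M" for r
  proof -
    have "(\<lambda>w. \<integral>\<^sup>+y. indicator {x. dist (fst x) (snd x) < r} (g w, y) \<partial>K w) \<in> borel_measurable M"
    proof (rule measurable_nn_integral_radon_kernel[OF K])
      have "{x. dist (fst x) (snd x) < r} \<in> sets (borel \<Otimes>\<^sub>M borel :: ((real ^ 'd) \<times> (real ^ 'd)) measure)"
        unfolding borel_prod by (intro borel_open open_Collect_less continuous_intros)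
      thus "(\<lambda>z. indicator {x. dist (fst x) (snd x) < r} (g (fst z), snd z) :: ennreal) \<in> borel_measurable (M \<Otimes>\<^sub>M borel)"
        by measurable
    qed
    moreover have "(\<integral>\<^sup>+y. indicator {x. dist (fst x) (snd x) < r} (g w, y) \<partial>K w) = emeasure (K w) (ball (g w) r)"
      if "w \<in> space M" for w
    proof -
      have "(\<integral>\<^sup>+y. indicator {x. dist (fst x) (snd x) < r} (g w, y) \<partial>K w) = (\<integral>\<^sup>+y. indicator (ball (g w) r) y \<partial>K w)"
        by (intro nn_integral_cong) (simp add: indicator_def)
      also have "\<dots> = emeasure (K w) (ball (g w) r)" using s[OF that] by (intro nn_integral_indicator) simp
      finally show ?thesis .
    qed
    ultimately show ?thesis by (subst measurable_cong) auto
  qed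
  have "{w \<in> space M. g w \<in> msupp (K w)} = {w \<in> space M. \<forall>n. emeasure (K w) (ball (g w) (inverse (real (Suc n)))) > 0}"
    using mem_msupp_iff[OF s] by blast
  also have "\<dots> \<in> sets M" by measurable
  finally show ?thesis .
qed

lemma scale_dom_sets: "scale_dom \<in> sets (borel_of (Mstar :: (real ^ 'd) measure topology))"
proof -
  have "{w \<in> space (borel_of Mstar). (0 :: real ^ 'd) \<in> msupp w} \<in> sets (borel_of Mstar)"
    by (rule sets_Collect_msupp[OF measurable_Mstar_weak]) simp
  thus ?thesis by (simp add: scale_dom_def)
qed

lemma magnify_magnify_0:
  assumes \<mu>: "\<mu> \<in> scale_dom" and r: "r > 0" "s > 0"
  shows "magnify s c (magnify r 0 \<mu>) = magnify (s * r) ((1 / r) *\<^sub>R c) \<mu>"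
proof -
  note \<mu>r = Mstar_radon[OF scale_dom_Mstar[OF \<mu>]]
  have "emeasure \<mu> (window r 0) > 0"
    by (rule window_pos_of_msupp[OF _ radon_sets[OF \<mu>r] r(1)]) (use \<mu> r in \<open>auto simp: scale_dom_def\<close>)
  from magnify_magnify[OF \<mu>r r(2,1) this, of c] show ?thesis by simp
qed

lemma mem_unit_of_center:
  fixes z z0 :: "real ^ 'd"
  assumes N: "N > 0" and z0: "z0 \<in> half_open_cube 0 1" "cell_center N z = cell_center N z0"
  shows "z \<in> half_open_cube 0 1"
  unfolding mem_half_open_cube
proof
  fix i
  have "\<bar>cell_center N z0 $ i\<bar> \<le> 1 - 1 / real N" by (rule abs_cell_center_le[OF N z0(1)])
  moreover have "cell_center N z0 $ i - 1 / real N \<le> z $ i \<and> z $ i < cell_center N z0 $ i + 1 / real N"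
    using mem_cell[OF N, of z] unfolding z0(2) mem_half_open_cube by blast
  ultimately show "(0 :: real ^ 'd) $ i - 1 \<le> z $ i \<and> z $ i < (0 :: real ^ 'd) $ i + 1"
    by (auto simp: abs_le_iff)
qed

lemma cell_center_1: "x \<in> half_open_cube 0 1 \<Longrightarrow> cell_center (Suc 0) x = 0"
  using abs_cell_center_le[of "Suc 0" x] by (simp add: vec_eq_iff)

lemma cell_shift_1: "x \<in> half_open_cube 0 1 \<Longrightarrow> cell_shift (Suc 0) x = x"
  by (simp add: cell_shift_def cell_center_1)

text \<open>The construction has to serve P and its ergodic components alike, so only what the
  components are known to satisfy is kept: the scaling by b preserves the law.\<close>

locale scaling_system =
  fixes p :: "(real ^ 'd) measure measure" and b :: nat
  assumes b2: "b \<ge> 2" and prob_p: "prob_space p" and sets_p: "sets p = sets (borel_of Mstar)"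
    and dom_p: "AE \<mu> in p. \<mu> \<in> scale_dom"
    and inv_p: "push_on scale_dom (scale_star (ln (real b))) p p = p"
begin

sublocale p: prob_space p by (rule prob_p)

lemma b0: "b > 0" using b2 by simp

lemma bn0: "b ^ n > 0" using b2 by simp

text \<open>The scaling by \<open>b ^ n\<close>, completed by the identity off
  \<open>scale_dom\<close>. The completion changes nothing almost surely and gives a measurable map
  of the whole space.\<close>

definition zoom :: "nat \<Rightarrow> (real ^ 'd) measure \<Rightarrow> (real ^ 'd) measure" where
  "zoom n \<mu> = (if \<mu> \<in> scale_dom then magnify (real (b ^ n)) 0 \<mu> else \<mu>)"

lemma zoom_scale_dom: "\<mu> \<in> scale_dom \<Longrightarrow> zoom n \<mu> \<in> scale_dom"
  unfolding zoom_def using bn0[of n] by (simp add: magnify_0_scale_dom)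

lemma zoom_measurable: "zoom n \<in> measurable p p"
proof -
  have K: "(\<lambda>\<mu>. \<mu>) \<in> measurable (borel_of Mstar) (borel_of weak_topology)" by (rule measurable_Mstar_weak)
  have "zoom n \<in> measurable (borel_of Mstar) (borel_of Mstar)"
  proof (rule measurable_MstarI)
    fix \<mu> :: "(real ^ 'd) measure" assume "\<mu> \<in> space (borel_of Mstar)"
    thus "zoom n \<mu> \<in> topspace Mstar"
      using zoom_scale_dom[of \<mu> n] by (cases "\<mu> \<in> scale_dom") (auto simp: scale_dom_Mstar zoom_def)
  next
    fix A :: "(real ^ 'd) set" assume A: "A \<in> sets borel"
    have "(\<lambda>\<mu>. if \<mu> \<in> scale_dom then emeasure (magnify (real (b ^ n)) 0 \<mu>) A else emeasure \<mu> A) \<in> borel_measurable (borel_of Mstar)"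
    proof (rule measurable_If)
      show "(\<lambda>\<mu>. emeasure (magnify (real (b ^ n)) 0 \<mu>) A) \<in> borel_measurable (borel_of Mstar)"
        by (rule measurable_emeasure_magnify[OF K _ A]) simp
      show "{x \<in> space (borel_of Mstar). x \<in> scale_dom} \<in> sets (borel_of Mstar)"
        using sets.Int[OF sets.top scale_dom_sets] by (simp only: Int_def mem_Collect_eq)
    qed (rule measurable_emeasure_Mstar[OF A])
    thus "(\<lambda>\<mu>. emeasure (zoom n \<mu>) A) \<in> borel_measurable (borel_of Mstar)"
      unfolding zoom_def by (simp add: if_distrib[of "\<lambda>\<kappa>. emeasure \<kappa> A"])
  qed
  thus ?thesis unfolding measurable_cong_sets[OF sets_p sets_p] .
qed

lemma distr_zoom_1: "distr p p (zoom 1) = p"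
proof -
  have "scale_dom \<inter> space p \<in> sets p"
    using scale_dom_sets sets_p by (intro sets.Int) auto
  from push_on_eq_distr_on[OF this dom_p zoom_measurable[of 1], of "scale_star (ln (real b))"]
  have "push_on scale_dom (scale_star (ln (real b))) p p = distr p p (zoom 1)"
    using b0 by (simp add: zoom_def scale_star_magnify)
  thus ?thesis using inv_p by simp
qed

lemma distr_zoom: "distr p p (zoom n) = p"
proof (induction n)
  case 0
  have "distr p p (zoom 0) = distr p p (\<lambda>\<mu>. \<mu>)"
    by (rule distr_cong_AE[OF refl refl]) (use dom_p zoom_measurable in \<open>auto simp: zoom_def magnify_1_0 scale_dom_Mstar\<close>)
  thus ?case by (simp add: distr_id2)
next
  case (Suc n)
  have "distr p p (zoom (Suc n)) = distr p p (zoom 1 \<circ> zoom n)"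
  proof (rule distr_cong_AE[OF refl refl])
    show "AE \<mu> in p. zoom (Suc n) \<mu> = (zoom 1 \<circ> zoom n) \<mu>"
      using dom_p
    proof eventually_elim
      case (elim \<mu>)
      have "zoom 1 (zoom n \<mu>) = magnify (real b) 0 (magnify (real (b ^ n)) 0 \<mu>)"
        using zoom_scale_dom[OF elim, of n] elim unfolding zoom_def by simp
      also have "\<dots> = zoom (Suc n) \<mu>"
        using magnify_magnify_0[OF elim, of "real (b ^ n)" "real b" 0] b0 elim by (simp add: zoom_def)
      finally show ?case by simp
    qed
  qed (use zoom_measurable in \<open>auto intro!: measurable_comp\<close>)
  also have "\<dots> = distr (distr p p (zoom n)) p (zoom 1)"
    by (rule distr_distr[symmetric]) (rule zoom_measurable)+
  also have "\<dots> = p" unfolding Suc by (rule distr_zoom_1)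
  finally show ?case .
qed

text \<open>
  A seed is the present position in \<open>B1\<close> together with its past digits, the most recent one first.
\<close>

definition digit_law :: "(real ^ 'd) measure" where
  "digit_law = distr unif_B1 borel (cell_center b)"

definition seed_law :: "((real ^ 'd) \<times> (nat \<Rightarrow> real ^ 'd)) measure" where
  "seed_law = unif_B1 \<Otimes>\<^sub>M PiM UNIV (\<lambda>_. digit_law)"

text \<open>One step of time: the leading digit of the present is split off and becomes the most
  recent digit of the past.\<close>

definition seed_shift :: "(real ^ 'd) \<times> (nat \<Rightarrow> real ^ 'd) \<Rightarrow> (real ^ 'd) \<times> (nat \<Rightarrow> real ^ 'd)" where
  "seed_shift s = (cell_shift b (fst s), case_nat (cell_center b (fst s)) (snd s))"

lemma sets_digit_law [simp, measurable_cong]: "sets digit_law = sets borel"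
  by (simp add: digit_law_def)

lemma space_digit_law [simp]: "space digit_law = UNIV"
  by (simp add: digit_law_def)

lemma prob_digit_law: "prob_space digit_law"
  unfolding digit_law_def by (rule prob_space.prob_space_distr[OF prob_space_unif_B1]) measurable

lemma prob_seed_law: "prob_space seed_law"
  unfolding seed_law_def
  by (intro prob_space_pair prob_space_unif_B1 prob_space_PiM prob_digit_law)

lemma seed_shift_measurable: "seed_shift \<in> measurable seed_law seed_law"
  unfolding seed_shift_def seed_law_def by measurable

text \<open>A uniform point splits into an independent remainder and digit, and an independent digit
  in front of an i.i.d. sequence gives an i.i.d. sequence. Rectangles are compared by integrating
  over the old past.\<close>

lemma distr_seed_shift: "distr seed_law seed_law seed_shift = seed_law"
proof -
  let ?S = "PiM UNIV (\<lambda>_::nat. digit_law)"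
  let ?U = "unif_B1 :: (real ^ 'd) measure"
  interpret U: prob_space ?U by (rule prob_space_unif_B1)
  interpret D: prob_space digit_law by (rule prob_digit_law)
  interpret S: sequence_space digit_law ..
  interpret US: pair_prob_space ?U ?S ..
  interpret DS: pair_prob_space digit_law ?S ..
  have "?U \<Otimes>\<^sub>M ?S = distr seed_law seed_law seed_shift"
  proof (rule pair_measure_eqI)
    show "sigma_finite_measure ?U" "sigma_finite_measure ?S" by unfold_locales
    show "sets (?U \<Otimes>\<^sub>M ?S) = sets (distr seed_law seed_law seed_shift)" by (simp add: seed_law_def)
    fix A B assume A: "A \<in> sets ?U" and B: "B \<in> sets ?S"
    have slice: "{d. case_nat d u \<in> B} \<in> sets borel" for u
    proof -
      have "(\<lambda>d. case_nat d u) \<in> measurable borel ?S"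
        by (rule measurable_case_nat') (auto simp: space_PiM intro!: measurable_const)
      from measurable_sets[OF this B] show ?thesis by (simp add: vimage_def)
    qed
    have [measurable]: "A \<in> sets borel" "B \<in> sets ?S" using A B by auto
    have "emeasure ?S B = emeasure (distr (digit_law \<Otimes>\<^sub>M ?S) ?S (\<lambda>(s, \<omega>). case_nat s \<omega>)) B"
      using S.PiM_iter by simp
    also have "\<dots> = emeasure (digit_law \<Otimes>\<^sub>M ?S) ((\<lambda>(s, \<omega>). case_nat s \<omega>) -` B \<inter> space (digit_law \<Otimes>\<^sub>M ?S))"
      by (rule emeasure_distr[OF _ B]) measurable
    also have "\<dots> = (\<integral>\<^sup>+u. emeasure digit_law {d. case_nat d u \<in> B} \<partial>?S)"
    proof (subst DS.emeasure_pair_measure_alt2)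
      show "(\<lambda>(s, \<omega>). case_nat s \<omega>) -` B \<inter> space (digit_law \<Otimes>\<^sub>M ?S) \<in> sets (digit_law \<Otimes>\<^sub>M ?S)"
        by (rule measurable_sets[OF _ B]) measurable
    qed (auto intro!: nn_integral_cong arg_cong2[of _ _ _ _ emeasure] simp: space_pair_measure digit_law_def)
    finally have SB: "emeasure ?S B = (\<integral>\<^sup>+u. emeasure digit_law {d. case_nat d u \<in> B} \<partial>?S)" .
    have pre: "seed_shift -` (A \<times> B) \<inter> space seed_law \<in> sets (?U \<Otimes>\<^sub>M ?S)"
      using measurable_sets[OF seed_shift_measurable, of "A \<times> B"] A B by (simp add: seed_law_def)
    have "emeasure (distr seed_law seed_law seed_shift) (A \<times> B) = emeasure (?U \<Otimes>\<^sub>M ?S) (seed_shift -` (A \<times> B) \<inter> space seed_law)"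
      using A B by (subst emeasure_distr[OF seed_shift_measurable]) (auto simp: seed_law_def)
    also have "\<dots> = (\<integral>\<^sup>+u. emeasure ?U {z. cell_shift b z \<in> A \<and> cell_center b z \<in> {d. case_nat d u \<in> B}} \<partial>?S)"
      by (subst US.emeasure_pair_measure_alt2[OF pre])
         (auto intro!: nn_integral_cong arg_cong2[of _ _ _ _ emeasure] simp: space_pair_measure seed_law_def seed_shift_def)
    also have "\<dots> = (\<integral>\<^sup>+u. emeasure ?U A * emeasure digit_law {d. case_nat d u \<in> B} \<partial>?S)"
    proof (rule nn_integral_cong)
      fix u
      let ?B = "{d. case_nat d u \<in> B}"
      have "emeasure ?U {z. cell_shift b z \<in> A \<and> cell_center b z \<in> ?B} = emeasure (distr ?U (borel \<Otimes>\<^sub>M borel) (\<lambda>z. (cell_shift b z, cell_center b z))) (A \<times> ?B)"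
        using A slice[of u] by (subst emeasure_distr) (auto simp: vimage_def)
      also have "\<dots> = emeasure ?U A * emeasure digit_law ?B"
        unfolding unif_B1_shift_center[OF b0] digit_law_def[symmetric]
        by (rule D.emeasure_pair_measure_Times) (use A slice[of u] in auto)
      finally show "emeasure ?U {z. cell_shift b z \<in> A \<and> cell_center b z \<in> ?B} = emeasure ?U A * emeasure digit_law ?B" .
    qed
    also have "\<dots> = emeasure ?U A * (\<integral>\<^sup>+u. emeasure digit_law {d. case_nat d u \<in> B} \<partial>?S)"
    proof (rule nn_integral_cmult)
      have "(\<lambda>(s, \<omega>). case_nat s \<omega>) -` B \<inter> space (digit_law \<Otimes>\<^sub>M ?S) \<in> sets (digit_law \<Otimes>\<^sub>M ?S)"
        by (rule measurable_sets[OF _ B]) measurable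
      from DS.measurable_emeasure_Pair2[OF this]
      show "(\<lambda>u. emeasure digit_law {d. case_nat d u \<in> B}) \<in> borel_measurable ?S"
        by (rule iffD1[OF measurable_cong, rotated])
           (auto intro!: arg_cong2[of _ _ _ _ emeasure] simp: space_pair_measure digit_law_def)
    qed
    finally show "emeasure ?U A * emeasure ?S B = emeasure (distr seed_law seed_law seed_shift) (A \<times> B)"
      using SB by simp
  qed
  thus ?thesis by (simp add: seed_law_def)
qed

end

section \<open>Measurability of the CP map and of its orbits\<close>

lemma measurable_top_of_setI:
  assumes "f \<in> borel_measurable M" "\<And>w. w \<in> space M \<Longrightarrow> f w \<in> (S :: 'b::second_countable_topology set)"
  shows "f \<in> measurable M (borel_of (top_of_set S))"
  unfolding measurable_borel_of_iff[OF coord_embedding_top_of_set] using assms by auto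

lemma measurable_top_of_set_borel: "(\<lambda>x. x) \<in> borel_measurable (borel_of (top_of_set (S :: 'b::second_countable_topology set)))"
  using measurable_coord_embedding[OF coord_embedding_top_of_set] .

lemma sets_borel_of_Mstar_B1: "sets (borel_of Mstar_B1) = sets (borel_of Mstar \<Otimes>\<^sub>M borel_of (top_of_set B1))"
  unfolding Mstar_B1_def by (rule sets_borel_of_prod[OF coord_embedding_Mstar coord_embedding_top_of_set])

lemma sets_borel_of_Mbox_B1: "sets (borel_of Mbox_B1) = sets (borel_of Mbox \<Otimes>\<^sub>M borel_of (top_of_set B1))"
  unfolding Mbox_B1_def by (rule sets_borel_of_prod[OF coord_embedding_Mbox coord_embedding_top_of_set])

lemma measurable_fst_Mbox_B1: "fst \<in> measurable (borel_of Mbox_B1) (borel_of Mbox)"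
  and measurable_fst_Mstar_B1: "fst \<in> measurable (borel_of Mstar_B1) (borel_of Mstar)"
  unfolding measurable_cong_sets[OF sets_borel_of_Mbox_B1 refl] measurable_cong_sets[OF sets_borel_of_Mstar_B1 refl]
  by (intro measurable_fst)+

lemma measurable_snd_Mbox_B1: "snd \<in> borel_measurable (borel_of Mbox_B1)"
  unfolding measurable_cong_sets[OF sets_borel_of_Mbox_B1 refl]
  by (rule measurable_compose[OF measurable_snd measurable_top_of_set_borel])

lemma measurable_snd_Mstar_B1: "snd \<in> borel_measurable (borel_of Mstar_B1)"
  unfolding measurable_cong_sets[OF sets_borel_of_Mstar_B1 refl]
  by (rule measurable_compose[OF measurable_snd measurable_top_of_set_borel])

lemma measurable_Mbox_B1I:
  fixes h :: "'a \<Rightarrow> (real ^ 'd) measure \<times> (real ^ 'd)"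
  assumes "\<And>w. w \<in> space M \<Longrightarrow> h w \<in> topspace Mbox_B1"
    and "\<And>A. A \<in> sets borel \<Longrightarrow> (\<lambda>w. emeasure (fst (h w)) A) \<in> borel_measurable M"
    and "(\<lambda>w. snd (h w)) \<in> borel_measurable M"
  shows "h \<in> measurable M (borel_of Mbox_B1)"
proof -
  have "(\<lambda>w. (fst (h w), snd (h w))) \<in> measurable M (borel_of Mbox \<Otimes>\<^sub>M borel_of (top_of_set B1))"
    using assms by (intro measurable_Pair measurable_MboxI measurable_top_of_setI)
      (auto simp: topspace_Mbox_B1 mem_Times_iff)
  thus ?thesis unfolding measurable_cong_sets[OF refl sets_borel_of_Mbox_B1] by simp
qed

lemma measurable_Mstar_B1I:
  fixes h :: "'a \<Rightarrow> (real ^ 'd) measure \<times> (real ^ 'd)"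
  assumes "\<And>w. w \<in> space M \<Longrightarrow> h w \<in> topspace Mstar_B1"
    and "\<And>A. A \<in> sets borel \<Longrightarrow> (\<lambda>w. emeasure (fst (h w)) A) \<in> borel_measurable M"
    and "(\<lambda>w. snd (h w)) \<in> borel_measurable M"
  shows "h \<in> measurable M (borel_of Mstar_B1)"
proof -
  have "(\<lambda>w. (fst (h w), snd (h w))) \<in> measurable M (borel_of Mstar \<Otimes>\<^sub>M borel_of (top_of_set B1))"
    using assms by (intro measurable_Pair measurable_MstarI measurable_top_of_setI)
      (auto simp: topspace_Mstar_B1 mem_Times_iff)
  thus ?thesis unfolding measurable_cong_sets[OF refl sets_borel_of_Mstar_B1] by simp
qed

lemma measurable_fst_Mbox_B1_weak: "fst \<in> measurable (borel_of Mbox_B1) (borel_of weak_topology)"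
  by (rule measurable_compose[OF measurable_fst_Mbox_B1 measurable_Mbox_weak])

lemma CP_map_topspace:
  assumes b: "b > 0" and x: "(\<mu>, x) \<in> CP_dom b"
  shows "CP_map b (\<mu>, x) \<in> topspace Mbox_B1"
    and "emeasure \<mu> (window (real b) (cell_center b x)) > 0"
proof -
  have \<mu>: "\<mu> \<in> topspace Mbox" and pos: "emeasure \<mu> (half_open_cube (cell_center b x) (1 / real b)) > 0"
    using x b by (auto simp: mem_CP_dom)
  note r = Mbox_radon[OF \<mu>]
  note pos
  also have "emeasure \<mu> (half_open_cube (cell_center b x) (1 / real b)) \<le> emeasure \<mu> (window (real b) (cell_center b x))"
    by (intro emeasure_mono cell_subset_window b) (simp add: radon_sets[OF r])
  finally show w: "emeasure \<mu> (window (real b) (cell_center b x)) > 0" .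
  have "magnify (real b) (cell_center b x) \<mu> \<in> topspace Mstar"
    using w b by (subst magnify_in_Mstar_iff[OF r]) auto
  thus "CP_map b (\<mu>, x) \<in> topspace Mbox_B1"
    unfolding CP_map_eq[OF b] using cell_shift_mem[OF b, of x] half_open_unit_subset
    by (auto simp: topspace_Mbox_B1 restrict_B1_in_Mbox)
qed

text \<open>The mass of the cell of x is the integral of one jointly measurable kernel, the
  indicator of lying in a common cell.\<close>

lemma CP_dom_sets:
  assumes b: "b > 0"
  shows "CP_dom b \<in> sets (borel_of (Mbox_B1 :: ((real ^ 'd) measure \<times> (real ^ 'd)) topology))"
proof -
  let ?T = "borel_of (Mbox_B1 :: ((real ^ 'd) measure \<times> (real ^ 'd)) topology)"
  let ?S = "{x. cell_center b (fst x) = cell_center b (snd x)} :: ((real ^ 'd) \<times> (real ^ 'd)) set"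
  have "?S = {x \<in> space (borel \<Otimes>\<^sub>M borel). cell_center b (fst x) = cell_center b (snd x)}" by (simp add: space_pair_measure)
  also have "\<dots> \<in> sets (borel \<Otimes>\<^sub>M borel)" by measurable
  finally have S: "?S \<in> sets (borel \<Otimes>\<^sub>M borel)" .
  have "(\<lambda>w. \<integral>\<^sup>+y. indicator ?S (snd w, y) \<partial>fst w) \<in> borel_measurable ?T"
  proof (rule measurable_nn_integral_radon_kernel[OF measurable_fst_Mbox_B1_weak])
    have [measurable]: "snd \<in> borel_measurable ?T" by (rule measurable_snd_Mbox_B1)
    note S [measurable]
    show "(\<lambda>z. indicator ?S (snd (fst z), snd z) :: ennreal) \<in> borel_measurable (?T \<Otimes>\<^sub>M borel)" by measurable
  qed
  hence "{w \<in> space ?T. (\<integral>\<^sup>+y. indicator ?S (snd w, y) \<partial>fst w) > 0} \<in> sets ?T" by measurable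
  also have "{w \<in> space ?T. (\<integral>\<^sup>+y. indicator ?S (snd w, y) \<partial>fst w) > 0} = CP_dom b"
  proof -
    have "(\<integral>\<^sup>+y. indicator ?S (x, y) \<partial>\<mu>) = emeasure \<mu> (half_open_cube (cell_center b x) (1 / real b))"
      if "\<mu> \<in> topspace Mbox" for \<mu> and x :: "real ^ 'd"
    proof -
      have "(\<integral>\<^sup>+y. indicator ?S (x, y) \<partial>\<mu>) = (\<integral>\<^sup>+y. indicator (half_open_cube (cell_center b x) (1 / real b)) y \<partial>\<mu>)"
        by (intro nn_integral_cong) (simp add: indicator_def cell_center_eq_iff[OF b, symmetric] eq_commute[of "cell_center b x"])
      also have "\<dots> = emeasure \<mu> (half_open_cube (cell_center b x) (1 / real b))"
        by (rule nn_integral_indicator) (simp add: radon_sets[OF Mbox_radon[OF that]])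
      finally show ?thesis .
    qed
    thus ?thesis by (auto simp: topspace_Mbox_B1 mem_CP_dom[OF b])
  qed
  finally show ?thesis .
qed

lemma measurable_CP_map:
  assumes b: "b > 0"
  shows "(\<lambda>w. if w \<in> CP_dom b then CP_map b w else w) \<in>
    measurable (borel_of Mbox_B1) (borel_of (Mbox_B1 :: ((real ^ 'd) measure \<times> (real ^ 'd)) topology))"
proof (rule measurable_Mbox_B1I)
  let ?T = "borel_of (Mbox_B1 :: ((real ^ 'd) measure \<times> (real ^ 'd)) topology)"
  have CPM: "CP_map b w = (scenery b (fst w) (snd w), cell_shift b (snd w))" for w :: "(real ^ 'd) measure \<times> (real ^ 'd)"
    by (cases w) (simp only: CP_map_eq[OF b] scenery_def fst_conv snd_conv)
  fix w assume "w \<in> space ?T"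
  thus "(if w \<in> CP_dom b then CP_map b w else w) \<in> topspace Mbox_B1"
    using CP_map_topspace(1)[OF b] by (cases w) auto
next
  let ?T = "borel_of (Mbox_B1 :: ((real ^ 'd) measure \<times> (real ^ 'd)) topology)"
  have D: "{w \<in> space ?T. w \<in> CP_dom b} \<in> sets ?T"
    using sets.Int[OF sets.top CP_dom_sets[OF b]] by (simp only: Int_def mem_Collect_eq)
  have CPM: "CP_map b w = (scenery b (fst w) (snd w), cell_shift b (snd w))" for w :: "(real ^ 'd) measure \<times> (real ^ 'd)"
    by (cases w) (simp only: CP_map_eq[OF b] scenery_def fst_conv snd_conv)
  have sm: "snd \<in> borel_measurable ?T" by (rule measurable_snd_Mbox_B1)
  {
    fix A :: "(real ^ 'd) set" assume A: "A \<in> sets borel"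
    have "(\<lambda>w. if w \<in> CP_dom b then emeasure (scenery b (fst w) (snd w)) A else emeasure (fst w) A) \<in> borel_measurable ?T"
      by (intro measurable_If measurable_emeasure_scenery measurable_fst_Mbox_B1_weak sm A D
            measurable_compose[OF measurable_fst_Mbox_B1 measurable_emeasure_Mbox[OF A]])
    thus "(\<lambda>w. emeasure (fst (if w \<in> CP_dom b then CP_map b w else w)) A) \<in> borel_measurable ?T"
      unfolding CPM by (simp add: if_distrib[of "\<lambda>\<kappa>. emeasure (fst \<kappa>) A"] cong: if_cong)
  }
  have "(\<lambda>w. if w \<in> CP_dom b then cell_shift b (snd w) else snd w) \<in> borel_measurable ?T"
    by (intro measurable_If sm D measurable_compose[OF sm cell_shift_measurable])
  thus "(\<lambda>w. snd (if w \<in> CP_dom b then CP_map b w else w)) \<in> borel_measurable ?T"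
    unfolding CPM by (simp add: if_distrib[of snd] cong: if_cong)
qed

lemma coord_Mbox_B1_inj:
  assumes "w \<in> topspace Mbox_B1" "v \<in> topspace Mbox_B1"
    and "(tent_coords (fst w), snd w) = (tent_coords (fst v), snd v)"
  shows "w = v"
  using assms tent_coords_inj[of "fst w" "fst v"] Mbox_radon
  by (auto simp: topspace_Mbox_B1 mem_Times_iff intro!: prod_eqI)

text \<open>The orbit equation is tested in tent coordinates, where equality of two measurable maps
  is a measurable condition. Injectivity of the coordinates recovers the equation itself.\<close>

lemma CP_orbits_sets:
  assumes b: "b > 0"
  shows "CP_orbits b \<in> sets (PiM (UNIV :: int set) (\<lambda>_. borel_of (Mbox_B1 :: ((real ^ 'd) measure \<times> (real ^ 'd)) topology)))"
proof -
  let ?T = "borel_of (Mbox_B1 :: ((real ^ 'd) measure \<times> (real ^ 'd)) topology)"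
  let ?PI = "PiM (UNIV :: int set) (\<lambda>_. ?T)"
  let ?e = "\<lambda>z :: (real ^ 'd) measure \<times> (real ^ 'd). (tent_coords (fst z), snd z)"
  define g where "g = (\<lambda>w. if w \<in> CP_dom b then CP_map b w else (w :: (real ^ 'd) measure \<times> (real ^ 'd)))"
  have gm: "g \<in> measurable ?T ?T" unfolding g_def by (rule measurable_CP_map[OF b])
  have em: "?e \<in> borel_measurable ?T" by (rule measurable_coord_embedding[OF coord_embedding_Mbox_B1])
  have comp: "(\<lambda>\<omega>. \<omega> n) \<in> measurable ?PI ?T" for n by (rule measurable_component_singleton) simp
  have spc: "\<omega> n \<in> topspace Mbox_B1" if "\<omega> \<in> space ?PI" for \<omega> n
    using that by (auto simp: space_PiM PiE_iff)
  have 1: "{\<omega> \<in> space ?PI. \<omega> n \<in> CP_dom b} \<in> sets ?PI" for n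
    using measurable_sets[OF comp CP_dom_sets[OF b], of n] by (simp add: vimage_def Int_def conj_commute)
  have 2: "{\<omega> \<in> space ?PI. ?e (\<omega> (n + 1)) = ?e (g (\<omega> n))} \<in> sets ?PI" for n
  proof -
    have a: "(\<lambda>\<omega>. ?e (\<omega> (n + 1))) \<in> borel_measurable ?PI"
      by (rule measurable_compose[OF comp em])
    have c: "(\<lambda>\<omega>. ?e (g (\<omega> n))) \<in> borel_measurable ?PI"
      by (rule measurable_compose[OF measurable_compose[OF comp gm] em])
    from measurable_equality_set[OF a c] show ?thesis by simp
  qed
  have "(\<Inter>n. {\<omega> \<in> space ?PI. \<omega> n \<in> CP_dom b}) \<inter> (\<Inter>n. {\<omega> \<in> space ?PI. ?e (\<omega> (n + 1)) = ?e (g (\<omega> n))}) \<in> sets ?PI"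
    by (intro sets.Int sets.countable_INT' image_subsetI 1 2) auto
  also have "(\<Inter>n. {\<omega> \<in> space ?PI. \<omega> n \<in> CP_dom b}) \<inter> (\<Inter>n. {\<omega> \<in> space ?PI. ?e (\<omega> (n + 1)) = ?e (g (\<omega> n))}) = CP_orbits b"
  proof (intro set_eqI iffI)
    fix \<omega> assume w: "\<omega> \<in> (\<Inter>n. {\<omega> \<in> space ?PI. \<omega> n \<in> CP_dom b}) \<inter> (\<Inter>n. {\<omega> \<in> space ?PI. ?e (\<omega> (n + 1)) = ?e (g (\<omega> n))})"
    hence sp: "\<omega> \<in> space ?PI" and d: "\<omega> n \<in> CP_dom b" and e: "?e (\<omega> (n + 1)) = ?e (g (\<omega> n))" for n by blast+
    have "\<omega> (n + 1) = g (\<omega> n)" for n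
      by (rule coord_Mbox_B1_inj[OF spc[OF sp] _ e]) (use measurable_space[OF gm] spc[OF sp] in simp)
    thus "\<omega> \<in> CP_orbits b" using d by (simp add: CP_orbits_def g_def)
  next
    fix \<omega> :: "int \<Rightarrow> (real ^ 'd) measure \<times> (real ^ 'd)" assume w: "\<omega> \<in> CP_orbits b"
    hence d: "\<omega> n \<in> CP_dom b" and s: "\<omega> (n + 1) = CP_map b (\<omega> n)" for n by (auto simp: CP_orbits_def)
    have "\<omega> n \<in> topspace Mbox_B1" for n using d[of n] by (auto simp: CP_dom_def)
    hence sp: "\<omega> \<in> space ?PI" by (simp add: space_PiM PiE_iff)
    show "\<omega> \<in> (\<Inter>n. {\<omega> \<in> space ?PI. \<omega> n \<in> CP_dom b}) \<inter> (\<Inter>n. {\<omega> \<in> space ?PI. ?e (\<omega> (n + 1)) = ?e (g (\<omega> n))})"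
      using sp d s by (simp add: g_def)
  qed
  finally show ?thesis .
qed

lemma irrational_point_measurable:
  "{x :: real ^ 'd. irrational_point x} \<in> sets borel"
proof -
  have "{x :: real ^ 'd. irrational_point x} = {x \<in> space borel. \<forall>i. \<forall>r::rat. x $ i \<noteq> real_of_rat r}"
    unfolding irrational_point_def Rats_def by auto
  also have "\<dots> \<in> sets borel" by measurable
  finally show ?thesis .
qed

text \<open>The unit mass at the origin serves as default value where the maps below are
  undefined.\<close>

lemma return_0_Mbox: "return borel 0 \<in> topspace (Mbox :: (real ^ 'd) measure topology)"
proof -
  have "return borel 0 \<in> (radon_measures :: (real ^ 'd) measure set)"
    by (rule radonI) (auto simp: indicator_def)
  thus ?thesis by (simp add: topspace_Mbox indicator_def mem_B1)
qed

section \<open>The orbit of a measure and a seed\<close>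

context scaling_system
begin

text \<open>Inserts the past digits one after the other; \<open>cell_shift b\<close> removes the
  digit inserted last and leads one step forward in time.\<close>

primrec past :: "nat \<Rightarrow> (real ^ 'd) \<times> (nat \<Rightarrow> real ^ 'd) \<Rightarrow> real ^ 'd" where
  "past 0 s = fst s"
| "past (Suc k) s = snd s k + (1 / real b) *\<^sub>R past k s"

definition pos :: "int \<Rightarrow> (real ^ 'd) \<times> (nat \<Rightarrow> real ^ 'd) \<Rightarrow> real ^ 'd" where
  "pos n s = (if n \<ge> 0 then cell_shift (b ^ nat n) (fst s) else past (nat (- n)) s)"

text \<open>Cell centres are rational, so an irrational present makes all earlier and later
  positions irrational and keeps them off the cell boundaries.\<close>

definition seed_good :: "(real ^ 'd) \<times> (nat \<Rightarrow> real ^ 'd) \<Rightarrow> bool" where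
  "seed_good s \<longleftrightarrow> fst s \<in> B1 \<and> irrational_point (fst s) \<and> (\<forall>k. snd s k \<in> cell_center b ` half_open_cube 0 1)"

lemma seed_good_fst: "seed_good s \<Longrightarrow> fst s \<in> half_open_cube 0 1"
  unfolding seed_good_def using irrational_half_open by blast

lemma past_good:
  assumes s: "seed_good s"
  shows "past k s \<in> half_open_cube 0 1 \<and> irrational_point (past k s)"
proof (induction k)
  case 0
  show ?case using s seed_good_fst[OF s] by (simp add: seed_good_def)
next
  case (Suc k)
  obtain z0 where z0: "z0 \<in> half_open_cube 0 1" "snd s k = cell_center b z0" using s unfolding seed_good_def by blast
  have "cell_center b (past (Suc k) s) = cell_center b z0"
    using cell_center_affine[OF b0, of "past k s" z0] Suc z0 by simp
  from mem_unit_of_center[OF b0 z0(1) this] have "past (Suc k) s \<in> half_open_cube 0 1" .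
  moreover have "irrational_point (past (Suc k) s)"
    using Suc b0 unfolding past.simps z0(2)
    by (intro irrational_affine cell_center_rat) (auto intro!: Rats_divide)
  ultimately show ?case by blast
qed

lemma cell_shift_past:
  assumes s: "seed_good s"
  shows "cell_shift b (past (Suc k) s) = past k s"
proof -
  obtain z0 where z0: "snd s k = cell_center b z0" using s unfolding seed_good_def by blast
  show ?thesis using cell_shift_affine[OF b0, of "past k s" z0] past_good[OF s, of k] by (simp add: z0)
qed

lemma pos_good:
  assumes s: "seed_good s"
  shows "pos n s \<in> half_open_cube 0 1" "irrational_point (pos n s)"
  using past_good[OF s] irrational_cell_shift[of "fst s" "b ^ nat n"] s cell_shift_mem[OF bn0]
  unfolding pos_def by (auto simp: seed_good_def b0)

lemma pos_0: "seed_good s \<Longrightarrow> pos 0 s = fst s"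
  unfolding pos_def using cell_shift_1[OF seed_good_fst] by simp

lemma pos_minus:
  assumes "seed_good s"
  shows "pos (- int k) s = past k s"
proof (cases k)
  case 0
  thus ?thesis using pos_0[OF assms] by simp
next
  case (Suc j)
  hence "\<not> - int k \<ge> 0" "nat (- (- int k)) = k" by simp_all
  thus ?thesis by (simp only: pos_def if_False)
qed

lemma pos_step:
  assumes s: "seed_good s"
  shows "pos (n + 1) s = cell_shift b (pos n s)"
proof (cases "n \<ge> 0")
  case True
  have "pos (n + 1) s = cell_shift (b ^ nat n * b) (fst s)"
    using True by (simp add: pos_def nat_add_distrib mult.commute)
  also have "\<dots> = cell_shift b (pos n s)" using True bn0[of "nat n"] b0 by (subst cell_shift_mult) (auto simp: pos_def)
  finally show ?thesis .
next
  case False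
  define k where "k = nat (- n) - 1"
  have k: "n = - int (Suc k)" using False unfolding k_def by simp
  have "pos n s = past (Suc k) s" unfolding k by (rule pos_minus[OF s])
  moreover have "pos (n + 1) s = past k s" using pos_minus[OF s, of k] unfolding k by simp
  ultimately show ?thesis using cell_shift_past[OF s, of k] by (simp only:)
qed

lemma pos_shift_iterate:
  assumes s: "seed_good s"
  shows "cell_shift (b ^ k) (pos n s) = pos (n + int k) s"
proof (induction k)
  case 0
  show ?case using cell_shift_1[OF pos_good(1)[OF s]] by simp
next
  case (Suc k)
  have "cell_shift (b ^ Suc k) (pos n s) = cell_shift (b ^ k * b) (pos n s)" by (simp add: mult.commute)
  also have "\<dots> = cell_shift b (pos (n + int k) s)" using bn0 b0 Suc by (simp add: cell_shift_mult)
  also have "\<dots> = pos (n + int (Suc k)) s" using pos_step[OF s, of "n + int k"] by (simp add: ac_simps)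
  finally show ?case .
qed

lemma seed_good_shift:
  assumes s: "seed_good s"
  shows "seed_good (seed_shift s)"
  unfolding seed_good_def
proof (intro conjI allI)
  show "fst (seed_shift s) \<in> B1" using cell_shift_mem[OF b0] half_open_unit_subset by (auto simp: seed_shift_def)
  show "irrational_point (fst (seed_shift s))"
    using s irrational_cell_shift b0 by (auto simp: seed_shift_def seed_good_def)
  fix k show "snd (seed_shift s) k \<in> cell_center b ` half_open_cube 0 1"
    using s seed_good_fst[OF s] by (cases k) (auto simp: seed_shift_def seed_good_def)
qed

lemma past_seed_shift:
  assumes "seed_good s"
  shows "past (Suc k) (seed_shift s) = past k s"
proof (induction k)
  case 0
  show ?case using cell_center_plus_shift[OF b0, of "fst s"] by (simp add: seed_shift_def)
next
  case (Suc k)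
  have "past (Suc (Suc k)) (seed_shift s) = snd s k + (1 / real b) *\<^sub>R past (Suc k) (seed_shift s)"
    by (simp add: seed_shift_def)
  thus ?case unfolding Suc by simp
qed

text \<open>At nonnegative times the split-off digit is one more level of refinement. At negative
  times the digit stored in the past rebuilds the old present.\<close>

lemma pos_seed_shift:
  assumes s: "seed_good s"
  shows "pos n (seed_shift s) = pos (n + 1) s"
proof (cases "n \<ge> 0")
  case True
  have "pos n (seed_shift s) = cell_shift (b ^ nat n) (cell_shift b (fst s))"
    using True by (simp add: pos_def seed_shift_def)
  also have "\<dots> = cell_shift (b * b ^ nat n) (fst s)" by (rule cell_shift_mult[OF b0 bn0, symmetric])
  finally have "pos n (seed_shift s) = cell_shift (b * b ^ nat n) (fst s)" .
  thus ?thesis using True by (simp add: pos_def nat_add_distrib)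
next
  case False
  define k where "k = nat (- n) - 1"
  have k: "n = - int (Suc k)" using False unfolding k_def by simp
  have "pos n (seed_shift s) = past (Suc k) (seed_shift s)" unfolding k by (rule pos_minus[OF seed_good_shift[OF s]])
  moreover have "pos (n + 1) s = past k s" using pos_minus[OF s, of k] unfolding k by simp
  ultimately show ?thesis using past_seed_shift[OF s, of k] by (simp only:)
qed

text \<open>The normalised image of \<mu> under the map sending y to \<open>b ^ n\<close> times y
  plus \<open>pos n s\<close>: scaled to time n, with the origin placed at the position. Negative
  times zoom out, hence the integer power.\<close>

definition ext_state :: "int \<Rightarrow> (real ^ 'd) measure \<Rightarrow> (real ^ 'd) \<times> (nat \<Rightarrow> real ^ 'd) \<Rightarrow> (real ^ 'd) measure" where
  "ext_state n \<mu> s = magnify (real b powi n) (- (1 / (real b powi n)) *\<^sub>R pos n s) \<mu>"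

lemma powi_pos: "real b powi n > 0"
  using b0 by (simp add: zero_less_power_int)

text \<open>The coordinates of the position are below 1 in absolute value, so the origin, a point of
  the support, is interior to the window.\<close>

lemma ext_state_window:
  assumes \<mu>: "\<mu> \<in> scale_dom" and s: "seed_good s"
  shows "emeasure \<mu> (window (real b powi n) (- (1 / (real b powi n)) *\<^sub>R pos n s)) > 0"
proof (rule window_pos_of_msupp[OF _ _ powi_pos])
  show "0 \<in> msupp \<mu>" using \<mu> by (simp add: scale_dom_def)
  show "sets \<mu> = sets borel" using \<mu> by (intro radon_sets Mstar_radon scale_dom_Mstar)
  fix i
  have "pos n s \<in> B1" using pos_good(1)[OF s] half_open_unit_subset by blast
  from irrational_unit[OF pos_good(2)[OF s] this]
  have "\<bar>pos n s $ i\<bar> < 1" .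
  hence "\<bar>1 / (real b powi n)\<bar> * \<bar>pos n s $ i\<bar> < 1 / (real b powi n) * 1"
    using powi_pos[of n] by (simp add: divide_strict_right_mono)
  thus "\<bar>0 $ i - (- (1 / real b powi n) *\<^sub>R pos n s) $ i\<bar> < 1 / real b powi n"
    unfolding abs_mult[symmetric] by simp
qed

lemma ext_state_Mstar:
  assumes \<mu>: "\<mu> \<in> scale_dom" and s: "seed_good s"
  shows "ext_state n \<mu> s \<in> topspace Mstar"
  unfolding ext_state_def
  using ext_state_window[OF assms] Mstar_radon[OF scale_dom_Mstar[OF \<mu>]] powi_pos
  by (subst magnify_in_Mstar_iff) auto

lemma ext_state_0: "seed_good s \<Longrightarrow> ext_state 0 \<mu> s = magnify 1 (- fst s) \<mu>"
  by (simp add: ext_state_def pos_0)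

text \<open>Magnification at the cell of the position has linear part \<open>b ^ k\<close> and
  carries \<open>pos n s\<close> to \<open>pos (n + k) s\<close>, so it preserves the form of
  \<open>ext_state\<close>.\<close>

lemma ext_state_step:
  assumes \<mu>: "\<mu> \<in> scale_dom" and s: "seed_good s"
  shows "magnify (real (b ^ k)) (cell_center (b ^ k) (pos n s)) (ext_state n \<mu> s) = ext_state (n + int k) \<mu> s"
proof -
  let ?\<beta> = "real b powi n" and ?c = "cell_center (b ^ k) (pos n s)"
  have bk: "real (b ^ k) > 0" using bn0[of k] by simp
  have "magnify (real (b ^ k)) ?c (ext_state n \<mu> s) = magnify (real (b ^ k) * ?\<beta>) (- (1 / ?\<beta>) *\<^sub>R pos n s + (1 / ?\<beta>) *\<^sub>R ?c) \<mu>"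
    unfolding ext_state_def
    by (rule magnify_magnify[OF Mstar_radon[OF scale_dom_Mstar[OF \<mu>]] bk powi_pos ext_state_window[OF assms]])
  also have "real (b ^ k) * ?\<beta> = real b powi (n + int k)"
    using b0 by (simp add: power_int_add mult.commute)
  also have "- (1 / ?\<beta>) *\<^sub>R pos n s + (1 / ?\<beta>) *\<^sub>R ?c = - (1 / (real b powi (n + int k))) *\<^sub>R pos (n + int k) s"
  proof -
    have "(1 / (real b powi (n + int k))) *\<^sub>R pos (n + int k) s = (1 / ?\<beta>) *\<^sub>R (pos n s - ?c)"
      unfolding pos_shift_iterate[OF s, symmetric] cell_shift_def using b0 by (simp add: power_int_add)
    thus ?thesis by (simp add: scaleR_diff_right)
  qed
  finally show ?thesis unfolding ext_state_def .
qed

definition frame :: "int \<Rightarrow> (real ^ 'd) measure \<times> ((real ^ 'd) \<times> (nat \<Rightarrow> real ^ 'd)) \<Rightarrow> (real ^ 'd) measure \<times> (real ^ 'd)" where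
  "frame n w = (restrict_B1 (ext_state n (fst w) (snd w)), pos n (snd w))"

lemma frame_topspace:
  assumes "\<mu> \<in> scale_dom" "seed_good s"
  shows "frame n (\<mu>, s) \<in> topspace Mbox_B1"
  unfolding frame_def topspace_Mbox_B1
  using restrict_B1_in_Mbox[OF ext_state_Mstar[OF assms]] pos_good(1)[OF assms(2)] half_open_unit_subset by auto

text \<open>The extended measure is magnified and restricted afterwards, while the CP map also
  restricts beforehand. Both agree because the closed cell of the position lies in
  \<open>B1\<close>.\<close>

lemma frame_step:
  assumes \<mu>: "\<mu> \<in> scale_dom" and s: "seed_good s"
  shows "frame (n + 1) (\<mu>, s) = CP_map b (frame n (\<mu>, s))"
proof -
  have "CP_map b (frame n (\<mu>, s)) =
      (restrict_B1 (magnify (real b) (cell_center b (pos n s)) (restrict_B1 (ext_state n \<mu> s))), cell_shift b (pos n s))"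
    by (simp only: frame_def fst_conv snd_conv CP_map_eq[OF b0])
  also have "restrict_B1 (magnify (real b) (cell_center b (pos n s)) (restrict_B1 (ext_state n \<mu> s))) =
      restrict_B1 (magnify (real b) (cell_center b (pos n s)) (ext_state n \<mu> s))"
    by (intro restrict_magnify_restrict window_cell_subset_B1 b0 pos_good(1)[OF s]) (simp add: ext_state_def)
  also have "magnify (real b) (cell_center b (pos n s)) (ext_state n \<mu> s) = ext_state (n + 1) \<mu> s"
    using ext_state_step[OF assms, of 1 n] by simp
  finally show ?thesis unfolding frame_def using pos_step[OF s] by simp
qed

lemma pos_msupp_ext_state:
  assumes \<mu>: "\<mu> \<in> scale_dom"
  shows "pos n s \<in> msupp (ext_state n \<mu> s)"
proof -
  have "0 \<in> msupp \<mu>" using \<mu> by (simp add: scale_dom_def)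
  from msupp_magnify[OF Mstar_radon[OF scale_dom_Mstar[OF \<mu>]] powi_pos this, of n "- (1 / (real b powi n)) *\<^sub>R pos n s"]
  show ?thesis unfolding ext_state_def using powi_pos[of n] b0 by simp
qed

text \<open>The support point 0 of \<mu> is carried to the position. Being irrational, the position
  is interior to its half-open cell, which therefore has positive mass.\<close>

lemma frame_CP_dom:
  assumes \<mu>: "\<mu> \<in> scale_dom" and s: "seed_good s"
  shows "frame n (\<mu>, s) \<in> CP_dom b"
proof -
  let ?z = "pos n s" and ?\<nu> = "ext_state n \<mu> s"
  let ?c = "cell_center b ?z"
  have zB: "?z \<in> half_open_cube 0 1" "irrational_point ?z" by (rule pos_good[OF s])+
  define U where "U = {y. \<forall>i. \<bar>y $ i - ?c $ i\<bar> < 1 / real b}"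
  have "U = (\<Inter>i. {y. \<bar>y $ i - ?c $ i\<bar> < 1 / real b})" unfolding U_def by blast
  also have "open \<dots>" by (intro open_INT open_Collect_less continuous_intros ballI) simp
  finally have oU: "open U" .
  have zU: "?z \<in> U" unfolding U_def
  proof (intro CollectI allI)
    fix i
    have b1: "?c $ i - 1 / real b \<le> ?z $ i \<and> ?z $ i < ?c $ i + 1 / real b"
      using mem_cell[OF b0, of ?z] unfolding mem_half_open_cube by blast
    have "?c $ i - 1 / real b \<in> \<rat>" by (intro Rats_diff cell_center_rat Rats_divide) auto
    hence "?c $ i - 1 / real b \<noteq> ?z $ i" using zB(2) unfolding irrational_point_def by metis
    thus "\<bar>?z $ i - ?c $ i\<bar> < 1 / real b" using b1 by (auto simp: abs_less_iff)
  qed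
  have "emeasure ?\<nu> U > 0" using pos_msupp_ext_state[OF \<mu>, of n s] oU zU unfolding msupp_def by blast
  also have "emeasure ?\<nu> U \<le> emeasure ?\<nu> (B1 \<inter> half_open_cube ?c (1 / real b))"
  proof (rule emeasure_mono)
    have "U \<subseteq> half_open_cube ?c (1 / real b)"
    proof
      fix y assume y: "y \<in> U"
      show "y \<in> half_open_cube ?c (1 / real b)" unfolding mem_half_open_cube
      proof
        fix i have "\<bar>y $ i - ?c $ i\<bar> < 1 / real b" using y unfolding U_def by blast
        thus "?c $ i - 1 / real b \<le> y $ i \<and> y $ i < ?c $ i + 1 / real b" by (auto simp: abs_less_iff)
      qed
    qed
    moreover have "half_open_cube ?c (1 / real b) \<subseteq> B1"
      using cell_subset_window[OF b0] window_cell_subset_B1[OF b0 zB(1)] by blast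
    ultimately show "U \<subseteq> B1 \<inter> half_open_cube ?c (1 / real b)" by blast
  qed (simp add: ext_state_def)
  also have "\<dots> = emeasure (restrict_B1 ?\<nu>) (half_open_cube ?c (1 / real b))"
    by (rule emeasure_restrict_B1[symmetric]) (simp_all add: ext_state_def)
  finally show ?thesis
    using frame_topspace[OF assms, of n] unfolding frame_def by (simp add: mem_CP_dom[OF b0] topspace_Mbox_B1)
qed

text \<open>Scaling \<mu> once and shifting the seed amounts to moving time by one. As the laws of
  both are invariant, the process is stationary.\<close>

lemma ext_state_zoom:
  assumes \<mu>: "\<mu> \<in> scale_dom" and s: "seed_good s"
  shows "ext_state n (zoom 1 \<mu>) (seed_shift s) = ext_state (n + 1) \<mu> s"
proof -
  have "ext_state n (zoom 1 \<mu>) (seed_shift s) = magnify (real b powi n) (- (1 / (real b powi n)) *\<^sub>R pos (n + 1) s) (magnify (real b) 0 \<mu>)"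
    unfolding ext_state_def pos_seed_shift[OF s] zoom_def using \<mu> by simp
  also have "\<dots> = magnify (real b powi n * real b) ((1 / real b) *\<^sub>R (- (1 / (real b powi n)) *\<^sub>R pos (n + 1) s)) \<mu>"
    using b0 by (intro magnify_magnify_0[OF \<mu>] powi_pos) simp
  also have "real b powi n * real b = real b powi (n + 1)" using b0 by (simp add: power_int_add)
  also have "(1 / real b) *\<^sub>R (- (1 / (real b powi n)) *\<^sub>R pos (n + 1) s) = - (1 / (real b powi (n + 1))) *\<^sub>R pos (n + 1) s"
    using b0 by (simp add: power_int_add mult.commute)
  finally show ?thesis unfolding ext_state_def .
qed

end

section \<open>Extending a given orbit\<close>

lemma emeasure_magnify_restrict:
  assumes s: "sets \<nu> = sets borel" and sub: "window r c \<subseteq> B1" and A: "A \<in> sets borel"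
  shows "emeasure (magnify r c (restrict_B1 \<nu>)) A =
    emeasure \<nu> (B1 \<inter> (\<lambda>y. r *\<^sub>R (y - c)) -` A) / emeasure \<nu> (window r c)"
proof -
  have "B1 \<inter> window r c = window r c" using sub by blast
  thus ?thesis
    using emeasure_magnify[of "restrict_B1 \<nu>" A r c] emeasure_restrict_B1[OF s preimage_homothety_borel[OF A], of r c]
      emeasure_restrict_B1[OF s window_borel, of r c] s A by simp
qed

lemma emeasure_magnify_restrict_le:
  assumes s: "sets \<nu> = sets borel" and sub: "window r c \<subseteq> B1" and A: "A \<in> sets borel"
  shows "emeasure (magnify r c (restrict_B1 \<nu>)) A \<le> emeasure (magnify r c \<nu>) A"
  unfolding emeasure_magnify_restrict[OF assms] emeasure_magnify[OF s A]
  by (intro divide_right_mono_ennreal emeasure_mono) (use preimage_homothety_borel[OF A] s in auto)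

text \<open>Both approximations magnify the same measure \<open>?\<nu>\<close>, the earlier one
  after restriction to \<open>B1\<close>.\<close>

lemma extension_approx_mono:
  fixes \<omega> :: "int \<Rightarrow> (real ^ 'd) measure \<times> (real ^ 'd)"
  assumes b: "b > 0" and \<omega>: "\<omega> \<in> CP_orbits b" and A: "A \<in> sets borel"
  shows "emeasure (extension_approx b \<omega> n) A \<le> emeasure (extension_approx b \<omega> (Suc n)) A"
proof -
  let ?k = "- int (Suc n)"
  obtain \<mu> x where \<mu>x: "\<omega> ?k = (\<mu>, x)" by (cases "\<omega> ?k")
  have "\<omega> ?k \<in> CP_dom b" "\<omega> (?k + 1) = CP_map b (\<omega> ?k)" using \<omega> unfolding CP_orbits_def by blast+
  hence dom: "(\<mu>, x) \<in> CP_dom b" and step: "\<omega> (?k + 1) = CP_map b (\<mu>, x)" unfolding \<mu>x .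
  have k: "?k + 1 = - int n" by simp
  let ?d = "cell_center b x" and ?y = "cell_shift b x"
  let ?\<nu> = "magnify (real b) ?d \<mu>"
  have bn: "b ^ n > 0" using b by simp
  have r: "\<mu> \<in> radon_measures" using dom b by (intro Mbox_radon) (simp add: mem_CP_dom)
  have n0: "extension_approx b \<omega> n = magnify (real (b ^ n)) (cell_center (b ^ n) ?y) (restrict_B1 ?\<nu>)"
    unfolding extension_approx_eq[OF b] k[symmetric] step CP_map_eq[OF b] by simp
  have "extension_approx b \<omega> (Suc n) = magnify (real (b ^ Suc n)) (cell_center (b ^ Suc n) x) \<mu>"
    unfolding extension_approx_eq[OF b] \<mu>x by simp
  also have "cell_center (b ^ Suc n) x = ?d + (1 / real b) *\<^sub>R cell_center (b ^ n) ?y"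
    using cell_center_mult[OF b bn, of x] by simp
  also have "real (b ^ Suc n) = real (b ^ n) * real b" by simp
  also have "magnify (real (b ^ n) * real b) (?d + (1 / real b) *\<^sub>R cell_center (b ^ n) ?y) \<mu> =
      magnify (real (b ^ n)) (cell_center (b ^ n) ?y) ?\<nu>"
    by (rule magnify_magnify[symmetric, OF r _ _ CP_map_topspace(2)[OF b dom]]) (use b in auto)
  finally have n1: "extension_approx b \<omega> (Suc n) = magnify (real (b ^ n)) (cell_center (b ^ n) ?y) ?\<nu>" .
  show ?thesis unfolding n0 n1
    by (rule emeasure_magnify_restrict_le[OF sets_magnify window_cell_subset_B1[OF bn cell_shift_mem[OF b]] A])
qed

lemma sets_extension_approx: "b > 0 \<Longrightarrow> sets (extension_approx b \<omega> n) = sets borel"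
  by (simp add: extension_approx_eq)

text \<open>Along an orbit the values increase, so the limit is a supremum, and suprema of
  increasing sequences of measures are countably additive.\<close>

lemma emeasure_extension_measure:
  fixes \<omega> :: "int \<Rightarrow> (real ^ 'd) measure \<times> (real ^ 'd)"
  assumes b: "b > 0" and \<omega>: "\<omega> \<in> CP_orbits b" and A: "A \<in> sets borel"
  shows "emeasure (extension_measure b \<omega>) A = (SUP n. emeasure (extension_approx b \<omega> n) A)"
proof -
  let ?m = "\<lambda>n. emeasure (extension_approx b \<omega> n)"
  have inc: "incseq (\<lambda>n. ?m n S)" if "S \<in> sets borel" for S
    by (intro incseq_SucI extension_approx_mono b \<omega> that)
  have lim: "lim (\<lambda>n. ?m n S) = (SUP n. ?m n S)" if "S \<in> sets borel" for S
    using LIMSEQ_SUP[OF inc[OF that]] by (rule limI)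
  have "extension_measure b \<omega> = measure_of UNIV (sets borel) (\<lambda>S. SUP n. ?m n S)"
    unfolding extension_measure_def by (intro measure_of_eq) (auto simp: sets.sigma_sets_eq[of borel, simplified] lim)
  moreover have "emeasure (measure_of UNIV (sets borel) (\<lambda>S. SUP n. ?m n S)) A = (SUP n. ?m n A)"
  proof (rule emeasure_measure_of_sigma)
    show "sigma_algebra UNIV (sets (borel :: (real ^ 'd) measure))"
      using sets.sigma_algebra_axioms[of "borel :: (real ^ 'd) measure"] by simp
    show "positive (sets borel) (\<lambda>S. SUP n. ?m n S)" by (simp add: positive_def)
    show "countably_additive (sets borel) (\<lambda>S. SUP n. ?m n S)"
      unfolding countably_additive_def
    proof (intro allI impI)
      fix F :: "nat \<Rightarrow> (real ^ 'd) set"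
      assume F: "range F \<subseteq> sets borel" "disjoint_family F" "\<Union> (range F) \<in> sets borel"
      have Fi: "F i \<in> sets borel" for i using F(1) by blast
      have "(\<Sum>i. SUP n. ?m n (F i)) = (SUP n. \<Sum>i. ?m n (F i))"
        by (rule ennreal_suminf_SUP_eq) (rule inc[OF Fi])
      also have "\<dots> = (SUP n. ?m n (\<Union> (range F)))"
        by (intro SUP_cong refl suminf_emeasure F(2)) (use F(1) sets_extension_approx[OF b] in auto)
      finally show "(\<Sum>i. SUP n. ?m n (F i)) = (SUP n. ?m n (\<Union> (range F)))" .
    qed
  qed (rule A)
  ultimately show ?thesis by simp
qed

lemma sets_extension_measure: "sets (extension_measure b \<omega>) = sets borel"
  unfolding extension_measure_def
  using sets.sigma_sets_eq[of "borel"] by (subst sets_measure_of) auto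

section \<open>The law of the stationary process\<close>

context scaling_system
begin

abbreviation boxes :: "((real ^ 'd) measure \<times> (real ^ 'd)) measure" where
  "boxes \<equiv> borel_of Mbox_B1"

abbreviation paths :: "(int \<Rightarrow> (real ^ 'd) measure \<times> (real ^ 'd)) measure" where
  "paths \<equiv> PiM UNIV (\<lambda>_. boxes)"

definition joint :: "((real ^ 'd) measure \<times> ((real ^ 'd) \<times> (nat \<Rightarrow> real ^ 'd))) measure" where
  "joint = p \<Otimes>\<^sub>M seed_law"

definition good :: "(real ^ 'd) measure \<times> ((real ^ 'd) \<times> (nat \<Rightarrow> real ^ 'd)) \<Rightarrow> bool" where
  "good w \<longleftrightarrow> fst w \<in> scale_dom \<and> seed_good (snd w)"

text \<open>The constant default off the good set keeps all values in the path space; the good set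
  has full measure.\<close>

definition proc :: "(real ^ 'd) measure \<times> ((real ^ 'd) \<times> (nat \<Rightarrow> real ^ 'd)) \<Rightarrow> int \<Rightarrow> (real ^ 'd) measure \<times> (real ^ 'd)" where
  "proc w = (\<lambda>n. if good w then frame n w else (return borel 0, 0))"

definition path_law :: "(int \<Rightarrow> (real ^ 'd) measure \<times> (real ^ 'd)) measure" where
  "path_law = distr joint paths proc"

lemma fst_seed_measurable: "fst \<in> borel_measurable seed_law"
  unfolding seed_law_def by measurable

lemma snd_seed_measurable: "(\<lambda>s. snd s k) \<in> borel_measurable seed_law"
  unfolding seed_law_def by measurable

lemma past_measurable: "past k \<in> borel_measurable seed_law"
proof (induction k)
  case 0
  thus ?case using fst_seed_measurable by simp
next
  case (Suc k)
  note [measurable] = Suc snd_seed_measurable[of k]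
  have "(\<lambda>s. snd s k + (1 / real b) *\<^sub>R past k s) \<in> borel_measurable seed_law" by measurable
  thus ?case by simp
qed

lemma pos_measurable: "pos n \<in> borel_measurable seed_law"
proof (cases "n \<ge> 0")
  case True
  hence "pos n = (\<lambda>s. cell_shift (b ^ nat n) (fst s))" by (auto simp: pos_def)
  thus ?thesis using measurable_compose[OF fst_seed_measurable cell_shift_measurable] by simp
next
  case False
  hence "pos n = past (nat (- n))" by (auto simp: pos_def)
  thus ?thesis using past_measurable by simp
qed

lemma seed_good_sets: "{s \<in> space seed_law. seed_good s} \<in> sets seed_law"
proof -
  note [measurable] = fst_seed_measurable snd_seed_measurable irrational_point_measurable
  have "finite (cell_center b ` half_open_cube (0 :: real ^ 'd) 1)" by (rule finite_cell_centers[OF b0])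
  hence [measurable]: "cell_center b ` half_open_cube (0 :: real ^ 'd) 1 \<in> sets borel"
    by (intro borel_closed finite_imp_closed)
  have "{s \<in> space seed_law. fst s \<in> B1 \<and> fst s \<in> {x. irrational_point x} \<and> (\<forall>k. snd s k \<in> cell_center b ` half_open_cube 0 1)} \<in> sets seed_law"
    by measurable
  thus ?thesis by (simp add: seed_good_def)
qed

lemma AE_seed_good: "AE s in seed_law. seed_good s"
proof -
  let ?U = "unif_B1 :: (real ^ 'd) measure" and ?S = "PiM UNIV (\<lambda>_::nat. digit_law)"
  interpret U: prob_space ?U by (rule prob_space_unif_B1)
  interpret S: prob_space ?S by (rule prob_space_PiM) (rule prob_digit_law)
  interpret pair_prob_space ?U ?S ..
  have "finite (cell_center b ` half_open_cube (0 :: real ^ 'd) 1)" by (rule finite_cell_centers[OF b0])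
  hence I: "cell_center b ` half_open_cube (0 :: real ^ 'd) 1 \<in> sets borel"
    by (intro borel_closed finite_imp_closed)
  have "AE z in ?U. cell_center b z \<in> cell_center b ` half_open_cube 0 1"
    using AE_unif_B1_irrational by eventually_elim (use irrational_half_open in blast)
  hence "AE d in digit_law. d \<in> cell_center b ` half_open_cube 0 1"
    unfolding digit_law_def using I by (subst AE_distr_iff) auto
  hence "AE u in ?S. \<forall>k. u k \<in> cell_center b ` half_open_cube 0 1"
    by (subst AE_all_countable) (intro allI AE_PiM_component prob_digit_law; simp)
  moreover have "{s \<in> space (?U \<Otimes>\<^sub>M ?S). seed_good s} \<in> sets (?U \<Otimes>\<^sub>M ?S)"
    using seed_good_sets unfolding seed_law_def .
  moreover have "AE z in ?U. AE u in ?S. seed_good (z, u)"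
    using AE_unif_B1_irrational
  proof eventually_elim
    case (elim z)
    show ?case using calculation(1) by eventually_elim (use elim in \<open>auto simp: seed_good_def\<close>)
  qed
  ultimately show ?thesis unfolding seed_law_def by (intro AE_pair_measure)
qed

sublocale seed: prob_space seed_law by (rule prob_seed_law)

sublocale js: pair_prob_space p seed_law ..

lemma prob_joint: "prob_space joint"
  unfolding joint_def by (rule js.prob_space_axioms)

lemma scale_dom_in_p: "{\<mu> \<in> space p. \<mu> \<in> scale_dom} \<in> sets p"
  using sets.Int[OF sets.top scale_dom_sets] sets_p sets_eq_imp_space_eq[OF sets_p] by (simp add: Int_def)

lemma good_sets: "{w \<in> space joint. good w} \<in> sets joint"
proof -
  have "{w \<in> space joint. good w} = {\<mu> \<in> space p. \<mu> \<in> scale_dom} \<times> {s \<in> space seed_law. seed_good s}"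
    by (auto simp: joint_def space_pair_measure good_def)
  thus ?thesis unfolding joint_def using scale_dom_in_p seed_good_sets by simp
qed

lemma AE_good: "AE w in joint. good w"
  unfolding joint_def
proof (rule js.AE_pair_measure)
  show "{w \<in> space (p \<Otimes>\<^sub>M seed_law). good w} \<in> sets (p \<Otimes>\<^sub>M seed_law)" using good_sets by (simp add: joint_def)
  show "AE \<mu> in p. AE s in seed_law. good (\<mu>, s)"
    using dom_p
  proof eventually_elim
    case (elim \<mu>)
    show ?case using AE_seed_good by eventually_elim (use elim in \<open>simp add: good_def\<close>)
  qed
qed

lemma fst_joint_Mstar: "fst \<in> measurable joint (borel_of Mstar)"
  unfolding joint_def using measurable_fst[of p seed_law] unfolding measurable_cong_sets[OF refl sets_p] .

lemma fst_joint_weak: "fst \<in> measurable joint (borel_of weak_topology)"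
  by (rule measurable_compose[OF fst_joint_Mstar measurable_Mstar_weak])

lemma snd_joint: "snd \<in> measurable joint seed_law"
  unfolding joint_def by simp

lemma pos_joint_measurable: "(\<lambda>w. pos n (snd w)) \<in> borel_measurable joint"
  by (rule measurable_compose[OF snd_joint pos_measurable])

lemma emeasure_ext_state_measurable:
  assumes A: "A \<in> sets borel"
  shows "(\<lambda>w. emeasure (ext_state n (fst w) (snd w)) A) \<in> borel_measurable joint"
proof -
  note [measurable] = pos_joint_measurable[of n]
  show ?thesis unfolding ext_state_def
    by (rule measurable_emeasure_magnify[OF fst_joint_weak _ A]) measurable
qed

lemma default_Mbox_B1: "(return borel 0, 0) \<in> topspace (Mbox_B1 :: ((real ^ 'd) measure \<times> (real ^ 'd)) topology)"
  using return_0_Mbox by (simp add: topspace_Mbox_B1 mem_B1)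

lemma proc_component: "(\<lambda>w. proc w n) \<in> measurable joint boxes"
proof (rule measurable_Mbox_B1I)
  fix w assume "w \<in> space joint"
  show "proc w n \<in> topspace Mbox_B1"
    using default_Mbox_B1 frame_topspace[of "fst w" "snd w" n] by (auto simp: proc_def good_def)
next
  fix A :: "(real ^ 'd) set" assume A: "A \<in> sets borel"
  have "B1 \<inter> A \<in> sets borel" using A by simp
  from emeasure_ext_state_measurable[OF this]
  have "(\<lambda>w. emeasure (restrict_B1 (ext_state n (fst w) (snd w))) A) \<in> borel_measurable joint"
    using A by (simp add: emeasure_restrict_B1 ext_state_def)
  hence "(\<lambda>w. if good w then emeasure (restrict_B1 (ext_state n (fst w) (snd w))) A else emeasure (return borel 0) A) \<in> borel_measurable joint"
    by (intro measurable_If good_sets) simp_all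
  thus "(\<lambda>w. emeasure (fst (proc w n)) A) \<in> borel_measurable joint"
    unfolding proc_def frame_def by (simp add: if_distrib[of "\<lambda>z. emeasure (fst z) A"] cong: if_cong)
next
  have "(\<lambda>w. if good w then pos n (snd w) else 0) \<in> borel_measurable joint"
    by (intro measurable_If good_sets pos_joint_measurable) simp_all
  thus "(\<lambda>w. snd (proc w n)) \<in> borel_measurable joint"
    unfolding proc_def frame_def by (simp add: if_distrib[of snd] cong: if_cong)
qed

lemma proc_measurable: "proc \<in> measurable joint paths"
proof -
  have "(\<lambda>w n. proc w n) \<in> measurable joint paths"
    by (rule measurable_PiM_single') (auto simp: proc_component measurable_space[OF proc_component, simplified])
  thus ?thesis by simp
qed

lemma sets_path_law: "sets path_law = sets paths"
  by (simp add: path_law_def)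

lemma prob_path_law: "prob_space path_law"
  unfolding path_law_def by (rule prob_space.prob_space_distr[OF prob_joint proc_measurable])

lemma proc_CP_orbits: "good w \<Longrightarrow> proc w \<in> CP_orbits b"
  using frame_CP_dom[of "fst w" "snd w"] frame_step[of "fst w" "snd w"]
  by (auto simp: CP_orbits_def proc_def good_def simp del: CP_map.simps)

lemma AE_path_law:
  assumes "{\<omega> \<in> space paths. Q \<omega>} \<in> sets paths" "AE w in joint. Q (proc w)"
  shows "AE \<omega> in path_law. Q \<omega>"
  unfolding path_law_def using assms by (subst AE_distr_iff[OF proc_measurable]) auto

lemma CP_orbits_Collect: "{\<omega> \<in> space paths. \<omega> \<in> CP_orbits b} \<in> sets paths"
  using sets.Int[OF sets.top CP_orbits_sets[OF b0]] by (simp only: Int_def mem_Collect_eq)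

lemma AE_CP_orbits: "AE \<omega> in path_law. \<omega> \<in> CP_orbits b"
  by (rule AE_path_law[OF CP_orbits_Collect]) (use AE_good proc_CP_orbits in auto)

definition step :: "(real ^ 'd) measure \<times> ((real ^ 'd) \<times> (nat \<Rightarrow> real ^ 'd)) \<Rightarrow> (real ^ 'd) measure \<times> ((real ^ 'd) \<times> (nat \<Rightarrow> real ^ 'd))" where
  "step w = (zoom 1 (fst w), seed_shift (snd w))"

lemma distr_step: "distr joint joint step = joint"
proof -
  have "sigma_finite_measure (distr seed_law seed_law seed_shift)"
    unfolding distr_seed_shift by unfold_locales
  from pair_measure_distr[OF zoom_measurable[of 1] seed_shift_measurable this]
  show ?thesis unfolding distr_seed_shift distr_zoom joint_def step_def by (simp add: case_prod_beta')
qed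

lemma step_measurable: "step \<in> measurable joint joint"
  unfolding joint_def step_def using zoom_measurable[of 1] seed_shift_measurable by measurable

lemma good_step: "good w \<Longrightarrow> good (step w)"
  by (simp add: good_def step_def zoom_scale_dom seed_good_shift)

lemma proc_step:
  assumes "good w"
  shows "proc (step w) = (\<lambda>n. proc w (n + 1))"
  using assms good_step[OF assms] ext_state_zoom[of "fst w" "snd w"] pos_seed_shift[of "snd w"]
  by (auto simp: proc_def frame_def good_def step_def fun_eq_iff)

lemma shift_measurable: "(\<lambda>\<omega> n. \<omega> (n + 1)) \<in> measurable paths (paths :: (int \<Rightarrow> (real ^ 'd) measure \<times> (real ^ 'd)) measure)"
  by (rule measurable_PiM_single') (auto simp: space_PiM PiE_iff intro!: measurable_component_singleton)

text \<open>On the good set \<open>proc\<close> intertwines the shift of paths with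
  \<open>step\<close>, and \<open>step\<close> preserves the joint law.\<close>

lemma distr_path_shift: "distr path_law path_law (\<lambda>\<omega> n. \<omega> (n + 1)) = path_law"
proof -
  have "distr path_law path_law (\<lambda>\<omega> n. \<omega> (n + 1)) = distr path_law paths (\<lambda>\<omega> n. \<omega> (n + 1))"
    by (rule distr_cong) (auto simp: sets_path_law)
  also have "\<dots> = distr joint paths ((\<lambda>\<omega> n. \<omega> (n + 1)) \<circ> proc)"
    unfolding path_law_def by (rule distr_distr[OF shift_measurable proc_measurable])
  also have "\<dots> = distr joint paths (proc \<circ> step)"
  proof (rule distr_cong_AE[OF refl refl])
    show "AE w in joint. ((\<lambda>\<omega> n. \<omega> (n + 1)) \<circ> proc) w = (proc \<circ> step) w"
      using AE_good by eventually_elim (simp add: proc_step)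
  qed (rule measurable_comp[OF proc_measurable shift_measurable] measurable_comp[OF step_measurable proc_measurable])+
  also have "\<dots> = distr (distr joint joint step) paths proc"
    by (rule distr_distr[symmetric, OF proc_measurable step_measurable])
  also have "\<dots> = path_law" unfolding distr_step path_law_def ..
  finally show ?thesis .
qed

definition box_law :: "((real ^ 'd) measure \<times> (real ^ 'd)) measure" where
  "box_law = distr path_law boxes (\<lambda>\<omega>. \<omega> 0)"

lemma two_sided: "two_sided_process b box_law path_law"
  unfolding two_sided_process_def box_law_def
  using prob_path_law sets_path_law distr_path_shift AE_CP_orbits by simp

lemma component_measurable: "(\<lambda>\<omega>. \<omega> n) \<in> measurable path_law boxes"
  unfolding measurable_cong_sets[OF sets_path_law refl] by (rule measurable_component_singleton) simp

lemma sets_box_law: "sets box_law = sets boxes" by (simp add: box_law_def)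

lemma prob_box_law: "prob_space box_law"
  unfolding box_law_def by (rule prob_space.prob_space_distr[OF prob_path_law component_measurable])

text \<open>The orbit relation between times 0 and 1 turns stationarity of the path law into
  invariance of its marginal under the CP map.\<close>

lemma invariant_box_law: "invariant_on (CP_dom b) (CP_map b) box_law"
proof -
  define g where "g = (\<lambda>w. if w \<in> CP_dom b then CP_map b w else (w :: (real ^ 'd) measure \<times> (real ^ 'd)))"
  have gm: "g \<in> measurable boxes boxes" unfolding g_def by (rule measurable_CP_map[OF b0])
  have gm': "g \<in> measurable box_law box_law"
    using gm unfolding measurable_cong_sets[OF sets_box_law sets_box_law] .
  have dm: "{w \<in> space boxes. w \<in> CP_dom b} \<in> sets boxes"
    using sets.Int[OF sets.top CP_dom_sets[OF b0]] by (simp only: Int_def mem_Collect_eq)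
  have dom: "AE w in box_law. w \<in> CP_dom b"
    unfolding box_law_def
    by (subst AE_distr_iff[OF component_measurable dm]) (use AE_CP_orbits in \<open>auto simp: CP_orbits_def elim: eventually_mono\<close>)
  have "CP_dom b \<inter> space box_law \<in> sets box_law"
    using CP_dom_sets[OF b0] by (intro sets.Int sets.top) (simp add: sets_box_law)
  from push_on_eq_distr_on[OF this dom gm', of "CP_map b"]
  have "push_on (CP_dom b) (CP_map b) box_law box_law = distr box_law box_law g" by (simp add: g_def)
  also have "\<dots> = distr box_law boxes g" by (rule distr_cong) (auto simp: sets_box_law)
  also have "\<dots> = distr path_law boxes (g \<circ> (\<lambda>\<omega>. \<omega> 0))"
    unfolding box_law_def by (rule distr_distr[OF gm component_measurable])
  also have "\<dots> = distr path_law boxes ((\<lambda>\<omega>. \<omega> 0) \<circ> (\<lambda>\<omega> n. \<omega> (n + 1)))"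
  proof (rule distr_cong_AE[OF refl refl])
    show "AE \<omega> in path_law. (g \<circ> (\<lambda>\<omega>. \<omega> 0)) \<omega> = ((\<lambda>\<omega>. \<omega> 0) \<circ> (\<lambda>\<omega> n. \<omega> (n + 1))) \<omega>"
      using AE_CP_orbits
    proof eventually_elim
      case (elim \<omega>)
      hence "\<omega> 0 \<in> CP_dom b" "\<omega> (0 + 1) = CP_map b (\<omega> 0)" unfolding CP_orbits_def by blast+
      thus ?case by (simp add: g_def)
    qed
    show "g \<circ> (\<lambda>\<omega>. \<omega> 0) \<in> measurable path_law boxes" by (intro measurable_comp[OF component_measurable gm])
    show "(\<lambda>\<omega>. \<omega> 0) \<circ> (\<lambda>\<omega> n. \<omega> (n + 1)) \<in> measurable path_law boxes"
      using component_measurable[of 1] by (simp add: comp_def)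
  qed
  also have "\<dots> = distr (distr path_law path_law (\<lambda>\<omega> n. \<omega> (n + 1))) boxes (\<lambda>\<omega>. \<omega> 0)"
    by (rule distr_distr[symmetric, OF component_measurable])
       (use shift_measurable in \<open>simp add: measurable_cong_sets[OF sets_path_law sets_path_law]\<close>)
  also have "\<dots> = box_law" unfolding distr_path_shift box_law_def ..
  finally show ?thesis unfolding invariant_on_def using dom by simp
qed

lemma distr_joint_base:
  "distr joint (p \<Otimes>\<^sub>M unif_B1) (\<lambda>w. (fst w, fst (snd w))) = p \<Otimes>\<^sub>M (unif_B1 :: (real ^ 'd) measure)"
proof -
  let ?U = "unif_B1 :: (real ^ 'd) measure" and ?S = "PiM UNIV (\<lambda>_::nat. digit_law)"
  interpret U: prob_space ?U by (rule prob_space_unif_B1)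
  interpret S: prob_space ?S by (rule prob_space_PiM) (rule prob_digit_law)
  have d: "distr seed_law ?U fst = ?U" unfolding seed_law_def by (rule S.distr_pair_fst)
  have sf: "sigma_finite_measure (distr seed_law ?U fst)" unfolding d by unfold_locales
  have fm: "fst \<in> measurable seed_law ?U" unfolding seed_law_def by simp
  from pair_measure_distr[OF measurable_ident_sets[OF refl] fm sf, of p]
  show ?thesis unfolding d joint_def by (simp add: case_prod_beta' distr_id2)
qed

end

context scaling_system
begin

section \<open>Extension and centering\<close>

text \<open>
  The windows seen from the past exhaust the space.
\<close>

definition wide :: "(real ^ 'd) \<times> (nat \<Rightarrow> real ^ 'd) \<Rightarrow> bool" where
  "wide s \<longleftrightarrow> (\<forall>m::nat. \<exists>n::nat. \<forall>i. \<bar>pos (- int n) s $ i\<bar> \<le> 1 - real (m + 1) / real (b ^ n))"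

text \<open>The approximations come from restrictions and never exceed the translated \<mu>. On a
  ball they agree with it once the preimage of the ball fits into \<open>B1\<close> as seen from a
  past time, which \<open>wide\<close> provides.\<close>

lemma extension_measure_proc:
  assumes g: "good w" and w: "wide (snd w)"
  shows "extension_measure b (proc w) = magnify 1 (- fst (snd w)) (fst w)"
proof (rule measure_eqI)
  obtain \<mu> s where ws: "w = (\<mu>, s)" by (cases w)
  have \<mu>: "\<mu> \<in> scale_dom" and s: "seed_good s" and wd: "wide s" using g w by (auto simp: good_def ws)
  fix A assume "A \<in> sets (extension_measure b (proc w))"
  hence A: "A \<in> sets borel" by (simp add: sets_extension_measure)
  let ?\<nu> = "magnify 1 (- fst s) \<mu>"
  define y where "y n = pos (- int n) s" for n
  define \<nu> where "\<nu> n = ext_state (- int n) \<mu> s" for n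
  define c where "c n = cell_center (b ^ n) (y n)" for n
  have yH: "y n \<in> half_open_cube 0 1" for n unfolding y_def by (rule pos_good(1)[OF s])
  have sub: "window (real (b ^ n)) (c n) \<subseteq> B1" for n
    unfolding c_def by (rule window_cell_subset_B1[OF bn0 yH])
  have approx: "extension_approx b (proc w) n = magnify (real (b ^ n)) (c n) (restrict_B1 (\<nu> n))" for n
    using g unfolding extension_approx_eq[OF b0] proc_def frame_def ws c_def y_def \<nu>_def by simp
  have full: "magnify (real (b ^ n)) (c n) (\<nu> n) = ?\<nu>" for n
    using ext_state_step[OF \<mu> s, of n "- int n"] ext_state_0[OF s, of \<mu>] unfolding c_def y_def \<nu>_def by simp
  have s\<nu>: "sets (\<nu> n) = sets borel" for n by (simp add: \<nu>_def ext_state_def)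
  have le: "emeasure (extension_approx b (proc w) n) A \<le> emeasure ?\<nu> A" for n
    using emeasure_magnify_restrict_le[OF s\<nu>[of n] sub[of n] A] unfolding approx full .
  have ge: "emeasure ?\<nu> (A \<inter> ball 0 (real m)) \<le> (SUP n. emeasure (extension_approx b (proc w) n) A)" for m
  proof -
    obtain n where n: "\<And>i. \<bar>y n $ i\<bar> \<le> 1 - real (m + 1) / real (b ^ n)" using wd unfolding wide_def y_def by blast
    have bn: "real (b ^ n) > 0" using bn0[of n] by simp
    let ?T = "\<lambda>y. real (b ^ n) *\<^sub>R (y - c n)"
    have Ab: "A \<inter> ball 0 (real m) \<in> sets borel" using A by simp
    have "?T -` (A \<inter> ball 0 (real m)) \<subseteq> B1"
    proof
      fix x assume "x \<in> ?T -` (A \<inter> ball 0 (real m))"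
      hence nx: "norm (?T x) < real m" by simp
      show "x \<in> B1" unfolding mem_B1
      proof
        fix i
        have "real (b ^ n) * \<bar>x $ i - c n $ i\<bar> = \<bar>?T x $ i\<bar>" by (simp add: abs_mult)
        also have "\<dots> \<le> norm (?T x)" by (rule component_le_norm_cart)
        finally have "\<bar>x $ i - c n $ i\<bar> * real (b ^ n) \<le> real m" using nx by (simp only: mult.commute)
        hence 1: "\<bar>x $ i - c n $ i\<bar> \<le> real m / real (b ^ n)" unfolding pos_le_divide_eq[OF bn] .
        have "c n $ i - 1 / real (b ^ n) \<le> y n $ i \<and> y n $ i < c n $ i + 1 / real (b ^ n)"
          using mem_cell[OF bn0, of "y n" n] unfolding c_def mem_half_open_cube by blast
        hence 2: "\<bar>y n $ i - c n $ i\<bar> \<le> 1 / real (b ^ n)" by (auto simp: abs_le_iff)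
        \<comment> \<open>The margin in \<open>wide\<close> splits into \<open>m / b ^ n\<close> for
          the ball and \<open>1 / b ^ n\<close> for the distance between the position and the centre
          of its cell.\<close>
        have 3: "real (m + 1) / real (b ^ n) = real m / real (b ^ n) + 1 / real (b ^ n)" by (simp add: add_divide_distrib)
        show "\<bar>x $ i\<bar> \<le> 1" using 1 2 n[of i] unfolding 3 by linarith
      qed
    qed
    hence "B1 \<inter> ?T -` (A \<inter> ball 0 (real m)) = ?T -` (A \<inter> ball 0 (real m))" by blast
    hence "emeasure (extension_approx b (proc w) n) (A \<inter> ball 0 (real m)) = emeasure ?\<nu> (A \<inter> ball 0 (real m))"
      unfolding approx emeasure_magnify_restrict[OF s\<nu> sub Ab] full[of n, symmetric] emeasure_magnify[OF s\<nu> Ab] by (simp only:)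
    hence "emeasure ?\<nu> (A \<inter> ball 0 (real m)) \<le> emeasure (extension_approx b (proc w) n) A"
      using emeasure_mono[OF Int_lower1[of A "ball 0 (real m)"], of "extension_approx b (proc w) n"] A sets_extension_approx[OF b0]
      by metis
    also have "\<dots> \<le> (SUP n. emeasure (extension_approx b (proc w) n) A)" by (rule SUP_upper) simp
    finally show ?thesis .
  qed
  have "emeasure ?\<nu> A = (SUP m. emeasure ?\<nu> (A \<inter> ball 0 (real m)))"
    by (rule emeasure_SUP_box[OF sets_magnify A])
  also have "\<dots> \<le> (SUP n. emeasure (extension_approx b (proc w) n) A)" by (rule SUP_least) (rule ge)
  finally have "emeasure ?\<nu> A \<le> (SUP n. emeasure (extension_approx b (proc w) n) A)" .
  moreover have "(SUP n. emeasure (extension_approx b (proc w) n) A) \<le> emeasure ?\<nu> A"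
    by (rule SUP_least) (rule le)
  ultimately show "emeasure (extension_measure b (proc w)) A = emeasure (magnify 1 (- fst (snd w)) (fst w)) A"
    unfolding emeasure_extension_measure[OF b0 proc_CP_orbits[OF g] A] by (simp add: ws)
qed (simp add: sets_extension_measure)

text \<open>Shifting the seed carries time -(n+1) to time -n, and the seed law is invariant, so
  every past position is distributed like the present one.\<close>

lemma distr_pos_minus: "distr seed_law borel (pos (- int n)) = (unif_B1 :: (real ^ 'd) measure)"
proof (induction n)
  case 0
  have "distr seed_law borel (pos (- int 0)) = distr seed_law borel fst"
    by (rule distr_cong_AE[OF refl refl _ pos_measurable fst_seed_measurable])
       (use AE_seed_good in \<open>eventually_elim, simp add: pos_0\<close>)
  also have "\<dots> = unif_B1"
  proof -
    interpret S: prob_space "PiM UNIV (\<lambda>_::nat. digit_law)" by (rule prob_space_PiM) (rule prob_digit_law)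
    have "distr seed_law borel fst = distr (unif_B1 \<Otimes>\<^sub>M PiM UNIV (\<lambda>_::nat. digit_law)) (unif_B1 :: (real ^ 'd) measure) fst"
      unfolding seed_law_def by (rule distr_cong) auto
    thus ?thesis using S.distr_pair_fst by simp
  qed
  finally show ?case .
next
  case (Suc n)
  have "distr seed_law borel (pos (- int (Suc n))) = distr (distr seed_law seed_law seed_shift) borel (pos (- int (Suc n)))"
    unfolding distr_seed_shift ..
  also have "\<dots> = distr seed_law borel (pos (- int (Suc n)) \<circ> seed_shift)"
    by (rule distr_distr[OF pos_measurable seed_shift_measurable])
  also have "\<dots> = distr seed_law borel (pos (- int n))"
  proof (rule distr_cong_AE[OF refl refl _ measurable_comp[OF seed_shift_measurable pos_measurable] pos_measurable])
    show "AE s in seed_law. (pos (- int (Suc n)) \<circ> seed_shift) s = pos (- int n) s"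
      using AE_seed_good
    proof eventually_elim
      case (elim s)
      have "- int (Suc n) + 1 = - int n" by simp
      thus ?case using pos_seed_shift[OF elim, of "- int (Suc n)"] by simp
    qed
  qed
  finally show ?case using Suc by simp
qed

text \<open>The sets decrease, and a point with all coordinates below 1 in absolute value leaves
  them as soon as the margin is smaller than its distance to the boundary.\<close>

lemma narrow_tendsto_0:
  "(\<lambda>n. emeasure unif_B1 {y :: real ^ 'd. \<exists>i. \<bar>y $ i\<bar> > 1 - real (m + 1) / real (b ^ n)}) \<longlonglongrightarrow> 0"
proof -
  interpret U: prob_space "unif_B1 :: (real ^ 'd) measure" by (rule prob_space_unif_B1)
  define C where "C n = {y :: real ^ 'd. \<exists>i. \<bar>y $ i\<bar> > 1 - real (m + 1) / real (b ^ n)}" for n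
  have Cb: "C n \<in> sets unif_B1" for n
  proof -
    have "C n = {y \<in> space borel. \<exists>i. \<bar>y $ i\<bar> > 1 - real (m + 1) / real (b ^ n)}" unfolding C_def by simp
    also have "\<dots> \<in> sets borel" by measurable
    finally show ?thesis by simp
  qed
  have dec: "decseq C"
  proof (rule decseq_SucI)
    fix n
    have "real (m + 1) / real (b ^ Suc n) \<le> real (m + 1) / real (b ^ n)"
      using b0 bn0[of n] by (intro divide_left_mono) (simp_all only: of_nat_le_iff of_nat_0_less_iff mult_pos_pos, simp_all)
    note le = this
    show "C (Suc n) \<subseteq> C n"
    proof
      fix y assume "y \<in> C (Suc n)"
      then obtain i where "\<bar>y $ i\<bar> > 1 - real (m + 1) / real (b ^ Suc n)" unfolding C_def by blast
      hence "\<bar>y $ i\<bar> > 1 - real (m + 1) / real (b ^ n)" using le by linarith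
      thus "y \<in> C n" unfolding C_def by blast
    qed
  qed
  have "(\<lambda>n. emeasure unif_B1 (C n)) \<longlonglongrightarrow> emeasure unif_B1 (\<Inter>n. C n)"
    by (rule Lim_emeasure_decseq[OF _ dec]) (use Cb in auto)
  also have "emeasure unif_B1 (\<Inter>n. C n) = 0"
  proof -
    have "AE y in unif_B1. y \<notin> (\<Inter>n. C n)"
      using AE_unif_B1_irrational
    proof eventually_elim
      case (elim y)
      define t where "t = Max (range (\<lambda>i. \<bar>y $ i\<bar>))"
      have t: "\<bar>y $ i\<bar> \<le> t" for i unfolding t_def by (intro Max_ge) auto
      have "t \<in> range (\<lambda>i. \<bar>y $ i\<bar>)" unfolding t_def by (intro Max_in) auto
      hence t1: "t < 1" using irrational_unit elim by auto
      have "(\<lambda>n. real (m + 1) * (1 / real b) ^ n) \<longlonglongrightarrow> real (m + 1) * 0"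
        using b2 by (intro tendsto_mult_left LIMSEQ_power_zero) simp
      hence "\<forall>\<^sub>F n in sequentially. real (m + 1) * (1 / real b) ^ n < 1 - t"
        using t1 by (intro order_tendstoD(2)[of _ 0]) simp_all
      then obtain n where "real (m + 1) * (1 / real b) ^ n < 1 - t"
        using eventually_happens[of _ sequentially] by auto
      hence "real (m + 1) / real (b ^ n) < 1 - t" by (simp add: power_divide)
      hence "\<bar>y $ i\<bar> \<le> 1 - real (m + 1) / real (b ^ n)" for i using t[of i] by linarith
      hence "y \<notin> C n" unfolding C_def by (simp add: not_less)
      thus ?case by blast
    qed
    from emeasure_eq_0_AE[OF this] show ?thesis
      by (simp only: space_unif_B1 UNIV_I simp_thms Collect_mem_eq)
  qed
  finally show ?thesis unfolding C_def .
qed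

text \<open>For a given m, failure at all times is contained in failure at each single time. The
  latter is a boundary event for a uniform point and its probability tends to 0.\<close>

lemma AE_wide: "AE s in seed_law. wide s"
proof -
  have "AE s in seed_law. \<exists>n::nat. \<forall>i. \<bar>pos (- int n) s $ i\<bar> \<le> 1 - real (m + 1) / real (b ^ n)" for m :: nat
  proof -
    define C where "C n = {y :: real ^ 'd. \<exists>i. \<bar>y $ i\<bar> > 1 - real (m + 1) / real (b ^ n)}" for n
    have Cb: "C n \<in> sets borel" for n
    proof -
      have "C n = {y \<in> space borel. \<exists>i. \<bar>y $ i\<bar> > 1 - real (m + 1) / real (b ^ n)}" unfolding C_def by simp
      also have "\<dots> \<in> sets borel" by measurable
      finally show ?thesis by simp
    qed
    define B where "B n = pos (- int n) -` C n \<inter> space seed_law" for n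
    have Bs: "B n \<in> sets seed_law" for n unfolding B_def by (rule measurable_sets[OF pos_measurable Cb])
    have Be: "emeasure seed_law (B n) = emeasure unif_B1 (C n)" for n
      unfolding B_def distr_pos_minus[of n, symmetric] by (rule emeasure_distr[symmetric, OF pos_measurable Cb])
    have "emeasure seed_law (\<Inter>n. B n) \<le> emeasure unif_B1 (C n)" for n
      unfolding Be[symmetric] by (rule emeasure_mono[OF _ Bs]) blast
    hence "emeasure seed_law (\<Inter>n. B n) \<le> 0"
      using narrow_tendsto_0[of m] unfolding C_def[symmetric] by (intro LIMSEQ_le_const) auto
    moreover have "(\<Inter>n. B n) \<in> sets seed_law" by (intro sets.countable_INT' image_subsetI Bs) auto
    ultimately have "(\<Inter>n. B n) \<in> null_sets seed_law" by (intro null_setsI) auto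
    from AE_not_in[OF this] show ?thesis
      by (rule AE_mp) (auto intro!: AE_I2 simp: B_def C_def not_less)
  qed
  hence "AE s in seed_law. \<forall>m::nat. \<exists>n::nat. \<forall>i. \<bar>pos (- int n) s $ i\<bar> \<le> 1 - real (m + 1) / real (b ^ n)"
    by (subst AE_all_countable) simp
  thus ?thesis unfolding wide_def .
qed

lemma AE_joint_snd: "AE s in seed_law. Q s \<Longrightarrow> AE w in joint. Q (snd w)"
proof -
  assume "AE s in seed_law. Q s"
  then obtain N where N: "{s \<in> space seed_law. \<not> Q s} \<subseteq> N" "emeasure seed_law N = 0" "N \<in> sets seed_law" by (rule AE_E)
  have "emeasure joint (space p \<times> N) = 0"
    unfolding joint_def using N by (subst seed.emeasure_pair_measure_Times) auto
  hence "space p \<times> N \<in> null_sets joint" using N(3) by (intro null_setsI) (auto simp: joint_def)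
  from AE_not_in[OF this] show ?thesis
    by (rule AE_mp, intro AE_I2) (use N(1) in \<open>auto simp: joint_def space_pair_measure\<close>)
qed

section \<open>The extended distribution and its centering\<close>

definition ext_law :: "((real ^ 'd) measure \<times> (real ^ 'd)) measure" where
  "ext_law = push_on (CP_orbits b) (\<lambda>\<omega>. (extension_measure b \<omega>, snd (\<omega> 0))) (borel_of Mstar_B1) path_law"

text \<open>The extension in closed form: \<mu> with its origin moved to the uniform point, together
  with that point.\<close>

definition ext_map :: "(real ^ 'd) measure \<times> ((real ^ 'd) \<times> (nat \<Rightarrow> real ^ 'd)) \<Rightarrow> (real ^ 'd) measure \<times> (real ^ 'd)" where
  "ext_map w = (if good w then (magnify 1 (- fst (snd w)) (fst w), fst (snd w)) else (return borel 0, 0))"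

lemma return_0_Mstar: "return borel 0 \<in> topspace (Mstar :: (real ^ 'd) measure topology)"
  using return_0_Mbox[where 'd='d] by (simp add: topspace_Mbox topspace_Mstar)

lemma ext_map_topspace: "ext_map w \<in> topspace Mstar_B1"
  using ext_state_Mstar[of "fst w" "snd w" 0] ext_state_0[of "snd w" "fst w"] return_0_Mstar
  by (auto simp: ext_map_def topspace_Mstar_B1 good_def seed_good_def mem_B1)

lemma ext_map_measurable: "ext_map \<in> measurable joint (borel_of Mstar_B1)"
proof (rule measurable_Mstar_B1I)
  note [measurable] = measurable_compose[OF snd_joint fst_seed_measurable]
  fix A :: "(real ^ 'd) set" assume A: "A \<in> sets borel"
  have "(\<lambda>w. if good w then emeasure (magnify 1 (- fst (snd w)) (fst w)) A else emeasure (return borel 0) A) \<in> borel_measurable joint"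
    by (intro measurable_If good_sets measurable_emeasure_magnify[OF fst_joint_weak _ A]) measurable
  thus "(\<lambda>w. emeasure (fst (ext_map w)) A) \<in> borel_measurable joint"
    unfolding ext_map_def by (simp add: if_distrib[of "\<lambda>z. emeasure (fst z) A"] cong: if_cong)
next
  note [measurable] = measurable_compose[OF snd_joint fst_seed_measurable]
  have "(\<lambda>w. if good w then fst (snd w) else 0) \<in> borel_measurable joint"
    by (intro measurable_If good_sets) measurable
  thus "(\<lambda>w. snd (ext_map w)) \<in> borel_measurable joint"
    unfolding ext_map_def by (simp add: if_distrib[of snd] cong: if_cong)
qed (rule ext_map_topspace)

lemma emeasure_extension_approx_measurable:
  assumes A: "A \<in> sets borel"
  shows "(\<lambda>\<omega>. emeasure (extension_approx b \<omega> n) A) \<in> borel_measurable paths"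
  unfolding extension_approx_eq[OF b0]
proof (rule measurable_emeasure_magnify[OF _ _ A])
  have c: "(\<lambda>\<omega>. \<omega> (- int n)) \<in> measurable paths boxes" by (rule measurable_component_singleton) simp
  show "(\<lambda>\<omega>. fst (\<omega> (- int n))) \<in> measurable paths (borel_of weak_topology)"
    by (rule measurable_compose[OF c measurable_fst_Mbox_B1_weak])
  show "(\<lambda>\<omega>. cell_center (b ^ n) (snd (\<omega> (- int n)))) \<in> borel_measurable paths"
    by (rule measurable_compose[OF measurable_compose[OF c measurable_snd_Mbox_B1] cell_center_measurable])
qed

text \<open>\<open>extension_measure\<close> is under control only along orbits and lies in
  \<open>Mstar\<close> only almost surely. It is therefore completed to a measurable map f on all
  paths, which is then compared with \<open>ext_map\<close> for good and wide pairs.\<close>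

lemma ext_law_eq: "ext_law = distr joint (borel_of Mstar_B1) ext_map"
proof -
  define K where "K \<omega> = (if \<omega> \<in> CP_orbits b then extension_measure b \<omega> else return borel 0)" for \<omega> :: "int \<Rightarrow> (real ^ 'd) measure \<times> (real ^ 'd)"
  define f where "f \<omega> = (if K \<omega> \<in> topspace Mstar then (K \<omega>, snd (\<omega> 0)) else (return borel 0, 0))" for \<omega>
  have Ks: "sets (K \<omega>) = sets borel" for \<omega> by (simp add: K_def sets_extension_measure)
  have Kev: "(\<lambda>\<omega>. emeasure (K \<omega>) A) \<in> borel_measurable paths" if A: "A \<in> sets borel" for A
  proof -
    have "(\<lambda>\<omega>. if \<omega> \<in> CP_orbits b then SUP n. emeasure (extension_approx b \<omega> n) A else emeasure (return borel 0) A) \<in> borel_measurable paths"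
      by (intro measurable_If CP_orbits_Collect borel_measurable_SUP emeasure_extension_approx_measurable A) auto
    also have "(\<lambda>\<omega>. if \<omega> \<in> CP_orbits b then SUP n. emeasure (extension_approx b \<omega> n) A else emeasure (return borel 0) A) = (\<lambda>\<omega>. emeasure (K \<omega>) A)"
      using emeasure_extension_measure[OF b0 _ A] by (auto simp: K_def fun_eq_iff)
    finally show ?thesis .
  qed
  have c0: "(\<lambda>\<omega>. \<omega> 0) \<in> measurable paths boxes" by (rule measurable_component_singleton) simp
  have D: "{\<omega> \<in> space paths. K \<omega> \<in> topspace Mstar} \<in> sets paths" by (rule sets_Collect_Mstar[OF Ks Kev])
  have s0: "(\<lambda>\<omega>. snd (\<omega> 0)) \<in> borel_measurable paths" by (rule measurable_compose[OF c0 measurable_snd_Mbox_B1])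
  have s0B: "snd (\<omega> 0) \<in> B1" if "\<omega> \<in> space paths" for \<omega>
    using measurable_space[OF c0 that] by (auto simp: topspace_Mbox_B1)
  have fm: "f \<in> measurable paths (borel_of Mstar_B1)"
  proof (rule measurable_Mstar_B1I)
    fix \<omega> assume "\<omega> \<in> space paths"
    thus "f \<omega> \<in> topspace Mstar_B1" using s0B return_0_Mstar by (auto simp: f_def topspace_Mstar_B1 mem_B1)
  next
    fix A :: "(real ^ 'd) set" assume A: "A \<in> sets borel"
    have "(\<lambda>\<omega>. if K \<omega> \<in> topspace Mstar then emeasure (K \<omega>) A else emeasure (return borel 0) A) \<in> borel_measurable paths"
      by (intro measurable_If D Kev A) simp
    thus "(\<lambda>\<omega>. emeasure (fst (f \<omega>)) A) \<in> borel_measurable paths"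
      unfolding f_def by (simp add: if_distrib[of "\<lambda>z. emeasure (fst z) A"] cong: if_cong)
  next
    have "(\<lambda>\<omega>. if K \<omega> \<in> topspace Mstar then snd (\<omega> 0) else 0) \<in> borel_measurable paths"
      by (intro measurable_If D s0) simp
    thus "(\<lambda>\<omega>. snd (f \<omega>)) \<in> borel_measurable paths"
      unfolding f_def by (simp add: if_distrib[of snd] cong: if_cong)
  qed
  have fm': "f \<in> measurable path_law (borel_of Mstar_B1)" using fm unfolding measurable_cong_sets[OF sets_path_law refl] .
  have spl: "space path_law = space paths" using sets_eq_imp_space_eq[OF sets_path_law] .
  have AEgw: "AE w in joint. good w \<and> wide (snd w)"
    using AE_good AE_joint_snd[OF AE_wide] by eventually_elim simp
  have on_good: "K (proc w) = magnify 1 (- fst (snd w)) (fst w) \<and> K (proc w) \<in> topspace Mstar \<and> snd (proc w 0) = fst (snd w)"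
    if "good w" "wide (snd w)" for w
  proof -
    have e: "K (proc w) = magnify 1 (- fst (snd w)) (fst w)"
      using extension_measure_proc[OF that] proc_CP_orbits[OF that(1)] by (simp add: K_def)
    have "fst (ext_map w) \<in> topspace Mstar" using ext_map_topspace[of w] by (auto simp: topspace_Mstar_B1)
    hence "K (proc w) \<in> topspace Mstar" using that(1) unfolding e by (simp add: ext_map_def)
    thus ?thesis using e that pos_0[of "snd w"] by (simp add: proc_def frame_def good_def)
  qed
  have AEK: "AE \<omega> in path_law. K \<omega> \<in> topspace Mstar"
    by (rule AE_path_law[OF D]) (use AEgw in eventually_elim, use on_good in blast)
  have "ext_law = distr path_law (borel_of Mstar_B1) f"
    unfolding ext_law_def
  proof (rule push_on_eq_distr[OF _ AE_CP_orbits fm'])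
    show "CP_orbits b \<inter> space path_law \<in> sets path_law"
      using CP_orbits_sets[OF b0] by (intro sets.Int sets.top) (simp add: sets_path_law)
    show "AE \<omega> in path_law. f \<omega> = (extension_measure b \<omega>, snd (\<omega> 0))"
      using AE_CP_orbits AEK by eventually_elim (simp add: f_def K_def)
    fix A :: "((real ^ 'd) measure \<times> (real ^ 'd)) set" assume "A \<in> sets (borel_of Mstar_B1)"
    hence A: "A \<in> sets (borel_of Mstar \<Otimes>\<^sub>M borel_of (top_of_set B1))" unfolding sets_borel_of_Mstar_B1 .
    have "{\<omega> \<in> space paths. (K \<omega>, snd (\<omega> 0)) \<in> A} \<in> sets paths"
      by (rule sets_Collect_Mstar_pair[OF Ks Kev _ A], assumption) (rule measurable_top_of_setI[OF s0], rule s0B)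
    from sets.Int[OF CP_orbits_Collect this]
    have "{\<omega> \<in> space paths. \<omega> \<in> CP_orbits b} \<inter> {\<omega> \<in> space paths. (K \<omega>, snd (\<omega> 0)) \<in> A} \<in> sets path_law"
      by (simp only: sets_path_law)
    also have "{\<omega> \<in> space paths. \<omega> \<in> CP_orbits b} \<inter> {\<omega> \<in> space paths. (K \<omega>, snd (\<omega> 0)) \<in> A} =
      {\<omega> \<in> space path_law. \<omega> \<in> CP_orbits b \<and> (extension_measure b \<omega>, snd (\<omega> 0)) \<in> A}"
      unfolding spl by (auto simp: K_def)
    finally show "{\<omega> \<in> space path_law. \<omega> \<in> CP_orbits b \<and> (extension_measure b \<omega>, snd (\<omega> 0)) \<in> A} \<in> sets path_law" .
  qed
  also have "\<dots> = distr joint (borel_of Mstar_B1) (f \<circ> proc)"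
    unfolding path_law_def by (rule distr_distr[OF fm proc_measurable])
  also have "\<dots> = distr joint (borel_of Mstar_B1) ext_map"
  proof (rule distr_cong_AE[OF refl refl _ measurable_comp[OF proc_measurable fm] ext_map_measurable])
    show "AE w in joint. (f \<circ> proc) w = ext_map w"
      using AEgw
    proof eventually_elim
      case (elim w)
      with on_good[of w] have e: "K (proc w) = magnify 1 (- fst (snd w)) (fst w)"
        "K (proc w) \<in> topspace Mstar" "snd (proc w 0) = fst (snd w)" by blast+
      show ?case using elim e(2,3) by (simp add: f_def ext_map_def e(1)[symmetric])
    qed
  qed
  finally show ?thesis .
qed

lemma lebesgue_second_ext_law: "lebesgue_second ext_law"
proof -
  have "distr ext_law borel snd = distr joint borel (snd \<circ> ext_map)"
    unfolding ext_law_eq by (rule distr_distr[OF measurable_snd_Mstar_B1 ext_map_measurable])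
  also have "\<dots> = distr joint borel (\<lambda>w. snd (fst w, fst (snd w)))"
  proof (rule distr_cong_AE[OF refl refl])
    show "AE w in joint. (snd \<circ> ext_map) w = snd (fst w, fst (snd w))"
      using AE_good by eventually_elim (simp add: ext_map_def)
  qed (use measurable_comp[OF ext_map_measurable measurable_snd_Mstar_B1] measurable_compose[OF snd_joint fst_seed_measurable] in auto)
  also have "\<dots> = distr (distr joint (p \<Otimes>\<^sub>M unif_B1) (\<lambda>w. (fst w, fst (snd w)))) borel snd"
  proof (subst distr_distr)
    have "fst \<in> measurable joint p" by (simp add: joint_def)
    moreover have "(\<lambda>w. fst (snd w)) \<in> measurable joint (unif_B1 :: (real ^ 'd) measure)"
      unfolding measurable_cong_sets[OF refl sets_unif_B1] by (rule measurable_compose[OF snd_joint fst_seed_measurable])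
    ultimately    show "(\<lambda>w. (fst w, fst (snd w))) \<in> measurable joint (p \<Otimes>\<^sub>M (unif_B1 :: (real ^ 'd) measure))" by (rule measurable_Pair)
  qed (auto simp: comp_def)
  also have "\<dots> = distr (p \<Otimes>\<^sub>M unif_B1) borel snd" unfolding distr_joint_base ..
  also have "\<dots> = (unif_B1 :: (real ^ 'd) measure)"
  proof (rule measure_eqI)
    fix A assume "A \<in> sets (distr (p \<Otimes>\<^sub>M unif_B1) borel (snd :: _ \<Rightarrow> real ^ 'd))"
    hence A: "A \<in> sets borel" by simp
    interpret U: prob_space "unif_B1 :: (real ^ 'd) measure" by (rule prob_space_unif_B1)
    have "snd -` A \<inter> space (p \<Otimes>\<^sub>M unif_B1) = space p \<times> A" by (auto simp: space_pair_measure)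
    thus "emeasure (distr (p \<Otimes>\<^sub>M unif_B1) borel snd) A = emeasure unif_B1 A"
      using A p.emeasure_space_1 by (simp add: emeasure_distr U.emeasure_pair_measure_Times)
  qed simp
  finally show ?thesis unfolding lebesgue_second_def unif_B1_def .
qed

text \<open>The uniform point lies in the support of the translate because 0 lies in the support of
  \<mu>; centring there undoes the translation.\<close>

lemma discrete_centering_ext_law: "discrete_centering ext_law = p"
proof -
  let ?D = "{(\<mu>, x). x \<in> msupp \<mu>} :: ((real ^ 'd) measure \<times> (real ^ 'd)) set"
  let ?N = "borel_of (Mstar :: (real ^ 'd) measure topology)"
  let ?B = "borel_of (Mstar_B1 :: ((real ^ 'd) measure \<times> (real ^ 'd)) topology)"
  have sQ: "sets ext_law = sets ?B" unfolding ext_law_eq by simp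
  have spQ: "space ext_law = space ?B" by (rule sets_eq_imp_space_eq[OF sQ])
  have fw: "fst \<in> measurable ?B (borel_of weak_topology)"
    by (rule measurable_compose[OF measurable_fst_Mstar_B1 measurable_Mstar_weak])
  define f where "f z = (if snd z \<in> msupp (fst z) then magnify 1 (snd z) (fst z) else fst z)" for z :: "(real ^ 'd) measure \<times> (real ^ 'd)"
  have Dm: "{z \<in> space ?B. snd z \<in> msupp (fst z)} \<in> sets ?B"
    by (rule sets_Collect_msupp[OF fw measurable_snd_Mstar_B1])
  have fm: "f \<in> measurable ?B ?N"
  proof (rule measurable_MstarI)
    fix z assume "z \<in> space ?B"
    hence z: "fst z \<in> topspace Mstar" by (auto simp: topspace_Mstar_B1)
    show "f z \<in> topspace Mstar"
    proof (cases "snd z \<in> msupp (fst z)")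
      case True
      have "emeasure (fst z) (window 1 (snd z)) > 0"
        by (rule window_pos_of_msupp[OF True radon_sets[OF Mstar_radon[OF z]]]) simp_all
      thus ?thesis using True magnify_in_Mstar_iff[OF Mstar_radon[OF z], of 1] by (simp add: f_def)
    qed (use z in \<open>simp add: f_def\<close>)
  next
    fix A :: "(real ^ 'd) set" assume A: "A \<in> sets borel"
    have "(\<lambda>z. if snd z \<in> msupp (fst z) then emeasure (magnify 1 (snd z) (fst z)) A else emeasure (fst z) A) \<in> borel_measurable ?B"
      by (intro measurable_If Dm measurable_emeasure_magnify[OF fw measurable_snd_Mstar_B1 A]
           measurable_compose[OF measurable_fst_Mstar_B1 measurable_emeasure_Mstar[OF A]])
    thus "(\<lambda>z. emeasure (f z) A) \<in> borel_measurable ?B"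
      unfolding f_def by (simp add: if_distrib[of "\<lambda>\<kappa>. emeasure \<kappa> A"] cong: if_cong)
  qed
  have fmQ: "f \<in> measurable ext_law ?N" using fm unfolding measurable_cong_sets[OF sQ refl] .
  have "discrete_centering ext_law = distr ext_law ?N f"
    unfolding discrete_centering_def
  proof (rule push_on_eq_distr_on[OF _ _ fmQ])
    have "?D \<inter> space ?B = {z \<in> space ?B. snd z \<in> msupp (fst z)}" by auto
    thus "?D \<inter> space ext_law \<in> sets ext_law" unfolding sQ spQ using Dm by (simp only:)
    have "AE z in ext_law. snd z \<in> msupp (fst z)"
      unfolding ext_law_eq
    proof (subst AE_distr_iff[OF ext_map_measurable Dm])
      show "AE w in joint. snd (ext_map w) \<in> msupp (fst (ext_map w))"
        using AE_good
      proof eventually_elim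
        case (elim w)
        thus ?case using pos_msupp_ext_state[of "fst w" 0 "snd w"] ext_state_0[of "snd w" "fst w"] pos_0[of "snd w"]
          by (simp add: ext_map_def good_def)
      qed
    qed
    thus "AE z in ext_law. z \<in> ?D" by (simp add: case_prod_beta')
  qed (auto simp: f_def transl_star_magnify)
  also have "\<dots> = distr joint ?N (f \<circ> ext_map)"
    unfolding ext_law_eq by (rule distr_distr[OF fm ext_map_measurable])
  also have "\<dots> = distr joint ?N fst"
  proof (rule distr_cong_AE[OF refl refl _ measurable_comp[OF ext_map_measurable fm] fst_joint_Mstar])
    show "AE w in joint. (f \<circ> ext_map) w = fst w"
      using AE_good
    proof eventually_elim
      case (elim w)
      let ?z = "fst (snd w)"
      have \<mu>: "fst w \<in> scale_dom" and s: "seed_good (snd w)" using elim by (auto simp: good_def)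
      have "?z \<in> msupp (magnify 1 (- ?z) (fst w))"
        using pos_msupp_ext_state[OF \<mu>, of 0 "snd w"] ext_state_0[OF s, of "fst w"] pos_0[OF s] by simp
      hence "(f \<circ> ext_map) w = magnify 1 ?z (magnify 1 (- ?z) (fst w))" using elim by (simp add: f_def ext_map_def)
      also have "\<dots> = magnify (1 * 1) (- ?z + (1 / 1) *\<^sub>R ?z) (fst w)"
        using s by (intro magnify_magnify Mstar_radon scale_dom_Mstar \<mu> window_translate_pos) (auto simp: seed_good_def)
      also have "\<dots> = fst w" using magnify_1_0[OF scale_dom_Mstar[OF \<mu>]] by simp
      finally show ?case .
    qed
  qed
  also have "\<dots> = distr (p \<Otimes>\<^sub>M seed_law) p fst" unfolding joint_def by (rule distr_cong) (auto simp: sets_p)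
  also have "\<dots> = p" by (rule seed.distr_pair_fst)
  finally show ?thesis .
qed

lemma extended_CP_ext_law:
  assumes "adapted box_law"
  shows "extended_CP b ext_law"
  unfolding extended_CP_def extended_version_def restricted_CP_def ext_law_def
  using assms two_sided prob_box_law sets_box_law invariant_box_law by blast

end

section \<open>Adaptedness\<close>

text \<open>Intersection-stable for the uniqueness theorem for measures, and countable so that the
  exceptional sets of all tests still form a null set.\<close>

lemma ex_countable_generator:
  assumes e: "coord_embedding X e"
  shows "\<exists>\<A>. countable \<A> \<and> Int_stable \<A> \<and> topspace X \<in> \<A> \<and> \<A> \<subseteq> sets (borel_of X) \<and>
    sets (borel_of X) = sigma_sets (topspace X) \<A>"
proof -
  obtain B :: "'b set set" where B: "countable B" "topological_basis B" using ex_countable_basis by blast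
  define \<A> where "\<A> = (\<lambda>F. e -` (\<Inter>F) \<inter> topspace X) ` {F. finite F \<and> F \<subseteq> B}"
  have "countable {F. finite F \<and> F \<subseteq> B}" using countable_Collect_finite_subset[OF B(1)] by (simp add: conj_commute)
  hence c: "countable \<A>" unfolding \<A>_def by (rule countable_image)
  have i: "Int_stable \<A>"
  proof (rule Int_stableI)
    fix S T assume "S \<in> \<A>" "T \<in> \<A>"
    then obtain F G where "finite F" "F \<subseteq> B" "S = e -` (\<Inter>F) \<inter> topspace X" "finite G" "G \<subseteq> B" "T = e -` (\<Inter>G) \<inter> topspace X"
      unfolding \<A>_def by auto
    thus "S \<inter> T \<in> \<A>" unfolding \<A>_def by (intro image_eqI[of _ _ "F \<union> G"]) auto
  qed
  \<comment> \<open>The intersection of the empty family is everything.\<close>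
  have t: "topspace X \<in> \<A>" unfolding \<A>_def by (intro image_eqI[of _ _ "{}"]) auto
  have op: "openin X (e -` V \<inter> topspace X)" if "open V" for V using e that unfolding coord_embedding_def by auto
  have sub: "\<A> \<subseteq> sets (borel_of X)"
  proof
    fix S assume "S \<in> \<A>"
    then obtain F where F: "finite F" "F \<subseteq> B" "S = e -` (\<Inter>F) \<inter> topspace X" unfolding \<A>_def by auto
    have "open (\<Inter>F)" using F topological_basis_open[OF B(2)] by (intro open_Inter) auto
    hence "openin X S" unfolding F(3) by (rule op)
    thus "S \<in> sets (borel_of X)" unfolding sets_borel_of by (intro sigma_sets.Basic) simp
  qed
  have "sigma_sets (topspace X) \<A> \<subseteq> sets (borel_of X)"
    using sets.sigma_sets_subset[OF sub] by simp
  moreover have "sets (borel_of X) \<subseteq> sigma_sets (topspace X) \<A>"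
    unfolding sets_borel_of
  proof (rule sigma_sets_mono, rule subsetI)
    fix U assume "U \<in> {U. openin X U}"
    then obtain V where V: "open V" "U = e -` V \<inter> topspace X" using e unfolding coord_embedding_def by auto
    obtain B' where B': "B' \<subseteq> B" "V = \<Union>B'" using B(2) V(1) unfolding topological_basis_def by metis
    have "U = (\<Union>S\<in>B'. e -` (\<Inter>{S}) \<inter> topspace X)" unfolding V(2) B'(2) by auto
    also have "\<dots> \<in> sigma_sets (topspace X) \<A>"
    proof (rule sigma_sets_UNION)
      show "countable ((\<lambda>S. e -` (\<Inter>{S}) \<inter> topspace X) ` B')" using countable_subset[OF B'(1) B(1)] by (rule countable_image)
      fix T assume "T \<in> (\<lambda>S. e -` (\<Inter>{S}) \<inter> topspace X) ` B'"
      then obtain S where S: "S \<in> B'" "T = e -` (\<Inter>{S}) \<inter> topspace X" by blast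
      have "T \<in> \<A>" unfolding \<A>_def S(2) using S(1) B'(1) by (intro image_eqI[of _ _ "{S}"]) auto
      thus "T \<in> sigma_sets (topspace X) \<A>" by (rule sigma_sets.Basic)
    qed
    finally show "U \<in> sigma_sets (topspace X) \<A>" .
  qed
  ultimately show ?thesis using c i t sub by blast
qed

lemma cell_center_tendsto:
  fixes x :: "real ^ 'd"
  assumes b: "b \<ge> 2"
  shows "(\<lambda>k. cell_center (b ^ k) x) \<longlonglongrightarrow> x"
proof (rule vec_tendstoI)
  fix i
  have bk: "b ^ k > 0" for k using b by simp
  have le: "norm (cell_center (b ^ k) x $ i - x $ i) \<le> (1 / real b) ^ k" for k
  proof -
    have "cell_center (b ^ k) x $ i - 1 / real (b ^ k) \<le> x $ i \<and> x $ i < cell_center (b ^ k) x $ i + 1 / real (b ^ k)"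
      using mem_cell[OF bk, of x k] unfolding mem_half_open_cube by blast
    thus ?thesis by (auto simp: abs_le_iff power_divide)
  qed
  have "(\<lambda>k. (1 / real b) ^ k) \<longlonglongrightarrow> 0" using b by (intro LIMSEQ_power_zero) simp
  hence "(\<lambda>k. cell_center (b ^ k) x $ i - x $ i) \<longlonglongrightarrow> 0"
    by (rule Lim_null_comparison[rotated]) (intro always_eventually allI le)
  thus "(\<lambda>k. cell_center (b ^ k) x $ i) \<longlonglongrightarrow> x $ i" by (simp add: LIM_zero_iff)
qed

lemma continuous_map_measurable:
  assumes "continuous_map X euclideanreal f"
  shows "f \<in> borel_measurable (borel_of X)"
proof (rule borel_measurableI)
  fix S :: "real set" assume "open S"
  hence "openin X {x \<in> topspace X. f x \<in> S}" using assms unfolding continuous_map_def by simp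
  hence "{x \<in> topspace X. f x \<in> S} \<in> sets (borel_of X)" unfolding sets_borel_of by (intro sigma_sets.Basic) simp
  thus "f -` S \<inter> space (borel_of X) \<in> sets (borel_of X)" by (simp add: vimage_def Int_def conj_commute)
qed

section \<open>Vanishing mean deviations\<close>

context scaling_system
begin

lemma distr_component: "distr path_law boxes (\<lambda>\<omega>. \<omega> (int n)) = box_law"
proof (induction n)
  case 0
  show ?case by (simp add: box_law_def)
next
  case (Suc n)
  have "distr path_law boxes (\<lambda>\<omega>. \<omega> (int (Suc n))) = distr path_law boxes ((\<lambda>\<omega>. \<omega> (int n)) \<circ> (\<lambda>\<omega> n. \<omega> (n + 1)))"
    by (simp add: comp_def add.commute)
  also have "\<dots> = distr (distr path_law path_law (\<lambda>\<omega> n. \<omega> (n + 1))) boxes (\<lambda>\<omega>. \<omega> (int n))"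
    by (rule distr_distr[symmetric, OF component_measurable])
       (use shift_measurable in \<open>simp add: measurable_cong_sets[OF sets_path_law sets_path_law]\<close>)
  finally show ?case unfolding distr_path_shift Suc .
qed

definition deviation :: "(real ^ 'd) measure set \<Rightarrow> (real ^ 'd) set \<Rightarrow> (real ^ 'd) measure \<times> (real ^ 'd) \<Rightarrow> real" where
  "deviation A C z = indicator A (fst z) * (indicator C (snd z) - measure (fst z) C)"

lemma measure_fst_measurable: "C \<in> sets borel \<Longrightarrow> (\<lambda>z. measure (fst z) C) \<in> borel_measurable boxes"
  unfolding measure_def
  by (intro borel_measurable_enn2real measurable_compose[OF measurable_fst_Mbox_B1 measurable_emeasure_Mbox])

lemma indicator_fst_measurable:
  "A \<in> sets (borel_of Mbox) \<Longrightarrow> (\<lambda>z. indicator A (fst z) :: real) \<in> borel_measurable boxes"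
  by (rule measurable_compose[OF measurable_fst_Mbox_B1 borel_measurable_indicator])

lemma indicator_snd_measurable:
  "C \<in> sets borel \<Longrightarrow> (\<lambda>z. indicator C (snd z) :: real) \<in> borel_measurable boxes"
  by (rule measurable_compose[OF measurable_snd_Mbox_B1 borel_measurable_indicator])

lemma deviation_measurable:
  assumes "A \<in> sets (borel_of Mbox)" "C \<in> sets borel"
  shows "deviation A C \<in> borel_measurable boxes"
  unfolding deviation_def
  by (intro borel_measurable_times borel_measurable_diff indicator_fst_measurable indicator_snd_measurable measure_fst_measurable assms)

text \<open>The level \<open>b ^ n\<close> scenery seen from time 0 is the state at time n.
  Discrepancies along the orbit thus become values of one function along a stationary
  process.\<close>

lemma discrepancy_proc:
  assumes "good w"
  shows "discrepancy A C (b ^ n) (fst (proc w 0)) (snd (proc w 0)) = deviation A C (proc w (int n))"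
proof -
  obtain \<mu> s where w: "w = (\<mu>, s)" by (cases w)
  have \<mu>: "\<mu> \<in> scale_dom" and s: "seed_good s" using assms by (auto simp: good_def w)
  have "scenery (b ^ n) (restrict_B1 (ext_state 0 \<mu> s)) (pos 0 s) = restrict_B1 (magnify (real (b ^ n)) (cell_center (b ^ n) (pos 0 s)) (ext_state 0 \<mu> s))"
    unfolding scenery_def
    by (intro restrict_magnify_restrict window_cell_subset_B1 bn0 pos_good(1)[OF s]) (simp add: ext_state_def)
  also have "\<dots> = restrict_B1 (ext_state (int n) \<mu> s)" using ext_state_step[OF \<mu> s, of n 0] by simp
  finally have sc: "scenery (b ^ n) (restrict_B1 (ext_state 0 \<mu> s)) (pos 0 s) = restrict_B1 (ext_state (int n) \<mu> s)" .
  have "cell_shift (b ^ n) (pos 0 s) = pos (int n) s" using pos_shift_iterate[OF s, of n 0] by simp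
  thus ?thesis using assms sc by (simp add: discrepancy_def deviation_def proc_def frame_def w)
qed

lemma AE_seed_fst: "AE z in unif_B1. Q z \<Longrightarrow> AE s in seed_law. Q (fst s)"
proof -
  assume Q: "AE z in unif_B1. Q z"
  interpret S: prob_space "PiM UNIV (\<lambda>_::nat. digit_law)" by (rule prob_space_PiM) (rule prob_digit_law)
  have d: "distr seed_law (unif_B1 :: (real ^ 'd) measure) fst = unif_B1" unfolding seed_law_def by (rule S.distr_pair_fst)
  have "AE z in distr seed_law (unif_B1 :: (real ^ 'd) measure) fst. Q z" unfolding d by (rule Q)
  moreover have "fst \<in> measurable seed_law (unif_B1 :: (real ^ 'd) measure)" by (simp add: seed_law_def)
  ultimately show ?thesis by (rule AE_distrD[rotated])
qed

text \<open>By stationarity all discrepancies along the process have the same mean, and so do their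
  averages. These are bounded and tend to 0 almost surely, so the common mean is 0.\<close>

lemma integral_deviation_eq_0:
  assumes A: "A \<in> sets (borel_of Mbox)" and C: "C \<in> sets borel"
    and av: "AE \<mu> in p. AE w in unif_B1. averages_vanish A C b (magnify 1 (- w) \<mu>) w"
  shows "(\<integral>z. deviation A C z \<partial>box_law) = 0"
proof -
  interpret J: prob_space joint by (rule prob_joint)
  define H where "H n w = discrepancy A C (b ^ n) (fst (proc w 0)) (snd (proc w 0))" for n w
  have Hm: "H n \<in> borel_measurable joint" for n
    unfolding H_def
    by (rule measurable_discrepancy[OF measurable_compose[OF proc_component measurable_fst_Mbox_B1_weak]
          measurable_compose[OF proc_component measurable_snd_Mbox_B1] A C])
  have H1: "\<bar>H n w\<bar> \<le> 1" if "w \<in> space joint" for n w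
    using measurable_space[OF proc_component that, of 0] unfolding H_def
    by (intro abs_discrepancy_le_1 bn0 C Mbox_radon) (auto simp: topspace_Mbox_B1)
  have Hint: "integrable joint (H n)" for n
    by (rule J.integrable_const_bound[of _ 1]) (use H1 Hm in auto)
  have dm: "deviation A C \<in> borel_measurable boxes" by (rule deviation_measurable[OF A C])
  have HI: "(\<integral>w. H n w \<partial>joint) = (\<integral>z. deviation A C z \<partial>box_law)" for n
  proof -
    have comp: "(\<lambda>\<omega>. \<omega> (int n)) \<in> measurable paths boxes" by (rule measurable_component_singleton) simp
    have "(\<integral>w. H n w \<partial>joint) = (\<integral>w. deviation A C (proc w (int n)) \<partial>joint)"
      by (rule integral_cong_AE[OF Hm measurable_compose[OF proc_component dm]])
         (use AE_good in \<open>eventually_elim, simp add: H_def discrepancy_proc\<close>)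
    also have "\<dots> = (\<integral>\<omega>. deviation A C (\<omega> (int n)) \<partial>path_law)"
      unfolding path_law_def
      by (rule integral_distr[symmetric, OF proc_measurable measurable_compose[OF comp dm]])
    also have "\<dots> = (\<integral>z. deviation A C z \<partial>box_law)"
      unfolding distr_component[of n, symmetric] by (rule integral_distr[symmetric, OF component_measurable dm])
    finally show ?thesis .
  qed
  define avg where "avg j w = (\<Sum>n<j\<^sup>2. H n w) / real (j\<^sup>2)" for j w
  have avgm: "avg j \<in> borel_measurable joint" for j
    unfolding avg_def by (intro borel_measurable_divide borel_measurable_sum Hm) auto
  have avg1: "\<bar>avg j w\<bar> \<le> 1" if "w \<in> space joint" for j w
  proof -
    have "\<bar>\<Sum>n<j\<^sup>2. H n w\<bar> \<le> (\<Sum>n<j\<^sup>2. 1)" by (rule order_trans[OF sum_abs sum_mono]) (rule H1[OF that])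
    thus ?thesis unfolding avg_def by (cases "j = 0") simp_all
  qed
  have "AE w in joint. (\<lambda>j. avg j w) \<longlonglongrightarrow> 0"
  proof -
    have "AE \<mu> in p. AE s in seed_law. (\<lambda>j. avg j (\<mu>, s)) \<longlonglongrightarrow> 0"
      using av dom_p
    proof eventually_elim
      case (elim \<mu>)
      show ?case using AE_seed_fst[OF elim(1)] AE_seed_good
      proof eventually_elim
        case (elim s)
        have "good (\<mu>, s)" using \<open>\<mu> \<in> scale_dom\<close> elim(2) by (simp add: good_def)
        hence "proc (\<mu>, s) 0 = (restrict_B1 (magnify 1 (- fst s) \<mu>), fst s)"
          using elim(2) by (simp add: proc_def frame_def ext_state_0 pos_0)
        thus ?case using elim(1) unfolding averages_vanish_def avg_def H_def by simp
      qed
    qed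
    moreover have "{w \<in> space joint. (\<lambda>j. avg j w) \<longlonglongrightarrow> 0} \<in> sets joint"
      by (rule sets_Collect_tendsto_0[OF avgm])
    ultimately show ?thesis unfolding joint_def by (intro js.AE_pair_measure) auto
  qed
  hence "(\<lambda>j. \<integral>w. avg j w \<partial>joint) \<longlonglongrightarrow> (\<integral>w. 0 \<partial>joint)"
    by (intro integral_dominated_convergence[where w="\<lambda>_. 1"] avgm) (use avg1 in auto)
  hence "(\<lambda>j. \<integral>w. avg j w \<partial>joint) \<longlonglongrightarrow> 0" by simp
  moreover have "(\<lambda>j. \<integral>w. avg j w \<partial>joint) \<longlonglongrightarrow> (\<integral>z. deviation A C z \<partial>box_law)"
  proof (rule tendsto_eventually, rule eventually_sequentiallyI[of 1])
    \<comment> \<open>For j = 0 the average is an empty sum divided by 0 and does not have the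
      common mean.\<close>
    fix j :: nat assume "1 \<le> j"
    have "(\<integral>w. avg j w \<partial>joint) = (\<Sum>n<j\<^sup>2. \<integral>w. H n w \<partial>joint) / real (j\<^sup>2)"
      unfolding avg_def using Hint by simp
    thus "(\<integral>w. avg j w \<partial>joint) = (\<integral>z. deviation A C z \<partial>box_law)" unfolding HI using \<open>1 \<le> j\<close> by simp
  qed
  ultimately show ?thesis using LIMSEQ_unique by blast
qed

text \<open>The averaging condition enters only through tests \<open>A\<close> from a generator and
  through single cells. Their countability is used where the condition is established for almost
  every measure.\<close>

context
  fixes \<A> :: "(real ^ 'd) measure set set"
  assumes stable: "Int_stable \<A>" and topA: "topspace Mbox \<in> \<A>" and subA: "\<A> \<subseteq> sets (borel_of Mbox)"
    and genA: "sets (borel_of Mbox) = sigma_sets (topspace Mbox) \<A>"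
    and av: "\<And>A k c0. A \<in> \<A> \<Longrightarrow> c0 \<in> cell_center (b ^ k) ` half_open_cube 0 1 \<Longrightarrow>
      AE \<mu> in p. AE w in unif_B1. averages_vanish A {y. cell_center (b ^ k) y = c0} b (magnify 1 (- w) \<mu>) w"
begin

interpretation BL: prob_space box_law by (rule prob_box_law)

lemma space_box_law: "space box_law = topspace Mbox \<times> B1"
  using sets_eq_imp_space_eq[OF sets_box_law] by (simp add: topspace_Mbox_B1)

lemma box_measurable: "f \<in> borel_measurable boxes \<Longrightarrow> f \<in> borel_measurable box_law"
  unfolding measurable_cong_sets[OF sets_box_law refl] .

lemma measure_fst_le_1: "z \<in> space box_law \<Longrightarrow> measure (fst z) C \<le> 1"
  using prob_space_Mbox(1)[of "fst z"] by (auto simp: space_box_law intro: prob_space.prob_le_1)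

text \<open>For a fixed cell, integrating either factor over the event that the measure lies in
  \<open>A\<close> gives a finite measure in \<open>A\<close>. Vanishing mean deviations make the
  two agree on the generator, hence everywhere, and \<phi> is integrated against both.\<close>

lemma conditional_cell:
  assumes c: "c \<in> cell_center (b ^ k) ` half_open_cube 0 1"
    and \<phi>: "\<phi> \<in> borel_measurable (borel_of Mbox)"
  defines "C \<equiv> {y. cell_center (b ^ k) y = c}"
  shows "(\<integral>z. \<phi> (fst z) * indicator C (snd z) \<partial>box_law) = (\<integral>z. \<phi> (fst z) * measure (fst z) C \<partial>box_law)"
proof -
  let ?N = "borel_of Mbox :: (real ^ 'd) measure measure"
  have C: "C \<in> sets borel" unfolding C_def by (rule cell_borel)
  have fstm: "fst \<in> measurable box_law ?N"
    using measurable_fst_Mbox_B1 unfolding measurable_cong_sets[OF sets_box_law refl] .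
  define d1 where "d1 z = (indicator C (snd z) :: real)" for z :: "(real ^ 'd) measure \<times> (real ^ 'd)"
  define d2 where "d2 z = measure (fst z) C" for z :: "(real ^ 'd) measure \<times> (real ^ 'd)"
  have dm: "d1 \<in> borel_measurable box_law" "d2 \<in> borel_measurable box_law"
    unfolding d1_def d2_def by (intro box_measurable indicator_snd_measurable measure_fst_measurable C)+
  have d0: "0 \<le> d1 z" "0 \<le> d2 z" for z by (simp_all add: d1_def d2_def)
  have dle: "d1 z \<le> 1" "z \<in> space box_law \<Longrightarrow> d2 z \<le> 1" for z by (simp_all add: d1_def d2_def measure_fst_le_1)
  have em: "emeasure (distr (density box_law (\<lambda>z. ennreal (d z))) ?N fst) A = ennreal (\<integral>z. indicator A (fst z) * d z \<partial>box_law)"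
    if A: "A \<in> sets ?N" and d: "d \<in> borel_measurable box_law" "\<And>z. 0 \<le> d z" "\<And>z. z \<in> space box_law \<Longrightarrow> d z \<le> 1" for A d
  proof -
    have ia: "(\<lambda>z. indicator A (fst z) :: real) \<in> borel_measurable box_law"
      by (intro box_measurable indicator_fst_measurable A)
    have "emeasure (distr (density box_law (\<lambda>z. ennreal (d z))) ?N fst) A =
        emeasure (density box_law (\<lambda>z. ennreal (d z))) (fst -` A \<inter> space box_law)"
      using fstm A by (subst emeasure_distr) auto
    also have "\<dots> = (\<integral>\<^sup>+z. ennreal (d z) * indicator (fst -` A \<inter> space box_law) z \<partial>box_law)"
      using d(1) measurable_sets[OF fstm A] by (intro emeasure_density) auto
    also have "\<dots> = (\<integral>\<^sup>+z. ennreal (indicator A (fst z) * d z) \<partial>box_law)"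
      by (intro nn_integral_cong) (auto simp: indicator_def)
    also have "\<dots> = ennreal (\<integral>z. indicator A (fst z) * d z \<partial>box_law)"
    proof (rule nn_integral_eq_integral)
      show "integrable box_law (\<lambda>z. indicator A (fst z) * d z)"
        by (rule BL.integrable_const_bound[of _ 1]) (use d ia in \<open>auto simp: indicator_def intro!: AE_I2\<close>)
    qed (use d(2) in simp)
    finally show ?thesis .
  qed
  have "distr (density box_law (\<lambda>z. ennreal (d1 z))) ?N fst = distr (density box_law (\<lambda>z. ennreal (d2 z))) ?N fst"
  proof (rule measure_eqI_generator_eq[OF stable, where \<Omega>="topspace Mbox" and A="\<lambda>_. topspace Mbox"])
    show "\<A> \<subseteq> Pow (topspace Mbox)"
    proof
      fix A assume "A \<in> \<A>"
      hence "A \<in> sets ?N" using subA by blast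
      from sets.sets_into_space[OF this] show "A \<in> Pow (topspace Mbox)" by simp
    qed
    fix A assume "A \<in> \<A>"
    hence A: "A \<in> sets ?N" using subA by blast
    have ia: "(\<lambda>z. indicator A (fst z) :: real) \<in> borel_measurable box_law"
      by (intro box_measurable indicator_fst_measurable A)
    have i1: "integrable box_law (\<lambda>z. indicator A (fst z) * d1 z)"
      by (rule BL.integrable_const_bound[of _ 1]) (use d0 dle dm ia in \<open>auto simp: indicator_def intro!: AE_I2\<close>)
    have i2: "integrable box_law (\<lambda>z. indicator A (fst z) * d2 z)"
      by (rule BL.integrable_const_bound[of _ 1]) (use d0 dle dm ia in \<open>auto simp: indicator_def intro!: AE_I2\<close>)
    have "0 = (\<integral>z. deviation A C z \<partial>box_law)"
      using integral_deviation_eq_0[OF A C] av[OF \<open>A \<in> \<A>\<close> c] unfolding C_def by simp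
    also have "\<dots> = (\<integral>z. indicator A (fst z) * d1 z - indicator A (fst z) * d2 z \<partial>box_law)"
      unfolding deviation_def d1_def d2_def by (simp add: right_diff_distrib)
    also have "\<dots> = (\<integral>z. indicator A (fst z) * d1 z \<partial>box_law) - (\<integral>z. indicator A (fst z) * d2 z \<partial>box_law)"
      by (rule Bochner_Integration.integral_diff[OF i1 i2])
    finally show "emeasure (distr (density box_law (\<lambda>z. ennreal (d1 z))) ?N fst) A =
        emeasure (distr (density box_law (\<lambda>z. ennreal (d2 z))) ?N fst) A"
      using em[OF A dm(1)] em[OF A dm(2)] d0 dle by simp
  next
    have "topspace Mbox \<in> sets ?N" using sets.top[of ?N] by simp
    from em[OF this dm(1) d0(1) dle(1)]
    show "emeasure (distr (density box_law (\<lambda>z. ennreal (d1 z))) ?N fst) (topspace Mbox) \<noteq> \<infinity>" by simp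
  qed (use genA topA in auto)
  hence "(\<integral>\<kappa>. \<phi> \<kappa> \<partial>distr (density box_law (\<lambda>z. ennreal (d1 z))) ?N fst) = (\<integral>\<kappa>. \<phi> \<kappa> \<partial>distr (density box_law (\<lambda>z. ennreal (d2 z))) ?N fst)"
    by simp
  moreover have "(\<integral>\<kappa>. \<phi> \<kappa> \<partial>distr (density box_law (\<lambda>z. ennreal (d z))) ?N fst) = (\<integral>z. \<phi> (fst z) * d z \<partial>box_law)"
    if d: "d \<in> borel_measurable box_law" "\<And>z. 0 \<le> d z" for d
  proof -
    have "(\<integral>\<kappa>. \<phi> \<kappa> \<partial>distr (density box_law (\<lambda>z. ennreal (d z))) ?N fst) = (\<integral>z. \<phi> (fst z) \<partial>density box_law (\<lambda>z. ennreal (d z)))"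
      using fstm by (intro integral_distr \<phi>) simp
    also have "\<dots> = (\<integral>z. d z *\<^sub>R \<phi> (fst z) \<partial>box_law)"
      by (rule integral_density) (use d measurable_compose[OF fstm \<phi>] in auto)
    finally show ?thesis by (simp add: mult.commute)
  qed
  ultimately show ?thesis using dm d0 unfolding d1_def d2_def by simp
qed

text \<open>Level 0 has a single cell inside the cube; through it \<open>conditional_cell\<close>
  also speaks about total mass.\<close>

lemma cell_center_1_eq_0: "{y :: real ^ 'd. cell_center (b ^ 0) y = 0} = half_open_cube 0 1"
proof -
  have "cell_center 1 (0 :: real ^ 'd) = 0" using cell_center_1[of 0] by (simp add: mem_half_open_cube)
  thus ?thesis using cell_center_eq_iff[of 1 _ "0 :: real ^ 'd"] by auto
qed

lemma AE_box_half_open: "AE z in box_law. snd z \<in> half_open_cube 0 1"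
proof -
  have m: "{z \<in> space boxes. snd z \<in> half_open_cube 0 1} \<in> sets boxes"
    using measurable_sets[OF measurable_snd_Mbox_B1 half_open_cube_borel, of 0 1] by (simp add: vimage_def Int_def conj_commute)
  have m': "{\<omega> \<in> space paths. snd (\<omega> 0) \<in> half_open_cube 0 1} \<in> sets paths"
  proof -
    have "(\<lambda>\<omega>. \<omega> 0) \<in> measurable paths boxes" by (rule measurable_component_singleton) simp
    from measurable_sets[OF measurable_compose[OF this measurable_snd_Mbox_B1] half_open_cube_borel, of 0 1]
    show ?thesis by (simp add: vimage_def Int_def conj_commute)
  qed
  have "AE w in joint. snd (proc w 0) \<in> half_open_cube 0 1"
    using AE_good by eventually_elim (simp add: proc_def frame_def good_def pos_good)
  from AE_path_law[OF m' this] show ?thesis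
    unfolding box_law_def by (subst AE_distr_iff[OF component_measurable m])
qed

text \<open>The point lies in the half-open cube almost surely, so by the level-0 case the mean mass
  of that cube is 1. A quantity bounded by 1 with mean 1 is 1 almost surely.\<close>

lemma AE_box_full: "AE z in box_law. measure (fst z) (half_open_cube 0 1) = 1"
proof -
  let ?H = "half_open_cube (0 :: real ^ 'd) 1"
  have "0 \<in> ?H" by (simp add: mem_half_open_cube)
  moreover have "cell_center (b ^ 0) (0 :: real ^ 'd) = 0" using cell_center_1_eq_0 \<open>0 \<in> ?H\<close> by blast
  ultimately have "(0 :: real ^ 'd) \<in> cell_center (b ^ 0) ` ?H" by (metis imageI)
  from conditional_cell[OF this borel_measurable_const[of 1]]
  have "(\<integral>z. indicator ?H (snd z) \<partial>box_law) = (\<integral>z. measure (fst z) ?H \<partial>box_law)"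
    unfolding cell_center_1_eq_0 by simp
  moreover have "(\<integral>z. (indicator ?H (snd z) :: real) \<partial>box_law) = (\<integral>z. 1 \<partial>box_law)"
  proof (rule integral_cong_AE[OF box_measurable[OF indicator_snd_measurable[OF half_open_cube_borel]]])
    show "AE z in box_law. (indicator ?H (snd z) :: real) = 1" using AE_box_half_open by eventually_elim simp
  qed simp
  ultimately have eq: "(\<integral>z. measure (fst z) ?H \<partial>box_law) = 1" using BL.prob_space by simp
  have mm: "(\<lambda>z. measure (fst z) ?H) \<in> borel_measurable box_law"
    by (intro box_measurable measure_fst_measurable half_open_cube_borel)
  have int: "integrable box_law (\<lambda>z. measure (fst z) ?H)"
    by (rule BL.integrable_const_bound[of _ 1]) (use mm measure_fst_le_1 in auto)
  have "(\<integral>z. 1 - measure (fst z) ?H \<partial>box_law) = 0" using int eq BL.prob_space by simp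
  moreover have "AE z in box_law. 0 \<le> 1 - measure (fst z) ?H" using measure_fst_le_1 by (intro AE_I2) simp
  ultimately have "AE z in box_law. 1 - measure (fst z) ?H = 0"
    using int by (subst (asm) integral_nonneg_eq_0_iff_AE) auto
  thus ?thesis by eventually_elim simp
qed

text \<open>In the point variable f is replaced by its values at the cell centres of level k. For
  these step functions adaptedness is a finite sum of instances of \<open>conditional_cell\<close>;
  both sides then pass to the limit by dominated convergence.\<close>

lemma adapted_box_law: "adapted box_law"
  unfolding adapted_def
proof (intro allI impI)
  fix f :: "(real ^ 'd) measure \<times> (real ^ 'd) \<Rightarrow> real"
  assume f: "continuous_map Mbox_B1 euclideanreal f"
  let ?H = "half_open_cube (0 :: real ^ 'd) 1"
  obtain B0 where B0: "\<And>z. z \<in> topspace Mbox_B1 \<Longrightarrow> \<bar>f z\<bar> \<le> B0" using continuous_Mbox_B1_bounded[OF f] by blast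
  define B where "B = max 0 B0"
  have B: "B \<ge> 0" "\<And>\<kappa> x. \<kappa> \<in> topspace Mbox \<Longrightarrow> x \<in> B1 \<Longrightarrow> \<bar>f (\<kappa>, x)\<bar> \<le> B"
    using B0 unfolding B_def by (auto simp: topspace_Mbox_B1 intro: max.coboundedI2)
  have fm: "f \<in> borel_measurable boxes" by (rule continuous_map_measurable[OF f])
  define I where "I k = cell_center (b ^ k) ` ?H" for k
  have finI: "finite (I k)" for k unfolding I_def by (rule finite_cell_centers[OF bn0])
  have IB: "c \<in> B1" if "c \<in> I k" for c k
    using that cell_center_in_unit[OF bn0] half_open_unit_subset unfolding I_def by blast
  define E where "E k c = {y :: real ^ 'd. cell_center (b ^ k) y = c}" for k c
  have Eb: "E k c \<in> sets borel" for k c unfolding E_def by (rule cell_borel)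
  \<comment> \<open>The centres lie in \<open>B1\<close>, so every value of f used here is taken in
    \<open>Mbox_B1\<close>, where f is continuous and bounded.\<close>
  define s where "s k \<kappa> y = (\<Sum>c\<in>I k. f (\<kappa>, c) * indicator (E k c) y)" for k \<kappa> y
  have s_eq: "s k \<kappa> y = (if cell_center (b ^ k) y \<in> I k then f (\<kappa>, cell_center (b ^ k) y) else 0)" for k \<kappa> y
  proof -
    have "s k \<kappa> y = (\<Sum>c\<in>I k. if c = cell_center (b ^ k) y then f (\<kappa>, c) else 0)"
      unfolding s_def E_def by (intro sum.cong) (auto simp: indicator_def)
    thus ?thesis using sum.delta'[OF finI[of k], of "cell_center (b ^ k) y" "\<lambda>c. f (\<kappa>, c)"] by (simp add: sum.delta[OF finI])
  qed
  have s_bd: "\<bar>s k \<kappa> y\<bar> \<le> B" if "\<kappa> \<in> topspace Mbox" for k \<kappa> y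
    unfolding s_eq using B IB that by auto
  have s_lim: "(\<lambda>k. s k \<kappa> y) \<longlonglongrightarrow> f (\<kappa>, y)" if \<kappa>: "\<kappa> \<in> topspace Mbox" and y: "y \<in> ?H" for \<kappa> y
  proof -
    have mI: "cell_center (b ^ k) y \<in> I k" for k unfolding I_def using y by blast
    have "(\<lambda>k. f (\<kappa>, cell_center (b ^ k) y)) \<longlonglongrightarrow> f (\<kappa>, y)"
    proof (rule tendsto_coord_embedding[OF coord_embedding_Mbox_B1 f])
      show "(\<kappa>, cell_center (b ^ k) y) \<in> topspace Mbox_B1" for k using \<kappa> IB[OF mI] by (simp add: topspace_Mbox_B1)
      show "(\<kappa>, y) \<in> topspace Mbox_B1" using \<kappa> y half_open_unit_subset by (auto simp: topspace_Mbox_B1)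
      show "(\<lambda>k. (tent_coords (fst (\<kappa>, cell_center (b ^ k) y)), snd (\<kappa>, cell_center (b ^ k) y)))
        \<longlonglongrightarrow> (tent_coords (fst (\<kappa>, y)), snd (\<kappa>, y))"
        unfolding fst_conv snd_conv by (intro tendsto_Pair tendsto_const cell_center_tendsto b2)
    qed
    thus ?thesis unfolding s_eq using mI by simp
  qed
  have slice: "(\<lambda>\<kappa>. f (\<kappa>, c)) \<in> borel_measurable (borel_of Mbox)" if "c \<in> B1" for c
  proof -
    have "(\<lambda>\<kappa>. (\<kappa>, c)) \<in> measurable (borel_of Mbox) boxes"
      by (rule measurable_Mbox_B1I) (use that in \<open>auto simp: topspace_Mbox_B1 intro: measurable_emeasure_Mbox\<close>)
    from measurable_compose[OF this fm] show ?thesis .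
  qed
  define F where "F z = (\<integral>x\<in>B1. f (fst z, x) \<partial>fst z)" for z :: "(real ^ 'd) measure \<times> (real ^ 'd)"
  \<comment> \<open>Nothing is known about f off \<open>Mbox_B1\<close>; \<open>cut\<close> sends
    the points outside \<open>B1\<close>, a null set for each measure, to the origin.\<close>
  define cut where "cut y = (if y \<in> B1 then y else 0)" for y :: "real ^ 'd"
  have cutB: "cut y \<in> B1" for y by (simp add: cut_def mem_B1)
  have cutm: "cut \<in> borel_measurable borel" unfolding cut_def by measurable
  \<comment> \<open>Adding \<open>B\<close> makes the integrand nonnegative, so that the
    measurability of kernels for nonnegative integrals applies.\<close>
  have F_alt: "F z = enn2real (\<integral>\<^sup>+y. ennreal (f (fst z, cut y) + B) \<partial>fst z) - B" and
    slice_y: "(\<lambda>y. f (fst z, cut y)) \<in> borel_measurable (fst z)" if z: "z \<in> space boxes" for z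
  proof -
    have \<kappa>: "fst z \<in> topspace Mbox" using z by (auto simp: topspace_Mbox_B1)
    note sk = radon_sets[OF Mbox_radon[OF \<kappa>]]
    interpret K: prob_space "fst z" by (rule prob_space_Mbox(1)[OF \<kappa>])
    have "(\<lambda>y. (fst z, cut y)) \<in> measurable borel boxes"
      by (rule measurable_Mbox_B1I) (use \<kappa> cutB cutm in \<open>auto simp: topspace_Mbox_B1\<close>)
    from measurable_compose[OF this fm] show m: "(\<lambda>y. f (fst z, cut y)) \<in> borel_measurable (fst z)"
      unfolding measurable_cong_sets[OF sk refl] .
    have "F z = (\<integral>y. f (fst z, cut y) \<partial>fst z)"
      unfolding F_def set_lebesgue_integral_def
    proof (rule integral_cong_AE)
      have "(\<lambda>y. indicat_real B1 y *\<^sub>R f (fst z, y)) = (\<lambda>y. indicat_real B1 y *\<^sub>R f (fst z, cut y))"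
        by (auto simp: fun_eq_iff indicator_def cut_def)
      moreover have "(\<lambda>y. indicat_real B1 y *\<^sub>R f (fst z, cut y)) \<in> borel_measurable (fst z)"
        using m sk by (intro borel_measurable_scaleR borel_measurable_indicator) auto
      ultimately show "(\<lambda>y. indicat_real B1 y *\<^sub>R f (fst z, y)) \<in> borel_measurable (fst z)" by simp
      show "AE y in fst z. indicat_real B1 y *\<^sub>R f (fst z, y) = f (fst z, cut y)"
        using prob_space_Mbox(2)[OF \<kappa>] by eventually_elim (simp add: cut_def)
    qed (rule m)
    moreover have bd: "\<bar>f (fst z, cut y)\<bar> \<le> B" for y using B(2)[OF \<kappa> cutB] .
    moreover have int: "integrable (fst z) (\<lambda>y. f (fst z, cut y))"
      by (rule K.integrable_const_bound[of _ B]) (use bd m in auto)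
    moreover have nonneg: "0 \<le> f (fst z, cut y) + B" for y using bd[of y] by linarith
    moreover have "(\<integral>\<^sup>+y. ennreal (f (fst z, cut y) + B) \<partial>fst z) = ennreal (\<integral>y. f (fst z, cut y) + B \<partial>fst z)"
      by (rule nn_integral_eq_integral[OF Bochner_Integration.integrable_add[OF int K.integrable_const]])
         (use nonneg in simp)
    moreover have "0 \<le> (\<integral>y. f (fst z, cut y) + B \<partial>fst z)"
      by (rule integral_nonneg_AE) (use nonneg in simp)
    ultimately show "F z = enn2real (\<integral>\<^sup>+y. ennreal (f (fst z, cut y) + B) \<partial>fst z) - B"
      using K.prob_space by simp
  qed
  have Fm: "F \<in> borel_measurable boxes"
  proof -
    have "(\<lambda>z. \<integral>\<^sup>+y. ennreal (f (fst z, cut y) + B) \<partial>fst z) \<in> borel_measurable boxes"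
    proof (rule measurable_nn_integral_radon_kernel[OF measurable_fst_Mbox_B1_weak])
      let ?M = "boxes \<Otimes>\<^sub>M (borel :: (real ^ 'd) measure)"
      have ff: "(\<lambda>z. fst (fst z)) \<in> measurable ?M (borel_of Mbox)"
        by (rule measurable_compose[OF measurable_fst measurable_fst_Mbox_B1])
      have "(\<lambda>z. (fst (fst z), cut (snd z))) \<in> measurable ?M boxes"
      proof (rule measurable_Mbox_B1I)
        show "(\<lambda>w. snd (fst (fst w), cut (snd w))) \<in> borel_measurable ?M"
          using measurable_compose[OF measurable_snd cutm] by simp
        show "(\<lambda>w. emeasure (fst (fst (fst w), cut (snd w))) A) \<in> borel_measurable ?M" if "A \<in> sets borel" for A
          using measurable_compose[OF ff measurable_emeasure_Mbox[OF that]] by simp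
      qed (use cutB in \<open>auto simp: topspace_Mbox_B1 space_pair_measure\<close>)
      from measurable_compose[OF this fm]
      show "(\<lambda>z. ennreal (f (fst (fst z), cut (snd z)) + B)) \<in> borel_measurable ?M" by simp
    qed
    hence "(\<lambda>z. enn2real (\<integral>\<^sup>+y. ennreal (f (fst z, cut y) + B) \<partial>fst z) - B) \<in> borel_measurable boxes" by simp
    thus ?thesis by (rule iffD2[OF measurable_cong, rotated]) (rule F_alt)
  qed
  have Fk: "(\<integral>y. s k \<kappa> y \<partial>\<kappa>) = (\<Sum>c\<in>I k. f (\<kappa>, c) * measure \<kappa> (E k c))" if \<kappa>: "\<kappa> \<in> topspace Mbox" for k \<kappa>
  proof -
    interpret K: prob_space \<kappa> by (rule prob_space_Mbox(1)[OF \<kappa>])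
    have "E k c \<in> sets \<kappa>" for c using Eb radon_sets[OF Mbox_radon[OF \<kappa>]] by simp
    thus ?thesis unfolding s_def by (simp add: less_top[symmetric])
  qed
  have sm\<kappa>: "s k \<kappa> \<in> borel_measurable \<kappa>" if \<kappa>: "\<kappa> \<in> topspace Mbox" for k \<kappa>
    unfolding s_def using Eb radon_sets[OF Mbox_radon[OF \<kappa>]]
    by (intro borel_measurable_sum borel_measurable_times borel_measurable_indicator) auto
  have smz: "(\<lambda>z. s k (fst z) (snd z)) \<in> borel_measurable box_law" for k
    unfolding s_def
    by (intro borel_measurable_sum borel_measurable_times box_measurable indicator_snd_measurable Eb
          measurable_compose[OF measurable_fst_Mbox_B1 slice] IB)
  define G where "G k z = (\<Sum>c\<in>I k. f (fst z, c) * measure (fst z) (E k c))" for k and z :: "(real ^ 'd) measure \<times> (real ^ 'd)"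
  have Gm: "G k \<in> borel_measurable box_law" for k
    unfolding G_def
    by (intro borel_measurable_sum borel_measurable_times box_measurable measure_fst_measurable Eb
          measurable_compose[OF measurable_fst_Mbox_B1 slice] IB)
  have eqk: "(\<integral>z. s k (fst z) (snd z) \<partial>box_law) = (\<integral>z. G k z \<partial>box_law)" for k
  proof -
    have fb: "\<bar>f (fst z, c)\<bar> \<le> B" if "c \<in> I k" "z \<in> space box_law" for c z
      using B(2)[OF _ IB[OF that(1)]] that(2) by (auto simp: space_box_law)
    have i1: "integrable box_law (\<lambda>z. f (fst z, c) * indicator (E k c) (snd z))" if "c \<in> I k" for c
      using fb[OF that] B(1)
      by (intro BL.integrable_const_bound[of _ B] borel_measurable_times box_measurable indicator_snd_measurable Eb
          measurable_compose[OF measurable_fst_Mbox_B1 slice] IB[OF that]) (auto simp: indicator_def intro!: AE_I2)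
    have i2: "integrable box_law (\<lambda>z. f (fst z, c) * measure (fst z) (E k c))" if "c \<in> I k" for c
    proof (intro BL.integrable_const_bound[of _ B] borel_measurable_times box_measurable measure_fst_measurable Eb
          measurable_compose[OF measurable_fst_Mbox_B1 slice] IB[OF that] AE_I2)
      fix z assume z: "z \<in> space box_law"
      have "\<bar>f (fst z, c)\<bar> * measure (fst z) (E k c) \<le> B * 1"
        using fb[OF that z] B(1) measure_fst_le_1[OF z] by (intro mult_mono) auto
      thus "norm (f (fst z, c) * measure (fst z) (E k c)) \<le> B" by (simp add: abs_mult)
    qed
    have "(\<integral>z. s k (fst z) (snd z) \<partial>box_law) = (\<Sum>c\<in>I k. \<integral>z. f (fst z, c) * indicator (E k c) (snd z) \<partial>box_law)"
      unfolding s_def using i1 by simp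
    also have "\<dots> = (\<Sum>c\<in>I k. \<integral>z. f (fst z, c) * measure (fst z) (E k c) \<partial>box_law)"
      unfolding E_def by (intro sum.cong refl conditional_cell slice IB) (auto simp: I_def)
    also have "\<dots> = (\<integral>z. G k z \<partial>box_law)" unfolding G_def using i2 by simp
    finally show ?thesis .
  qed
  have l1: "(\<lambda>k. \<integral>z. s k (fst z) (snd z) \<partial>box_law) \<longlonglongrightarrow> (\<integral>z. f z \<partial>box_law)"
  proof (rule integral_dominated_convergence[where w="\<lambda>_. B"])
    show "AE z in box_law. (\<lambda>k. s k (fst z) (snd z)) \<longlonglongrightarrow> f z"
      using AE_box_half_open AE_space
    proof eventually_elim
      case (elim z)
      have "fst z \<in> topspace Mbox" using elim(2) by (auto simp: space_box_law)
      from s_lim[OF this elim(1)] show ?case by simp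
    qed
    show "AE z in box_law. norm (s k (fst z) (snd z)) \<le> B" for k
      by (intro AE_I2) (use s_bd in \<open>auto simp: space_box_law\<close>)
  qed (use smz box_measurable[OF fm] in auto)
  have l2: "(\<lambda>k. \<integral>z. G k z \<partial>box_law) \<longlonglongrightarrow> (\<integral>z. F z \<partial>box_law)"
  proof (rule integral_dominated_convergence[where w="\<lambda>_. B"])
    \<comment> \<open>The step functions vanish on the upper faces of \<open>B1\<close>, so the
      limit is correct only if those faces carry no mass; \<open>AE_box_full\<close> ensures
      this.\<close>
    have Glim: "(\<lambda>k. G k z) \<longlonglongrightarrow> F z" if z: "z \<in> space boxes" and full: "measure (fst z) ?H = 1" for z
    proof -
      have \<kappa>: "fst z \<in> topspace Mbox" using z by (auto simp: topspace_Mbox_B1)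
      interpret K: prob_space "fst z" by (rule prob_space_Mbox(1)[OF \<kappa>])
      have "AE y in fst z. y \<in> ?H"
        using full radon_sets[OF Mbox_radon[OF \<kappa>]] by (intro K.AE_prob_1) simp
      moreover note prob_space_Mbox(2)[OF \<kappa>]
      ultimately have "AE y in fst z. (\<lambda>k. s k (fst z) y) \<longlonglongrightarrow> f (fst z, cut y)"
        by eventually_elim (use s_lim[OF \<kappa>] in \<open>simp add: cut_def\<close>)
      hence "(\<lambda>k. \<integral>y. s k (fst z) y \<partial>fst z) \<longlonglongrightarrow> (\<integral>y. f (fst z, cut y) \<partial>fst z)"
        by (intro integral_dominated_convergence[where w="\<lambda>_. B"] sm\<kappa>[OF \<kappa>] slice_y[OF z]) (use s_bd[OF \<kappa>] B(1) in auto)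
      moreover have "(\<integral>y. f (fst z, cut y) \<partial>fst z) = F z"
        unfolding F_def set_lebesgue_integral_def
      proof (rule integral_cong_AE[symmetric])
        have "(\<lambda>y. indicat_real B1 y *\<^sub>R f (fst z, y)) = (\<lambda>y. indicat_real B1 y *\<^sub>R f (fst z, cut y))"
          by (auto simp: fun_eq_iff indicator_def cut_def)
        moreover have "(\<lambda>y. indicat_real B1 y *\<^sub>R f (fst z, cut y)) \<in> borel_measurable (fst z)"
          using slice_y[OF z] radon_sets[OF Mbox_radon[OF \<kappa>]] by (intro borel_measurable_scaleR borel_measurable_indicator) auto
        ultimately show "(\<lambda>y. indicat_real B1 y *\<^sub>R f (fst z, y)) \<in> borel_measurable (fst z)" by simp
        show "AE y in fst z. indicat_real B1 y *\<^sub>R f (fst z, y) = f (fst z, cut y)"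
          using prob_space_Mbox(2)[OF \<kappa>] by eventually_elim (simp add: cut_def)
      qed (rule slice_y[OF z])
      ultimately show ?thesis unfolding Fk[OF \<kappa>] G_def by simp
    qed
    show "AE z in box_law. (\<lambda>k. G k z) \<longlonglongrightarrow> F z"
      using AE_box_full AE_space
      by eventually_elim (rule Glim, simp_all add: space_box_law topspace_Mbox_B1)
    show "AE z in box_law. norm (G k z) \<le> B" for k
    proof (rule AE_I2)
      fix z assume "z \<in> space box_law"
      hence \<kappa>: "fst z \<in> topspace Mbox" by (auto simp: space_box_law)
      interpret K: prob_space "fst z" by (rule prob_space_Mbox(1)[OF \<kappa>])
      have "norm (G k z) = norm (\<integral>y. s k (fst z) y \<partial>fst z)" unfolding Fk[OF \<kappa>] G_def ..
      also have "\<dots> \<le> (\<integral>y. norm (s k (fst z) y) \<partial>fst z)" by (rule integral_norm_bound)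
      also have "\<dots> \<le> (\<integral>y. B \<partial>fst z)"
        by (intro integral_mono integrable_norm K.integrable_const_bound[of _ B] sm\<kappa>[OF \<kappa>]) (use s_bd[OF \<kappa>] B(1) in auto)
      also have "\<dots> = B" using K.prob_space by simp
      finally show "norm (G k z) \<le> B" .
    qed
  qed (use Gm box_measurable[OF Fm] in auto)
  show "(\<integral>z. f z \<partial>box_law) = (\<integral>z. (\<integral>x\<in>B1. f (fst z, x) \<partial>fst z) \<partial>box_law)"
    using LIMSEQ_unique[OF l1[unfolded eqk] l2] unfolding F_def .
qed

lemma ex_extended_CP: "\<exists>Q. extended_CP b Q \<and> discrete_centering Q = p \<and> lebesgue_second Q"
  using extended_CP_ext_law[OF adapted_box_law] discrete_centering_ext_law lebesgue_second_ext_law by blast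

end

end

text \<open>Every scaling preserves P, so the integrand is constant in t and its mean over the
  interval is P.\<close>

lemma continuous_centering_eq:
  assumes FD: "fractal_distribution P" and b: "b \<ge> 2" and Q: "discrete_centering Q = P"
  shows "continuous_centering b Q = P"
proof -
  have sP: "sets P = sets (borel_of Mstar)" using FD by (simp add: fractal_distribution_def)
  have spP: "space P = topspace Mstar" using sets_eq_imp_space_eq[OF sP] by simp
  have inv: "push_on scale_dom (scale_star t) (borel_of Mstar) P = P" for t
  proof -
    have "push_on scale_dom (scale_star t) (borel_of Mstar) P = push_on scale_dom (scale_star t) P P"
      unfolding push_on_def by (rule distr_cong) (simp_all add: sP)
    thus ?thesis using FD by (simp add: fractal_distribution_def invariant_on_def)
  qed
  have lb: "0 < ln (real b)" using b by simp
  have "continuous_centering b Q = measure_of (space P) (sets P) (emeasure P)"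
    unfolding continuous_centering_def Q inv spP[symmetric] sP[symmetric]
  proof (intro measure_of_eq sets.space_closed)
    fix A assume "A \<in> sigma_sets (space P) (sets P)"
    have "(\<integral>\<^sup>+ t\<in>{0..ln (real b)}. emeasure P A \<partial>lborel) = emeasure P A * ennreal (ln (real b))"
      using lb by (simp add: nn_integral_cmult_indicator)
    thus "(\<integral>\<^sup>+ t\<in>{0..ln (real b)}. emeasure P A \<partial>lborel) / ennreal (ln (real b)) = emeasure P A"
      using lb by (simp add: mult_divide_eq_ennreal)
  qed
  thus ?thesis by (simp add: measure_of_of_measure)
qed

theorem proposition1p16:
  fixes P :: "(real ^ 'd) measure measure" and b :: nat
  assumes "fractal_distribution P" and "b \<ge> 2"
  shows "(\<exists>Q. extended_CP b Q \<and> continuous_centering b Q = P \<and> lebesgue_second Q) \<and>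
    (\<forall>\<Theta>. ergodic_decomposition scale_dom (scale_star (ln (real b))) P \<Theta> \<longrightarrow>
       (AE p in \<Theta>. \<exists>Q. extended_CP b Q \<and> discrete_centering Q = p \<and> lebesgue_second Q))"
proof -
  have b0: "b > 0" using assms(2) by simp
  have P: "prob_space P" and sP: "sets P = sets (borel_of Mstar)" and inv: "\<And>t. invariant_on scale_dom (scale_star t) P"
    using assms(1) by (auto simp: fractal_distribution_def)
  obtain \<A> where \<A>: "countable \<A>" "Int_stable \<A>" "topspace Mbox \<in> \<A>" "\<A> \<subseteq> sets (borel_of (Mbox :: (real ^ 'd) measure topology))"
      "sets (borel_of Mbox) = sigma_sets (topspace Mbox) \<A>"
    using ex_countable_generator[of "Mbox :: (real ^ 'd) measure topology", OF coord_embedding_Mbox] by blast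
  \<comment> \<open>All tests are collected in one condition on a single measure. Generator, levels
    and cells are countably many, so it holds almost surely for P.\<close>
  define \<Phi> where "\<Phi> \<mu> \<longleftrightarrow> (\<forall>A\<in>\<A>. \<forall>k. \<forall>c0\<in>cell_center (b ^ k) ` half_open_cube 0 1.
    AE w in unif_B1. averages_vanish A {y. cell_center (b ^ k) y = c0} b (magnify 1 (- w) \<mu>) w)" for \<mu> :: "(real ^ 'd) measure"
  have \<Phi>P: "AE \<mu> in P. \<Phi> \<mu>"
  proof -
    have "AE \<mu> in P. \<forall>c0\<in>cell_center (b ^ k) ` half_open_cube 0 1.
        AE w in unif_B1. averages_vanish A {y. cell_center (b ^ k) y = c0} b (magnify 1 (- w) \<mu>) w" if "A \<in> \<A>" for A k
    proof (subst AE_ball_countable)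
      show "countable (cell_center (b ^ k) ` half_open_cube (0 :: real ^ 'd) 1)"
        using b0 by (intro countable_finite finite_cell_centers) simp
    qed (use AE_averages_vanish[OF assms(1) b0] that \<A>(4) in blast)
    hence "AE \<mu> in P. \<forall>k. \<forall>c0\<in>cell_center (b ^ k) ` half_open_cube 0 1.
        AE w in unif_B1. averages_vanish A {y. cell_center (b ^ k) y = c0} b (magnify 1 (- w) \<mu>) w" if "A \<in> \<A>" for A
      using that by (subst AE_all_countable) blast
    thus ?thesis unfolding \<Phi>_def by (subst AE_ball_countable[OF \<A>(1)]) blast
  qed
  \<comment> \<open>Used twice, for P and for almost every ergodic component.\<close>
  have main: "\<exists>Q. extended_CP b Q \<and> discrete_centering Q = p \<and> lebesgue_second Q"
    if p: "prob_space p" "sets p = sets (borel_of Mstar)" "invariant_on scale_dom (scale_star (ln (real b))) p"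
      and \<Phi>p: "AE \<mu> in p. \<Phi> \<mu>" for p
  proof -
    interpret scaling_system p b
      using p assms(2) unfolding scaling_system_def invariant_on_def by blast
    show ?thesis
    proof (rule ex_extended_CP[OF \<A>(2-5)])
      fix A k and c0 :: "real ^ 'd" assume mem: "A \<in> \<A>" "c0 \<in> cell_center (b ^ k) ` half_open_cube 0 1"
      show "AE \<mu> in p. AE w in unif_B1. averages_vanish A {y. cell_center (b ^ k) y = c0} b (magnify 1 (- w) \<mu>) w"
        using \<Phi>p unfolding \<Phi>_def by eventually_elim (use mem in blast)
    qed
  qed
  show ?thesis
  proof (intro conjI allI impI)
    obtain Q where "extended_CP b Q" "discrete_centering Q = P" "lebesgue_second Q"
      using main[OF P sP inv \<Phi>P] by blast
    thus "\<exists>Q. extended_CP b Q \<and> continuous_centering b Q = P \<and> lebesgue_second Q"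
      using continuous_centering_eq[OF assms] by blast
  next
    fix \<Theta> assume \<Theta>: "ergodic_decomposition scale_dom (scale_star (ln (real b))) P \<Theta>"
    have s\<Theta>: "sets \<Theta> = sets (prob_algebra P)" and erg: "AE p in \<Theta>. ergodic_on scale_dom (scale_star (ln (real b))) p"
      and bary: "\<And>A. A \<in> sets P \<Longrightarrow> emeasure P A = (\<integral>\<^sup>+ p. emeasure p A \<partial>\<Theta>)"
      using \<Theta> by (auto simp: ergodic_decomposition_def)
    have sp\<Theta>: "space \<Theta> = space (prob_algebra P)" by (rule sets_eq_imp_space_eq[OF s\<Theta>])
    \<comment> \<open>The failure set of \<Phi> is enclosed in a measurable null set, since the
      barycentre formula applies to measurable sets only.\<close>
    obtain N where N: "{\<mu> \<in> space P. \<not> \<Phi> \<mu>} \<subseteq> N" "emeasure P N = 0" "N \<in> sets P" using \<Phi>P by (rule AE_E)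
    have "(\<lambda>p. emeasure p N) \<in> borel_measurable (prob_algebra P)"
      unfolding prob_algebra_def
      by (intro measurable_restrict_space1 measurable_emeasure_subprob_algebra N(3))
    hence Nm: "(\<lambda>p. emeasure p N) \<in> borel_measurable \<Theta>" unfolding measurable_cong_sets[OF s\<Theta> refl] .
    have "(\<integral>\<^sup>+ p. emeasure p N \<partial>\<Theta>) = 0" using bary[OF N(3)] N(2) by simp
    hence "AE p in \<Theta>. emeasure p N = 0" using nn_integral_0_iff_AE[OF Nm] by simp
    with erg AE_space show "AE p in \<Theta>. \<exists>Q. extended_CP b Q \<and> discrete_centering Q = p \<and> lebesgue_second Q"
    proof eventually_elim
      case (elim p)
      have sp: "sets p = sets P" using elim(2) unfolding sp\<Theta> space_prob_algebra by simp
      have "N \<in> null_sets p" using elim(3) N(3) sp by (intro null_setsI) auto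
      from AE_not_in[OF this] have "AE \<mu> in p. \<Phi> \<mu>"
        by (rule AE_mp) (use N(1) sets_eq_imp_space_eq[OF sp] in \<open>auto intro!: AE_I2\<close>)
      thus ?case using elim(1) sp sP by (intro main) (auto simp: ergodic_on_def)
    qed
  qed
qed

end
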